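(* Let $N$ be a connected smooth $n$-manifold without boundary, $m,n\ge1$, and let $j_N\colon S^{n-1}\to N-\{x_0\}$ be a basepoint preserving inclusion of the boundary sphere of a small $n$-ball in $N$ around some point $x_0$. Given $[f]\in\pi_m(N)$, consider the conditions (ii) $(f,f)$ is loose by small deformation; (iii) $(f,f)$ is loose (by any deformation); (iii') $f$ is not coincidence producing, i.e. there exists some map $f'\colon S^m\to N$ such that the pair $(f,f')$ is loose; (iii'') $j_{N*}(\partial_N[f])\in\pi_{m-1}(N-\{x_0\})$ vanishes. Then (ii) $\Rightarrow$ (iii) $\Rightarrow$ (iii') $\Leftrightarrow$ (iii''). The three conditions (ii), (iii), (iii') are equivalent for all maps $f\colon S^m\to N$ if and only if $$0=\partial_N(\pi_m(N))\cap\ker\bigl(j_{N*}\colon\pi_{m-1}(S^{n-1})\to\pi_{m-1}(N-\{x_0\})\bigr).$$ This holds for example when $N$ is not simply connected, or when $N$ is a real, complex or quaternionic projective space $\mathbb KP(n')$ with $n'\ge2$ (since then $\ker j_{N*}=0$).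
   Context: $\partial_N\colon\pi_m(N)\to\pi_{m-1}(S^{n-1})$ is the boundary homomorphism in the exact homotopy sequence of the unit tangent sphere bundle $STN\to N$ with fiber $S^{n-1}$ (any Riemannian metric); for $m=1$ put $\partial_N\equiv0$. A pair $f_1,f_2\colon M\to N$ is loose if there are maps $f_1'\sim f_1$, $f_2'\sim f_2$ (homotopic, basepoint free) with $f_1'(x)\ne f_2'(x)$ for all $x\in M$. A pair $(f,f)$ is loose by small deformation if for every metric on $N$ and every $\varepsilon>0$ there is an $\varepsilon$-approximation $f'$ of $f$ with $f'(x)\neq f(x)$ for all $x\in M$. *)

theory Defs
  imports "HOL-Analysis.Analysis"
begin

section \<open>Smooth manifolds\<close>

text \<open>The recursion clause asks for all directional derivatives to be \<open>C\<^sup>k\<close>; on open subsets of a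
  Euclidean space, the only sets it is used for, this is the usual notion.\<close>

primrec Ck_on :: "nat \<Rightarrow> 'e::euclidean_space set \<Rightarrow> ('e \<Rightarrow> 'f::euclidean_space) \<Rightarrow> bool" where
  "Ck_on 0 S f \<longleftrightarrow> continuous_on S f"
| "Ck_on (Suc k) S f \<longleftrightarrow>
     (\<forall>x\<in>S. f differentiable (at x)) \<and> (\<forall>v. Ck_on k S (\<lambda>x. frechet_derivative f (at x) v))"

definition smooth_on :: "'e::euclidean_space set \<Rightarrow> ('e \<Rightarrow> 'f::euclidean_space) \<Rightarrow> bool" where
  "smooth_on S f \<longleftrightarrow> (\<forall>k. Ck_on k S f)"

text \<open>A chart is a pair of its domain and its coordinate map; values of the coordinate map outside
  the domain are irrelevant. The dimension of the manifold is that of the Euclidean space \<^typ>\<open>'e\<close>,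
  so it is at least 1.\<close>

type_synonym ('a, 'e) chart = "'a set \<times> ('a \<Rightarrow> 'e)"

definition chart_dom :: "('a, 'e) chart \<Rightarrow> 'a set" where
  "chart_dom c = fst c"

definition chart_inv :: "('a, 'e) chart \<Rightarrow> 'e \<Rightarrow> 'a" where
  "chart_inv c = inv_into (chart_dom c) (snd c)"

definition is_chart :: "'a topology \<Rightarrow> ('a, 'e::euclidean_space) chart \<Rightarrow> bool" where
  "is_chart X c \<longleftrightarrow> openin X (chart_dom c) \<and> open (snd c ` chart_dom c) \<and>
     homeomorphic_map (subtopology X (chart_dom c)) (top_of_set (snd c ` chart_dom c)) (snd c)"

definition transition :: "('a, 'e) chart \<Rightarrow> ('a, 'e) chart \<Rightarrow> 'e \<Rightarrow> 'e" where
  "transition c d = snd d \<circ> chart_inv c"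

definition smooth_manifold :: "'a topology \<Rightarrow> ('a, 'e::euclidean_space) chart set \<Rightarrow> bool" where
  "smooth_manifold X A \<longleftrightarrow>
     Hausdorff_space X \<and> second_countable X \<and>
     (\<forall>c\<in>A. is_chart X c) \<and> (\<Union>c\<in>A. chart_dom c) = topspace X \<and>
     (\<forall>c\<in>A. \<forall>d\<in>A. smooth_on (snd c ` (chart_dom c \<inter> chart_dom d)) (transition c d))"

definition smooth_map ::
  "'a topology \<Rightarrow> ('a, 'e::euclidean_space) chart set \<Rightarrow>
   'b topology \<Rightarrow> ('b, 'f::euclidean_space) chart set \<Rightarrow> ('a \<Rightarrow> 'b) \<Rightarrow> bool" where
  "smooth_map X A Y B h \<longleftrightarrow> continuous_map X Y h \<and>
     (\<forall>c\<in>A. \<forall>d\<in>B. smooth_on (snd c ` {p \<in> chart_dom c. h p \<in> chart_dom d}) (snd d \<circ> h \<circ> chart_inv c))"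

definition diffeomorphic ::
  "'a topology \<Rightarrow> ('a, 'e::euclidean_space) chart set \<Rightarrow>
   'b topology \<Rightarrow> ('b, 'f::euclidean_space) chart set \<Rightarrow> bool" where
  "diffeomorphic X A Y B \<longleftrightarrow>
     (\<exists>h k. smooth_map X A Y B h \<and> smooth_map Y B X A k \<and>
        (\<forall>x\<in>topspace X. k (h x) = x) \<and> (\<forall>y\<in>topspace Y. h (k y) = y))"


section \<open>The unit tangent sphere bundle\<close>

text \<open>A tangent vector at \<open>p\<close> is the family of its coordinate vectors in all charts of the atlas
  around \<open>p\<close>, compatible under the derivatives of the transition maps; the family is \<open>0\<close> at all
  other indices.\<close>

definition tangent_space ::
  "('a, 'e::euclidean_space) chart set \<Rightarrow> 'a \<Rightarrow> (('a, 'e) chart \<Rightarrow> 'e) set" where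
  "tangent_space A p = {v.
     (\<forall>c\<in>A. \<forall>d\<in>A. p \<in> chart_dom c \<longrightarrow> p \<in> chart_dom d \<longrightarrow>
        v d = frechet_derivative (transition c d) (at (snd c p)) (v c)) \<and>
     (\<forall>c. \<not> (c \<in> A \<and> p \<in> chart_dom c) \<longrightarrow> v c = 0)}"

text \<open>The tangent vector at \<open>p\<close> with coordinate vector \<open>u\<close> in the chart \<open>c\<close>.\<close>

definition coord_vec ::
  "('a, 'e::euclidean_space) chart set \<Rightarrow> ('a, 'e) chart \<Rightarrow> 'a \<Rightarrow> 'e \<Rightarrow> (('a, 'e) chart \<Rightarrow> 'e)" where
  "coord_vec A c p u = (\<lambda>d. if d \<in> A \<and> p \<in> chart_dom d
     then frechet_derivative (transition c d) (at (snd c p)) u else 0)"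

definition tangent_bundle ::
  "'a topology \<Rightarrow> ('a, 'e::euclidean_space) chart set \<Rightarrow> ('a \<times> (('a, 'e) chart \<Rightarrow> 'e)) topology" where
  "tangent_bundle X A = topology_generated_by
     {{(p, v). p \<in> chart_dom c \<and> v \<in> tangent_space A p \<and> (snd c p, v c) \<in> W} | c W. c \<in> A \<and> open W}"

definition riemannian_metric ::
  "('a, 'e::euclidean_space) chart set \<Rightarrow>
   ('a \<Rightarrow> (('a, 'e) chart \<Rightarrow> 'e) \<Rightarrow> (('a, 'e) chart \<Rightarrow> 'e) \<Rightarrow> real) \<Rightarrow> bool" where
  "riemannian_metric A g \<longleftrightarrow> (\<forall>c\<in>A.
     (\<forall>p\<in>chart_dom c. bilinear (\<lambda>u w. g p (coord_vec A c p u) (coord_vec A c p w)) \<and>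
        (\<forall>u w. g p (coord_vec A c p u) (coord_vec A c p w) =
               g p (coord_vec A c p w) (coord_vec A c p u)) \<and>
        (\<forall>u. u \<noteq> 0 \<longrightarrow> g p (coord_vec A c p u) (coord_vec A c p u) > 0)) \<and>
     (\<forall>u w. smooth_on (snd c ` chart_dom c)
        (\<lambda>x. g (chart_inv c x) (coord_vec A c (chart_inv c x) u) (coord_vec A c (chart_inv c x) w))))"

definition unit_tangent_bundle ::
  "'a topology \<Rightarrow> ('a, 'e::euclidean_space) chart set \<Rightarrow>
   ('a \<Rightarrow> (('a, 'e) chart \<Rightarrow> 'e) \<Rightarrow> (('a, 'e) chart \<Rightarrow> 'e) \<Rightarrow> real) \<Rightarrow>
   ('a \<times> (('a, 'e) chart \<Rightarrow> 'e)) topology" where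
  "unit_tangent_bundle X A g = subtopology (tangent_bundle X A) {(p, v). g p v v = 1}"


section \<open>Homotopy groups\<close>

text \<open>\<open>\<pi>\<^sub>k\<close> is the set of based homotopy classes of based maps from the \<open>k\<close>-sphere. Only the
  neutral element (the class of the constant map) is used below, so no group operation
  is defined; \<open>\<pi>\<^sub>0\<close> is a pointed set. Classes are sets of functions that are unconstrained off the sphere.\<close>

definition pole :: "nat \<Rightarrow> nat \<Rightarrow> real" where
  "pole k = (\<lambda>i. if i = k then 1 else 0)"

definition based_map :: "nat \<Rightarrow> 'a topology \<Rightarrow> 'a \<Rightarrow> ((nat \<Rightarrow> real) \<Rightarrow> 'a) \<Rightarrow> bool" where
  "based_map k X b f \<longleftrightarrow> continuous_map (nsphere k) X f \<and> f (pole k) = b"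

definition hclass :: "nat \<Rightarrow> 'a topology \<Rightarrow> 'a \<Rightarrow> ((nat \<Rightarrow> real) \<Rightarrow> 'a) \<Rightarrow> ((nat \<Rightarrow> real) \<Rightarrow> 'a) set" where
  "hclass k X b f = {f'. homotopic_with (\<lambda>h. h (pole k) = b) (nsphere k) X f f'}"

definition hgroup :: "nat \<Rightarrow> 'a topology \<Rightarrow> 'a \<Rightarrow> ((nat \<Rightarrow> real) \<Rightarrow> 'a) set set" where
  "hgroup k X b = hclass k X b ` {f. based_map k X b f}"

definition hzero :: "nat \<Rightarrow> 'a topology \<Rightarrow> 'a \<Rightarrow> ((nat \<Rightarrow> real) \<Rightarrow> 'a) set" where
  "hzero k X b = hclass k X b (\<lambda>_. b)"

text \<open>As usual for maps defined on classes by representatives, the union below is over one and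
  the same class.\<close>

definition hinduced ::
  "nat \<Rightarrow> 'b topology \<Rightarrow> 'b \<Rightarrow> ('a \<Rightarrow> 'b) \<Rightarrow> ((nat \<Rightarrow> real) \<Rightarrow> 'a) set \<Rightarrow> ((nat \<Rightarrow> real) \<Rightarrow> 'b) set" where
  "hinduced k Y b' j \<alpha> = (\<Union>f\<in>\<alpha>. hclass k Y b' (j \<circ> f))"

definition simply_connected_space :: "'a topology \<Rightarrow> bool" where
  "simply_connected_space X \<longleftrightarrow>
     path_connected_space X \<and> (\<forall>b\<in>topspace X. hgroup 1 X b = {hzero 1 X b})"


section \<open>The boundary homomorphism\<close>

definition disc :: "nat \<Rightarrow> (nat \<Rightarrow> real) topology" where
  "disc m = subtopology (Euclidean_space m) {x. (\<Sum>i<m. x i ^ 2) \<le> 1}"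

text \<open>The quotient map from the \<open>m\<close>-disc to the \<open>m\<close>-sphere which collapses the boundary sphere,
  \<^term>\<open>nsphere (m - 1)\<close>, to \<^term>\<open>pole m\<close> and is injective on the interior:
  \<open>x \<mapsto> (2 \<surd>(1 - |x|\<^sup>2) x, 2 |x|\<^sup>2 - 1)\<close>.\<close>

definition collapse :: "nat \<Rightarrow> (nat \<Rightarrow> real) \<Rightarrow> nat \<Rightarrow> real" where
  "collapse m x = (let s = (\<Sum>i<m. x i ^ 2) in
     (\<lambda>i. if i < m then 2 * sqrt (1 - s) * x i else if i = m then 2 * s - 1 else 0))"

text \<open>Let \<open>p : E \<rightarrow> B\<close> be a bundle whose fiber over the base point is identified with \<open>F\<close>
  by \<open>\<tau>\<close>, and let \<open>v\<close> be the base point of \<open>F\<close>. To obtain the boundary of the class of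
  \<open>f\<close>, compose \<open>f\<close> with the collapse map, lift to a map \<open>(disc, sphere, pole) \<rightarrow> (E, fiber, \<tau> v)\<close>,
  and restrict this lift to the boundary sphere. For \<open>m = 1\<close> the boundary is zero by
  convention.\<close>

definition boundary_hom ::
  "nat \<Rightarrow> 'b topology \<Rightarrow> ('b \<Rightarrow> 'a) \<Rightarrow> 'f topology \<Rightarrow> ('f \<Rightarrow> 'b) \<Rightarrow> 'f \<Rightarrow>
   ((nat \<Rightarrow> real) \<Rightarrow> 'a) set \<Rightarrow> ((nat \<Rightarrow> real) \<Rightarrow> 'f) set" where
  "boundary_hom m E p F \<tau> v \<alpha> = (if m = 1 then hzero 0 F v else
     \<Union>{hclass (m - 1) F v h | h f L.
         f \<in> \<alpha> \<and> continuous_map (disc m) E L \<and>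
         (\<forall>x\<in>topspace (disc m). p (L x) = f (collapse m x)) \<and>
         based_map (m - 1) F v h \<and>
         (\<forall>s\<in>topspace (nsphere (m - 1)). L s = \<tau> (h s))})"


section \<open>The sphere around a point, and the maps in the theorem\<close>

text \<open>The small ball is the ball with center \<open>a\<close> and radius \<open>r\<close> in the chart \<open>c\<close>.\<close>

definition ball_center :: "('a, 'e::euclidean_space) chart \<Rightarrow> 'e \<Rightarrow> 'a" where
  "ball_center c a = chart_inv c a"

definition sphere_incl :: "('a, 'e::euclidean_space) chart \<Rightarrow> 'e \<Rightarrow> real \<Rightarrow> 'e \<Rightarrow> 'a" where
  "sphere_incl c a r v = chart_inv c (a + r *\<^sub>R v)"

definition punctured :: "'a topology \<Rightarrow> 'a \<Rightarrow> 'a topology" where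
  "punctured X x0 = subtopology X (topspace X - {x0})"

abbreviation unit_sphere :: "'e::euclidean_space topology" where
  "unit_sphere \<equiv> top_of_set (sphere 0 1)"

text \<open>The chart \<open>c\<close> trivializes the tangent bundle over the ball; this identifies the unit sphere of
  the model space with the fiber of the unit tangent bundle over a point \<open>b\<close> of the ball.\<close>

definition fiber_param ::
  "('a, 'e::euclidean_space) chart set \<Rightarrow>
   ('a \<Rightarrow> (('a, 'e) chart \<Rightarrow> 'e) \<Rightarrow> (('a, 'e) chart \<Rightarrow> 'e) \<Rightarrow> real) \<Rightarrow>
   ('a, 'e) chart \<Rightarrow> 'a \<Rightarrow> 'e \<Rightarrow> 'a \<times> (('a, 'e) chart \<Rightarrow> 'e)" where
  "fiber_param A g c b v =
     (b, coord_vec A c b (v /\<^sub>R sqrt (g b (coord_vec A c b v) (coord_vec A c b v))))"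

text \<open>The base point of the manifold is \<^term>\<open>sphere_incl c a r v0\<close>, so that \<^term>\<open>sphere_incl c a r\<close>
  is base point preserving from \<open>(S\<^sup>n\<^sup>-\<^sup>1, v0)\<close> into the punctured manifold. The same chart \<open>c\<close>
  is used to identify the sphere with the fiber over the base point and with the boundary of the
  ball, so the orientations of the two identifications agree.\<close>

definition boundary_N ::
  "'a topology \<Rightarrow> ('a, 'e::euclidean_space) chart set \<Rightarrow>
   ('a \<Rightarrow> (('a, 'e) chart \<Rightarrow> 'e) \<Rightarrow> (('a, 'e) chart \<Rightarrow> 'e) \<Rightarrow> real) \<Rightarrow>
   ('a, 'e) chart \<Rightarrow> 'e \<Rightarrow> real \<Rightarrow> 'e \<Rightarrow> nat \<Rightarrow>
   ((nat \<Rightarrow> real) \<Rightarrow> 'a) set \<Rightarrow> ((nat \<Rightarrow> real) \<Rightarrow> 'e) set" where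
  "boundary_N X A g c a r v0 m =
     boundary_hom m (unit_tangent_bundle X A g) fst unit_sphere
       (fiber_param A g c (sphere_incl c a r v0)) v0"

definition j_star ::
  "'a topology \<Rightarrow> ('a, 'e::euclidean_space) chart \<Rightarrow> 'e \<Rightarrow> real \<Rightarrow> 'e \<Rightarrow> nat \<Rightarrow>
   ((nat \<Rightarrow> real) \<Rightarrow> 'e) set \<Rightarrow> ((nat \<Rightarrow> real) \<Rightarrow> 'a) set" where
  "j_star X c a r v0 k =
     hinduced k (punctured X (ball_center c a)) (sphere_incl c a r v0) (sphere_incl c a r)"

definition ker_j ::
  "'a topology \<Rightarrow> ('a, 'e::euclidean_space) chart \<Rightarrow> 'e \<Rightarrow> real \<Rightarrow> 'e \<Rightarrow> nat \<Rightarrow>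
   ((nat \<Rightarrow> real) \<Rightarrow> 'e) set set" where
  "ker_j X c a r v0 k = {\<beta> \<in> hgroup k unit_sphere v0.
     j_star X c a r v0 k \<beta> = hzero k (punctured X (ball_center c a)) (sphere_incl c a r v0)}"


section \<open>Looseness\<close>

definition loose :: "'s topology \<Rightarrow> 'a topology \<Rightarrow> ('s \<Rightarrow> 'a) \<Rightarrow> ('s \<Rightarrow> 'a) \<Rightarrow> bool" where
  "loose M X f1 f2 \<longleftrightarrow> (\<exists>f1' f2'.
     homotopic_with (\<lambda>_. True) M X f1 f1' \<and> homotopic_with (\<lambda>_. True) M X f2 f2' \<and>
     (\<forall>x\<in>topspace M. f1' x \<noteq> f2' x))"

definition loose_by_small_deformation :: "'s topology \<Rightarrow> 'a topology \<Rightarrow> ('s \<Rightarrow> 'a) \<Rightarrow> bool" where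
  "loose_by_small_deformation M X f \<longleftrightarrow>
     (\<forall>d \<epsilon>. Metric_space (topspace X) d \<longrightarrow> Metric_space.mtopology (topspace X) d = X \<longrightarrow> \<epsilon> > 0 \<longrightarrow>
        (\<exists>f'. continuous_map M X f' \<and> (\<forall>x\<in>topspace M. d (f x) (f' x) < \<epsilon> \<and> f' x \<noteq> f x)))"

definition coincidence_producing :: "'s topology \<Rightarrow> 'a topology \<Rightarrow> ('s \<Rightarrow> 'a) \<Rightarrow> bool" where
  "coincidence_producing M X f \<longleftrightarrow> (\<nexists>f'. continuous_map M X f' \<and> loose M X f f')"


section \<open>Projective spaces\<close>

text \<open>A skew field \<open>K\<close> is given by its multiplication \<open>mul\<close> and unit \<open>e\<close>. The points of \<open>KP(n')\<close>,
  where \<open>n' = CARD('k)\<close>, are the lines \<open>x K\<close> in \<open>K\<^sup>n\<^sup>'\<^sup>+\<^sup>1\<close>, with coordinates indexed by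
  \<^typ>\<open>'k option\<close>.\<close>

definition line :: "('K \<Rightarrow> 'K \<Rightarrow> 'K) \<Rightarrow> 'K ^ 'i \<Rightarrow> ('K ^ 'i) set" where
  "line mul x = range (\<lambda>l. \<chi> i. mul (x $ i) l)"

definition proj_space :: "('K::euclidean_space \<Rightarrow> 'K \<Rightarrow> 'K) \<Rightarrow> ('K ^ 'k::finite option) set topology" where
  "proj_space mul = topology (\<lambda>U. U \<subseteq> line mul ` {x. x \<noteq> 0} \<and> open {x. x \<noteq> 0 \<and> line mul x \<in> U})"

text \<open>The quotient topology is indeed a topology.\<close>

lemma openin_proj_space:
  fixes U :: "('K::euclidean_space ^ 'k::finite option) set set"
  shows "openin (proj_space mul) U \<longleftrightarrow>
     U \<subseteq> line mul ` {x. x \<noteq> 0} \<and> open {x. x \<noteq> 0 \<and> line mul x \<in> U}"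
proof -
  let ?P = "\<lambda>U :: ('K ^ 'k option) set set. U \<subseteq> line mul ` {x. x \<noteq> 0} \<and> open {x. x \<noteq> 0 \<and> line mul x \<in> U}"
  have "?P (S \<inter> T)" if "?P S" "?P T" for S T
  proof -
    have "{x. x \<noteq> 0 \<and> line mul x \<in> S \<inter> T} =
        {x. x \<noteq> 0 \<and> line mul x \<in> S} \<inter> {x. x \<noteq> 0 \<and> line mul x \<in> T}"
      by blast
    with that show ?thesis by auto
  qed
  moreover have "?P (\<Union>\<K>)" if "\<forall>U\<in>\<K>. ?P U" for \<K>
  proof -
    have "{x. x \<noteq> 0 \<and> line mul x \<in> \<Union>\<K>} = (\<Union>U\<in>\<K>. {x. x \<noteq> 0 \<and> line mul x \<in> U})" by blast
    moreover have "open (\<Union>U\<in>\<K>. {x. x \<noteq> 0 \<and> line mul x \<in> U})" using that by blast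
    ultimately show ?thesis using that by auto
  qed
  ultimately have "istopology ?P"
    unfolding istopology_def by blast
  then show ?thesis
    unfolding proj_space_def by (simp add: topology_inverse')
qed

text \<open>The affine chart on \<open>{x\<^sub>i \<noteq> 0}\<close> normalizes \<open>x\<^sub>i\<close> to \<open>e\<close> and drops it. The remaining
  coordinates are indexed by \<^typ>\<open>'k\<close>, where the coordinate \<open>None\<close> (if \<open>i \<noteq> None\<close>) takes the
  free place of \<open>i\<close>.\<close>

definition affine_chart ::
  "('K::euclidean_space \<Rightarrow> 'K \<Rightarrow> 'K) \<Rightarrow> 'K \<Rightarrow> 'k::finite option \<Rightarrow> (('K ^ 'k option) set, 'K ^ 'k) chart" where
  "affine_chart mul e i =
     (line mul ` {x. x $ i \<noteq> 0},
      \<lambda>L. let x = (THE x. x \<in> L \<and> x $ i = e) in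
        \<chi> j. x $ (if Some j = i then None else Some j))"

definition proj_atlas ::
  "('K::euclidean_space \<Rightarrow> 'K \<Rightarrow> 'K) \<Rightarrow> 'K \<Rightarrow> (('K ^ 'k::finite option) set, 'K ^ 'k) chart set" where
  "proj_atlas mul e = range (affine_chart mul e)"

text \<open>Quaternions, by the Cayley--Dickson construction: the pair \<open>(a, b)\<close> is \<open>a + b j\<close>.\<close>

type_synonym quat = "complex \<times> complex"

definition qmul :: "quat \<Rightarrow> quat \<Rightarrow> quat" where
  "qmul x y = (fst x * fst y - snd x * cnj (snd y), fst x * snd y + snd x * cnj (fst y))"

definition qone :: quat where
  "qone = (1, 0)"

lemma qmul_assoc: "qmul (qmul x y) z = qmul x (qmul y z)"
  by (simp add: qmul_def algebra_simps)

lemma qmul_qone: "qmul qone x = x" "qmul x qone = x"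
  by (simp_all add: qmul_def qone_def)

lemma qmul_ij: "qmul (\<i>, 0) (0, 1) = (0, \<i>)" "qmul (0, 1) (\<i>, 0) = - (0, \<i>)" "qmul (0, 1) (0, 1) = - qone"
  by (simp_all add: qmul_def qone_def)

text \<open>A manifold is a projective space \<open>KP(n')\<close> with \<open>n' = CARD('k)\<close>, up to diffeomorphism.\<close>

definition is_projective_space ::
  "'k::finite itself \<Rightarrow> 'a topology \<Rightarrow> ('a, 'e::euclidean_space) chart set \<Rightarrow> bool" where
  "is_projective_space _ X A \<longleftrightarrow>
     diffeomorphic X A (proj_space (*) :: (real ^ 'k option) set topology)
       (proj_atlas (*) 1 :: ((real ^ 'k option) set, real ^ 'k) chart set) \<or>
     diffeomorphic X A (proj_space (*) :: (complex ^ 'k option) set topology)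
       (proj_atlas (*) 1 :: ((complex ^ 'k option) set, complex ^ 'k) chart set) \<or>
     diffeomorphic X A (proj_space qmul :: (quat ^ 'k option) set topology)
       (proj_atlas qmul qone :: ((quat ^ 'k option) set, quat ^ 'k) chart set)"

end

theory Submission
 imports Defs
begin

text \<open>
 Let \<open>m = k + 1\<close>. The collapse map pulls a based map \<open>f\<close> back to the \<open>m\<close>-disc. As the disc is contractible,
 the pull-back lifts to unit tangent vectors, and the lift restricts on the boundary sphere to a map
 \<open>h : S\<^sup>k \<rightarrow> S\<^sup>n\<^sup>-\<^sup>1\<close> that represents \<open>\<partial>[f]\<close> (\<open>boundary_N_class\<close>). Each of the conditions is a statement about \<open>h\<close>.

 \<^item> \<open>f\<close> is loose by small deformation iff there is a unit vector field along \<open>f\<close>: push \<open>f\<close> along the field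
  (\<open>push_exists\<close>); conversely take the direction from \<open>f x\<close> to a nearby \<open>f' x\<close> (\<open>direction_exists\<close>).
  Such a field is a section of the sphere bundle over \<open>f\<close>, so it exists iff \<open>h\<close> is null-homotopic
  (\<open>section_of_null\<close>, \<open>null_of_section\<close>, \<open>lifts_iff_null\<close>).
 \<^item> \<open>f\<close> is not coincidence producing iff it lifts to the space of pairs of distinct points of \<open>N\<close>, which fibers over
  \<open>N\<close> with fiber \<open>N\<close> minus a point. Pushing the lift over the disc along itself shows that the obstruction
  is now a small sphere around the base point, parametrized by \<open>h\<close>; dragging its center to \<open>x\<^sub>0\<close> makes it \<open>j \<circ> h\<close>.
  So the condition says that \<open>j \<circ> h\<close> is null-homotopic (\<open>producing_iff_null\<close>), that is, \<open>j\<^sub>*(\<partial>[f]) = 0\<close>.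

 The equivalence of the conditions for all \<open>f\<close> therefore says that no \<open>\<partial>[f] \<noteq> 0\<close> is killed by \<open>j\<^sub>*\<close>. For \<open>m = 1\<close>,
 all fields exist: the fiber is connected if \<open>n \<ge> 2\<close>, and connected \<open>1\<close>-manifolds are orientable (\<open>no_flipping_path\<close>).

 If \<open>N\<close> is not simply connected, a null-homotopy of \<open>j \<circ> h\<close> lifts to the universal cover and misses two points
 over \<open>x\<^sub>0\<close>. One can be moved close to the other, and there is a map from the complement of both to
 \<open>\<real>\<^sup>n - {0}\<close> that is the identity near one of them, up to homotopy; so \<open>h\<close> is null-homotopic (\<open>sphere_null_off_two_points\<close>).
 In a projective space, lift the null-homotopy to nonzero vectors and project along the line \<open>x\<^sub>0\<close>: it ends in
 one line of a space of dimension at least two, hence \<open>h\<close> is null-homotopic (\<open>null_inclusion_projective\<close>).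
\<close>

section \<open>The homotopy lifting property\<close>

text \<open>Lifts can be moved to nearby fibers, continuously in the lift and in the target. This weak form of local
 triviality holds for sphere bundles, configuration spaces, coverings and the tautological bundle, and it suffices
 for lifting homotopies.\<close>

definition sliced :: "'e topology \<Rightarrow> 'b topology \<Rightarrow> ('e \<Rightarrow> 'b) \<Rightarrow> bool" where
 "sliced E B p \<longleftrightarrow> continuous_map E B p \<and>
   (\<forall>b\<in>topspace B. \<exists>U T. openin B U \<and> b \<in> U \<and>
    continuous_map (subtopology (prod_topology E B) {(e, y). p e \<in> U \<and> y \<in> U}) E (\<lambda>(e, y). T e y) \<and>
    (\<forall>e\<in>topspace E. \<forall>y\<in>U. p e \<in> U \<longrightarrow> p (T e y) = y) \<and>
    (\<forall>e\<in>topspace E. p e \<in> U \<longrightarrow> T e (p e) = e))"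

abbreviation cont_on :: "'z::topological_space set \<Rightarrow> 'y topology \<Rightarrow> ('z \<Rightarrow> 'y) \<Rightarrow> bool" where
 "cont_on S \<equiv> continuous_map (top_of_set S)"

abbreviation homot :: "'x topology \<Rightarrow> 'y topology \<Rightarrow> ('x \<Rightarrow> 'y) \<Rightarrow> ('x \<Rightarrow> 'y) \<Rightarrow> bool" where
 "homot \<equiv> homotopic_with (\<lambda>_. True)"

lemmas into_sub = continuous_map_in_subtopology
 and cmap_comp = continuous_map_compose
 and cmap_restrict = continuous_map_from_subtopology
 and cmap_mono = continuous_map_from_subtopology_mono
 and open_preim = openin_continuous_map_preimage

lemma cmap_paste:
 assumes "closedin X S" "closedin X S'" "topspace X \<subseteq> S \<union> S'"
  and "continuous_map (subtopology X S) Y h" "continuous_map (subtopology X S') Y h"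
 shows "continuous_map X Y h"
 by (rule pasting_lemma_closed[where I="{True, False}" and T="\<lambda>b. if b then S else S'" and f="\<lambda>_. h"])
  (use assms in \<open>auto split: if_splits\<close>)

abbreviation cyl :: "'z::metric_space set \<Rightarrow> (real \<times> 'z) topology" where
 "cyl K \<equiv> top_of_set ({0..1} \<times> K)"

abbreviation cont_cyl :: "'z::metric_space set \<Rightarrow> 'y topology \<Rightarrow> (real \<times> 'z \<Rightarrow> 'y) \<Rightarrow> bool" where
 "cont_cyl K \<equiv> continuous_map (cyl K)"

lemma cmap_comp_pair:
 assumes "continuous_on S u" "continuous_on S v" "\<And>x. x \<in> S \<Longrightarrow> (u x, v x) \<in> T"
  and "cont_on T Y h"
 shows "cont_on S Y (\<lambda>x. h (u x, v x))"
proof -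
 have "cont_on S (top_of_set T) (\<lambda>x. (u x, v x))" using assms by (auto intro!: continuous_intros simp: into_sub)
 from cmap_comp[OF this assms(4)] show ?thesis by (simp add: o_def)
qed

lemma cmap_comp_on:
 assumes "continuous_on S u" "u \<in> S \<rightarrow> T" "cont_on T Y h"
 shows "cont_on S Y (\<lambda>x. h (u x))"
proof -
 have "cont_on S (top_of_set T) u" using assms by auto
 from cmap_comp[OF this assms(3)] show ?thesis by (simp add: o_def)
qed

text \<open>The path over \<open>z\<close> is lifted up to the time \<open>tau z\<close> only; the last clause makes the lift constant where \<open>f\<close> is.\<close>

definition partial_lift ::
 "'e topology \<Rightarrow> ('e \<Rightarrow> 'b) \<Rightarrow> 'z::metric_space set \<Rightarrow> (real \<times> 'z \<Rightarrow> 'b) \<Rightarrow> ('z \<Rightarrow> 'e) \<Rightarrow> ('z \<Rightarrow> real) \<Rightarrow> bool" where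
 "partial_lift E p K f g tau \<longleftrightarrow> (\<exists>F. cont_cyl K E F \<and>
   (\<forall>z\<in>K. F (0, z) = g z) \<and>
   (\<forall>t\<in>{0..1}. \<forall>z\<in>K. p (F (t, z)) = f (min t (tau z), z)) \<and>
   (\<forall>z\<in>K. (\<forall>t\<in>{0..1}. f (t, z) = f (0, z)) \<longrightarrow> (\<forall>t\<in>{0..1}. F (t, z) = g z)))"

text \<open>Between the times \<open>tau z\<close> and \<open>tau' z\<close>, the homotopy stays in a set \<open>U\<close> over which \<open>T\<close> moves lifts; so \<open>T\<close>
 continues the lift.\<close>

lemma partial_lift_step:
 assumes P: "partial_lift E p K f g tau"
  and f: "cont_cyl K B f"
  and tau: "continuous_on K tau" "continuous_on K tau'" "\<And>z. z \<in> K \<Longrightarrow> 0 \<le> tau z \<and> tau z \<le> tau' z \<and> tau' z \<le> 1"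
  and C: "closed C" "\<And>z. z \<in> K \<Longrightarrow> tau z < tau' z \<Longrightarrow> z \<in> C"
  and U: "\<And>z t. z \<in> K \<Longrightarrow> z \<in> C \<Longrightarrow> tau z \<le> t \<Longrightarrow> t \<le> tau' z \<Longrightarrow> f (t, z) \<in> U"
  and T: "continuous_map (subtopology (prod_topology E B) {(e, y). p e \<in> U \<and> y \<in> U}) E (\<lambda>(e, y). T e y)"
   "\<And>e y. e \<in> topspace E \<Longrightarrow> y \<in> U \<Longrightarrow> p e \<in> U \<Longrightarrow> p (T e y) = y"
   "\<And>e. e \<in> topspace E \<Longrightarrow> p e \<in> U \<Longrightarrow> T e (p e) = e"
 shows "partial_lift E p K f g tau'"
proof -
 obtain F where F: "cont_cyl K E F" "\<And>z. z\<in>K \<Longrightarrow> F (0, z) = g z"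
  "\<And>t z. t\<in>{0..1} \<Longrightarrow> z \<in> K \<Longrightarrow> p (F (t, z)) = f (min t (tau z), z)"
  "\<And>z t. z\<in>K \<Longrightarrow> (\<forall>t\<in>{0..1}. f (t, z) = f (0, z)) \<Longrightarrow> t\<in>{0..1} \<Longrightarrow> F (t, z) = g z"
  using P unfolding partial_lift_def by blast
 have FE: "F (t, z) \<in> topspace E" if "t\<in>{0..1}" "z \<in> K" for t z using F(1) that by (auto simp: continuous_map_def)
 define F' where "F' = (\<lambda>(t, z). if t \<le> tau z \<or> tau' z \<le> tau z then F (t, z) else T (F (t, z)) (f (min t (tau' z), z)))"
 have F'T: "F' (t, z) = T (F (t, z)) (f (min t (tau' z), z))" if "t\<in>{0..1}" "z \<in> K" "z \<in> C" "tau z \<le> t" for t z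
 proof (cases "t \<le> tau z \<or> tau' z \<le> tau z")
  case True
  then have "min t (tau' z) = min t (tau z)" using tau(3)[OF that(2)] that(4) by auto
  moreover have "f (min t (tau z), z) \<in> U"
   using U[OF that(2,3), of "tau z"] that(4) tau(3)[OF that(2)] by (simp add: min_def)
  ultimately show ?thesis using T(3)[OF FE[OF that(1,2)]] F(3)[OF that(1,2)] True by (simp add: F'_def)
 qed (simp add: F'_def)
 let ?S = "{x \<in> {0..1} \<times> K. fst x \<le> tau (snd x)} \<union> {x \<in> {0..1} \<times> K. tau' (snd x) \<le> tau (snd x)}"
 let ?S' = "{x \<in> {0..1} \<times> K. tau (snd x) \<le> fst x \<and> snd x \<in> C}"
 have ct: "continuous_on ({0..1} \<times> K) (\<lambda>x. tau (snd x))" "continuous_on ({0..1} \<times> K) (\<lambda>x. tau' (snd x))"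
  by (auto intro!: continuous_intros continuous_on_compose2[OF tau(1)] continuous_on_compose2[OF tau(2)])
 have cl: "closedin (cyl K) {x \<in> {0..1} \<times> K. u x \<le> v x}"
  if "continuous_on ({0..1} \<times> K) u" "continuous_on ({0..1} \<times> K) v" for u v :: "real \<times> 'c \<Rightarrow> real"
 proof -
  have "{x \<in> {0..1} \<times> K. u x \<le> v x} = ({0..1} \<times> K) \<inter> (\<lambda>x. v x - u x) -` {0..}" by auto
  then show ?thesis using continuous_closedin_preimage[of "{0..1} \<times> K" "\<lambda>x. v x - u x" "{0..}"] that
   by (auto intro!: continuous_intros)
 qed
 have S: "closedin (cyl K) ?S" by (intro closedin_Un cl ct continuous_intros)
 have "closedin (cyl K) ({0..1} \<times> K \<inter> UNIV \<times> C)" using C(1) by (intro closedin_closed_Int closed_Times) auto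
 moreover have "closedin (cyl K) {x \<in> {0..1} \<times> K. tau (snd x) \<le> fst x}" by (intro cl ct continuous_intros)
 ultimately have "closedin (cyl K) (({0..1} \<times> K \<inter> UNIV \<times> C) \<inter> {x \<in> {0..1} \<times> K. tau (snd x) \<le> fst x})"
  by (rule closedin_Int)
 moreover have "({0..1} \<times> K \<inter> UNIV \<times> C) \<inter> {x \<in> {0..1} \<times> K. tau (snd x) \<le> fst x} = ?S'" by auto
 ultimately have S': "closedin (cyl K) ?S'" by simp
 have F'1: "continuous_map (subtopology (cyl K) ?S) E F'"
 proof (rule continuous_map_eq)
  show "continuous_map (subtopology (cyl K) ?S) E F" using F(1) by (rule cmap_restrict)
 qed (auto simp: F'_def)
 have F'2: "continuous_map (subtopology (cyl K) ?S') E F'"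
 proof (rule continuous_map_eq)
  have "continuous_map (subtopology (cyl K) ?S') (prod_topology E B) (\<lambda>x. (F x, f (min (fst x) (tau' (snd x)), snd x)))"
  proof (rule continuous_map_pairedI)
   show "continuous_map (subtopology (cyl K) ?S') E F" using F(1) by (rule cmap_restrict)
   have "cont_cyl K B (\<lambda>x. f (min (fst x) (tau' (snd x)), snd x))" by (rule cmap_comp_pair[OF _ _ _ f])
     (use tau(3) in \<open>fastforce intro!: continuous_intros ct simp: min_def\<close>)+
   then show "continuous_map (subtopology (cyl K) ?S') B (\<lambda>x. f (min (fst x) (tau' (snd x)), snd x))"
    by (rule cmap_restrict)
  qed
  moreover have "(p (F (t, z)) \<in> U \<and> f (min t (tau' z), z) \<in> U)"
   if "t \<in> {0..1}" "z \<in> K" "z \<in> C" "tau z \<le> t" for t z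
   using F(3)[OF that(1,2)] U[OF that(2,3)] tau(3)[OF that(2)] that(4) by (simp add: min_def)
  ultimately have "continuous_map (subtopology (cyl K) ?S')
    (subtopology (prod_topology E B) {(e, y). p e \<in> U \<and> y \<in> U}) (\<lambda>x. (F x, f (min (fst x) (tau' (snd x)), snd x)))"
   by (auto simp: into_sub)
  from cmap_comp[OF this T(1)]
  show "continuous_map (subtopology (cyl K) ?S') E (\<lambda>x. T (F x) (f (min (fst x) (tau' (snd x)), snd x)))"
   by (simp add: o_def)
 qed (use F'T in auto)
 have "cont_cyl K E F'"
 proof (rule cmap_paste[OF S S' _ F'1 F'2])
  show "topspace (cyl K) \<subseteq> ?S \<union> ?S'" using C(2) by force
 qed
 moreover have "F' (0, z) = g z" if "z \<in> K" for z using F(2)[OF that] tau(3)[OF that] by (simp add: F'_def)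
 moreover have "p (F' (t, z)) = f (min t (tau' z), z)" if tz: "t \<in> {0..1}" "z \<in> K" for t z
 proof (cases "t \<le> tau z \<or> tau' z \<le> tau z")
  case True
  then have "min t (tau' z) = min t (tau z)" using tau(3)[OF tz(2)] by auto
  with True show ?thesis using F(3)[OF tz] by (simp add: F'_def)
 next
  case False
  then have z: "z \<in> C" "tau z \<le> t" using C(2) tz by auto
  have "p (F (t, z)) \<in> U \<and> f (min t (tau' z), z) \<in> U"
   using F(3)[OF tz] U[OF tz(2) z(1)] tau(3)[OF tz(2)] z(2) by (simp add: min_def)
  then show ?thesis using F'T[OF tz z] T(2) FE[OF tz] by simp
 qed
 moreover have "F' (t, z) = g z" if z: "z \<in> K" "\<forall>t\<in>{0..1}. f (t, z) = f (0, z)" "t \<in> {0..1}" for z t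
 proof (cases "t \<le> tau z \<or> tau' z \<le> tau z")
  case True
  then show ?thesis using F(4)[OF z] by (auto simp: F'_def)
 next
  case False
  then have zC: "z \<in> C" "tau z \<le> t" using C(2) z by auto
  have m: "min t (tau' z) \<in> {0..1}" "min t (tau z) \<in> {0..1}" using tau(3)[OF z(1)] z(3) by auto
  have "f (min t (tau' z), z) = f (min t (tau z), z)" using z(2) m by metis
  also have "\<dots> = p (F (t, z))" using F(3)[OF z(3,1)] by simp
  finally have "f (min t (tau' z), z) = p (F (t, z))" .
  moreover have "f (min t (tau z), z) \<in> U" using U[OF z(1) zC(1)] tau(3)[OF z(1)] zC(2) by (simp add: min_def)
  ultimately show ?thesis using F'T[OF z(3,1) zC] T(3)[OF FE[OF z(3,1)]] F(3)[OF z(3,1)] F(4)[OF z] by simp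
 qed
 ultimately show ?thesis unfolding partial_lift_def by blast
qed

text \<open>A Lebesgue number cuts \<open>{0..1} \<times> K\<close> into boxes on which \<open>f\<close> stays in one slice. In each time step, bump
 functions \<open>psi\<close> continue the lift over the balls of a finite cover of \<open>K\<close>, one after the other.\<close>

theorem homotopy_lifting:
 fixes K :: "'z::metric_space set"
 assumes E: "sliced E B p" and K: "compact K"
  and f: "cont_cyl K B f" and g: "cont_on K E g"
  and pg: "\<And>z. z \<in> K \<Longrightarrow> p (g z) = f (0, z)"
 shows "\<exists>F. cont_cyl K E F \<and> (\<forall>z\<in>K. F (0, z) = g z) \<and> (\<forall>t\<in>{0..1}. \<forall>z\<in>K. p (F (t, z)) = f (t, z)) \<and>
  (\<forall>z\<in>K. (\<forall>t\<in>{0..1}. f (t, z) = f (0, z)) \<longrightarrow> (\<forall>t\<in>{0..1}. F (t, z) = g z))"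
proof -
 define slice where "slice U \<longleftrightarrow> openin B U \<and> (\<exists>T.
    continuous_map (subtopology (prod_topology E B) {(e, y). p e \<in> U \<and> y \<in> U}) E (\<lambda>(e, y). T e y) \<and>
    (\<forall>e\<in>topspace E. \<forall>y\<in>U. p e \<in> U \<longrightarrow> p (T e y) = y) \<and>
    (\<forall>e\<in>topspace E. p e \<in> U \<longrightarrow> T e (p e) = e))" for U
 have slice: "\<exists>U. slice U \<and> b \<in> U" if "b \<in> topspace B" for b using E that unfolding sliced_def slice_def by blast
 define \<G> where "\<G> = {G. open G \<and> (\<exists>U. slice U \<and> (\<forall>x\<in>G \<inter> {0..1} \<times> K. f x \<in> U))}"
 have cov: "{0..1} \<times> K \<subseteq> \<Union>\<G>"
 proof
  fix x :: "real \<times> 'z" assume x: "x \<in> {0..1} \<times> K"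
  then have "f x \<in> topspace B" using f by (auto simp: continuous_map_def)
  then obtain U where U: "slice U" "f x \<in> U" using slice by blast
  then have "openin (cyl K) {x \<in> {0..1} \<times> K. f x \<in> U}" using f open_preim[OF f, of U] unfolding slice_def by simp
  then obtain G where "open G" "{x \<in> {0..1} \<times> K. f x \<in> U} = G \<inter> {0..1} \<times> K" by (auto simp: openin_open)
  then show "x \<in> \<Union>\<G>" using U x unfolding \<G>_def by blast
 qed
 have "compact ({0..1::real} \<times> K)" using K by (intro compact_Times) auto
 then obtain eps where eps: "eps > 0" "\<And>x. x \<in> {0..1} \<times> K \<Longrightarrow> \<exists>G\<in>\<G>. ball x eps \<subseteq> G"
  by (rule Heine_Borel_lemma[OF _ cov]) (auto simp: \<G>_def)
 obtain N where N: "N > 0" "1 / real N < eps / 2" using eps(1) by (metis half_gt_zero nat_approx_posE zero_less_Suc)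
 obtain A where A: "A \<subseteq> K" "finite A" "K \<subseteq> (\<Union>a\<in>A. ball a (eps / 4))"
  by (rule compactE_image[OF K, of K "\<lambda>a. ball a (eps / 4)"]) (use eps(1) in auto)
 \<comment> \<open>\<open>psi a\<close> is \<open>1\<close> on the ball of radius \<open>eps / 4\<close> and supported in that of radius \<open>eps / 2\<close>\<close>
 define psi where "psi a z = max 0 (min 1 (2 - 4 * dist z a / eps))" for a z :: 'z
 have psic: "continuous_on K (psi a)" for a unfolding psi_def by (intro continuous_intros) (use eps in auto)
 have psi1: "psi a z = 1" if "z \<in> ball a (eps / 4)" for a z
  using that eps(1) by (auto simp: psi_def dist_commute field_simps min_def max_def)
 have psi0: "z \<in> cball a (eps / 2)" if "psi a z > 0" for a z
  using that eps(1) by (auto simp: psi_def dist_commute field_simps min_def max_def split: if_splits)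
 have psi01: "0 \<le> psi a z" "psi a z \<le> 1" for a z by (auto simp: psi_def)
 have main: "partial_lift E p K f g (\<lambda>_. real j / real N)" if "j \<le> N" for j using that
 proof (induction j)
  case 0
  have "cont_cyl K E (\<lambda>x. g (snd x))" by (rule cmap_comp_on[OF _ _ g]) (auto intro!: continuous_intros)
  then show ?case unfolding partial_lift_def by (intro exI[of _ "\<lambda>x. g (snd x)"]) (auto simp: pg)
 next
  case (Suc j)
  have "\<exists>sig. continuous_on K sig \<and> (\<forall>z\<in>K. 0 \<le> sig z \<and> sig z \<le> 1) \<and> (\<forall>z\<in>K. \<forall>a\<in>A'. psi a z \<le> sig z) \<and>
    partial_lift E p K f g (\<lambda>z. (real j + sig z) / real N)" if "A' \<subseteq> A" for A' using finite_subset[OF that A(2)] that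
  proof (induction A' rule: finite_induct)
   case empty
   then show ?case using Suc by (intro exI[of _ "\<lambda>_. 0"]) auto
  next
   case (insert a A')
   then obtain sig where sig: "continuous_on K sig" "\<And>z. z \<in> K \<Longrightarrow> 0 \<le> sig z \<and> sig z \<le> 1"
    "\<And>z a. z\<in>K \<Longrightarrow> a \<in> A' \<Longrightarrow> psi a z \<le> sig z"
    "partial_lift E p K f g (\<lambda>z. (real j + sig z) / real N)" by auto
   define sig' where "sig' z = max (sig z) (psi a z)" for z
   have sig'c: "continuous_on K sig'" unfolding sig'_def by (intro continuous_intros sig psic)
   have aK: "(real j / real N, a) \<in> {0..1} \<times> K" using insert A Suc.prems by auto
   from eps(2)[OF aK] obtain G where "G \<in> \<G>" and G: "ball (real j / real N, a) eps \<subseteq> G" by blast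
   then obtain U where U: "slice U" "\<And>x. x \<in> G \<inter> {0..1} \<times> K \<Longrightarrow> f x \<in> U" unfolding \<G>_def by blast
   from U(1) obtain T where T:
    "continuous_map (subtopology (prod_topology E B) {(e, y). p e \<in> U \<and> y \<in> U}) E (\<lambda>(e, y). T e y)"
    "\<And>e y. e\<in>topspace E \<Longrightarrow> y\<in>U \<Longrightarrow> p e \<in> U \<Longrightarrow> p (T e y) = y"
    "\<And>e. e\<in>topspace E \<Longrightarrow> p e \<in> U \<Longrightarrow> T e (p e) = e" unfolding slice_def by blast
   have "partial_lift E p K f g (\<lambda>z. (real j + sig' z) / real N)"
   proof (rule partial_lift_step[OF sig(4) f _ _ _ closed_cball[of a "eps/2"] _ _ T])
    show "continuous_on K (\<lambda>z. (real j + sig z) / real N)" "continuous_on K (\<lambda>z. (real j + sig' z) / real N)"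
     using N by (auto intro!: continuous_intros sig sig'c)
    show "0 \<le> (real j + sig z) / real N \<and> (real j + sig z) / real N \<le> (real j + sig' z) / real N \<and>
     (real j + sig' z) / real N \<le> 1" if "z \<in> K" for z
    proof -
     have "sig' z \<le> 1" "sig z \<le> sig' z" "0 \<le> sig z" using sig(2)[OF that] psi01 by (auto simp: sig'_def)
     then show ?thesis using N Suc.prems by (simp add: field_simps)
    qed
    show "z \<in> cball a (eps / 2)" if "z \<in> K" "(real j + sig z) / real N < (real j + sig' z) / real N" for z
    proof -
     have "sig z < sig' z" using that N by (simp add: divide_less_cancel)
     then show ?thesis using sig(2)[OF that(1)] by (intro psi0) (auto simp: sig'_def max_def split: if_splits)
    qed
    show "f (t, z) \<in> U" if "z \<in> K" "z \<in> cball a (eps / 2)" "(real j + sig z) / real N \<le> t" "t \<le> (real j + sig' z) / real N" for z t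
    proof (rule U(2))
     have "sig' z \<le> 1" "0 \<le> sig z" using sig(2)[OF that(1)] psi01 by (auto simp: sig'_def)
     then have t: "real j / real N \<le> t" "t \<le> (real j + 1) / real N"
      using that(3,4) N(1) by (smt (verit, best) divide_right_mono of_nat_0_less_iff)+
     have "dist (real j / real N, a) (t, z) \<le> \<bar>t - real j / real N\<bar> + dist a z"
      unfolding dist_prod_def using sqrt_sum_squares_le_sum_abs[of "dist (real j / real N) t" "dist a z"]
      by (simp add: dist_real_def abs_minus_commute)
     also have "\<dots> < eps" using t N(2) that(2) by (simp add: add_divide_distrib)
     finally have "(t, z) \<in> G" using G by auto
     moreover have "0 \<le> real j / real N" "(real j + 1) / real N \<le> 1" using N(1) Suc.prems by auto
     then have "t \<in> {0..1}" using t by (metis atLeastAtMost_iff order_trans)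
     ultimately show "(t, z) \<in> G \<inter> {0..1} \<times> K" using that(1) by auto
    qed
   qed
   moreover have "\<forall>z\<in>K. 0 \<le> sig' z \<and> sig' z \<le> 1" using sig(2) psi01 by (simp add: sig'_def le_max_iff_disj)
   moreover have "\<forall>z\<in>K. \<forall>a\<in>insert a A'. psi a z \<le> sig' z" using sig(3) by (auto simp: sig'_def le_max_iff_disj)
   ultimately show ?case using sig'c by blast
  qed
  from this[OF order_refl] obtain sig where sig: "\<And>z. z\<in>K \<Longrightarrow> 0 \<le> sig z \<and> sig z \<le> 1" "\<And>z a. z\<in>K \<Longrightarrow> a\<in>A \<Longrightarrow> psi a z \<le> sig z"
   "partial_lift E p K f g (\<lambda>z. (real j + sig z) / real N)" by blast
  have "sig z = 1" if "z \<in> K" for z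
  proof -
   obtain a where "a \<in> A" "z \<in> ball a (eps / 4)" using A(3) \<open>z \<in> K\<close> by auto
   then show ?thesis using sig(1,2)[OF that] psi1 by (metis antisym)
  qed
  then show ?case using sig(3) unfolding partial_lift_def by (simp add: add.commute cong: ball_cong)
 qed
 have "partial_lift E p K f g (\<lambda>_. 1)" using main[of N] N by simp
 then obtain F where F: "cont_cyl K E F" "\<forall>z\<in>K. F (0, z) = g z"
  "\<forall>t\<in>{0..1}. \<forall>z\<in>K. p (F (t, z)) = f (min t 1, z)"
  "\<forall>z\<in>K. (\<forall>t\<in>{0..1}. f (t, z) = f (0, z)) \<longrightarrow> (\<forall>t\<in>{0..1}. F (t, z) = g z)" unfolding partial_lift_def by blast
 have "\<forall>t\<in>{0..1}. \<forall>z\<in>K. p (F (t, z)) = f (t, z)" using F(3) by (simp add: min.absorb1)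
 with F show ?thesis by (intro exI[of _ F]) blast
qed

section \<open>Vertical homotopies\<close>

abbreviation fib :: "'e topology \<Rightarrow> ('e \<Rightarrow> 'b) \<Rightarrow> 'b \<Rightarrow> 'e topology" where
 "fib E p b \<equiv> subtopology E {e. p e = b}"

lemma into_fib:
 "continuous_map X (fib E p b) f \<longleftrightarrow> continuous_map X E f \<and> (\<forall>x\<in>topspace X. p (f x) = b)" by (auto simp: into_sub)

lemma closedin_le_preimage:
 fixes u v :: "'x::topological_space \<Rightarrow> real"
 assumes "continuous_on S u" "continuous_on S v"
 shows "closedin (top_of_set S) {x \<in> S. u x \<le> v x}"
proof -
 have "{x \<in> S. u x \<le> v x} = S \<inter> (\<lambda>x. v x - u x) -` {0..}" by auto
 then show ?thesis using continuous_closedin_preimage[of S "\<lambda>x. v x - u x" "{0..}"] assms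
  by (auto intro!: continuous_intros)
qed

lemma continuous_map_if_le:
 fixes u v :: "'x::topological_space \<Rightarrow> real"
 assumes uv: "continuous_on S u" "continuous_on S v"
  and f: "cont_on {x \<in> S. u x \<le> v x} Y f"
  and g: "cont_on {x \<in> S. v x \<le> u x} Y g"
  and fg: "\<And>x. x \<in> S \<Longrightarrow> u x = v x \<Longrightarrow> f x = g x"
 shows "cont_on S Y (\<lambda>x. if u x \<le> v x then f x else g x)"
proof (rule cmap_paste[OF closedin_le_preimage[OF uv] closedin_le_preimage[OF uv(2,1)]])
 have [simp]: "S \<inter> {x \<in> S. P x} = {x \<in> S. P x}" for P by auto
 show "continuous_map (subtopology (top_of_set S) {x \<in> S. u x \<le> v x}) Y (\<lambda>x. if u x \<le> v x then f x else g x)"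
  by (rule continuous_map_eq[where f=f]) (use f in \<open>auto simp: subtopology_subtopology\<close>)
 show "continuous_map (subtopology (top_of_set S) {x \<in> S. v x \<le> u x}) Y (\<lambda>x. if u x \<le> v x then f x else g x)"
  by (rule continuous_map_eq[where f=g]) (use g fg in \<open>auto simp: subtopology_subtopology\<close>)
qed auto

lemma homotopic_withI_cyl:
 assumes "cont_cyl K Y H" "\<And>z. z \<in> K \<Longrightarrow> H (0, z) = f z" "\<And>z. z \<in> K \<Longrightarrow> H (1, z) = g z"
 shows "homot (top_of_set K) Y f g" unfolding homotopic_with[where P="\<lambda>_. True" and X="top_of_set K", simplified]
 by (rule exI[of _ H]) (use assms in \<open>auto simp: prod_topology_subtopology_eu\<close>)

lemma homotopic_withD_cyl:
 assumes "homotopic_with P (top_of_set K) Y f g"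
 shows "\<exists>H. cont_cyl K Y H \<and> (\<forall>z. H (0, z) = f z) \<and> (\<forall>z. H (1, z) = g z) \<and>
  (\<forall>t\<in>{0..1}. P (\<lambda>z. H (t, z)))" using assms unfolding homotopic_with_def by (auto simp: prod_topology_subtopology_eu)

text \<open>Run back along \<open>G\<close> and forward along \<open>G'\<close>. This lifts a path that runs back and forth along \<open>f\<close>, so it
 contracts to \<open>f (1, z)\<close>; lift the contraction.\<close>

lemma lifts_vertically_homotopic:
 fixes K :: "'z::metric_space set"
 assumes E: "sliced E B p" and K: "compact K" and f: "cont_cyl K B f"
  and G: "cont_cyl K E G" "\<And>t z. t \<in> {0..1} \<Longrightarrow> z \<in> K \<Longrightarrow> p (G (t, z)) = f (t, z)"
  and G': "cont_cyl K E G'" "\<And>t z. t \<in> {0..1} \<Longrightarrow> z \<in> K \<Longrightarrow> p (G' (t, z)) = f (t, z)"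
  and GG': "\<And>z. z \<in> K \<Longrightarrow> G (0, z) = G' (0, z)"
 shows "\<exists>H. cont_cyl K E H \<and> (\<forall>z\<in>K. H (0, z) = G (1, z)) \<and>
  (\<forall>z\<in>K. H (1, z) = G' (1, z)) \<and> (\<forall>u\<in>{0..1}. \<forall>z\<in>K. p (H (u, z)) = f (1, z))"
proof -
 let ?Z = "{-1..1::real} \<times> K"
 define M where "M = (\<lambda>(s, u, z). f (\<bar>u\<bar> + s * (1 - \<bar>u\<bar>), z))"
 define st where "st = (\<lambda>x. if 0 \<le> fst x then G (fst x, snd x) else G' (- fst x, snd x))"
 have in01: "\<bar>u\<bar> + s * (1 - \<bar>u\<bar>) \<in> {0..1}" if "u \<in> {-1..1}" "s \<in> {0..1}" for u s :: real
 proof -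
  have "\<bar>u\<bar> \<le> 1" using that by auto
  then have "s * (1 - \<bar>u\<bar>) \<le> 1 * (1 - \<bar>u\<bar>)" "0 \<le> s * (1 - \<bar>u\<bar>)"
   using that by (intro mult_right_mono mult_nonneg_nonneg; simp)+
  then show ?thesis by auto
 qed
 have M: "cont_cyl ?Z B M"
 proof -
  have "cont_cyl ?Z B (\<lambda>x. f (\<bar>fst (snd x)\<bar> + fst x * (1 - \<bar>fst (snd x)\<bar>), snd (snd x)))"
   by (rule cmap_comp_pair[OF _ _ _ f]) (use in01 in \<open>auto intro!: continuous_intros\<close>)
  then show ?thesis by (simp add: M_def case_prod_unfold)
 qed
 have st: "cont_on ?Z E st" unfolding st_def
 proof (rule continuous_map_if_le)
  show "cont_on {x \<in> ?Z. 0 \<le> fst x} E (\<lambda>x. G (fst x, snd x))"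
   by (rule cmap_comp_pair[OF _ _ _ G(1)]) (auto intro!: continuous_intros)
  show "cont_on {x \<in> ?Z. fst x \<le> 0} E (\<lambda>x. G' (- fst x, snd x))"
   by (rule cmap_comp_pair[OF _ _ _ G'(1)]) (auto intro!: continuous_intros)
 qed (use GG' in \<open>auto intro!: continuous_intros\<close>)
 have pst: "p (st z) = M (0, z)" if "z \<in> ?Z" for z using that G(2) G'(2) by (auto simp: st_def M_def)
 have "compact ?Z" using K by (intro compact_Times) auto
 obtain F where
  F: "cont_cyl ?Z E F" "\<forall>z\<in>?Z. F (0, z) = st z"
  "\<forall>t\<in>{0..1}. \<forall>z\<in>?Z. p (F (t, z)) = M (t, z)"
  "\<forall>z\<in>?Z. (\<forall>t\<in>{0..1}. M (t, z) = M (0, z)) \<longrightarrow> (\<forall>t\<in>{0..1}. F (t, z) = st z)"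
  using homotopy_lifting[OF E \<open>compact ?Z\<close> M st pst] by blast
 have "cont_cyl K E (\<lambda>x. F (1, 1 - 2 * fst x, snd x))"
  by (rule cmap_comp_pair[OF _ _ _ F(1)]) (auto intro!: continuous_intros)
 moreover have "F (1, 1, z) = G (1, z)" "F (1, -1, z) = G' (1, z)" if "z \<in> K" for z
  using F(4)[rule_format, of "(1, z)" 1] F(4)[rule_format, of "(-1, z)" 1] that by (auto simp: M_def st_def)
 moreover have "p (F (1, 1 - 2 * u, z)) = f (1, z)" if "u \<in> {0..1}" "z \<in> K" for u z
  using F(3)[rule_format, of 1 "(1 - 2 * u, z)"] that by (auto simp: M_def)
 ultimately show ?thesis by (intro exI[of _ "\<lambda>x. F (1, 1 - 2 * fst x, snd x)"]) auto
qed

text \<open>Transport of fibers along a path of the base preserves null-homotopic maps: lift the null-homotopy along the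
 path and compare with \<open>G\<close>, by uniqueness of lifts up to vertical homotopy.\<close>

lemma null_homotopy_transport:
 fixes K :: "'z::metric_space set"
 assumes E: "sliced E B p" and K: "compact K" "K \<noteq> {}"
  and G: "cont_cyl K E G" "\<And>t z. t \<in> {0..1} \<Longrightarrow> z \<in> K \<Longrightarrow> p (G (t, z)) = alp t"
  and null: "homot (top_of_set K) (fib E p (alp 0)) (\<lambda>z. G (0, z)) (\<lambda>_. y)"
 shows "\<exists>y'. homot (top_of_set K) (fib E p (alp 1)) (\<lambda>z. G (1, z)) (\<lambda>_. y')"
proof -
 obtain z0 where z0: "z0 \<in> K" using K by blast
 have pc: "continuous_map E B p" using E by (simp add: sliced_def)
 have "continuous_map (cyl {z0}) E G" using G(1) by (rule cmap_mono) (use z0 in auto)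
 have "cont_on {0..1} E (\<lambda>t. G (t, z0))"
  by (rule cmap_comp_pair[OF _ _ _ G(1)]) (use z0 in \<open>auto intro!: continuous_intros\<close>)
 from cmap_comp[OF this pc] have alp: "cont_on {0..1} B alp" by (rule continuous_map_eq) (use G(2) z0 in auto)
 obtain N where N: "cont_cyl K (fib E p (alp 0)) N" "\<And>z. N (0, z) = G (0, z)" "\<And>z. N (1, z) = y"
  using homotopic_withD_cyl[OF null] by blast
 have N': "cont_cyl K E N" "\<And>u z. u \<in> {0..1} \<Longrightarrow> z \<in> K \<Longrightarrow> p (N (u, z)) = alp 0" using N(1) by (auto simp: into_fib)
 let ?Z = "{0..1::real} \<times> K"
 have c1: "cont_cyl ?Z B (\<lambda>x. alp (fst x))" by (rule cmap_comp_on[OF _ _ alp]) (auto intro!: continuous_intros)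
 have c2: "compact ?Z" using K by (intro compact_Times) auto
 have c3: "p (N z) = alp (fst (0::real, z))" if "z \<in> ?Z" for z using N'(2) that by auto
 obtain F where F: "cont_cyl ?Z E F" "\<forall>z\<in>?Z. F (0, z) = N z"
  "\<forall>t\<in>{0..1}. \<forall>z\<in>?Z. p (F (t, z)) = alp (fst (t, z))" using homotopy_lifting[OF E c2 c1 N'(1) c3] by blast
 have Fc: "cont_cyl K E (\<lambda>x. F (fst x, u, v (snd x)))"
  if "u \<in> {0..1}" "continuous_on K v" "v \<in> K \<rightarrow> K" for u v by (rule cmap_comp_pair[OF _ _ _ F(1)])
   (use that in \<open>auto intro!: continuous_intros continuous_on_compose2[OF that(2)]\<close>)
 have alp': "cont_cyl K B (\<lambda>x. alp (fst x))" by (rule cmap_comp_on[OF _ _ alp]) (auto intro!: continuous_intros)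
 have "\<exists>H. cont_cyl K E H \<and> (\<forall>z\<in>K. H (0, z) = G (1, z)) \<and>
  (\<forall>z\<in>K. H (1, z) = F (1, 0, z)) \<and> (\<forall>u\<in>{0..1}. \<forall>z\<in>K. p (H (u, z)) = alp 1)"
  using lifts_vertically_homotopic[OF E K(1) alp' G(1) _ Fc[of 0 id]] G F N(2) by simp
 then obtain H1 where H1: "cont_cyl K E H1" "\<forall>z\<in>K. H1 (0, z) = G (1, z)"
  "\<forall>z\<in>K. H1 (1, z) = F (1, 0, z)" "\<forall>u\<in>{0..1}. \<forall>z\<in>K. p (H1 (u, z)) = alp 1" by blast
 have h1: "homot (top_of_set K) (fib E p (alp 1)) (\<lambda>z. G (1, z)) (\<lambda>z. F (1, 0, z))"
  by (rule homotopic_withI_cyl[of _ _ H1]) (use H1 in \<open>auto simp: into_fib\<close>)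
 have "cont_cyl K E (\<lambda>x. F (1, fst x, snd x))"
  by (rule cmap_comp_pair[OF _ _ _ F(1)]) (auto intro!: continuous_intros)
 then have h2: "homot (top_of_set K) (fib E p (alp 1)) (\<lambda>z. F (1, 0, z)) (\<lambda>z. F (1, 1, z))"
  by (intro homotopic_withI_cyl[of _ _ "\<lambda>x. F (1, x)"]) (use F in \<open>auto simp: into_fib\<close>)
 have "\<exists>H. cont_cyl K E H \<and> (\<forall>z\<in>K. H (0, z) = F (1, 1, z)) \<and>
  (\<forall>z\<in>K. H (1, z) = F (1, 1, z0)) \<and> (\<forall>u\<in>{0..1}. \<forall>z\<in>K. p (H (u, z)) = alp 1)"
  using lifts_vertically_homotopic[OF E K(1) alp' Fc[of 1 id] _ Fc[of 1 "\<lambda>_. z0"]] F N(3) z0 by simp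
 then obtain H3 where H3: "cont_cyl K E H3" "\<forall>z\<in>K. H3 (0, z) = F (1, 1, z)"
  "\<forall>z\<in>K. H3 (1, z) = F (1, 1, z0)" "\<forall>u\<in>{0..1}. \<forall>z\<in>K. p (H3 (u, z)) = alp 1" by blast
 have h3: "homot (top_of_set K) (fib E p (alp 1)) (\<lambda>z. F (1, 1, z)) (\<lambda>z. F (1, 1, z0))"
  by (rule homotopic_withI_cyl[of _ _ H3]) (use H3 in \<open>auto simp: into_fib\<close>)
 show ?thesis using homotopic_with_trans[OF homotopic_with_trans[OF h1 h2] h3] by blast
qed

section \<open>Discs and spheres\<close>

definition Sph :: "nat \<Rightarrow> (nat \<Rightarrow> real) set" where
 "Sph k = {x. (\<Sum>i\<le>k. (x i)\<^sup>2) = 1 \<and> (\<forall>i>k. x i = 0)}"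

definition Dsc :: "nat \<Rightarrow> (nat \<Rightarrow> real) set" where
 "Dsc m = {x. (\<Sum>i<m. (x i)\<^sup>2) \<le> 1 \<and> (\<forall>i\<ge>m. x i = 0)}"

lemma nsphere_eq: "nsphere k = top_of_set (Sph k)" by (simp add: nsphere Sph_def euclidean_product_topology)

lemma disc_eq: "disc m = top_of_set (Dsc m)"
proof -
 have "{x. \<forall>i\<ge>m. x i = 0} \<inter> {x. (\<Sum>i<m. (x i)\<^sup>2) \<le> 1} = Dsc m" by (auto simp: Dsc_def)
 then show ?thesis by (simp add: disc_def Euclidean_space_def euclidean_product_topology subtopology_subtopology)
qed

lemma topspace_nsphere [simp]: "topspace (nsphere k) = Sph k" by (simp add: nsphere_eq)

lemma continuous_on_coord:
 fixes f :: "'z::topological_space \<Rightarrow> nat \<Rightarrow> real"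
 shows "continuous_on S f \<Longrightarrow> continuous_on S (\<lambda>x. f x i)" by (rule continuous_on_product_then_coordinatewise)

lemma continuous_on_coord_app [continuous_intros]:
 "continuous_on S (\<lambda>x::nat \<Rightarrow> real. x i)"
 "continuous_on T (\<lambda>x::'b::topological_space \<times> (nat \<Rightarrow> real). snd x i)"
 by (rule continuous_on_coord[OF continuous_on_id], rule continuous_on_coord[OF continuous_on_snd[OF continuous_on_id]])

declare continuous_on_coordinatewise_then_product [continuous_intros del]

lemma continuous_on_coordI:
 fixes f :: "'z::topological_space \<Rightarrow> nat \<Rightarrow> real"
 shows "(\<And>i. continuous_on S (\<lambda>x. f x i)) \<Longrightarrow> continuous_on S f" by (rule continuous_on_coordinatewise_then_product)

lemma compact_bounded_closed_coords:
 fixes S :: "(nat \<Rightarrow> real) set"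
 assumes "closed S" "\<And>x i. x \<in> S \<Longrightarrow> \<bar>x i\<bar> \<le> 1"
 shows "compact S"
proof -
 have "compactin (product_topology (\<lambda>i. euclidean) UNIV) (PiE (UNIV::nat set) (\<lambda>i. {-1..1::real}))"
  by (simp add: compactin_PiE)
 then have "compact (PiE (UNIV::nat set) (\<lambda>i. {-1..1::real}))" by (simp add: euclidean_product_topology)
 moreover have "S \<subseteq> PiE (UNIV::nat set) (\<lambda>i. {-1..1::real})" using assms(2) by (force simp: abs_le_iff)
 ultimately show ?thesis using assms(1) by (metis compact_Int_closed inf.absorb_iff2)
qed

lemma square_le_sum: "finite A \<Longrightarrow> i \<in> A \<Longrightarrow> (x i)\<^sup>2 \<le> (\<Sum>i\<in>A. (x i :: real)\<^sup>2)"
 by (metis (no_types, lifting) member_le_sum zero_le_power2)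

lemma compact_Dsc: "compact (Dsc m)"
proof (rule compact_bounded_closed_coords)
 have "Dsc m = {x. (\<Sum>i<m. (x i)\<^sup>2) \<le> 1} \<inter> (\<Inter>i\<in>{m..}. {x. x i = 0})" by (auto simp: Dsc_def)
 moreover have "closed {x::nat\<Rightarrow>real. (\<Sum>i<m. (x i)\<^sup>2) \<le> 1}" by (intro closed_Collect_le continuous_intros)
 moreover have "closed {x::nat\<Rightarrow>real. x i = 0}" for i by (intro closed_Collect_eq continuous_intros)
 ultimately show "closed (Dsc m)" by (simp add: closed_INT closed_Int)
 show "\<bar>x i\<bar> \<le> 1" if "x \<in> Dsc m" for x i
 proof (cases "i < m")
  case True
  then have "(x i)\<^sup>2 \<le> 1" using square_le_sum[of "{..<m}" i x] that by (auto simp: Dsc_def)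
  then show ?thesis by (simp add: abs_square_le_1)
 qed (use that in \<open>auto simp: Dsc_def\<close>)
qed

lemma Sph_eq: "Sph k = {x \<in> Dsc (Suc k). (\<Sum>i<Suc k. (x i)\<^sup>2) = 1}"
 by (auto simp: Sph_def Dsc_def lessThan_Suc_atMost Suc_le_eq)

lemma Sph_subset_Dsc: "Sph k \<subseteq> Dsc (Suc k)" by (auto simp: Sph_eq)

lemma compact_Sph: "compact (Sph k)"
proof -
 have "Sph k = Dsc (Suc k) \<inter> {x. (\<Sum>i<Suc k. (x i)\<^sup>2) = 1}" using Sph_eq by auto
 moreover have "closed {x::nat\<Rightarrow>real. (\<Sum>i<Suc k. (x i)\<^sup>2) = 1}" by (intro closed_Collect_eq continuous_intros)
 ultimately show ?thesis using compact_Dsc by (metis compact_Int_closed)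
qed

lemma pole_in_Sph: "pole k \<in> Sph k"
 by (simp add: Sph_def pole_def if_distrib[where f="\<lambda>x. x\<^sup>2"] sum.delta cong: if_cong)

lemma pole_in_Dsc: "pole k \<in> Dsc (Suc k)" using pole_in_Sph Sph_subset_Dsc by blast

definition lin :: "real \<Rightarrow> (nat \<Rightarrow> real) \<Rightarrow> (nat \<Rightarrow> real) \<Rightarrow> nat \<Rightarrow> real" where
 "lin t x y = (\<lambda>i. (1 - t) * x i + t * y i)"

lemma lin_simps [simp]: "lin 0 x y = x" "lin 1 x y = y" "lin t x x = x" by (auto simp: lin_def algebra_simps)

lemma lin_in_Dsc: "x \<in> Dsc m \<Longrightarrow> y \<in> Dsc m \<Longrightarrow> t \<in> {0..1} \<Longrightarrow> lin t x y \<in> Dsc m"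
proof -
 assume a: "x \<in> Dsc m" "y \<in> Dsc m" "t \<in> {0..1}"
 have "((1 - t) * u + t * v)\<^sup>2 \<le> (1 - t) * u\<^sup>2 + t * v\<^sup>2" for u v
 proof -
  have "(1 - t) * u\<^sup>2 + t * v\<^sup>2 - ((1 - t) * u + t * v)\<^sup>2 = t * (1 - t) * (u - v)\<^sup>2"
   by (simp add: power2_eq_square algebra_simps)
  moreover have "0 \<le> t * (1 - t) * (u - v)\<^sup>2" using a(3) by auto
  ultimately show ?thesis by linarith
 qed
 then have "(\<Sum>i<m. (lin t x y i)\<^sup>2) \<le> (\<Sum>i<m. (1 - t) * (x i)\<^sup>2 + t * (y i)\<^sup>2)" unfolding lin_def by (intro sum_mono)
 also have "\<dots> = (1 - t) * (\<Sum>i<m. (x i)\<^sup>2) + t * (\<Sum>i<m. (y i)\<^sup>2)" by (simp add: sum.distrib sum_distrib_left)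
 also have "\<dots> \<le> (1 - t) * 1 + t * 1" using a by (intro add_mono mult_left_mono) (auto simp: Dsc_def)
 finally show "lin t x y \<in> Dsc m" using a by (auto simp: Dsc_def lin_def)
qed

lemma continuous_on_lin [continuous_intros]:
 "continuous_on S t \<Longrightarrow> continuous_on S x \<Longrightarrow> continuous_on S y \<Longrightarrow> continuous_on S (\<lambda>z. lin (t z) (x z) (y z))"
proof (unfold lin_def, rule continuous_on_coordI)
 fix i assume a: "continuous_on S t" "continuous_on S x" "continuous_on S y"
 note c = continuous_on_coord[OF a(2), of i] continuous_on_coord[OF a(3), of i]
 show "continuous_on S (\<lambda>z. (1 - t z) * x z i + t z * y z i)" by (intro continuous_intros a c)
qed

definition nrm :: "nat \<Rightarrow> (nat \<Rightarrow> real) \<Rightarrow> real" where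
 "nrm m x = sqrt (\<Sum>i<m. (x i)\<^sup>2)"

lemma continuous_on_nrm [continuous_intros]: "continuous_on S f \<Longrightarrow> continuous_on S (\<lambda>x. nrm m (f x))"
proof -
 assume a: "continuous_on S f"
 note c = continuous_on_coord[OF a]
 show ?thesis unfolding nrm_def by (intro continuous_intros c)
qed

lemma nrm_scale: "nrm m (\<lambda>i. c * x i) = \<bar>c\<bar> * nrm m x"
 by (simp add: nrm_def power_mult_distrib flip: sum_distrib_left) (simp add: real_sqrt_mult)

lemma Dsc_nrm: "x \<in> Dsc m \<longleftrightarrow> nrm m x \<le> 1 \<and> (\<forall>i\<ge>m. x i = 0)" by (simp add: Dsc_def nrm_def)

lemma Sph_nrm: "x \<in> Sph k \<longleftrightarrow> nrm (Suc k) x = 1 \<and> (\<forall>i\<ge>Suc k. x i = 0)"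
 unfolding Sph_eq nrm_def Dsc_def by (auto simp del: sum.lessThan_Suc)

text \<open>The disc of radius \<open>1 + t\<close> carries \<open>L\<close> on the unit disc and the homotopy \<open>N\<close> on the collar; rescale it to the
 unit disc.\<close>

lemma disc_homotopy_extension:
 assumes L: "continuous_map (disc (Suc k)) Y L"
  and N: "cont_cyl (Sph k) Y N" "\<And>s. s \<in> Sph k \<Longrightarrow> N (0, s) = L s"
 shows "\<exists>G. cont_cyl (Dsc (Suc k)) Y G \<and> (\<forall>x\<in>Dsc (Suc k). G (0, x) = L x) \<and>
  (\<forall>t\<in>{0..1}. \<forall>s\<in>Sph k. G (t, s) = N (t, s))"
proof -
 let ?u = "\<lambda>x. (1 + fst x) * nrm (Suc k) (snd x)"
 let ?L = "\<lambda>x::real\<times>(nat\<Rightarrow>real). L (\<lambda>i. (1 + fst x) * snd x i)"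
 let ?N = "\<lambda>x::real\<times>(nat\<Rightarrow>real). N (?u x - 1, (\<lambda>i. snd x i / nrm (Suc k) (snd x)))"
 have L': "cont_on (Dsc (Suc k)) Y L" using L by (simp add: disc_eq)
 have n0: "nrm (Suc k) x \<ge> 0" for x by (simp add: nrm_def sum_nonneg)
 have 1: "cont_cyl (Dsc (Suc k)) Y (\<lambda>x. if ?u x \<le> 1 then ?L x else ?N x)"
 proof (rule continuous_map_if_le)
  show "cont_on {x \<in> {0..1} \<times> Dsc (Suc k). ?u x \<le> 1} Y ?L"
  proof (rule cmap_comp_on[OF _ _ L'])
   show "continuous_on {x \<in> {0..1} \<times> Dsc (Suc k). ?u x \<le> 1} (\<lambda>x i. (1 + fst x) * snd x i)"
    by (intro continuous_on_coordI continuous_intros)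
  qed (auto simp: Dsc_nrm nrm_scale)
  have "nrm (Suc k) x \<noteq> 0" if "1 \<le> (1 + t) * nrm (Suc k) x" for t x using that by auto
  then show "cont_on {x \<in> {0..1} \<times> Dsc (Suc k). 1 \<le> ?u x} Y ?N"
  proof (intro cmap_comp_pair[OF _ _ _ N(1)] continuous_intros continuous_on_coordI)
   fix x assume x: "x \<in> {x \<in> {0..1} \<times> Dsc (Suc k). 1 \<le> ?u x}"
   then have ne: "nrm (Suc k) (snd x) \<noteq> 0" by auto
   have "(1 + fst x) * nrm (Suc k) (snd x) \<le> 2 * 1" using x n0 by (intro mult_mono) (auto simp: Dsc_nrm)
   moreover have "nrm (Suc k) (\<lambda>i. snd x i / nrm (Suc k) (snd x)) = 1"
    using nrm_scale[of "Suc k" "1 / nrm (Suc k) (snd x)" "snd x"] ne n0[of "snd x"] by simp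
   ultimately show "(?u x - 1, (\<lambda>i. snd x i / nrm (Suc k) (snd x))) \<in> {0..1} \<times> Sph k"
    using x by (auto simp: Sph_nrm Dsc_nrm)
  qed auto
  show "?L x = ?N x" if x: "x \<in> {0..1} \<times> Dsc (Suc k)" "?u x = 1" for x
  proof -
   have ne: "nrm (Suc k) (snd x) \<noteq> 0" using x by auto
   then have "1 + fst x = 1 / nrm (Suc k) (snd x)" using x(2) by (simp add: field_simps)
   then have "(\<lambda>i. (1 + fst x) * snd x i) = (\<lambda>i. snd x i / nrm (Suc k) (snd x))" by simp
   moreover have "(\<lambda>i. (1 + fst x) * snd x i) \<in> Sph k" using x by (auto simp: Sph_nrm nrm_scale Dsc_nrm)
   ultimately show ?thesis using x(2) N(2) by simp
  qed
 qed (auto intro!: continuous_intros)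
 have 2: "(if ?u (0, x) \<le> 1 then ?L (0, x) else ?N (0, x)) = L x" if "x \<in> Dsc (Suc k)" for x
  using that by (simp add: Dsc_nrm)
 have 3: "(if ?u (t, s) \<le> 1 then ?L (t, s) else ?N (t, s)) = N (t, s)" if "t \<in> {0..1}" "s \<in> Sph k" for t s
 proof (cases "t = 0")
  case True
  then show ?thesis using that N(2)[OF that(2)] Sph_nrm[of s k] by simp
 next
  case False
  then have "\<not> ?u (t, s) \<le> 1" using that by (simp add: Sph_nrm)
  moreover have "?N (t, s) = N (t, s)" using that by (simp add: Sph_nrm)
  ultimately show ?thesis by presburger
 qed
 show ?thesis by (rule exI[of _ "\<lambda>x. if ?u x \<le> 1 then ?L x else ?N x"]) (use 1 2 3 in blast)
qed

definition nullh :: "nat \<Rightarrow> 'a topology \<Rightarrow> ((nat \<Rightarrow> real) \<Rightarrow> 'a) \<Rightarrow> bool" where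
 "nullh k Y g \<longleftrightarrow> (\<exists>y. homot (nsphere k) Y g (\<lambda>_. y))"

lemma nullh_extends:
 assumes "nullh k Y g"
 shows "\<exists>G. continuous_map (disc (Suc k)) Y G \<and> (\<forall>s\<in>Sph k. G s = g s)"
proof -
 obtain y where "homot (nsphere k) Y g (\<lambda>_. y)" using assms unfolding nullh_def by blast
 then have h: "homot (top_of_set (Sph k)) Y (\<lambda>_. y) g" by (simp add: nsphere_eq homotopic_with_sym)
 obtain N where N: "cont_cyl (Sph k) Y N" "\<forall>z. N (0, z) = y" "\<forall>z. N (1, z) = g z"
  using homotopic_withD_cyl[OF h] by blast
 have "y \<in> topspace Y" using N(1,2) pole_in_Sph[of k] by (fastforce simp: continuous_map_def)
 then obtain G where G: "cont_cyl (Dsc (Suc k)) Y G" "\<forall>s\<in>Sph k. G (1, s) = N (1, s)"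
  using disc_homotopy_extension[of k Y "\<lambda>_. y" N] N by auto
 have "cont_on (Dsc (Suc k)) Y (\<lambda>x. G (1, x))"
  by (rule cmap_comp_pair[OF _ _ _ G(1)]) (auto intro!: continuous_intros)
 then show ?thesis using G(2) N(3) by (auto simp: disc_eq intro!: exI[of _ "\<lambda>x. G (1, x)"])
qed

lemma extends_null_based:
 assumes G: "continuous_map (disc (Suc k)) Y G" "\<And>s. s \<in> Sph k \<Longrightarrow> G s = g s"
  and b: "g (pole k) = b"
 shows "homotopic_with (\<lambda>h. h (pole k) = b) (nsphere k) Y g (\<lambda>_. b)"
proof -
 have p: "pole k \<in> Dsc (Suc k)" by (rule pole_in_Dsc)
 have s: "Sph k \<subseteq> Dsc (Suc k)" by (rule Sph_subset_Dsc)
 have "cont_cyl (Sph k) Y (\<lambda>x. G (lin (fst x) (snd x) (pole k)))" by (rule cmap_comp_on[where T="Dsc (Suc k)"])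
   (use G p s in \<open>auto intro!: continuous_intros lin_in_Dsc simp: disc_eq\<close>)
 then show ?thesis unfolding nsphere_eq using G(2) b pole_in_Sph[of k]
  by (intro iffD2[OF homotopic_with] exI[of _ "\<lambda>x. G (lin (fst x) (snd x) (pole k))"])
   (auto simp: prod_topology_subtopology_eu)
qed

text \<open>A free null-homotopy extends the map over the disc, which contracts to the pole.\<close>

lemma nullh_based:
 assumes "nullh k Y g" "g (pole k) = b"
 shows "homotopic_with (\<lambda>h. h (pole k) = b) (nsphere k) Y g (\<lambda>_. b)"
proof -
 obtain G where "continuous_map (disc (Suc k)) Y G" "\<forall>s\<in>Sph k. G s = g s" using nullh_extends[OF assms(1)] by blast
 with extends_null_based[of k Y G g b] assms(2) show ?thesis by blast
qed

lemma homotopic_based_free: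
 "homotopic_with P X Y f g \<Longrightarrow> homot X Y f g" by (erule homotopic_with_mono) auto

lemma hclass_eqI:
 assumes "homotopic_with (\<lambda>h. h (pole k) = b) (nsphere k) Y f g"
 shows "hclass k Y b f = hclass k Y b g"
 using assms homotopic_with_trans homotopic_with_symD unfolding hclass_def by blast

lemma hclass_self: "based_map k Y b f \<Longrightarrow> f \<in> hclass k Y b f" by (auto simp: hclass_def based_map_def)

lemma hclass_eq_hzero_iff:
 assumes "based_map k Y b f"
 shows "hclass k Y b f = hzero k Y b \<longleftrightarrow> nullh k Y f"
proof
 assume "hclass k Y b f = hzero k Y b"
 then have "f \<in> hclass k Y b (\<lambda>_. b)" using hclass_self[OF assms] by (simp add: hzero_def)
 then show "nullh k Y f" unfolding nullh_def hclass_def using homotopic_based_free homotopic_with_symD by blast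
next
 assume "nullh k Y f"
 from hclass_eqI[OF nullh_based[OF this]] assms show "hclass k Y b f = hzero k Y b"
  by (simp add: based_map_def hzero_def)
qed

lemma nullh_compose:
 assumes "nullh k Y g" "continuous_map Y Z f"
 shows "nullh k Z (f \<circ> g)"
 using assms homotopic_with_compose_continuous_map_left[of "\<lambda>_. True" "nsphere k" Y g _ Z f "\<lambda>_. True"]
 unfolding nullh_def by (force simp: o_def)

lemma nullh_homotopic:
 assumes "homotopic_with P (nsphere k) Y f g" "nullh k Y g"
 shows "nullh k Y f" using assms homotopic_with_trans homotopic_based_free unfolding nullh_def by metis

lemma nullh_cong:
 assumes "nullh k Y g" "\<And>x. x \<in> Sph k \<Longrightarrow> f x = g x"
 shows "nullh k Y f"
proof -
 have "continuous_map (nsphere k) Y g" using assms(1) homotopic_with_imp_continuous_maps unfolding nullh_def by blast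
 then have "homot (nsphere k) Y f g" by (intro homotopic_with_equal) (use assms in \<open>auto intro: continuous_map_eq\<close>)
 then show ?thesis using assms(1) nullh_homotopic by blast
qed

section \<open>Lifts over the disc\<close>

lemma collapse_less: "i < m \<Longrightarrow> collapse m x i = 2 * sqrt (1 - (\<Sum>i<m. (x i)\<^sup>2)) * x i"
 and collapse_eq: "collapse m x m = 2 * (\<Sum>i<m. (x i)\<^sup>2) - 1"
 and collapse_gt: "i > m \<Longrightarrow> collapse m x i = 0" by (auto simp: collapse_def Let_def)

lemma continuous_on_collapse: "continuous_on S (collapse m)"
proof (rule continuous_on_coordI)
 fix i
 consider "i < m" | "i = m" | "i > m" by linarith
 then show "continuous_on S (\<lambda>x. collapse m x i)"
 proof cases
  case 1
  then show ?thesis unfolding collapse_less[OF 1] by (intro continuous_intros)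
 next
  case 2
  show ?thesis unfolding 2 collapse_eq by (intro continuous_intros)
 next
  case 3
  then show ?thesis by (simp add: collapse_gt)
 qed
qed

lemma collapse_in_Sph:
 assumes "x \<in> Dsc m"
 shows "collapse m x \<in> Sph m"
proof -
 define s where "s = (\<Sum>i<m. (x i)\<^sup>2)"
 have s: "s \<le> 1" using assms by (simp add: Dsc_def s_def)
 have "(\<Sum>i<m. (collapse m x i)\<^sup>2) = (\<Sum>i<m. 4 * (1 - s) * (x i)\<^sup>2)"
  by (rule sum.cong) (use s in \<open>auto simp: collapse_less power_mult_distrib simp flip: s_def\<close>)
 also have "\<dots> = 4 * (1 - s) * s" by (simp add: s_def sum_distrib_left)
 finally have "(\<Sum>i\<le>m. (collapse m x i)\<^sup>2) = 4 * (1 - s) * s + (2 * s - 1)\<^sup>2"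
  by (simp add: lessThan_Suc_atMost[symmetric] collapse_eq flip: s_def)
 also have "\<dots> = 1" by (simp add: power2_eq_square algebra_simps)
 finally show ?thesis by (simp add: Sph_def collapse_gt)
qed

lemma collapse_boundary:
 assumes "x \<in> Sph k"
 shows "collapse (Suc k) x = pole (Suc k)"
proof
 fix i
 have "(\<Sum>i<Suc k. (x i)\<^sup>2) = 1" using assms by (auto simp: Sph_eq)
 then show "collapse (Suc k) x i = pole (Suc k) i" by (auto simp: collapse_def pole_def Let_def)
qed

lemma collapse_surj:
 assumes y: "y \<in> Sph (Suc k)"
 shows "\<exists>x\<in>Dsc (Suc k). collapse (Suc k) x = y"
proof (cases "y (Suc k) = 1")
 case True
 have "y = pole (Suc k)"
 proof
  fix i
  have "(\<Sum>i<Suc k. (y i)\<^sup>2) = 0" using y True by (simp add: Sph_def lessThan_Suc_atMost)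
  then have "\<forall>i\<in>{..<Suc k}. (y i)\<^sup>2 = 0" by (subst (asm) sum_nonneg_eq_0_iff) auto
  then show "y i = pole (Suc k) i" using True y by (cases "i < Suc k"; cases "i = Suc k") (auto simp: pole_def Sph_def)
 qed
 then show ?thesis using collapse_boundary[OF pole_in_Sph] pole_in_Dsc by metis
next
 case False
 have sum: "(\<Sum>i<Suc k. (y i)\<^sup>2) = 1 - (y (Suc k))\<^sup>2" using y by (simp add: Sph_def lessThan_Suc_atMost)
 moreover have "0 \<le> (\<Sum>i<Suc k. (y i)\<^sup>2)" by (rule sum_nonneg) simp
 ultimately have y1: "\<bar>y (Suc k)\<bar> \<le> 1" by (simp add: abs_square_le_1)
 define s where "s = (1 + y (Suc k)) / 2"
 have s: "0 \<le> s" "s < 1" using y1 False by (auto simp: s_def)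
 define x where "x = (\<lambda>i. if i < Suc k then y i / (2 * sqrt (1 - s)) else 0)"
 have "(\<Sum>i<Suc k. (x i)\<^sup>2) = (\<Sum>i<Suc k. (y i)\<^sup>2 / (4 * (1 - s)))"
  by (rule sum.cong) (use s in \<open>auto simp: x_def power_divide power_mult_distrib\<close>)
 also have "\<dots> = (1 - (y (Suc k))\<^sup>2) / (4 * (1 - s))" using sum by (simp only: flip: sum_divide_distrib)
 also have "\<dots> = s"
 proof -
  have yk: "y (Suc k) = 2 * s - 1" by (simp add: s_def field_simps)
  have "1 - (y (Suc k))\<^sup>2 = s * (4 * (1 - s))" unfolding yk by (simp add: power2_eq_square algebra_simps)
  then show ?thesis using s by simp
 qed
 finally have xs: "(\<Sum>i<Suc k. (x i)\<^sup>2) = s" .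
 have "x \<in> Dsc (Suc k)" using xs s by (simp add: Dsc_def x_def del: sum.lessThan_Suc)
 moreover have "collapse (Suc k) x = y"
 proof
  fix i
  consider "i < Suc k" | "i = Suc k" | "i > Suc k" by linarith
  then show "collapse (Suc k) x i = y i"
  proof cases
   case 1
   then show ?thesis unfolding collapse_less[OF 1] xs using s by (simp add: x_def)
  next
   case 2
   then show ?thesis unfolding 2 collapse_eq xs by (simp add: s_def field_simps)
  next
   case 3
   then show ?thesis using y by (simp add: collapse_gt Sph_def)
  qed
 qed
 ultimately show ?thesis by blast
qed

lemma collapse_inj:
 assumes x: "x \<in> Dsc (Suc k)" and y: "y \<in> Dsc (Suc k)" and c: "collapse (Suc k) x = collapse (Suc k) y"
 shows "x = y \<or> x \<in> Sph k \<and> y \<in> Sph k"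
proof -
 define s where "s = (\<Sum>i<Suc k. (x i)\<^sup>2)"
 have s': "s = (\<Sum>i<Suc k. (y i)\<^sup>2)" using fun_cong[OF c, of "Suc k"] unfolding collapse_eq s_def by simp
 show ?thesis
 proof (cases "s = 1")
  case True
  then show ?thesis using x y s' by (simp add: Sph_eq s_def)
 next
  case False
  then have "s < 1" using x by (simp add: Dsc_def s_def del: sum.lessThan_Suc)
  have "x i = y i" for i
  proof (cases "i < Suc k")
   case True
   then show ?thesis
    using fun_cong[OF c, of i] \<open>s < 1\<close> unfolding collapse_less[OF True] s_def[symmetric] s'[symmetric] by simp
  qed (use x y in \<open>simp add: Dsc_def\<close>)
  then show ?thesis by blast
 qed
qed

text \<open>The collapse map is a quotient map of compact spaces, and so is its product with a compact interval.\<close>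

lemma descend_collapse:
 fixes J :: "real set"
 assumes J: "compact J" and G: "cont_on (J \<times> Dsc (Suc k)) Y G"
  and c: "\<And>t s. t \<in> J \<Longrightarrow> s \<in> Sph k \<Longrightarrow> G (t, s) = gam t"
 shows "\<exists>g. cont_on (J \<times> Sph (Suc k)) Y g \<and>
  (\<forall>t\<in>J. \<forall>x\<in>Dsc (Suc k). g (t, collapse (Suc k) x) = G (t, x))"
proof -
 let ?q = "\<lambda>z::real \<times> (nat \<Rightarrow> real). (fst z, collapse (Suc k) (snd z))"
 have q: "quotient_map (top_of_set (J \<times> Dsc (Suc k))) (top_of_set (J \<times> Sph (Suc k))) ?q"
 proof (rule continuous_imp_quotient_map)
  have "continuous_on (J \<times> Dsc (Suc k)) ?q"
   by (intro continuous_intros continuous_on_compose2[OF continuous_on_collapse[of UNIV]]) auto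
  then show "cont_on (J \<times> Dsc (Suc k)) (top_of_set (J \<times> Sph (Suc k))) ?q" using collapse_in_Sph by auto
  show "compact_space (top_of_set (J \<times> Dsc (Suc k)))"
   using J compact_Dsc by (simp add: compact_space_subtopology compact_Times)
  show "?q ` topspace (top_of_set (J \<times> Dsc (Suc k))) = topspace (top_of_set (J \<times> Sph (Suc k)))"
   using collapse_in_Sph collapse_surj by (fastforce simp: image_iff)
 qed (simp add: Hausdorff_space_subtopology)
 define r where "r y = (SOME x. x \<in> Dsc (Suc k) \<and> collapse (Suc k) x = y)" for y
 define g where "g = (\<lambda>z. G (fst z, r (snd z)))"
 have r: "r y \<in> Dsc (Suc k)" "collapse (Suc k) (r y) = y" if "y \<in> Sph (Suc k)" for y
  using someI_ex[of "\<lambda>x. x \<in> Dsc (Suc k) \<and> collapse (Suc k) x = y"] collapse_surj[OF that] unfolding r_def by blast+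
 have g: "g (t, collapse (Suc k) x) = G (t, x)" if "t \<in> J" "x \<in> Dsc (Suc k)" for t x
 proof -
  have "r (collapse (Suc k) x) = x \<or> r (collapse (Suc k) x) \<in> Sph k \<and> x \<in> Sph k"
   using r collapse_in_Sph[OF that(2)] that(2) by (intro collapse_inj) auto
  then show ?thesis using c[OF that(1)] by (auto simp: g_def)
 qed
 have "cont_on (J \<times> Dsc (Suc k)) Y (g \<circ> ?q)" by (rule continuous_map_eq[OF G]) (use g in auto)
 then have "cont_on (J \<times> Sph (Suc k)) Y g" using continuous_compose_quotient_map[OF q] by blast
 with g show ?thesis by blast
qed

lemma descend_collapse_const:
 assumes G: "continuous_map (disc (Suc k)) Y G" and c: "\<And>s. s \<in> Sph k \<Longrightarrow> G s = y"
 shows "\<exists>g. continuous_map (nsphere (Suc k)) Y g \<and> (\<forall>x\<in>Dsc (Suc k). g (collapse (Suc k) x) = G x)"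
proof -
 have "cont_on ({0} \<times> Dsc (Suc k)) Y (\<lambda>x. G (snd x))"
  by (rule cmap_comp_on[of _ snd "Dsc (Suc k)"]) (use G in \<open>auto simp: disc_eq intro!: continuous_intros\<close>)
 from descend_collapse[OF _ this, of "\<lambda>_. y"] c obtain g where
  g: "cont_on ({0::real} \<times> Sph (Suc k)) Y g"
   "\<forall>x\<in>Dsc (Suc k). g (0, collapse (Suc k) x) = G x" by auto
 have "continuous_map (nsphere (Suc k)) Y (\<lambda>x. g (0, x))"
  unfolding nsphere_eq by (rule cmap_comp_pair[OF _ _ _ g(1)]) (auto intro!: continuous_intros)
 with g(2) show ?thesis by blast
qed

lemma continuous_map_collapse: "continuous_map (disc m) (nsphere m) (collapse m)"
 using collapse_in_Sph by (auto simp: disc_eq nsphere_eq continuous_on_collapse)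

text \<open>Contract the disc to the pole and lift the contraction backwards.\<close>

lemma disc_lift_exists:
 assumes E: "sliced E B p" and f: "continuous_map (nsphere (Suc k)) B f"
  and e: "e0 \<in> topspace E" "p e0 = f (pole (Suc k))"
 shows "\<exists>L. continuous_map (disc (Suc k)) E L \<and> (\<forall>x\<in>Dsc (Suc k). p (L x) = f (collapse (Suc k) x)) \<and>
  L (pole k) = e0"
proof -
 let ?M = "\<lambda>z. f (collapse (Suc k) (lin (fst z) (pole k) (snd z)))"
 have f': "cont_on (Sph (Suc k)) B f" using f by (simp add: nsphere_eq)
 have M: "cont_cyl (Dsc (Suc k)) B ?M"
 proof (rule cmap_comp_on[OF _ _ f'])
  have "continuous_on ({0..1} \<times> Dsc (Suc k)) (\<lambda>z. lin (fst z) (pole k) (snd z))"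
   by (rule continuous_on_lin) (auto intro!: continuous_intros)
  then show "continuous_on ({0..1} \<times> Dsc (Suc k)) (\<lambda>z. collapse (Suc k) (lin (fst z) (pole k) (snd z)))"
   by (rule continuous_on_compose2[OF continuous_on_collapse[of UNIV]]) auto
 qed (use collapse_in_Sph lin_in_Dsc pole_in_Dsc in auto)
 have g: "cont_on (Dsc (Suc k)) E (\<lambda>_. e0)" using e by simp
 have pg: "p e0 = ?M (0, z)" for z using e collapse_boundary[OF pole_in_Sph] by simp
 obtain F where F: "cont_cyl (Dsc (Suc k)) E F"
  "\<forall>t\<in>{0..1}. \<forall>z\<in>Dsc (Suc k). p (F (t, z)) = ?M (t, z)"
  "\<forall>z\<in>Dsc (Suc k). (\<forall>t\<in>{0..1}. ?M (t, z) = ?M (0, z)) \<longrightarrow> (\<forall>t\<in>{0..1}. F (t, z) = e0)"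
  using homotopy_lifting[OF E compact_Dsc M g pg] by blast
 have "continuous_map (disc (Suc k)) E (\<lambda>x. F (1, x))"
  unfolding disc_eq by (rule cmap_comp_pair[OF _ _ _ F(1)]) (auto intro!: continuous_intros)
 moreover have "F (1, pole k) = e0" using F(3) pole_in_Dsc[of k] by simp
 ultimately show ?thesis using F(2) by (intro exI[of _ "\<lambda>x. F (1, x)"]) simp
qed

text \<open>On \<open>{-1..2} \<times> disc\<close>, go from \<open>L\<close> at \<open>-1\<close> radially to its value at the pole, along \<open>e\<close> during \<open>{0..1}\<close>, and
 back to \<open>L'\<close> at \<open>2\<close>. The projection of this path deforms to one that collapses the boundary sphere to the base
 point; lifting the deformation joins \<open>L\<close> and \<open>L'\<close> within the fiber. The predicate records that the homotopy is
 based if \<open>e\<close> is constant.\<close>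

lemma disc_lifts_homotopic:
 fixes e :: "real \<Rightarrow> 'e"
 assumes E: "sliced E B p" and f: "cont_cyl (Sph (Suc k)) B f"
  and fb: "\<And>t. t \<in> {0..1} \<Longrightarrow> f (t, pole (Suc k)) = b"
  and L: "continuous_map (disc (Suc k)) E L" "\<And>x. x \<in> Dsc (Suc k) \<Longrightarrow> p (L x) = f (0, collapse (Suc k) x)"
  and L': "continuous_map (disc (Suc k)) E L'" "\<And>x. x \<in> Dsc (Suc k) \<Longrightarrow> p (L' x) = f (1, collapse (Suc k) x)"
  and e: "cont_on {0..1} (fib E p b) e" "e 0 = L (pole k)" "e 1 = L' (pole k)"
 shows "homotopic_with (\<lambda>h. (\<forall>t\<in>{0..1}. e t = e 0) \<longrightarrow> h (pole k) = e 0) (nsphere k) (fib E p b) L L'"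
proof -
 let ?D = "Dsc (Suc k)"
 let ?Z = "{-1..2::real} \<times> ?D"
 \<comment> \<open>\<open>M (0, u, x)\<close> is the projection of the path, and \<open>M (1, u, x)\<close> is \<open>f\<close> after the collapse of \<open>x\<close>\<close>
 define w where "w u = max 0 (max (- u) (u - 1))" for u :: real
 define cl where "cl u = max 0 (min u 1)" for u :: real
 define M where "M z = f (cl (fst (snd z)), collapse (Suc k)
   (lin (w (fst (snd z)) + fst z * (1 - w (fst (snd z)))) (pole k) (snd (snd z))))" for z :: "real \<times> real \<times> (nat \<Rightarrow> real)"
 define st where "st z = (if fst z \<le> 0 then L (lin (- fst z) (pole k) (snd z))
   else (if fst z \<le> 1 then e (fst z) else L' (lin (fst z - 1) (pole k) (snd z))))" for z :: "real \<times> (nat \<Rightarrow> real)"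
 have e': "cont_on {0..1} E e" "\<And>t. t \<in> {0..1} \<Longrightarrow> p (e t) = b" using e(1) by (auto simp: into_fib)
 have w01: "w u \<in> {0..1}" if "u \<in> {-1..2}" for u using that by (auto simp: w_def)
 have ws: "w u + s * (1 - w u) \<in> {0..1}" if "u \<in> {-1..2}" "s \<in> {0..1}" for u s
 proof -
  have "0 \<le> s * (1 - w u)" "s * (1 - w u) \<le> 1 * (1 - w u)"
   using w01[OF that(1)] that(2) by (intro mult_nonneg_nonneg mult_right_mono; simp)+
  then show ?thesis using w01[OF that(1)] by auto
 qed
 have lc: "collapse (Suc k) (lin t (pole k) x) \<in> Sph (Suc k)" if "t \<in> {0..1}" "x \<in> ?D" for t x
  using that by (intro collapse_in_Sph lin_in_Dsc pole_in_Dsc)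
 have M: "cont_cyl ?Z B M" unfolding M_def
 proof (rule cmap_comp_pair[OF _ _ _ f])
  show "continuous_on ({0..1} \<times> ?Z) (\<lambda>z. cl (fst (snd z)))" unfolding cl_def by (intro continuous_intros)
  have "continuous_on ({0..1} \<times> ?Z) (\<lambda>z. lin (w (fst (snd z)) + fst z * (1 - w (fst (snd z)))) (pole k) (snd (snd z)))"
   unfolding w_def by (intro continuous_on_lin continuous_intros)
  then show "continuous_on ({0..1} \<times> ?Z) (\<lambda>z. collapse (Suc k) (lin (w (fst (snd z)) + fst z * (1 - w (fst (snd z)))) (pole k) (snd (snd z))))"
   by (rule continuous_on_compose2[OF continuous_on_collapse[of UNIV]]) auto
  show "(cl (fst (snd z)), collapse (Suc k) (lin (w (fst (snd z)) + fst z * (1 - w (fst (snd z)))) (pole k) (snd (snd z))))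
   \<in> {0..1} \<times> Sph (Suc k)" if "z \<in> {0..1} \<times> ?Z" for z using that lc[OF ws] by (auto simp: cl_def)
 qed
 have LD: "cont_on ?D E L" "cont_on ?D E L'" using L(1) L'(1) by (simp_all add: disc_eq)
 have st: "cont_on ?Z E st" unfolding st_def
 proof (rule continuous_map_if_le)
  show "cont_on {x \<in> ?Z. fst x \<le> 0} E (\<lambda>z. L (lin (- fst z) (pole k) (snd z)))" by (rule cmap_comp_on[OF _ _ LD(1)])
    (use lin_in_Dsc pole_in_Dsc in \<open>auto intro!: continuous_on_lin continuous_intros\<close>)
  show "cont_on {x \<in> ?Z. 0 \<le> fst x} E
   (\<lambda>z. if fst z \<le> 1 then e (fst z) else L' (lin (fst z - 1) (pole k) (snd z)))"
  proof (rule continuous_map_if_le)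
   show "cont_on {x \<in> {x \<in> ?Z. 0 \<le> fst x}. fst x \<le> 1} E (\<lambda>z. e (fst z))"
    by (rule cmap_comp_on[OF _ _ e'(1)]) (auto intro!: continuous_intros)
   show "cont_on {x \<in> {x \<in> ?Z. 0 \<le> fst x}. 1 \<le> fst x} E (\<lambda>z. L' (lin (fst z - 1) (pole k) (snd z)))"
    by (rule cmap_comp_on[OF _ _ LD(2)])
     (use lin_in_Dsc pole_in_Dsc in \<open>auto intro!: continuous_on_lin continuous_intros\<close>)
  qed (use e in \<open>auto intro!: continuous_intros\<close>)
 qed (use e in \<open>auto intro!: continuous_intros\<close>)
 have colp: "collapse (Suc k) (pole k) = pole (Suc k)" by (rule collapse_boundary[OF pole_in_Sph])
 have pst: "p (st z) = M (0, z)" if zZ: "z \<in> ?Z" for z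
 proof -
  obtain u x where zux: "z = (u, x)" by (cases z)
  with zZ have z: "z = (u, x)" "u \<in> {-1..2}" "x \<in> ?D" by auto
  consider "u \<le> 0" | "0 < u" "u \<le> 1" | "1 < u" by linarith
  then show ?thesis
  proof cases
   case 1
   then have "lin (- u) (pole k) x \<in> ?D" using z by (intro lin_in_Dsc pole_in_Dsc) auto
   then show ?thesis using 1 L(2) by (simp add: z st_def M_def w_def cl_def)
  next
   case 2
   then have "w u = 0" by (auto simp: w_def)
   then show ?thesis using 2 e'(2)[of u] fb[of u] colp by (simp add: z st_def M_def cl_def)
  next
   case 3
   then have "lin (u - 1) (pole k) x \<in> ?D" using z by (intro lin_in_Dsc pole_in_Dsc) auto
   then show ?thesis using 3 L'(2) by (simp add: z st_def M_def w_def cl_def)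
  qed
 qed
 have "compact ?Z" using compact_Dsc by (intro compact_Times) auto
 then obtain F where F: "cont_cyl ?Z E F"
  "\<forall>t\<in>{0..1}. \<forall>z\<in>?Z. p (F (t, z)) = M (t, z)"
  "\<forall>z\<in>?Z. (\<forall>t\<in>{0..1}. M (t, z) = M (0, z)) \<longrightarrow> (\<forall>t\<in>{0..1}. F (t, z) = st z)"
  using homotopy_lifting[OF E _ M st pst] by blast
 let ?H = "\<lambda>z. F (1, 3 * fst z - 1, snd z)"
 have SD: "s \<in> ?D" if "s \<in> Sph k" for s using that Sph_subset_Dsc by blast
 have H: "cont_cyl (Sph k) E ?H" by (rule cmap_comp_on[OF _ _ F(1), of _ "\<lambda>z. (1, 3 * fst z - 1, snd z)"])
   (use SD in \<open>auto intro!: continuous_intros\<close>)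
 have "p (?H (u, s)) = b" if "u \<in> {0..1}" "s \<in> Sph k" for u s
 proof -
  have "p (?H (u, s)) = M (1, 3 * u - 1, s)" using F(2) that SD by simp
  also have "\<dots> = f (cl (3 * u - 1), collapse (Suc k) s)" by (simp add: M_def)
  also have "\<dots> = b" using collapse_boundary[OF that(2)] fb[of "cl (3 * u - 1)"] by (simp add: cl_def)
  finally show ?thesis .
 qed
 then have 1: "cont_cyl (Sph k) (fib E p b) ?H" using H by (auto simp: into_fib)
 have 2: "?H (0, s) = L s" if "s \<in> Sph k" for s
 proof -
  have "F (1, -1, s) = st (-1, s)" using F(3)[rule_format, of "(-1, s)" 1] SD[OF that] by (simp add: M_def w_def)
  then show ?thesis by (simp add: st_def)
 qed
 have 3: "?H (1, s) = L' s" if "s \<in> Sph k" for s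
 proof -
  have "F (1, 2, s) = st (2, s)" using F(3)[rule_format, of "(2, s)" 1] SD[OF that] by (simp add: M_def w_def)
  then show ?thesis by (simp add: st_def)
 qed
 have 4: "?H (u, pole k) = e 0" if "u \<in> {0..1}" "\<forall>t\<in>{0..1}. e t = e 0" for u
 proof -
  have "F (1, 3 * u - 1, pole k) = st (3 * u - 1, pole k)"
   using F(3)[rule_format, of "(3 * u - 1, pole k)" 1] pole_in_Dsc[of k] that(1) by (simp add: M_def)
  then show ?thesis using that e(2,3) by (auto simp: st_def)
 qed
 define Q where "Q \<longleftrightarrow> (\<forall>t\<in>{0..1}. e t = e 0)"
 have 5: "Q \<longrightarrow> ?H (u, pole k) = e 0" if "u \<in> {0..1}" for u using 4[OF that] unfolding Q_def by blast
 have "homotopic_with (\<lambda>h. Q \<longrightarrow> h (pole k) = e 0) (top_of_set (Sph k)) (fib E p b) L L'"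
 proof (rule iffD2[OF homotopic_with])
  show "(Q \<longrightarrow> h (pole k) = e 0) = (Q \<longrightarrow> h' (pole k) = e 0)"
   if "\<And>x. x \<in> topspace (top_of_set (Sph k)) \<Longrightarrow> h x = h' x" for h h' :: "(nat \<Rightarrow> real) \<Rightarrow> 'e"
   using that[of "pole k"] pole_in_Sph[of k] by simp
  show "\<exists>h. continuous_map (prod_topology (top_of_set {0..1::real}) (top_of_set (Sph k))) (fib E p b) h \<and>
   (\<forall>x\<in>topspace (top_of_set (Sph k)). h (0, x) = L x) \<and> (\<forall>x\<in>topspace (top_of_set (Sph k)). h (1, x) = L' x) \<and>
   (\<forall>t\<in>{0..1}. Q \<longrightarrow> h (t, pole k) = e 0)"
  proof (unfold prod_topology_subtopology_eu, rule exI[of _ ?H], intro conjI ballI)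
   show "cont_on ({0..1} \<times> Sph k) (fib E p b) ?H" by (rule 1)
  qed (use 2 3 5 in auto)
 qed
 then show ?thesis unfolding Q_def nsphere_eq .
qed

lemma disc_lifts_homotopic_based:
 assumes E: "sliced E B p" and f: "homotopic_with (\<lambda>h. h (pole (Suc k)) = b) (nsphere (Suc k)) B f f'"
  and L: "continuous_map (disc (Suc k)) E L" "\<And>x. x \<in> Dsc (Suc k) \<Longrightarrow> p (L x) = f (collapse (Suc k) x)"
  and L': "continuous_map (disc (Suc k)) E L'" "\<And>x. x \<in> Dsc (Suc k) \<Longrightarrow> p (L' x) = f' (collapse (Suc k) x)"
  and LL': "L (pole k) = e0" "L' (pole k) = e0"
 shows "homotopic_with (\<lambda>h. h (pole k) = e0) (nsphere k) (fib E p b) L L'"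
proof -
 obtain F where F: "cont_cyl (Sph (Suc k)) B F" "\<forall>z. F (0, z) = f z" "\<forall>z. F (1, z) = f' z"
  "\<forall>t\<in>{0..1}. F (t, pole (Suc k)) = b" using homotopic_withD_cyl[OF f[unfolded nsphere_eq]] by blast
 have "e0 \<in> topspace E" using L(1) LL'(1) pole_in_Dsc[of k] by (force simp: disc_eq continuous_map_def)
 moreover have "p e0 = b"
  using L(2)[OF pole_in_Dsc] LL'(1) F(2)[rule_format, of "pole (Suc k)"] F(4)[rule_format, of 0]
  by (simp add: collapse_boundary[OF pole_in_Sph])
 ultimately have e: "cont_on {0..1::real} (fib E p b) (\<lambda>_. e0)" by simp
 have "homotopic_with (\<lambda>h. (\<forall>t\<in>{0..1::real}. e0 = e0) \<longrightarrow> h (pole k) = e0) (nsphere k) (fib E p b) L L'"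
  by (rule disc_lifts_homotopic[OF E F(1) _ L(1) _ L'(1) _ e]) (use F L(2) L'(2) LL' in auto)
 then show ?thesis by simp
qed

lemma section_homotopic:
 assumes E: "sliced E B p" and f: "homotopic_with P (nsphere k) B f f'"
  and g: "continuous_map (nsphere k) E g" "\<And>x. x \<in> Sph k \<Longrightarrow> p (g x) = f x"
 shows "\<exists>g'. continuous_map (nsphere k) E g' \<and> (\<forall>x\<in>Sph k. p (g' x) = f' x)"
proof -
 obtain F where F: "cont_cyl (Sph k) B F" "\<forall>z. F (0, z) = f z" "\<forall>z. F (1, z) = f' z"
  using homotopic_withD_cyl[OF f[unfolded nsphere_eq]] by blast
 have g': "cont_on (Sph k) E g" using g(1) by (simp add: nsphere_eq)
 have "p (g z) = F (0, z)" if "z \<in> Sph k" for z using g(2)[OF that] F(2) by simp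
 then obtain G where G: "cont_cyl (Sph k) E G"
  "\<forall>t\<in>{0..1}. \<forall>z\<in>Sph k. p (G (t, z)) = F (t, z)" using homotopy_lifting[OF E compact_Sph F(1) g'] by blast
 have "continuous_map (nsphere k) E (\<lambda>x. G (1, x))"
  unfolding nsphere_eq by (rule cmap_comp_pair[OF _ _ _ G(1)]) (auto intro!: continuous_intros)
 then show ?thesis using G(2) F(3) by (intro exI[of _ "\<lambda>x. G (1, x)"]) simp
qed

text \<open>Extend the null-homotopy of the boundary over the disc; the end of the extension descends to the sphere, and
 it is a section over a map homotopic to \<open>f\<close>.\<close>

lemma section_of_null:
 assumes E: "sliced E B p" and f: "continuous_map (nsphere (Suc k)) B f" and b: "f (pole (Suc k)) = b"
  and L: "continuous_map (disc (Suc k)) E L" "\<And>x. x \<in> Dsc (Suc k) \<Longrightarrow> p (L x) = f (collapse (Suc k) x)"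
  and null: "nullh k (fib E p b) L"
 shows "\<exists>g. continuous_map (nsphere (Suc k)) E g \<and> (\<forall>x\<in>Sph (Suc k). p (g x) = f x)"
proof -
 have pc: "continuous_map E B p" using E by (simp add: sliced_def)
 obtain y where h: "homot (top_of_set (Sph k)) (fib E p b) L (\<lambda>_. y)"
  using null unfolding nullh_def nsphere_eq by blast
 obtain N where N: "cont_cyl (Sph k) (fib E p b) N" "\<forall>z. N (0, z) = L z" "\<forall>z. N (1, z) = y"
  using homotopic_withD_cyl[OF h] by blast
 then have N': "cont_cyl (Sph k) E N" "\<And>t s. t \<in> {0..1} \<Longrightarrow> s \<in> Sph k \<Longrightarrow> p (N (t, s)) = b" by (auto simp: into_fib)
 obtain G where G: "cont_cyl (Dsc (Suc k)) E G" "\<forall>x\<in>Dsc (Suc k). G (0, x) = L x"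
  "\<forall>t\<in>{0..1}. \<forall>s\<in>Sph k. G (t, s) = N (t, s)" using disc_homotopy_extension[OF L(1) N'(1) N(2)[rule_format]] by blast
 have "continuous_map (disc (Suc k)) E (\<lambda>x. G (1, x))"
  unfolding disc_eq by (rule cmap_comp_pair[OF _ _ _ G(1)]) (auto intro!: continuous_intros)
 then obtain g where g: "continuous_map (nsphere (Suc k)) E g" "\<forall>x\<in>Dsc (Suc k). g (collapse (Suc k) x) = G (1, x)"
  using descend_collapse_const[of k E "\<lambda>x. G (1, x)" y] G(3) N(3) by auto
 have "cont_cyl (Dsc (Suc k)) B (p \<circ> G)" using G(1) pc by (rule cmap_comp)
 then obtain H where H: "cont_cyl (Sph (Suc k)) B H"
  "\<forall>t\<in>{0..1}. \<forall>x\<in>Dsc (Suc k). H (t, collapse (Suc k) x) = (p \<circ> G) (t, x)"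
  using descend_collapse[of "{0..1}" k B "p \<circ> G" "\<lambda>_. b"] G(3) N'(2) by auto
 have H0: "H (0, y) = f y" "H (1, y) = p (g y)" if y: "y \<in> Sph (Suc k)" for y
 proof -
  obtain x where x: "x \<in> Dsc (Suc k)" "collapse (Suc k) x = y" using collapse_surj[OF y] by blast
  show "H (0, y) = f y" using H(2)[rule_format, of 0 x] x G(2) L(2) by simp
  show "H (1, y) = p (g y)" using H(2)[rule_format, of 1 x] x g(2) by auto
 qed
 have "homot (nsphere (Suc k)) B f (p \<circ> g)"
  unfolding nsphere_eq by (rule homotopic_withI_cyl[OF H(1)]) (use H0 in auto)
 then have "homot (nsphere (Suc k)) B (p \<circ> g) f" by (simp add: homotopic_with_sym)
 from section_homotopic[OF E this g(1)] show ?thesis by simp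
qed

text \<open>The composite of a section with the collapse map is another lift over the disc, constant on the boundary; in a
 path connected fiber all boundary values are homotopic.\<close>

lemma null_of_section:
 assumes E: "sliced E B p" and f: "continuous_map (nsphere (Suc k)) B f" and b: "f (pole (Suc k)) = b"
  and L: "continuous_map (disc (Suc k)) E L" "\<And>x. x \<in> Dsc (Suc k) \<Longrightarrow> p (L x) = f (collapse (Suc k) x)"
  and g: "continuous_map (nsphere (Suc k)) E g" "\<And>x. x \<in> Sph (Suc k) \<Longrightarrow> p (g x) = f x"
  and fc: "path_connected_space (fib E p b)"
 shows "nullh k (fib E p b) L"
proof -
 have s: "collapse (Suc k) s = pole (Suc k)" if "s \<in> Sph k" for s by (rule collapse_boundary[OF that])
 have "L (pole k) \<in> topspace E" "p (L (pole k)) = b"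
  using L pole_in_Dsc[of k] s[OF pole_in_Sph] b by (force simp: disc_eq continuous_map_def)+
 moreover have "g (pole (Suc k)) \<in> topspace E" "p (g (pole (Suc k))) = b"
  using g pole_in_Sph[of "Suc k"] b by (force simp: nsphere_eq continuous_map_def)+
 ultimately obtain e where e: "pathin (fib E p b) e" "e 0 = L (pole k)" "e 1 = g (pole (Suc k))"
  using fc unfolding path_connected_space_def by force
 have F: "cont_cyl (Sph (Suc k)) B (\<lambda>z. f (snd z))"
  by (rule cmap_comp_on[of _ snd "Sph (Suc k)"]) (use f in \<open>auto simp: nsphere_eq intro!: continuous_intros\<close>)
 have "homotopic_with (\<lambda>h. (\<forall>t\<in>{0..1}. e t = e 0) \<longrightarrow> h (pole k) = e 0) (nsphere k) (fib E p b) L (g \<circ> collapse (Suc k))"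
 proof (rule disc_lifts_homotopic[OF E F _ L(1) _ cmap_comp[OF continuous_map_collapse g(1)]])
  show "cont_on {0..1} (fib E p b) e" using e(1) by (simp add: pathin_def)
 qed (use b L(2) g(2) e collapse_in_Sph s[OF pole_in_Sph] in auto)
 then have "homot (nsphere k) (fib E p b) L (g \<circ> collapse (Suc k))" by (rule homotopic_based_free)
 moreover have "homot (nsphere k) (fib E p b) (g \<circ> collapse (Suc k)) (\<lambda>_. g (pole (Suc k)))"
  using homotopic_with_imp_continuous_maps[OF calculation] by (intro homotopic_with_equal) (auto simp: s)
 ultimately show ?thesis using homotopic_with_trans unfolding nullh_def by blast
qed

lemma homotopic_to_based:
 assumes f: "continuous_map (nsphere (Suc k)) X f" and gam: "pathin X gam" "gam 0 = f (pole (Suc k))" "gam 1 = b"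
 shows "\<exists>f'. based_map (Suc k) X b f' \<and> homot (nsphere (Suc k)) X f f'"
proof -
 have gam': "cont_on {0..1} X gam" using gam(1) by (simp add: pathin_def)
 have N: "cont_cyl (Sph k) X (\<lambda>z. gam (fst z))" by (rule cmap_comp_on[OF _ _ gam']) (auto intro!: continuous_intros)
 have L: "continuous_map (disc (Suc k)) X (f \<circ> collapse (Suc k))" using continuous_map_collapse f by (rule cmap_comp)
 obtain G where G: "cont_cyl (Dsc (Suc k)) X G" "\<forall>x\<in>Dsc (Suc k). G (0, x) = f (collapse (Suc k) x)"
  "\<forall>t\<in>{0..1}. \<forall>s\<in>Sph k. G (t, s) = gam t"
  using disc_homotopy_extension[OF L N] gam(2) collapse_boundary by (auto simp: o_def)
 obtain H where H: "cont_cyl (Sph (Suc k)) X H"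
  "\<forall>t\<in>{0..1}. \<forall>x\<in>Dsc (Suc k). H (t, collapse (Suc k) x) = G (t, x)"
  using descend_collapse[OF _ G(1), of gam] G(3) by auto
 have "H (0, y) = f y" if "y \<in> Sph (Suc k)" for y using collapse_surj[OF that] H(2) G(2) by force
 then have "homot (nsphere (Suc k)) X f (\<lambda>y. H (1, y))"
  unfolding nsphere_eq by (intro homotopic_withI_cyl[OF H(1)]) auto
 moreover have "H (1, pole (Suc k)) = b"
  using H(2)[rule_format, of 1 "pole k"] pole_in_Dsc[of k] pole_in_Sph[of k] collapse_boundary[OF pole_in_Sph, of k] G(3) gam(3) by simp
 ultimately show ?thesis using homotopic_with_imp_continuous_maps unfolding based_map_def by blast
qed

section \<open>Locally Euclidean spaces\<close>

definition loc_euclid :: "'e::euclidean_space itself \<Rightarrow> 'a topology \<Rightarrow> bool" where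
 "loc_euclid _ Y \<longleftrightarrow> (\<forall>x\<in>topspace Y. \<exists>U S phi. openin Y U \<and> x \<in> U \<and> open (S::'e set) \<and>
   homeomorphic_map (subtopology Y U) (top_of_set S) phi)"

lemma loc_euclid_manifold:
 fixes A :: "('a, 'e::euclidean_space) chart set"
 assumes "smooth_manifold X A" shows "loc_euclid TYPE('e) X" unfolding loc_euclid_def
proof
 fix x assume "x \<in> topspace X"
 then obtain c where "c \<in> A" "x \<in> chart_dom c" using assms unfolding smooth_manifold_def by blast
 then show "\<exists>U S phi. openin X U \<and> x \<in> U \<and> open (S::'e set) \<and> homeomorphic_map (subtopology X U) (top_of_set S) phi"
  using assms unfolding smooth_manifold_def is_chart_def by blast
qed

lemma loc_euclid_open:
 assumes "loc_euclid TYPE('e::euclidean_space) Y" "openin Y V"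
 shows "loc_euclid TYPE('e) (subtopology Y V)" unfolding loc_euclid_def
proof
 fix x assume "x \<in> topspace (subtopology Y V)"
 then have x: "x \<in> topspace Y" "x \<in> V" by auto
 then obtain U and S :: "'e set" and phi where U: "openin Y U" "x \<in> U" "open S"
  "homeomorphic_map (subtopology Y U) (top_of_set S) phi" using assms(1) unfolding loc_euclid_def by blast
 have "openin (subtopology Y U) (U \<inter> V)" using assms(2) by (metis inf_commute openin_subtopology_Int)
 then have "openin (top_of_set S) (phi ` (U \<inter> V))" using U(4) by (meson homeomorphic_imp_open_map open_map_def)
 then have "open (phi ` (U \<inter> V))" using U(3) by (meson openin_open_trans)
 moreover have "homeomorphic_map (subtopology Y (U \<inter> V)) (top_of_set (phi ` (U \<inter> V))) phi"
 proof -
  have t: "topspace (subtopology Y U) = U" using openin_subset[OF U(1)] by auto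
  have "phi ` (U \<inter> V) \<subseteq> S" using homeomorphic_imp_surjective_map[OF U(4)] t by auto
  then have "homeomorphic_map (subtopology (subtopology Y U) V) (subtopology (top_of_set S) (phi ` (U \<inter> V))) phi"
   by (intro homeomorphic_map_subtopologies[OF U(4)]) (unfold t, auto)
  moreover have "S \<inter> phi ` (U \<inter> V) = phi ` (U \<inter> V)" using \<open>phi ` (U \<inter> V) \<subseteq> S\<close> by blast
  ultimately show ?thesis by (simp add: subtopology_subtopology)
 qed
 ultimately show "\<exists>U S phi. openin (subtopology Y V) U \<and> x \<in> U \<and> open (S::'e set) \<and>
   homeomorphic_map (subtopology (subtopology Y V) U) (top_of_set S) phi"
  using U(1,2) x by (intro exI[of _ "U \<inter> V"] exI[of _ "phi ` (U \<inter> V)"] exI[of _ phi])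
   (auto simp: subtopology_subtopology inf_assoc inf_left_commute openin_subtopology_Int)
qed

text \<open>Every ball is a Euclidean space, so charts may be taken onto the whole model space.\<close>

lemma ball_homeomorphic_maps:
 fixes a :: "'e::euclidean_space"
 assumes rho: "rho > 0"
 shows "homeomorphic_maps (top_of_set (ball a rho)) euclidean
  (\<lambda>y. (y - a) /\<^sub>R (rho - norm (y - a))) (\<lambda>w. a + (rho / (1 + norm w)) *\<^sub>R w)"
proof -
 have n: "1 + norm w \<noteq> 0" for w :: 'e using norm_ge_zero[of w] by linarith
 have b: "norm ((rho / (1 + norm w)) *\<^sub>R w) = rho * (norm w / (1 + norm w))" for w :: 'e
  using rho by (simp add: abs_of_pos add_pos_nonneg)
 have lt: "norm ((rho / (1 + norm w)) *\<^sub>R w) < rho" for w :: 'e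
  using rho n[of w] unfolding b by (simp add: divide_less_eq add_pos_nonneg)
 have 1: "continuous_on (ball a rho) (\<lambda>y. (y - a) /\<^sub>R (rho - norm (y - a)))"
  by (intro continuous_intros) (auto simp: dist_norm norm_minus_commute)
 have 2: "continuous_on UNIV (\<lambda>w::'e. a + (rho / (1 + norm w)) *\<^sub>R w)" using n by (intro continuous_intros) auto
 have 3: "a + (rho / (1 + norm w)) *\<^sub>R w \<in> ball a rho" for w :: 'e using lt[of w] by (simp add: dist_norm)
 have 4: "(a + (rho / (1 + norm w)) *\<^sub>R w - a) /\<^sub>R (rho - norm (a + (rho / (1 + norm w)) *\<^sub>R w - a)) = w" for w :: 'e
 proof -
  have "rho - norm (a + (rho / (1 + norm w)) *\<^sub>R w - a) = rho / (1 + norm w)"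
   using n[of w] unfolding add_diff_cancel_left' b by (simp add: field_simps)
  then show ?thesis using rho n[of w] by (simp del: norm_scaleR)
 qed
 have 5: "a + (rho / (1 + norm ((y - a) /\<^sub>R (rho - norm (y - a))))) *\<^sub>R ((y - a) /\<^sub>R (rho - norm (y - a))) = y" if "y \<in> ball a rho" for y
 proof -
  have p: "rho - norm (y - a) > 0" using that by (simp add: dist_norm norm_minus_commute)
  then have "norm ((y - a) /\<^sub>R (rho - norm (y - a))) = norm (y - a) / (rho - norm (y - a))"
   by (simp add: divide_inverse mult.commute)
  then have "1 + norm ((y - a) /\<^sub>R (rho - norm (y - a))) = rho / (rho - norm (y - a))"
   using p by (simp add: divide_simps)
  then show ?thesis using p rho by simp
 qed
 show ?thesis unfolding homeomorphic_maps_def using 1 2 3 4 5 by (auto simp: into_sub)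
qed

lemma euclid_chart_exists:
 assumes Y: "loc_euclid TYPE('e::euclidean_space) Y" and V: "openin Y V" "x \<in> V"
 shows "\<exists>U phi psi. openin Y U \<and> U \<subseteq> V \<and> homeomorphic_maps (subtopology Y U) (euclidean::'e topology) phi psi \<and> psi 0 = x"
proof -
 have "x \<in> topspace (subtopology Y V)" using openin_subset[OF V(1)] V(2) by auto
 then obtain U and S :: "'e set" and phi where U: "openin (subtopology Y V) U" "x \<in> U" "open S"
  "homeomorphic_map (subtopology (subtopology Y V) U) (top_of_set S) phi"
  using loc_euclid_open[OF Y V(1)] unfolding loc_euclid_def by blast
 have UV: "U \<subseteq> V" "openin Y U" using U(1) V(1) openin_trans_full openin_subset by (force, blast)
 then have U4: "homeomorphic_map (subtopology Y U) (top_of_set S) phi"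
  using U(4) by (simp add: subtopology_subtopology inf.absorb2)
 then obtain psi where h: "homeomorphic_maps (subtopology Y U) (top_of_set S) phi psi"
  using homeomorphic_map_maps by blast
 have tU: "topspace (subtopology Y U) = U" using openin_subset[OF UV(2)] by auto
 have "phi x \<in> S" using homeomorphic_imp_surjective_map[OF U4] U(2) tU by auto
 then obtain rho where rho: "rho > 0" "ball (phi x) rho \<subseteq> S" using U(3) open_contains_ball by blast
 let ?b = "ball (phi x) rho"
 let ?W = "{y \<in> U. phi y \<in> ?b}"
 have cphi: "continuous_map (subtopology Y U) (top_of_set S) phi" using h by (simp add: homeomorphic_maps_def)
 have cpsi: "cont_on S (subtopology Y U) psi" using h by (simp add: homeomorphic_maps_def)
 have inv: "psi (phi y) = y" if "y \<in> U" for y using h that tU by (simp add: homeomorphic_maps_def)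
 have inv': "phi (psi w) = w" "psi w \<in> U" if "w \<in> S" for w
  using h that cpsi by (auto simp: homeomorphic_maps_def continuous_map_def)
 have "openin (subtopology Y U) {y \<in> topspace (subtopology Y U). phi y \<in> ?b}"
  using open_preim[OF cphi, of ?b] rho(2) by (simp add: openin_open_eq[OF U(3)])
 then have "openin Y {y \<in> topspace (subtopology Y U). phi y \<in> ?b}" using UV(2) openin_trans_full by blast
 then have W: "openin Y ?W" unfolding tU .
 have "homeomorphic_maps (subtopology Y ?W) (top_of_set ?b) phi psi" unfolding homeomorphic_maps_def
 proof (intro conjI ballI)
  have "continuous_map (subtopology Y ?W) (top_of_set S) phi" by (rule cmap_mono[OF cphi]) auto
  then show "continuous_map (subtopology Y ?W) (top_of_set ?b) phi" by (auto simp: into_sub)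
  have "cont_on ?b (subtopology Y U) psi" by (rule cmap_mono[OF cpsi rho(2)])
  then show "cont_on ?b (subtopology Y ?W) psi" using inv' rho(2) by (auto simp: into_sub)
 qed (use inv inv' rho in auto)
 from homeomorphic_maps_compose[OF conjI[OF this ball_homeomorphic_maps[OF rho(1), of "phi x"]]] show ?thesis
  by (intro exI[of _ ?W] exI[of _ "(\<lambda>y. (y - phi x) /\<^sub>R (rho - norm (y - phi x))) \<circ> phi"]
    exI[of _ "psi \<circ> (\<lambda>w. phi x + (rho / (1 + norm w)) *\<^sub>R w)"] conjI W)
   (use UV inv[OF U(2)] in auto)
qed

lemma euclid_chartD:
 assumes "homeomorphic_maps (subtopology Y U) (euclidean::'e::euclidean_space topology) phi psi" "openin Y U"
 shows "continuous_map (subtopology Y U) euclidean phi" "continuous_map euclidean Y psi"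
  "\<And>w. psi w \<in> U" "\<And>w. phi (psi w) = w" "\<And>y. y \<in> U \<Longrightarrow> psi (phi y) = y"
  "\<And>S. open S \<Longrightarrow> openin Y (psi ` S)"
proof -
 have tU: "topspace (subtopology Y U) = U" using openin_subset[OF assms(2)] by auto
 show "continuous_map (subtopology Y U) euclidean phi" "continuous_map euclidean Y psi"
  "\<And>w. psi w \<in> U" "\<And>w. phi (psi w) = w" "\<And>y. y \<in> U \<Longrightarrow> psi (phi y) = y"
  using assms(1) tU by (auto simp: homeomorphic_maps_def into_sub)
 fix S :: "'e set" assume "open S"
 have "homeomorphic_map euclidean (subtopology Y U) psi"
  using assms(1) homeomorphic_maps_map homeomorphic_maps_sym by blast
 then have "openin (subtopology Y U) (psi ` S)"
  using \<open>open S\<close> by (meson homeomorphic_imp_open_map open_map_def open_openin)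
 then show "openin Y (psi ` S)" using assms(2) openin_trans_full by blast
qed

lemma loc_euclid_locally_path_connected:
 assumes Y: "loc_euclid TYPE('e::euclidean_space) Y"
 shows "locally_path_connected_space Y" unfolding locally_path_connected_space
proof (intro allI impI)
 fix V x assume V: "openin Y V \<and> x \<in> V"
 obtain U and phi and psi :: "'e \<Rightarrow> 'a" where U: "openin Y U" "U \<subseteq> V"
  "homeomorphic_maps (subtopology Y U) euclidean phi psi" "psi 0 = x"
  using euclid_chart_exists[OF Y conjunct1[OF V] conjunct2[OF V]] by blast
 note c = euclid_chartD[OF U(3,1)]
 have "path_connectedin Y (psi ` UNIV)" using c(2) by (rule path_connectedin_continuous_map_image) simp
 moreover have "psi ` UNIV = U" using c(3,5) by (auto simp: image_iff) (metis c(5))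
 ultimately show "\<exists>U. openin Y U \<and> path_connectedin Y U \<and> x \<in> U \<and> U \<subseteq> V" using U c(3) by metis
qed

lemma loc_euclid_path_connected:
 assumes Y: "loc_euclid TYPE('e::euclidean_space) Y" and c: "connected_space Y"
 shows "path_connected_space Y"
 using c path_connected_eq_connected_space[OF loc_euclid_locally_path_connected[OF Y]] by blast

text \<open>A punctured chart is connected and meets both parts of a separation of the punctured space; so filling in the
 point would separate the whole space.\<close>

lemma connected_punctured:
 assumes Y: "loc_euclid TYPE('e::euclidean_space) Y" and c: "connected_space Y" and n: "DIM('e) \<ge> 2"
  and H: "Hausdorff_space Y"
 shows "connected_space (punctured Y b)"
proof (cases "b \<in> topspace Y")
 case False
 then show ?thesis using c by (simp add: punctured_def)
next
 case b: True
 obtain U and phi and psi :: "'e \<Rightarrow> 'a" where U: "openin Y U"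
  "homeomorphic_maps (subtopology Y U) euclidean phi psi" "psi 0 = b"
  using euclid_chart_exists[OF Y openin_topspace b] by blast
 note ch = euclid_chartD[OF U(2,1)]
 have "connectedin Y (psi ` (- {0}))" by (rule connectedin_continuous_map_image[OF ch(2)])
    (simp add: path_connected_imp_connected path_connected_punctured_universe[OF n])
 moreover have "psi ` (- {0}) = U - {b}"
 proof -
  have "psi w \<noteq> b" if "w \<noteq> 0" for w using that ch(4) U(3) by metis
  moreover have "y \<in> psi ` (- {0})" if "y \<in> U - {b}" for y
   using ch(5)[of y] that U(3) by (intro image_eqI[of _ _ "phi y"]) auto
  ultimately show ?thesis using ch(3) by auto
 qed
 ultimately have con: "connectedin Y (U - {b})" by simp
 have op: "openin Y (topspace Y - {b})"
  using H by (metis Hausdorff_imp_t1_space openin_diff openin_topspace t1_space_closedin_singleton b)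
 show ?thesis unfolding connected_space_def
 proof (rule notI, elim exE conjE)
  fix E1 E2 assume E: "openin (punctured Y b) E1" "openin (punctured Y b) E2"
   "topspace (punctured Y b) \<subseteq> E1 \<union> E2" "E1 \<inter> E2 = {}" "E1 \<noteq> {}" "E2 \<noteq> {}"
  have tp: "topspace (punctured Y b) = topspace Y - {b}" by (auto simp: punctured_def)
  have o: "openin Y E1" "openin Y E2" using E(1,2) op unfolding punctured_def by (meson openin_trans_full)+
  have sub: "E1 \<subseteq> topspace Y - {b}" "E2 \<subseteq> topspace Y - {b}" using E(1,2) tp openin_subset by metis+
  have key: False if "U - {b} \<subseteq> E1'" "openin Y E1'" "openin Y E2'" "E1' \<inter> E2' = {}" "E2' \<noteq> {}"
   "topspace Y - {b} \<subseteq> E1' \<union> E2'" "E2' \<subseteq> topspace Y - {b}" for E1' E2'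
  proof -
   have "openin Y (E1' \<union> U)" using that U(1) by blast
   moreover have "(E1' \<union> U) \<inter> E2' = {}" using that by blast
   moreover have "topspace Y \<subseteq> (E1' \<union> U) \<union> E2'" using that U ch(3)[of 0] by auto
   moreover have "E1' \<union> U \<noteq> {}" using ch(3) by blast
   ultimately show False using c that(3,5) unfolding connected_space_def by blast
  qed
  have "U - {b} \<subseteq> E1 \<union> E2" using E(3) tp openin_subset[OF U(1)] by blast
  then have "E1 \<inter> (U - {b}) = {} \<or> E2 \<inter> (U - {b}) = {}" using con o E(4) unfolding connectedin by blast
  then have "U - {b} \<subseteq> E1 \<or> U - {b} \<subseteq> E2" using \<open>U - {b} \<subseteq> E1 \<union> E2\<close> by blast
  then show False using key[of E1 E2] key[of E2 E1] o E sub tp by auto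
 qed
qed

lemma openin_punctured:
 "Hausdorff_space Y \<Longrightarrow> openin Y (topspace Y - {b})"
 by (cases "b \<in> topspace Y") (metis Hausdorff_imp_t1_space openin_diff openin_topspace t1_space_closedin_singleton, simp)

lemma loc_euclid_punctured:
 "loc_euclid TYPE('e::euclidean_space) Y \<Longrightarrow> Hausdorff_space Y \<Longrightarrow> loc_euclid TYPE('e) (punctured Y b)"
 unfolding punctured_def by (intro loc_euclid_open openin_punctured)

lemma path_connected_punctured:
 assumes Y: "loc_euclid TYPE('e::euclidean_space) Y" and c: "connected_space Y" and n: "DIM('e) \<ge> 2"
  and H: "Hausdorff_space Y"
 shows "path_connected_space (punctured Y b)"
 by (rule loc_euclid_path_connected[OF loc_euclid_punctured[OF Y H] connected_punctured[OF Y c n H]])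

section \<open>The configuration space of two points\<close>

definition conf :: "'a topology \<Rightarrow> ('a \<times> 'a) topology" where
 "conf Y = subtopology (prod_topology Y Y) {(x, y). x \<noteq> y}"

lemma into_conf:
 "continuous_map Z (conf Y) f \<longleftrightarrow> continuous_map Z Y (fst \<circ> f) \<and> continuous_map Z Y (snd \<circ> f) \<and>
  (\<forall>z\<in>topspace Z. fst (f z) \<noteq> snd (f z))" by (auto simp: conf_def into_sub continuous_map_pairwise case_prod_unfold)

lemma continuous_map_conf_fst: "continuous_map (conf Y) Y fst"
 and continuous_map_conf_snd: "continuous_map (conf Y) Y snd"
 unfolding conf_def by (auto intro: cmap_restrict continuous_map_fst continuous_map_snd)

lemma continuous_map_fib_conf:
 assumes "b \<in> topspace Y"
 shows "continuous_map (punctured Y b) (fib (conf Y) fst b) (Pair b)"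
 using assms by (auto simp: into_sub into_conf punctured_def o_def)

lemma continuous_map_conf_fib: "continuous_map (fib (conf Y) fst b) (punctured Y b) snd" unfolding punctured_def
 by (auto simp: into_sub conf_def intro: cmap_restrict continuous_map_snd)

lemma path_connected_fib_conf:
 assumes Y: "loc_euclid TYPE('e::euclidean_space) Y" and c: "connected_space Y" and n: "DIM('e) \<ge> 2"
  and H: "Hausdorff_space Y" and b: "b \<in> topspace Y"
 shows "path_connected_space (fib (conf Y) fst b)"
proof -
 have "path_connectedin (fib (conf Y) fst b) (Pair b ` topspace (punctured Y b))"
  by (rule path_connectedin_continuous_map_image[OF continuous_map_fib_conf[OF b]])
   (use path_connected_punctured[OF Y c n H] in \<open>simp add: path_connectedin_topspace\<close>)
 moreover have "Pair b ` topspace (punctured Y b) = topspace (fib (conf Y) fst b)"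
  using b by (auto simp: punctured_def conf_def image_iff)
 ultimately show ?thesis using path_connectedin_topspace by metis
qed

text \<open>In a chart, \<open>tht u u'\<close> drags \<open>u\<close> to \<open>u'\<close>; it fixes all points outside the unit ball and moves no other point
 to \<open>u'\<close>.\<close>

lemma sliced_conf:
 assumes Y: "loc_euclid TYPE('e::euclidean_space) Y" and H: "Hausdorff_space Y"
 shows "sliced (conf Y) Y fst" unfolding sliced_def
proof (intro conjI ballI continuous_map_conf_fst)
 fix b assume b: "b \<in> topspace Y"
 obtain U and phi and psi :: "'e \<Rightarrow> 'a" where U: "openin Y U"
  "homeomorphic_maps (subtopology Y U) euclidean phi psi" "psi 0 = b"
  using euclid_chart_exists[OF Y openin_topspace b] by blast
 note ch = euclid_chartD[OF U(2,1)]
 define V where "V = psi ` ball 0 (1/4)"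
 define C where "C = psi ` cball 0 1"
 define O' where "O' = psi ` ball 0 1"
 have inU: "psi ` S \<subseteq> U" for S using ch(3) by blast
 have V: "openin Y V" "b \<in> V" "openin Y O'" using ch(6) U(3) by (auto simp: V_def O'_def)
 have "compactin Y C" unfolding C_def by (rule image_compactin[OF _ ch(2)]) simp
 then have C: "closedin Y C" using H by (rule compactin_imp_closedin[rotated])
 have VD: "x \<in> U \<and> norm (phi x) < 1/4" if "x \<in> V" for x using that ch(3,4) by (auto simp: V_def)
 have CD: "y \<in> C \<longleftrightarrow> y \<in> U \<and> norm (phi y) \<le> 1" for y
  using ch(3,4,5) by (auto simp: C_def intro!: image_eqI[of _ _ "phi y"])
 have OD: "y \<in> O' \<longleftrightarrow> y \<in> U \<and> norm (phi y) < 1" for y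
  using ch(3,4,5) by (auto simp: O'_def intro!: image_eqI[of _ _ "phi y"])
 define tht where "tht u u' w = w + max 0 (1 - 2 * norm (w - u)) *\<^sub>R (u' - u)" for u u' w :: 'e
 have tht0: "tht u u' w = w" if "norm u < 1/4" "norm w \<ge> 1" for u u' w
 proof -
  have "norm (w - u) \<ge> 3/4" using that norm_triangle_ineq2[of w u] by linarith
  then show ?thesis by (simp add: tht_def)
 qed
 have thtne: "tht u u' w \<noteq> u'" if "norm u < 1/4" "norm u' < 1/4" "w \<noteq> u" for u u' w
 proof
  assume eq: "tht u u' w = u'"
  have d: "norm (u' - u) < 1/2" using that norm_triangle_ineq4[of u' u] by linarith
  show False
  proof (cases "norm (w - u) \<le> 1/2")
   case True
   then have "w - u = (2 * norm (w - u)) *\<^sub>R (u' - u)" using eq by (simp add: tht_def algebra_simps)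
   then have "norm (w - u) = (2 * norm (w - u)) * norm (u' - u)"
    by (metis abs_of_nonneg norm_ge_zero norm_scaleR zero_le_mult_iff zero_le_numeral)
   then show False using that(3) d by simp
  next
   case False
   then have "w = u'" using eq by (simp add: tht_def)
   then show False using False d by simp
  qed
 qed
 define T where "T e x' = (x', if snd e \<in> U then psi (tht (phi (fst e)) (phi x') (phi (snd e))) else snd e)" for e x'
 let ?S = "{(e, x'). fst e \<in> V \<and> x' \<in> V}"
 let ?P = "subtopology (prod_topology (conf Y) Y) ?S"
 have c1: "continuous_map ?P Y (\<lambda>(e, x'). x')" "continuous_map ?P Y (\<lambda>(e, x'). fst e)" "continuous_map ?P Y (\<lambda>(e, x'). snd e)"
  unfolding case_prod_unfold by (auto intro!: cmap_restrict continuous_map_snd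
     cmap_comp[OF continuous_map_fst continuous_map_conf_fst, unfolded o_def]
     cmap_comp[OF continuous_map_fst continuous_map_conf_snd, unfolded o_def])
 have cT: "continuous_map ?P Y (\<lambda>(e, x'). snd (T e x'))"
 proof (rule cmap_paste)
  let ?A = "{z \<in> topspace ?P. snd (fst z) \<in> C}"
  let ?B = "{z \<in> topspace ?P. snd (fst z) \<in> topspace Y - O'}"
  have c3: "continuous_map ?P Y (\<lambda>z. snd (fst z))" using c1(3) by (simp add: case_prod_unfold)
  show "closedin ?P ?A" by (rule closedin_continuous_map_preimage[OF c3 C])
  show "closedin ?P ?B" by (rule closedin_continuous_map_preimage[OF c3]) (use V(3) in blast)
  show "topspace ?P \<subseteq> ?A \<union> ?B"
  proof
   fix z assume z: "z \<in> topspace ?P"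
   then have "snd (fst z) \<in> topspace Y" using c3 by (auto simp: continuous_map_def)
   then show "z \<in> ?A \<union> ?B" using z CD[of "snd (fst z)"] OD[of "snd (fst z)"] by auto
  qed
  show "continuous_map (subtopology ?P ?B) Y (\<lambda>(e, x'). snd (T e x'))"
  proof (rule continuous_map_eq[OF cmap_restrict[OF c3]])
   fix z assume z: "z \<in> topspace (subtopology ?P ?B)"
   then have "fst (fst z) \<in> V" "snd (fst z) \<notin> O'" by auto
   then show "snd (fst z) = (case z of (e, x') \<Rightarrow> snd (T e x'))"
    using tht0 VD OD[of "snd (fst z)"] ch(5) by (auto simp: T_def case_prod_unfold not_less)
  qed
  have "continuous_map (subtopology ?P ?A) Y (\<lambda>z. psi (tht (phi (fst (fst z))) (phi (snd z)) (phi (snd (fst z)))))"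
  proof -
   have cU: "continuous_map (subtopology ?P ?A) euclidean (\<lambda>z. phi (h z))"
    if "continuous_map ?P Y h" "\<And>z. z \<in> topspace (subtopology ?P ?A) \<Longrightarrow> h z \<in> U" for h
   proof -
    have "continuous_map (subtopology ?P ?A) (subtopology Y U) h"
     using that by (auto simp: into_sub intro: cmap_restrict)
    from cmap_comp[OF this ch(1)] show ?thesis by (simp add: o_def)
   qed
   have "continuous_map (subtopology ?P ?A) euclidean (\<lambda>z. phi (fst (fst z)))"
    "continuous_map (subtopology ?P ?A) euclidean (\<lambda>z. phi (snd z))"
    "continuous_map (subtopology ?P ?A) euclidean (\<lambda>z. phi (snd (fst z)))"
    by (rule cU; use c1 VD CD in \<open>auto simp: case_prod_unfold\<close>)+
   then have "continuous_map (subtopology ?P ?A) (prod_topology euclidean (prod_topology euclidean euclidean))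
     (\<lambda>z. (phi (fst (fst z)), phi (snd z), phi (snd (fst z))))" by (intro continuous_map_pairedI)
   then have 1: "continuous_map (subtopology ?P ?A) euclidean (\<lambda>z. (phi (fst (fst z)), phi (snd z), phi (snd (fst z))))"
    by simp
   have "continuous_on UNIV (\<lambda>v. tht (fst v) (fst (snd v)) (snd (snd v)))"
    unfolding tht_def by (intro continuous_intros)
   then have 2: "continuous_map euclidean euclidean (\<lambda>v. tht (fst v) (fst (snd v)) (snd (snd v)))" by simp
   have "continuous_map (subtopology ?P ?A) euclidean (\<lambda>z. tht (phi (fst (fst z))) (phi (snd z)) (phi (snd (fst z))))"
    using cmap_comp[OF 1 2] by (simp add: o_def)
   from cmap_comp[OF this ch(2)] show ?thesis by (simp add: o_def)
  qed
  then show "continuous_map (subtopology ?P ?A) Y (\<lambda>(e, x'). snd (T e x'))"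
   by (rule continuous_map_eq) (use CD in \<open>auto simp: T_def\<close>)
 qed
 have "x' \<noteq> snd (T e x')" if "fst e \<in> V" "x' \<in> V" "fst e \<noteq> snd e" for e x'
 proof (cases "snd e \<in> U")
  case True
  have "phi (snd e) \<noteq> phi (fst e)" using ch(5) True VD that by metis
  then have "tht (phi (fst e)) (phi x') (phi (snd e)) \<noteq> phi x'" using thtne VD that by blast
  then have "psi (tht (phi (fst e)) (phi x') (phi (snd e))) \<noteq> x'" using ch(4) by metis
  then show ?thesis using True by (auto simp: T_def)
 next
  case False
  then show ?thesis using that VD by (auto simp: T_def)
 qed
 then have ne: "snd z \<noteq> snd (T (fst z) (snd z))" if "z \<in> topspace ?P" for z using that by (auto simp: conf_def)
 have fT: "fst (T e x') = x'" for e x' by (simp add: T_def)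
 have T1: "continuous_map ?P (conf Y) (\<lambda>(e, x'). T e x')"
  using c1(1) cT ne by (simp add: into_conf o_def case_prod_unfold fT)
 have T2: "T e (fst e) = e" if "fst e \<in> V" "e \<in> topspace (conf Y)" for e
  using ch(5) by (auto simp: T_def tht_def prod_eq_iff)
 show "\<exists>U T. openin Y U \<and> b \<in> U \<and>
   continuous_map (subtopology (prod_topology (conf Y) Y) {(e, y). fst e \<in> U \<and> y \<in> U}) (conf Y) (\<lambda>(e, y). T e y) \<and>
   (\<forall>e\<in>topspace (conf Y). \<forall>y\<in>U. fst e \<in> U \<longrightarrow> fst (T e y) = y) \<and>
   (\<forall>e\<in>topspace (conf Y). fst e \<in> U \<longrightarrow> T e (fst e) = e)"
  using V T1 T2 by (intro exI[of _ V] exI[of _ T]) (auto simp: T_def)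
qed

section \<open>Charts, transition maps and the unit tangent bundle\<close>

lemma has_derivative_basis_sum:
 fixes D :: "'e::euclidean_space \<Rightarrow> 'f::real_vector"
 assumes "linear D"
 shows "D u = (\<Sum>b\<in>Basis. (u \<bullet> b) *\<^sub>R D b)"
 by (subst euclidean_representation[of u, symmetric]) (simp add: linear_sum[OF assms] linear_cmul[OF assms] del: euclidean_representation)

lemma C1_derivative_continuous:
 fixes f :: "'e::euclidean_space \<Rightarrow> 'f::euclidean_space"
 assumes "Ck_on 1 S f"
 shows "continuous_on (S \<times> UNIV) (\<lambda>(x, u). frechet_derivative f (at x) u)"
proof -
 have lin: "linear (frechet_derivative f (at x))" if "x \<in> S" for x
  using assms that by (auto intro!: linear_frechet_derivative)
 have c: "continuous_on S (\<lambda>x. frechet_derivative f (at x) b)" for b using assms by auto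
 have "continuous_on (S \<times> UNIV) (\<lambda>z. \<Sum>b\<in>Basis. (snd z \<bullet> b) *\<^sub>R frechet_derivative f (at (fst z)) b)"
  by (intro continuous_intros continuous_on_compose2[OF c]) auto
 then show ?thesis by (rule continuous_on_eq) (use has_derivative_basis_sum[OF lin] in auto)
qed

text \<open>Differentiability is strict at points where the derivative is continuous: increments of \<open>f\<close> between any two
 nearby points are close to those of the derivative.\<close>

lemma C1_strict:
 fixes f :: "'e::euclidean_space \<Rightarrow> 'f::euclidean_space"
 assumes f: "Ck_on 1 S f" and S: "open S" "x0 \<in> S" and eta: "eta > 0"
 shows "\<exists>dlt>0. ball x0 dlt \<subseteq> S \<and> (\<forall>x\<in>ball x0 dlt. \<forall>y\<in>ball x0 dlt.
  norm (f y - f x - frechet_derivative f (at x0) (y - x)) \<le> eta * norm (y - x))"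
proof -
 let ?D = "\<lambda>x. frechet_derivative f (at x)"
 have der: "(f has_derivative ?D x) (at x)" if "x \<in> S" for x using f that by (auto simp: frechet_derivative_works)
 have c: "continuous_on S (\<lambda>x. ?D x b)" for b using f by auto
 have "continuous_on S (\<lambda>x. \<Sum>b\<in>Basis. norm (?D x b - ?D x0 b))" by (intro continuous_intros c)
 from continuous_open_preimage[OF this S(1) open_lessThan[of eta]]
 have "open {x \<in> S. (\<Sum>b\<in>Basis. norm (?D x b - ?D x0 b)) \<in> {..<eta}}" by (simp only: vimage_def Int_def mem_Collect_eq)
 moreover have "x0 \<in> {x \<in> S. (\<Sum>b\<in>Basis. norm (?D x b - ?D x0 b)) \<in> {..<eta}}" using S eta by simp
 ultimately obtain dlt where dlt: "dlt > 0" "ball x0 dlt \<subseteq> {x \<in> S. (\<Sum>b\<in>Basis. norm (?D x b - ?D x0 b)) \<in> {..<eta}}"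
  using open_contains_ball by blast
 have lin: "linear (?D x)" if "x \<in> S" for x using der[OF that] has_derivative_linear by blast
 have "norm (f y - f x - ?D x0 (y - x)) \<le> eta * norm (y - x)" if xy: "x \<in> ball x0 dlt" "y \<in> ball x0 dlt" for x y
 proof -
  have "norm ((f y - ?D x0 y) - (f x - ?D x0 x)) \<le> eta * norm (y - x)"
  proof (rule differentiable_bound[of "ball x0 dlt" "\<lambda>x. f x - ?D x0 x" "\<lambda>x u. ?D x u - ?D x0 u"])
   fix z assume z: "z \<in> ball x0 dlt"
   then have zS: "z \<in> S" and zs: "(\<Sum>b\<in>Basis. norm (?D z b - ?D x0 b)) < eta" using dlt(2) by auto
   have "(?D x0 has_derivative ?D x0) (at z within ball x0 dlt)"
    using lin[OF S(2)] by (rule linear_imp_has_derivative)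
   then show "((\<lambda>x. f x - ?D x0 x) has_derivative (\<lambda>u. ?D z u - ?D x0 u)) (at z within ball x0 dlt)"
    by (intro has_derivative_diff has_derivative_at_withinI[OF der[OF zS]])
   show "onorm (\<lambda>u. ?D z u - ?D x0 u) \<le> eta"
   proof (rule onorm_le)
    fix u
    have "linear (\<lambda>u. ?D z u - ?D x0 u)" using lin zS S(2) by (intro linear_compose_sub)
    then have "norm (?D z u - ?D x0 u) = norm (\<Sum>b\<in>Basis. (u \<bullet> b) *\<^sub>R (?D z b - ?D x0 b))"
     using has_derivative_basis_sum by metis
    also have "\<dots> \<le> (\<Sum>b\<in>Basis. norm u * norm (?D z b - ?D x0 b))"
     by (rule sum_norm_le) (auto intro!: mult_right_mono simp: Basis_le_norm)
    also have "\<dots> \<le> eta * norm u"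
     unfolding sum_distrib_left[symmetric] using mult_left_mono[OF less_imp_le[OF zs] norm_ge_zero[of u]]
     by (simp add: mult.commute)
    finally show "norm (?D z u - ?D x0 u) \<le> eta * norm u" .
   qed
  qed (use xy in auto)
  then show ?thesis by (simp add: linear_diff[OF lin[OF S(2)]] algebra_simps)
 qed
 with dlt show ?thesis by blast
qed

locale smooth_mfd =
 fixes X :: "'a topology" and A :: "('a, 'e::euclidean_space) chart set"
 assumes M: "smooth_manifold X A"
begin

lemma chart_open: "c \<in> A \<Longrightarrow> openin X (chart_dom c)"
 and chart_cover: "p \<in> topspace X \<Longrightarrow> \<exists>c\<in>A. p \<in> chart_dom c"
 and Hausdorff: "Hausdorff_space X" using M unfolding smooth_manifold_def is_chart_def by blast+

lemma dom_subset: "c \<in> A \<Longrightarrow> chart_dom c \<subseteq> topspace X" by (rule openin_subset[OF chart_open])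

lemma dom_topspace: "c \<in> A \<Longrightarrow> p \<in> chart_dom c \<Longrightarrow> p \<in> topspace X" using dom_subset by blast

lemma topspace_dom: "c \<in> A \<Longrightarrow> topspace (subtopology X (chart_dom c)) = chart_dom c"
 by (rule topspace_subtopology_subset[OF dom_subset])

lemma chart_homeo:
 assumes "c \<in> A"
 shows "homeomorphic_map (subtopology X (chart_dom c)) (top_of_set (snd c ` chart_dom c)) (snd c)"
 using M assms unfolding smooth_manifold_def is_chart_def by blast

lemma chart_inj: "c \<in> A \<Longrightarrow> inj_on (snd c) (chart_dom c)"
 using homeomorphic_imp_injective_map[OF chart_homeo[of c]] topspace_dom[of c] by simp

lemma chart_inv_chart: "c \<in> A \<Longrightarrow> p \<in> chart_dom c \<Longrightarrow> chart_inv c (snd c p) = p"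
 unfolding chart_inv_def by (simp add: chart_inj)

lemma chart_chart_inv: "y \<in> snd c ` chart_dom c \<Longrightarrow> snd c (chart_inv c y) = y"
 and chart_inv_in: "y \<in> snd c ` chart_dom c \<Longrightarrow> chart_inv c y \<in> chart_dom c"
 unfolding chart_inv_def by (auto intro: f_inv_into_f inv_into_into)

lemma chart_cont: "c \<in> A \<Longrightarrow> continuous_map (subtopology X (chart_dom c)) euclidean (snd c)"
 using homeomorphic_imp_continuous_map[OF chart_homeo] by (simp add: into_sub)

lemma chart_open_image:
 assumes "c \<in> A" "openin X V"
 shows "open (snd c ` (chart_dom c \<inter> V))"
proof -
 have "openin (subtopology X (chart_dom c)) (chart_dom c \<inter> V)"
  using assms(2) by (metis inf_commute openin_subtopology_Int)
 then have "openin (top_of_set (snd c ` chart_dom c)) (snd c ` (chart_dom c \<inter> V))"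
  using homeomorphic_imp_open_map[OF chart_homeo[OF assms(1)]] by (simp add: open_map_def)
 moreover have "open (snd c ` chart_dom c)" using M assms unfolding smooth_manifold_def is_chart_def by blast
 ultimately show ?thesis using openin_open_trans by blast
qed

lemma chart_image_open: "c \<in> A \<Longrightarrow> open (snd c ` chart_dom c)"
 using M unfolding smooth_manifold_def is_chart_def by blast

lemma chart_inv_continuous:
 assumes "c \<in> A" shows "cont_on (snd c ` chart_dom c) X (chart_inv c)"
proof -
 obtain k where k: "homeomorphic_maps (subtopology X (chart_dom c)) (top_of_set (snd c ` chart_dom c)) (snd c) k"
  using chart_homeo[OF assms] homeomorphic_map_maps by blast
 then have "cont_on (snd c ` chart_dom c) X k" by (simp add: homeomorphic_maps_def into_sub)
 then show ?thesis by (rule continuous_map_eq)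
   (use k chart_inv_chart[OF assms] in \<open>auto simp: homeomorphic_maps_def dom_topspace[OF assms]\<close>)
qed

definition DT :: "('a, 'e) chart \<Rightarrow> ('a, 'e) chart \<Rightarrow> 'a \<Rightarrow> 'e \<Rightarrow> 'e" where
 "DT c d p = frechet_derivative (transition c d) (at (snd c p))"

lemma transition_C1:
 assumes "c \<in> A" "d \<in> A"
 shows "Ck_on 1 (snd c ` (chart_dom c \<inter> chart_dom d)) (transition c d)"
  "open (snd c ` (chart_dom c \<inter> chart_dom d))"
proof -
 show "Ck_on 1 (snd c ` (chart_dom c \<inter> chart_dom d)) (transition c d)"
  using M assms unfolding smooth_manifold_def smooth_on_def by blast
 show "open (snd c ` (chart_dom c \<inter> chart_dom d))" using chart_open_image assms chart_open by blast
qed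

lemma transition_chart: "c \<in> A \<Longrightarrow> p \<in> chart_dom c \<Longrightarrow> transition c d (snd c p) = snd d p"
 by (simp add: transition_def chart_inv_chart)

lemma DT_derivative:
 assumes "c \<in> A" "d \<in> A" "p \<in> chart_dom c" "p \<in> chart_dom d"
 shows "(transition c d has_derivative DT c d p) (at (snd c p))"
 using transition_C1(1)[OF assms(1,2)] assms(3,4) unfolding DT_def by (auto simp: frechet_derivative_works)

lemma DT_linear:
 assumes "c \<in> A" "d \<in> A" "p \<in> chart_dom c" "p \<in> chart_dom d"
 shows "linear (DT c d p)" using DT_derivative[OF assms] has_derivative_linear by blast

lemma DT_self:
 assumes "c \<in> A" "p \<in> chart_dom c"
 shows "DT c c p u = u"
proof -
 have "((\<lambda>x. x) has_derivative (\<lambda>x. x)) (at (snd c p))" by simp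
 then have "(transition c c has_derivative (\<lambda>x. x)) (at (snd c p))"
  by (rule has_derivative_transform_within_open[OF _ chart_image_open[OF assms(1)]])
   (use assms in \<open>auto simp: transition_chart\<close>)
 then show ?thesis using DT_derivative[OF assms(1,1,2,2)] has_derivative_unique by metis
qed

lemma DT_chain:
 assumes "c \<in> A" "d \<in> A" "e \<in> A" "p \<in> chart_dom c" "p \<in> chart_dom d" "p \<in> chart_dom e"
 shows "DT d e p (DT c d p u) = DT c e p u"
proof -
 have "(transition d e has_derivative DT d e p) (at (transition c d (snd c p)))"
  using DT_derivative[OF assms(2,3,5,6)] transition_chart assms by simp
 then have 1: "((transition d e \<circ> transition c d) has_derivative (DT d e p \<circ> DT c d p)) (at (snd c p))"
  using DT_derivative[OF assms(1,2,4,5)] diff_chain_at by blast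
 have "open (snd c ` (chart_dom c \<inter> (chart_dom d \<inter> chart_dom e)))"
  by (intro chart_open_image openin_Int chart_open assms)
 then have "(transition c e has_derivative (DT d e p \<circ> DT c d p)) (at (snd c p))"
  by (rule has_derivative_transform_within_open[OF 1]) (use assms in \<open>auto simp: transition_chart\<close>)
 from has_derivative_unique[OF this DT_derivative[OF assms(1,3,4,6)]] show ?thesis by (simp add: o_def fun_eq_iff)
qed

lemma DT_inverse:
 assumes "c \<in> A" "d \<in> A" "p \<in> chart_dom c" "p \<in> chart_dom d"
 shows "DT d c p (DT c d p u) = u" using DT_chain[OF assms(1,2,1,3,4,3)] DT_self assms by simp

lemma DT_continuous:
 assumes c: "c \<in> A" "d \<in> A" and p: "continuous_map Z X p" "continuous_map Z euclidean u"
  "\<And>z. z \<in> topspace Z \<Longrightarrow> p z \<in> chart_dom c \<inter> chart_dom d"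
 shows "continuous_map Z euclidean (\<lambda>z. DT c d (p z) (u z))"
proof -
 let ?S = "snd c ` (chart_dom c \<inter> chart_dom d)"
 have "continuous_map Z (subtopology X (chart_dom c)) p" using p by (auto simp: into_sub)
 from cmap_comp[OF this chart_cont[OF c(1)]] have "continuous_map Z euclidean (snd c \<circ> p)" .
 then have "continuous_map Z (prod_topology euclidean euclidean) (\<lambda>z. (snd c (p z), u z))"
  using p(2) by (intro continuous_map_pairedI) (simp_all add: o_def)
 then have "continuous_map Z (top_of_set (?S \<times> UNIV)) (\<lambda>z. (snd c (p z), u z))" using p(3) by (auto simp: into_sub)
 moreover have "cont_on (?S \<times> UNIV) euclidean (\<lambda>(x, u). frechet_derivative (transition c d) (at x) u)"
  using C1_derivative_continuous[OF transition_C1(1)[OF c]] by simp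
 ultimately have "continuous_map Z euclidean ((\<lambda>(x, u). frechet_derivative (transition c d) (at x) u) \<circ> (\<lambda>z. (snd c (p z), u z)))"
  by (rule cmap_comp)
 then show ?thesis by (simp add: o_def DT_def)
qed

lemma transition_strict:
 assumes "c \<in> A" "d \<in> A" "p \<in> chart_dom c" "p \<in> chart_dom d" "eta > 0"
 shows "\<exists>dlt>0. ball (snd c p) dlt \<subseteq> snd c ` (chart_dom c \<inter> chart_dom d) \<and>
  (\<forall>x\<in>ball (snd c p) dlt. \<forall>y\<in>ball (snd c p) dlt.
   norm (transition c d y - transition c d x - DT c d p (y - x)) \<le> eta * norm (y - x))"
 unfolding DT_def by (rule C1_strict[OF transition_C1[OF assms(1,2)]]) (use assms in auto)

lemma coord_vec_eq: "coord_vec A c p u = (\<lambda>d. if d \<in> A \<and> p \<in> chart_dom d then DT c d p u else 0)"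
 unfolding coord_vec_def DT_def ..

lemma coord_vec_tangent:
 assumes "c \<in> A" "p \<in> chart_dom c" shows "coord_vec A c p u \<in> tangent_space A p"
 using DT_chain[OF assms(1) _ _ assms(2)] unfolding tangent_space_def coord_vec_eq by (auto simp: DT_def)

lemma coord_vec_at: "c \<in> A \<Longrightarrow> p \<in> chart_dom c \<Longrightarrow> coord_vec A c p u c = u" by (simp add: coord_vec_eq DT_self)

lemma tangent_eq:
 assumes "v \<in> tangent_space A p" "c \<in> A" "d \<in> A" "p \<in> chart_dom c" "p \<in> chart_dom d"
 shows "v d = DT c d p (v c)" using assms unfolding tangent_space_def DT_def by blast

lemma coord_vec_tangent_eq:
 assumes "v \<in> tangent_space A p" "c \<in> A" "p \<in> chart_dom c"
 shows "coord_vec A c p (v c) = v"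
proof
 fix d show "coord_vec A c p (v c) d = v d"
 proof (cases "d \<in> A \<and> p \<in> chart_dom d")
  case True
  then show ?thesis using tangent_eq[OF assms(1,2) _ assms(3), of d] unfolding coord_vec_eq by simp
 next
  case False
  then have "v d = 0" using assms(1) unfolding tangent_space_def by blast
  then show ?thesis using False unfolding coord_vec_eq by auto
 qed
qed

lemma coord_vec_linear:
 assumes "c \<in> A" "p \<in> chart_dom c"
 shows "coord_vec A c p (t *\<^sub>R u) = (\<lambda>d. t *\<^sub>R coord_vec A c p u d)"
  "coord_vec A c p 0 = (\<lambda>_. 0)"
 using DT_linear[OF assms(1) _ assms(2)] by (auto simp: coord_vec_eq linear_cmul linear_0)

abbreviation "TB \<equiv> tangent_bundle X A"

lemma tangent_basis_open:
 "c \<in> A \<Longrightarrow> open W \<Longrightarrow> openin TB {(p, v). p \<in> chart_dom c \<and> v \<in> tangent_space A p \<and> (snd c p, v c) \<in> W}"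
 unfolding tangent_bundle_def by (rule topology_generated_by_Basis) blast

lemma topspace_TB: "topspace TB = {(p, v). p \<in> topspace X \<and> v \<in> tangent_space A p}"
proof -
 have "\<Union>{{(p, v). p \<in> chart_dom c \<and> v \<in> tangent_space A p \<and> (snd c p, v c) \<in> W} | c W. c \<in> A \<and> open W}
  = {(p, v). p \<in> topspace X \<and> v \<in> tangent_space A p}" (is "?L = ?R")
 proof
  show "?L \<subseteq> ?R" using dom_topspace by blast
  show "?R \<subseteq> ?L"
  proof
   fix z assume z: "z \<in> ?R"
   then obtain p v where pv: "z = (p, v)" "p \<in> topspace X" "v \<in> tangent_space A p" by auto
   then obtain c where c: "c \<in> A" "p \<in> chart_dom c" using chart_cover by blast
   then have "z \<in> {(p, v). p \<in> chart_dom c \<and> v \<in> tangent_space A p \<and> (snd c p, v c) \<in> UNIV}" using pv by simp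
   then show "z \<in> ?L" using c open_UNIV by blast
  qed
 qed
 then show ?thesis by (simp add: tangent_bundle_def topology_generated_by_topspace)
qed

lemma TB_fst_continuous: "continuous_map TB X fst" unfolding continuous_map_def
proof (intro conjI allI impI)
 show "fst \<in> topspace TB \<rightarrow> topspace X" by (auto simp: topspace_TB)
 fix V assume V: "openin X V"
 have "{z \<in> topspace TB. fst z \<in> V} = (\<Union>c\<in>A. {(p, v). p \<in> chart_dom c \<and> v \<in> tangent_space A p \<and>
   (snd c p, v c) \<in> (snd c ` (chart_dom c \<inter> V)) \<times> UNIV})" (is "?L = ?R")
 proof
  show "?L \<subseteq> ?R" using chart_cover by (fastforce simp: topspace_TB)
  show "?R \<subseteq> ?L" using dom_topspace chart_inj by (fastforce simp: topspace_TB inj_on_def)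
 qed
 moreover have "openin TB ?R"
 proof (rule openin_Union)
  fix S assume "S \<in> (\<lambda>c. {(p, v). p \<in> chart_dom c \<and> v \<in> tangent_space A p \<and>
   (snd c p, v c) \<in> (snd c ` (chart_dom c \<inter> V)) \<times> UNIV}) ` A"
  then show "openin TB S" using tangent_basis_open[OF _ open_Times[OF chart_open_image[OF _ V] open_UNIV]] by blast
 qed
 ultimately show "openin TB {z \<in> topspace TB. fst z \<in> V}" by simp
qed

lemma TB_coord_continuous:
 assumes c: "c \<in> A"
 shows "continuous_map (subtopology TB {z. fst z \<in> chart_dom c}) euclidean (\<lambda>z. snd z c)" unfolding continuous_map_def
proof (intro conjI allI impI)
 fix W :: "'e set" assume "openin euclidean W"
 then have "openin TB {(p, v). p \<in> chart_dom c \<and> v \<in> tangent_space A p \<and> (snd c p, v c) \<in> UNIV \<times> W}"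
  using c by (intro tangent_basis_open open_Times) auto
 then have "openin (subtopology TB {z. fst z \<in> chart_dom c}) ({z. fst z \<in> chart_dom c} \<inter> {(p, v). p \<in> chart_dom c \<and> v \<in> tangent_space A p \<and> (snd c p, v c) \<in> UNIV \<times> W})"
  by (rule openin_subtopology_Int2)
 moreover have "({z. fst z \<in> chart_dom c} \<inter> {(p, v). p \<in> chart_dom c \<and> v \<in> tangent_space A p \<and> (snd c p, v c) \<in> UNIV \<times> W}) =
  {z \<in> topspace (subtopology TB {z. fst z \<in> chart_dom c}). snd z c \<in> W}"
  using dom_topspace[OF c] by (auto simp: topspace_TB)
 ultimately show "openin (subtopology TB {z. fst z \<in> chart_dom c})
  {z \<in> topspace (subtopology TB {z. fst z \<in> chart_dom c}). snd z c \<in> W}" by simp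
qed auto

text \<open>One chart around each point decides on the continuity of a vector field, since transition maps are \<open>C\<^sup>1\<close>.\<close>

lemma continuous_map_TB:
 assumes p: "continuous_map Z X p" and v: "\<And>z. z \<in> topspace Z \<Longrightarrow> v z \<in> tangent_space A (p z)"
  and loc: "\<And>z. z \<in> topspace Z \<Longrightarrow> \<exists>Q c. openin Z Q \<and> z \<in> Q \<and> c \<in> A \<and> (\<forall>z'\<in>Q. p z' \<in> chart_dom c) \<and>
   continuous_map (subtopology Z Q) euclidean (\<lambda>z. v z c)"
 shows "continuous_map Z TB (\<lambda>z. (p z, v z))" unfolding tangent_bundle_def
proof (rule continuous_on_generated_topo)
 have "(\<lambda>z. (p z, v z)) ` topspace Z \<subseteq> topspace TB" using p v by (auto simp: topspace_TB continuous_map_def)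
 then show "(\<lambda>z. (p z, v z)) ` topspace Z \<subseteq>
  \<Union>{{(p, v). p \<in> chart_dom c \<and> v \<in> tangent_space A p \<and> (snd c p, v c) \<in> W} | c W. c \<in> A \<and> open W}"
  by (simp add: tangent_bundle_def topology_generated_by_topspace)
 fix U assume "U \<in> {{(p, v). p \<in> chart_dom c \<and> v \<in> tangent_space A p \<and> (snd c p, v c) \<in> W} | c W. c \<in> A \<and> open W}"
 then obtain d W where d: "d \<in> A" "open W" and U: "U = {(p, v). p \<in> chart_dom d \<and> v \<in> tangent_space A p \<and> (snd d p, v d) \<in> W}"
  by blast
 show "openin Z ((\<lambda>z. (p z, v z)) -` U \<inter> topspace Z)"
 proof (subst openin_subopen, intro ballI)
  fix z assume z: "z \<in> (\<lambda>z. (p z, v z)) -` U \<inter> topspace Z"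
  then obtain Q c where Q: "openin Z Q" "z \<in> Q" "c \<in> A" "\<forall>z'\<in>Q. p z' \<in> chart_dom c"
   "continuous_map (subtopology Z Q) euclidean (\<lambda>z. v z c)" using loc by blast
  let ?R = "Q \<inter> {z \<in> topspace Z. p z \<in> chart_dom d}"
  have R: "openin Z ?R" using Q(1) open_preim[OF p chart_open[OF d(1)]] by blast
  have pR: "continuous_map (subtopology Z ?R) X p" using p by (rule cmap_restrict)
  have "continuous_map (subtopology Z ?R) euclidean (\<lambda>z. v z c)" by (rule cmap_mono[OF Q(5)]) auto
  then have "continuous_map (subtopology Z ?R) euclidean (\<lambda>z. DT c d (p z) (v z c))"
   using Q(3) d(1) pR by (intro DT_continuous) (use Q(4) in auto)
  then have vd: "continuous_map (subtopology Z ?R) euclidean (\<lambda>z. v z d)"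
  proof (rule continuous_map_eq)
   fix z' assume "z' \<in> topspace (subtopology Z ?R)"
   then have "z' \<in> topspace Z" "p z' \<in> chart_dom c" "p z' \<in> chart_dom d" using Q(4) by auto
   from tangent_eq[OF v[OF this(1)] Q(3) d(1) this(2,3)] show "DT c d (p z') (v z' c) = v z' d" by simp
  qed
  have "continuous_map (subtopology Z ?R) (subtopology X (chart_dom d)) p" using pR by (auto simp: into_sub)
  from cmap_comp[OF this chart_cont[OF d(1)]]
  have "continuous_map (subtopology Z ?R) euclidean (\<lambda>z. snd d (p z))" by (simp add: o_def)
  then have "continuous_map (subtopology Z ?R) (prod_topology euclidean euclidean) (\<lambda>z. (snd d (p z), v z d))"
   using vd by (intro continuous_map_pairedI)
  then have "continuous_map (subtopology Z ?R) euclidean (\<lambda>z. (snd d (p z), v z d))" by simp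
  from open_preim[OF this, of W] d(2)
  have "openin (subtopology Z ?R) {z \<in> topspace (subtopology Z ?R). (snd d (p z), v z d) \<in> W}"
   by (simp only: open_openin)
  then have "openin Z {z \<in> topspace (subtopology Z ?R). (snd d (p z), v z d) \<in> W}" using R openin_trans_full by blast
  moreover have "z \<in> {z \<in> topspace (subtopology Z ?R). (snd d (p z), v z d) \<in> W}" using z Q(2) by (auto simp: U)
  moreover have "{z \<in> topspace (subtopology Z ?R). (snd d (p z), v z d) \<in> W} \<subseteq> (\<lambda>z. (p z, v z)) -` U \<inter> topspace Z"
   using v by (auto simp: U)
  ultimately show "\<exists>T. openin Z T \<and> z \<in> T \<and> T \<subseteq> (\<lambda>z. (p z, v z)) -` U \<inter> topspace Z" by blast
 qed
qed

end

locale riem_mfd = smooth_mfd X A for X :: "'a topology" and A :: "('a, 'e::euclidean_space) chart set" +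
 fixes g :: "'a \<Rightarrow> (('a, 'e) chart \<Rightarrow> 'e) \<Rightarrow> (('a, 'e) chart \<Rightarrow> 'e) \<Rightarrow> real"
 assumes G: "riemannian_metric A g"
begin

abbreviation "ST \<equiv> unit_tangent_bundle X A g"

definition gsq :: "('a, 'e) chart \<Rightarrow> 'a \<Rightarrow> 'e \<Rightarrow> real" where
 "gsq c p u = g p (coord_vec A c p u) (coord_vec A c p u)"

definition unit_vec :: "('a, 'e) chart \<Rightarrow> 'a \<Rightarrow> 'e \<Rightarrow> ('a, 'e) chart \<Rightarrow> 'e" where
 "unit_vec c p u = coord_vec A c p (u /\<^sub>R sqrt (gsq c p u))"

lemma fiber_param_eq: "fiber_param A g c p u = (p, unit_vec c p u)"
 by (simp add: fiber_param_def unit_vec_def gsq_def)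

lemma g_bilinear:
 assumes "c \<in> A" "p \<in> chart_dom c"
 shows "bilinear (\<lambda>u w. g p (coord_vec A c p u) (coord_vec A c p w))"
 using G assms unfolding riemannian_metric_def by blast

lemma gsq_pos:
 assumes "c \<in> A" "p \<in> chart_dom c" "u \<noteq> 0" shows "gsq c p u > 0"
 using G assms unfolding riemannian_metric_def gsq_def by blast

lemma gsq_scale:
 assumes "c \<in> A" "p \<in> chart_dom c" shows "gsq c p (t *\<^sub>R u) = t\<^sup>2 * gsq c p u"
 using bilinear_lmul[OF g_bilinear[OF assms]] bilinear_rmul[OF g_bilinear[OF assms]]
 by (simp add: gsq_def power2_eq_square)

lemma gsq_0: "c \<in> A \<Longrightarrow> p \<in> chart_dom c \<Longrightarrow> gsq c p 0 = 0" using gsq_scale[of c p 0 0] by simp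

lemma gsq_continuous:
 assumes c: "c \<in> A" and p: "continuous_map Z X p" "continuous_map Z euclidean u"
  "\<And>z. z \<in> topspace Z \<Longrightarrow> p z \<in> chart_dom c"
 shows "continuous_map Z euclidean (\<lambda>z. gsq c (p z) (u z))"
proof -
 define G2 where "G2 x b b' = g (chart_inv c x) (coord_vec A c (chart_inv c x) b) (coord_vec A c (chart_inv c x) b')" for x b b'
 have "smooth_on (snd c ` chart_dom c) (\<lambda>x. G2 x b b')" for b b'
  using G c unfolding riemannian_metric_def G2_def by blast
 then have "Ck_on 0 (snd c ` chart_dom c) (\<lambda>x. G2 x b b')" for b b' unfolding smooth_on_def by blast
 then have "continuous_on (snd c ` chart_dom c) (\<lambda>x. G2 x b b')" for b b' by simp
 then have G2: "cont_on (snd c ` chart_dom c) euclidean (\<lambda>x. G2 x b b')" for b b' by simp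
 have "continuous_map Z (subtopology X (chart_dom c)) p" using p by (auto simp: into_sub)
 from cmap_comp[OF this chart_cont[OF c]] have "continuous_map Z euclidean (\<lambda>z. snd c (p z))" by (simp add: o_def)
 then have "continuous_map Z (top_of_set (snd c ` chart_dom c)) (\<lambda>z. snd c (p z))" using p(3) by (auto simp: into_sub)
 from cmap_comp[OF this G2] have G3: "continuous_map Z euclidean (\<lambda>z. G2 (snd c (p z)) b b')" for b b'
  by (simp add: o_def)
 have u: "continuous_map Z euclidean (\<lambda>z. u z \<bullet> b)" for b
 proof -
  have "continuous_map euclidean euclidean (\<lambda>x::'e. x \<bullet> b)" by (simp add: continuous_intros)
  from cmap_comp[OF p(2) this] show ?thesis by (simp add: o_def)
 qed
 have "continuous_map Z euclidean (\<lambda>z. \<Sum>b\<in>Basis. \<Sum>b'\<in>Basis. (u z \<bullet> b) * ((u z \<bullet> b') * G2 (snd c (p z)) b b'))"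
  by (intro continuous_map_sum continuous_map_real_mult u G3) auto
 then show ?thesis
 proof (rule continuous_map_eq)
  fix z assume "z \<in> topspace Z"
  then have pz: "p z \<in> chart_dom c" by (rule p(3))
  let ?B = "\<lambda>u w. g (p z) (coord_vec A c (p z) u) (coord_vec A c (p z) w)"
  have bl: "bilinear ?B" by (rule g_bilinear[OF c pz])
  have "gsq c (p z) (u z) = ?B (\<Sum>b\<in>Basis. (u z \<bullet> b) *\<^sub>R b) (\<Sum>b\<in>Basis. (u z \<bullet> b) *\<^sub>R b)"
   by (simp add: gsq_def euclidean_representation)
  also have "\<dots> = (\<Sum>b\<in>Basis. \<Sum>b'\<in>Basis. (u z \<bullet> b) * ((u z \<bullet> b') * ?B b b'))"
   unfolding bilinear_sum[OF bl] sum.cartesian_product[symmetric] bilinear_lmul[OF bl] bilinear_rmul[OF bl]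
   by (simp add: mult.left_commute)
  finally show "(\<Sum>b\<in>Basis. \<Sum>b'\<in>Basis. (u z \<bullet> b) * ((u z \<bullet> b') * G2 (snd c (p z)) b b')) = gsq c (p z) (u z)"
   by (simp add: G2_def chart_inv_chart[OF c pz])
 qed
qed

lemma topspace_ST: "topspace ST = {(p, v). p \<in> topspace X \<and> v \<in> tangent_space A p \<and> g p v v = 1}"
 by (auto simp: unit_tangent_bundle_def topspace_TB)

lemma ST_fst_continuous: "continuous_map ST X fst"
 unfolding unit_tangent_bundle_def by (rule cmap_restrict[OF TB_fst_continuous])

lemma ST_coord_continuous:
 assumes c: "c \<in> A"
 shows "continuous_map (subtopology ST {z. fst z \<in> chart_dom c}) euclidean (\<lambda>z. snd z c)"
 unfolding unit_tangent_bundle_def subtopology_subtopology by (rule cmap_mono[OF TB_coord_continuous[OF c]]) auto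

lemma continuous_map_ST_coord:
 assumes c: "c \<in> A" and V: "continuous_map Z ST V" "\<And>z. z \<in> topspace Z \<Longrightarrow> fst (V z) \<in> chart_dom c"
 shows "continuous_map Z euclidean (\<lambda>z. snd (V z) c)"
proof -
 have "continuous_map Z (subtopology ST {z. fst z \<in> chart_dom c}) V" using V by (auto simp: into_sub)
 from cmap_comp[OF this ST_coord_continuous[OF c]] show ?thesis by (simp add: o_def)
qed

lemma ST_vec:
 assumes "(p, v) \<in> topspace ST" "c \<in> A" "p \<in> chart_dom c"
 shows "coord_vec A c p (v c) = v" "gsq c p (v c) = 1" "v c \<noteq> 0" "unit_vec c p (v c) = v"
proof -
 show 1: "coord_vec A c p (v c) = v" using assms coord_vec_tangent_eq by (auto simp: topspace_ST)
 show 2: "gsq c p (v c) = 1" using assms 1 by (simp add: gsq_def topspace_ST)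
 show "v c \<noteq> 0" using 2 gsq_0[OF assms(2,3)] by auto
 show "unit_vec c p (v c) = v" using 1 2 by (simp add: unit_vec_def)
qed

lemma unit_vec_ST:
 assumes "c \<in> A" "p \<in> chart_dom c" "u \<noteq> 0"
 shows "(p, unit_vec c p u) \<in> topspace ST" "unit_vec c p u c = u /\<^sub>R sqrt (gsq c p u)"
proof -
 have "gsq c p (u /\<^sub>R sqrt (gsq c p u)) = 1"
  using gsq_scale[OF assms(1,2)] gsq_pos[OF assms] by (simp add: power_inverse)
 then show "(p, unit_vec c p u) \<in> topspace ST"
  using coord_vec_tangent dom_topspace assms by (auto simp: topspace_ST unit_vec_def gsq_def)
 show "unit_vec c p u c = u /\<^sub>R sqrt (gsq c p u)" using coord_vec_at assms by (simp add: unit_vec_def)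
qed

lemma continuous_map_ST:
 assumes p: "continuous_map Z X p" and v: "\<And>z. z \<in> topspace Z \<Longrightarrow> (p z, v z) \<in> topspace ST"
  and loc: "\<And>z. z \<in> topspace Z \<Longrightarrow> \<exists>Q c. openin Z Q \<and> z \<in> Q \<and> c \<in> A \<and> (\<forall>z'\<in>Q. p z' \<in> chart_dom c) \<and>
   continuous_map (subtopology Z Q) euclidean (\<lambda>z. v z c)"
 shows "continuous_map Z ST (\<lambda>z. (p z, v z))"
proof -
 have "continuous_map Z TB (\<lambda>z. (p z, v z))"
  by (rule continuous_map_TB[OF p _ loc]) (use v in \<open>auto simp: topspace_ST\<close>)
 then show ?thesis using v by (auto simp: unit_tangent_bundle_def into_sub)
qed

lemma unit_vec_continuous:
 assumes p: "continuous_map Z X p" and c: "c \<in> A" "\<And>z. z \<in> topspace Z \<Longrightarrow> p z \<in> chart_dom c"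
  and u: "continuous_map Z euclidean u" "\<And>z. z \<in> topspace Z \<Longrightarrow> u z \<noteq> 0"
 shows "continuous_map Z ST (\<lambda>z. (p z, unit_vec c (p z) (u z)))"
proof (rule continuous_map_ST[OF p])
 show "(p z, unit_vec c (p z) (u z)) \<in> topspace ST" if "z \<in> topspace Z" for z using unit_vec_ST c u that by blast
 fix z assume z: "z \<in> topspace Z"
 have "continuous_map Z (top_of_set {0<..}) (\<lambda>z. gsq c (p z) (u z))"
  using gsq_continuous[OF c(1) p u(1)] c u gsq_pos by (auto simp: into_sub)
 then have "continuous_map Z (prod_topology (top_of_set {0<..}) euclidean) (\<lambda>z. (gsq c (p z) (u z), u z))"
  using u(1) by (intro continuous_map_pairedI)
 then have 1: "continuous_map Z (top_of_set ({0<..} \<times> UNIV)) (\<lambda>z. (gsq c (p z) (u z), u z))"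
  using prod_topology_subtopology_eu[of "{0<..}::real set" "UNIV::'e set"] by simp
 have "continuous_on ({0<..} \<times> UNIV) (\<lambda>w::real \<times> 'e. snd w /\<^sub>R sqrt (fst w))" by (intro continuous_intros) auto
 then have "cont_on ({0<..} \<times> UNIV) euclidean (\<lambda>w::real \<times> 'e. snd w /\<^sub>R sqrt (fst w))" by simp
 from cmap_comp[OF 1 this]
 have "continuous_map Z euclidean (\<lambda>z. u z /\<^sub>R sqrt (gsq c (p z) (u z)))" by (simp add: o_def)
 then have "continuous_map Z euclidean (\<lambda>z. unit_vec c (p z) (u z) c)"
  by (rule continuous_map_eq) (use unit_vec_ST(2)[OF c(1)] c(2) u(2) in auto)
 then show "\<exists>Q c'. openin Z Q \<and> z \<in> Q \<and> c' \<in> A \<and> (\<forall>z'\<in>Q. p z' \<in> chart_dom c') \<and>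
   continuous_map (subtopology Z Q) euclidean (\<lambda>z. unit_vec c (p z) (u z) c')"
  using z c by (intro exI[of _ "topspace Z"] exI[of _ c]) auto
qed

text \<open>A chart moves a unit vector to another point by keeping its coordinates up to normalization.\<close>

lemma sliced_ST: "sliced ST X fst" unfolding sliced_def
proof (intro conjI ballI ST_fst_continuous)
 fix b assume "b \<in> topspace X"
 then obtain c where c: "c \<in> A" "b \<in> chart_dom c" using chart_cover by blast
 let ?P = "subtopology (prod_topology ST X) {(e, y). fst e \<in> chart_dom c \<and> y \<in> chart_dom c}"
 let ?T = "\<lambda>e y. (y, unit_vec c y (snd e c))"
 have "continuous_map ?P ST fst" by (rule cmap_restrict[OF continuous_map_fst])
 then have 1: "continuous_map ?P euclidean (\<lambda>z. snd (fst z) c)" by (rule continuous_map_ST_coord[OF c(1)]) auto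
 have 2: "continuous_map ?P X snd" by (rule cmap_restrict[OF continuous_map_snd])
 have nz: "snd (fst z) c \<noteq> 0" if "z \<in> topspace ?P" for z
  using ST_vec(3)[of "fst (fst z)" "snd (fst z)", OF _ c(1)] that by auto
 have "continuous_map ?P ST (\<lambda>(e, y). ?T e y)"
  using unit_vec_continuous[OF 2 c(1) _ 1] nz by (simp add: case_prod_unfold)
 moreover have "?T e (fst e) = e" if "e \<in> topspace ST" "fst e \<in> chart_dom c" for e
  using ST_vec(4)[of "fst e" "snd e" c] that c by simp
 ultimately show "\<exists>U T. openin X U \<and> b \<in> U \<and>
   continuous_map (subtopology (prod_topology ST X) {(e, y). fst e \<in> U \<and> y \<in> U}) ST (\<lambda>(e, y). T e y) \<and>
   (\<forall>e\<in>topspace ST. \<forall>y\<in>U. fst e \<in> U \<longrightarrow> fst (T e y) = y) \<and>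
   (\<forall>e\<in>topspace ST. fst e \<in> U \<longrightarrow> T e (fst e) = e)"
  using chart_open[OF c(1)] c(2) by (intro exI[of _ "chart_dom c"] exI[of _ ?T]) auto
qed

lemma fiber_param_continuous:
 assumes "c \<in> A" "b \<in> chart_dom c"
 shows "continuous_map unit_sphere (fib ST fst b) (fiber_param A g c b)"
proof -
 have "continuous_map unit_sphere ST (\<lambda>u. (b, unit_vec c b u))"
  by (rule unit_vec_continuous) (use assms dom_topspace in auto)
 then have "continuous_map unit_sphere ST (fiber_param A g c b)"
  by (rule continuous_map_eq) (simp add: fiber_param_eq)
 then show ?thesis by (simp add: into_fib fiber_param_eq)
qed

lemma fiber_coord_continuous:
 assumes "c \<in> A" "b \<in> chart_dom c"
 shows "continuous_map (fib ST fst b) unit_sphere (\<lambda>e. sgn (snd e c))"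
proof -
 have "continuous_map (fib ST fst b) euclidean (\<lambda>e. snd e c)"
  by (rule continuous_map_ST_coord[OF assms(1)]) (use assms in \<open>auto intro: cmap_restrict\<close>)
 moreover have nz: "snd e c \<noteq> 0" if "e \<in> topspace (fib ST fst b)" for e
  using ST_vec(3)[of "fst e" "snd e" c] that assms by auto
 ultimately have "continuous_map (fib ST fst b) (top_of_set (- {0})) (\<lambda>e. snd e c)" by (auto simp: into_sub)
 moreover have "cont_on (- {0}) unit_sphere (sgn :: 'e \<Rightarrow> 'e)"
  by (auto simp: into_sub norm_sgn intro!: continuous_intros)
 ultimately have "continuous_map (fib ST fst b) unit_sphere (sgn \<circ> (\<lambda>e. snd e c))" by (rule cmap_comp)
 then show ?thesis by (simp add: o_def)
qed

lemma fiber_coord_param: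
 assumes "c \<in> A" "b \<in> chart_dom c" "u \<in> sphere 0 1"
 shows "sgn (snd (fiber_param A g c b u) c) = u"
proof -
 have "u \<noteq> 0" using assms(3) by auto
 then have "snd (fiber_param A g c b u) c = u /\<^sub>R sqrt (gsq c b u)" "gsq c b u > 0"
  using unit_vec_ST(2)[OF assms(1,2)] gsq_pos[OF assms(1,2)] by (simp_all add: fiber_param_eq)
 then show ?thesis using assms(3) by (simp add: sgn_div_norm)
qed

lemma unit_vec_scale:
 assumes "c \<in> A" "b \<in> chart_dom c" "t > 0"
 shows "unit_vec c b (t *\<^sub>R u) = unit_vec c b u"
proof -
 have "(t *\<^sub>R u) /\<^sub>R sqrt (gsq c b (t *\<^sub>R u)) = u /\<^sub>R sqrt (gsq c b u)"
  using gsq_scale[OF assms(1,2), of t u] assms(3) by (simp add: real_sqrt_mult field_simps)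
 then show ?thesis by (simp only: unit_vec_def)
qed

lemma fiber_param_coord:
 assumes "c \<in> A" "b \<in> chart_dom c" "e \<in> topspace (fib ST fst b)"
 shows "fiber_param A g c b (sgn (snd e c)) = e"
proof -
 have e: "(b, snd e) \<in> topspace ST" "fst e = b" using assms(3) by (metis (mono_tags, lifting) IntD1 IntD2 mem_Collect_eq prod.collapse topspace_subtopology)+
 have "snd e c \<noteq> 0" using ST_vec(3)[OF e(1) assms(1,2)] .
 then have "unit_vec c b (sgn (snd e c)) = unit_vec c b (snd e c)"
  unfolding sgn_div_norm by (intro unit_vec_scale assms) auto
 then show ?thesis using ST_vec(4)[OF e(1) assms(1,2)] e(2) by (simp add: fiber_param_eq prod_eq_iff)
qed

lemma path_connected_fib_ST:
 assumes "DIM('e) \<ge> 2" "b \<in> topspace X"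
 shows "path_connected_space (fib ST fst b)"
proof -
 obtain c where c: "c \<in> A" "b \<in> chart_dom c" using chart_cover assms by blast
 have "path_connectedin (fib ST fst b) (fiber_param A g c b ` sphere 0 1)"
  by (rule path_connectedin_continuous_map_image[OF fiber_param_continuous[OF c]])
    (use path_connected_sphere[of "0::'e" 1] assms(1) in \<open>simp add: path_connectedin_subtopology\<close>)
 moreover have "fiber_param A g c b ` sphere 0 1 = topspace (fib ST fst b)"
 proof
  show "fiber_param A g c b ` sphere 0 1 \<subseteq> topspace (fib ST fst b)"
   using fiber_param_continuous[OF c] by (auto simp: continuous_map_def)
  show "topspace (fib ST fst b) \<subseteq> fiber_param A g c b ` sphere 0 1"
  proof
   fix e assume e: "e \<in> topspace (fib ST fst b)"
   then have "sgn (snd e c) \<in> sphere 0 1" using fiber_coord_continuous[OF c] by (force simp: continuous_map_def)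
   then show "e \<in> fiber_param A g c b ` sphere 0 1" using fiber_param_coord[OF c e] by (metis image_eqI)
  qed
 qed
 ultimately show ?thesis using path_connectedin_topspace by metis
qed

end

section \<open>Pushing along a vector field\<close>

lemma tube_lemma_interval:
 fixes C :: "'z::metric_space set"
 assumes C: "compact C" and W: "openin (top_of_set ({0..e} \<times> C)) W" and e: "(e::real) > 0"
  and 0: "\<And>z. z \<in> C \<Longrightarrow> (0, z) \<in> W"
 shows "\<exists>e'. 0 < e' \<and> e' \<le> e \<and> {0..e'} \<times> C \<subseteq> W"
proof -
 obtain G where G: "open G" "W = ({0..e} \<times> C) \<inter> G" using W by (auto simp: openin_open)
 have c: "compact ({0::real} \<times> C)" using C by (intro compact_Times) auto
 have "{0} \<times> C \<subseteq> \<Union>{G}" using 0 G by auto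
 then obtain r where r: "r > 0" "\<forall>x\<in>{0} \<times> C. ball x r \<subseteq> G" by (rule Heine_Borel_lemma[OF c]) (use G in auto)
 have "(t, z) \<in> G" if "t \<in> {0..min e (r / 2)}" "z \<in> C" for t z
 proof -
  have "dist (0, z) (t, z) < r" using that r(1) by (simp add: dist_prod_def dist_real_def)
  moreover have "ball (0, z) r \<subseteq> G" using r(2) that(2) by auto
  ultimately show ?thesis by (meson mem_ball subsetD)
 qed
 then show ?thesis using e r(1) G by (intro exI[of _ "min e (r / 2)"]) auto
qed

abbreviation within_nhds :: "'z::metric_space \<Rightarrow> 'z set \<Rightarrow> 'z filter" where
 "within_nhds z K \<equiv> inf (nhds z) (principal K)"

text \<open>Approach of \<open>z\<close> in \<open>K\<close>, together with a time tending to \<open>0\<close> from above.\<close>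

definition pfil :: "'z::metric_space \<Rightarrow> 'z set \<Rightarrow> (real \<times> 'z) filter" where
 "pfil z K = at_right 0 \<times>\<^sub>F within_nhds z K"

lemma eventually_push_filter:
 assumes "eventually P (pfil z K)"
 shows "\<exists>dlt>0. \<forall>eps x. 0 < eps \<longrightarrow> eps < dlt \<longrightarrow> x \<in> K \<longrightarrow> dist x z < dlt \<longrightarrow> P (eps, x)"
proof -
 obtain P1 P2 where P: "eventually P1 (at_right 0)" "eventually P2 (within_nhds z K)" "\<And>x y. P1 x \<Longrightarrow> P2 y \<Longrightarrow> P (x, y)"
  using assms unfolding pfil_def eventually_prod_filter by blast
 obtain b where b: "b > 0" "\<And>x. 0 < x \<Longrightarrow> x < b \<Longrightarrow> P1 x" using P(1) unfolding eventually_at_right_field by blast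
 obtain d where d: "d > 0" "\<And>x. dist x z < d \<Longrightarrow> x \<in> K \<Longrightarrow> P2 x"
  using P(2) unfolding eventually_inf_principal eventually_nhds_metric by blast
 show ?thesis using b d P(3) by (intro exI[of _ "min b d"]) auto
qed

lemma push_filter_fst: "(fst \<longlongrightarrow> 0) (pfil z K)" "eventually (\<lambda>x. 0 < fst x) (pfil z K)"
 and push_filter_snd: "filterlim snd (within_nhds z K) (pfil z K)"
 and eventually_push_snd: "eventually P (within_nhds z K) \<Longrightarrow> eventually (\<lambda>x. P (snd x)) (pfil z K)"
proof -
 have f: "filterlim fst (at_right 0) (pfil z K)" unfolding pfil_def by (rule filterlim_fst)
 show "(fst \<longlongrightarrow> 0) (pfil z K)" using filterlim_mono[OF f, of "nhds 0" "pfil z K"] by (simp add: at_within_le_nhds)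
 have "eventually (\<lambda>x. 0 < x) (at_right (0::real))" by (simp add: eventually_at_right_less)
 from eventually_compose_filterlim[OF this f] show "eventually (\<lambda>x. 0 < fst x) (pfil z K)" .
 show s: "filterlim snd (within_nhds z K) (pfil z K)" unfolding pfil_def by (rule filterlim_snd)
 show "eventually P (within_nhds z K) \<Longrightarrow> eventually (\<lambda>x. P (snd x)) (pfil z K)"
  by (rule eventually_compose_filterlim[OF _ s])
qed

lemma continuous_map_eventually:
 assumes "cont_on K X f" "z \<in> K" "openin X U" "f z \<in> U"
 shows "eventually (\<lambda>x. f x \<in> U) (within_nhds z K)"
proof -
 have "openin (top_of_set K) {x \<in> K. f x \<in> U}" using open_preim[OF assms(1,3)] by simp
 then obtain G where G: "open G" "{x \<in> K. f x \<in> U} = K \<inter> G" by (auto simp: openin_open)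
 then have "eventually (\<lambda>x. x \<in> G) (nhds z)" using assms by (intro eventually_nhds_in_open) auto
 then show ?thesis unfolding eventually_inf_principal by eventually_elim (use G in auto)
qed

lemma continuous_map_tendsto:
 fixes h :: "'z::metric_space \<Rightarrow> 'f::metric_space"
 assumes "openin (top_of_set K) Q" "z \<in> Q" "continuous_map (subtopology (top_of_set K) Q) euclidean h"
 shows "(h \<longlongrightarrow> h z) (within_nhds z K)"
proof -
 obtain G where G: "open G" "Q = K \<inter> G" using assms(1) by (auto simp: openin_open)
 have "continuous_on (K \<inter> G) h" using assms(3) G by (simp add: subtopology_subtopology)
 then have "(h \<longlongrightarrow> h z) (at z within (K \<inter> G))" using assms(2) G by (auto simp: continuous_on)
 then have "(h \<longlongrightarrow> h z) (within_nhds z (K \<inter> G))"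
  unfolding tendsto_iff eventually_inf_principal eventually_at_filter by (auto elim!: eventually_mono)
 moreover have "eventually (\<lambda>x. x \<in> G) (nhds z)" using assms(2) G by (intro eventually_nhds_in_open) auto
 ultimately show ?thesis unfolding tendsto_iff eventually_inf_principal
 proof (intro allI impI)
  fix e :: real assume "\<forall>e>0. \<forall>\<^sub>F x in nhds z. x \<in> K \<inter> G \<longrightarrow> dist (h x) (h z) < e" "e > 0"
  then have "\<forall>\<^sub>F x in nhds z. x \<in> K \<inter> G \<longrightarrow> dist (h x) (h z) < e" by blast
  then show "\<forall>\<^sub>F x in nhds z. x \<in> K \<longrightarrow> dist (h x) (h z) < e"
   using \<open>eventually (\<lambda>x. x \<in> G) (nhds z)\<close> by eventually_elim auto
 qed
qed

context smooth_mfd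
begin

text \<open>Difference quotients between two moving points transform by the derivative; this is where strict
 differentiability enters.\<close>

lemma strict_tendsto:
 assumes c: "c \<in> A" "d \<in> A" "p \<in> chart_dom c" "p \<in> chart_dom d"
  and y: "(y \<longlongrightarrow> snd c p) F" "(y' \<longlongrightarrow> snd c p) F" and e: "eventually (\<lambda>x. e x > 0) F"
  and w: "((\<lambda>x. (y' x - y x) /\<^sub>R e x) \<longlongrightarrow> w) F"
 shows "((\<lambda>x. (transition c d (y' x) - transition c d (y x)) /\<^sub>R e x) \<longlongrightarrow> DT c d p w) F"
proof -
 let ?T = "transition c d" and ?D = "DT c d p"
 have lin: "linear ?D" by (rule DT_linear[OF c])
 have bl: "bounded_linear ?D" using lin by (simp add: linear_linear)
 have 1: "((\<lambda>x. ?D ((y' x - y x) /\<^sub>R e x)) \<longlongrightarrow> ?D w) F" by (rule bounded_linear.tendsto[OF bl w])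
 have 2: "((\<lambda>x. (?T (y' x) - ?T (y x) - ?D (y' x - y x)) /\<^sub>R e x) \<longlongrightarrow> 0) F"
 proof (rule tendstoI)
  fix eta :: real assume eta: "eta > 0"
  have wp: "norm w + 1 > 0" using norm_ge_zero[of w] by linarith
  then have "eta / (norm w + 1) / 2 > 0" using eta by simp
  from transition_strict[OF c this] obtain dlt where dlt: "dlt > 0"
   "\<forall>x\<in>ball (snd c p) dlt. \<forall>y\<in>ball (snd c p) dlt. norm (?T y - ?T x - ?D (y - x)) \<le> eta / (norm w + 1) / 2 * norm (y - x)" by blast
  have "eventually (\<lambda>x. norm ((y' x - y x) /\<^sub>R e x) < norm w + 1) F"
   using order_tendstoD(2)[OF tendsto_norm[OF w], of "norm w + 1"] by simp
  moreover have "eventually (\<lambda>x. y x \<in> ball (snd c p) dlt) F" "eventually (\<lambda>x. y' x \<in> ball (snd c p) dlt) F"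
   using tendstoD[OF y(1) dlt(1)] tendstoD[OF y(2) dlt(1)] by (simp_all add: dist_commute)
  ultimately show "eventually (\<lambda>x. dist ((?T (y' x) - ?T (y x) - ?D (y' x - y x)) /\<^sub>R e x) 0 < eta) F" using e
  proof eventually_elim
   fix x assume x: "norm ((y' x - y x) /\<^sub>R e x) < norm w + 1" "y x \<in> ball (snd c p) dlt" "y' x \<in> ball (snd c p) dlt" "e x > 0"
   have "norm ((?T (y' x) - ?T (y x) - ?D (y' x - y x)) /\<^sub>R e x) = norm (?T (y' x) - ?T (y x) - ?D (y' x - y x)) / e x"
    using x(4) by (simp add: divide_inverse mult.commute)
   also have "\<dots> \<le> eta / (norm w + 1) / 2 * norm (y' x - y x) / e x" using dlt(2) x by (intro divide_right_mono) auto
   also have "\<dots> = eta / (norm w + 1) / 2 * norm ((y' x - y x) /\<^sub>R e x)"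
   proof -
    have "norm ((y' x - y x) /\<^sub>R e x) = norm (y' x - y x) / e x"
     using x(4) by (simp only: norm_scaleR abs_inverse abs_of_pos divide_inverse mult.commute)
    then show ?thesis by simp
   qed
   also have "\<dots> \<le> eta / (norm w + 1) / 2 * (norm w + 1)" using x(1) eta wp by (intro mult_left_mono) auto
   also have "\<dots> = eta / 2" using wp by (simp add: divide_simps)
   also have "\<dots> < eta" using eta by simp
   finally show "dist ((?T (y' x) - ?T (y x) - ?D (y' x - y x)) /\<^sub>R e x) 0 < eta" by simp
  qed
 qed
 have aux: "(a - ?D u) /\<^sub>R s + ?D (u /\<^sub>R s) = a /\<^sub>R s" for a u s by (simp add: linear_cmul[OF lin] scaleR_diff_right)
 from tendsto_add[OF 2 1] show ?thesis unfolding aux by simp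
qed

lemma chart_tendsto:
 assumes f: "cont_on K X f" "z \<in> K" "c \<in> A" "f z \<in> chart_dom c"
 shows "((\<lambda>x. snd c (f x)) \<longlongrightarrow> snd c (f z)) (within_nhds z K)"
proof (rule continuous_map_tendsto)
 let ?Q = "{x \<in> K. f x \<in> chart_dom c}"
 show "openin (top_of_set K) ?Q" using open_preim[OF f(1) chart_open[OF f(3)]] by simp
 show "z \<in> ?Q" using f by auto
 have "continuous_map (subtopology (top_of_set K) ?Q) (subtopology X (chart_dom c)) f"
  using f(1) by (auto simp: into_sub intro: cmap_restrict)
 from cmap_comp[OF this chart_cont[OF f(3)]]
 show "continuous_map (subtopology (top_of_set K) ?Q) euclidean (\<lambda>x. snd c (f x))" by (simp add: o_def)
qed

end

context riem_mfd
begin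

lemma ST_coord_tendsto:
 assumes V: "cont_on K ST V" "z \<in> K" "c \<in> A" "fst (V z) \<in> chart_dom c"
 shows "((\<lambda>x. snd (V x) c) \<longlongrightarrow> snd (V z) c) (within_nhds z K)"
proof (rule continuous_map_tendsto)
 let ?Q = "{x \<in> K. fst (V x) \<in> chart_dom c}"
 have "cont_on K X (\<lambda>x. fst (V x))" using cmap_comp[OF V(1) ST_fst_continuous] by (simp add: o_def)
 from open_preim[OF this chart_open[OF V(3)]] show "openin (top_of_set K) ?Q" by simp
 show "z \<in> ?Q" using V by auto
 show "continuous_map (subtopology (top_of_set K) ?Q) euclidean (\<lambda>x. snd (V x) c)"
  by (rule continuous_map_ST_coord[OF V(3)]) (use V(1) in \<open>auto intro: cmap_restrict\<close>)
qed

abbreviation slope :: "('a, 'e) chart \<Rightarrow> (real \<times> 'z \<Rightarrow> 'a) \<Rightarrow> ('z \<Rightarrow> 'a \<times> (('a, 'e) chart \<Rightarrow> 'e)) \<Rightarrow> real \<times> 'z \<Rightarrow> 'e" where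
 "slope c P V x \<equiv> (snd c (P x) - snd c (fst (V (snd x)))) /\<^sub>R fst x"

text \<open>The homotopy \<open>P\<close> starts at the base points of \<open>V\<close> with velocity \<open>Phi z\<close> times \<open>V z\<close> in every chart, uniformly
 near each \<open>z\<close>.\<close>

definition pushes ::
 "'z::metric_space set \<Rightarrow> ('z \<Rightarrow> 'a \<times> (('a, 'e) chart \<Rightarrow> 'e)) \<Rightarrow> real \<Rightarrow> (real \<times> 'z \<Rightarrow> 'a) \<Rightarrow> ('z \<Rightarrow> real) \<Rightarrow> bool" where
 "pushes K V e P Phi \<longleftrightarrow> e > 0 \<and> cont_on ({0..e} \<times> K) X P \<and>
   (\<forall>z\<in>K. P (0, z) = fst (V z)) \<and>
   (\<forall>z\<in>K. \<forall>c\<in>A. fst (V z) \<in> chart_dom c \<longrightarrow>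
    eventually (\<lambda>x. P x \<in> chart_dom c) (pfil z K) \<and>
    ((\<lambda>x. slope c P V x) \<longlongrightarrow> Phi z *\<^sub>R snd (V z) c) (pfil z K))"

lemma pushes_chart:
 assumes P: "pushes K V e P Phi" and V: "cont_on K ST V"
  and z: "z \<in> K" "c \<in> A" "fst (V z) \<in> chart_dom c"
 shows "((\<lambda>x. snd c (P x)) \<longlongrightarrow> snd c (fst (V z))) (pfil z K)"
proof -
 have f: "cont_on K X (\<lambda>x. fst (V x))" using cmap_comp[OF V ST_fst_continuous] by (simp add: o_def)
 have 1: "((\<lambda>x. snd c (fst (V (snd x)))) \<longlongrightarrow> snd c (fst (V z))) (pfil z K)"
  by (rule filterlim_compose[OF chart_tendsto[OF f z] push_filter_snd])
 have L: "((\<lambda>x. slope c P V x) \<longlongrightarrow> Phi z *\<^sub>R snd (V z) c) (pfil z K)" using P z unfolding pushes_def by blast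
 have "((\<lambda>x. fst x *\<^sub>R (slope c P V x)) \<longlongrightarrow> 0 *\<^sub>R (Phi z *\<^sub>R snd (V z) c)) (pfil z K)"
  by (rule tendsto_scaleR[OF push_filter_fst(1) L])
 from tendsto_add[OF this 1]
 have "((\<lambda>x. fst x *\<^sub>R (slope c P V x) + snd c (fst (V (snd x)))) \<longlongrightarrow> snd c (fst (V z))) (pfil z K)"
  by (simp only: scaleR_zero_left add_0)
 then show ?thesis by (rule Lim_transform_eventually) (rule eventually_mono[OF push_filter_fst(2)], simp)
qed

text \<open>Follow \<open>P\<close> by a motion in the chart \<open>a\<close> with velocity \<open>psi z\<close> times \<open>V z\<close>, where the bump function \<open>psi\<close> is
 supported in the part of \<open>K\<close> that the chart covers. Velocities add up.\<close>

lemma pushes_step: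
 fixes K :: "'z::metric_space set"
 assumes P: "pushes K V e P Phi" and V: "cont_on K ST V" and K: "compact K"
  and a: "a \<in> A" "rho > 0" "\<And>z. z \<in> K \<Longrightarrow> z \<in> cball q rho \<Longrightarrow> fst (V z) \<in> chart_dom a"
 defines "psi \<equiv> \<lambda>z. max 0 (1 - dist z q / rho)"
 shows "\<exists>e' P'. pushes K V e' P' (\<lambda>z. Phi z + psi z)"
proof -
 have e: "e > 0" and Pc: "cont_on ({0..e} \<times> K) X P" and P0: "\<And>z. z \<in> K \<Longrightarrow> P (0, z) = fst (V z)"
  using P by (auto simp: pushes_def)
 have psic: "continuous_on S psi" for S unfolding psi_def using a(2) by (intro continuous_intros) auto
 have psi0: "psi z = 0" if "rho \<le> dist z q" for z using that a(2) by (simp add: psi_def)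
 define C where "C = K \<inter> cball q rho"
 have C: "compact C" unfolding C_def using K by (simp add: compact_Int_closed)
 define y where "y x = snd a (P x) + (fst x * psi (snd x)) *\<^sub>R snd (V (snd x)) a" for x
 let ?W1 = "{x \<in> {0..e} \<times> C. P x \<in> chart_dom a}"
 have PC: "cont_on ({0..e} \<times> C) X P" by (rule cmap_mono[OF Pc]) (auto simp: C_def)
 have W1: "openin (top_of_set ({0..e} \<times> C)) ?W1" using open_preim[OF PC chart_open[OF a(1)]] by simp
 have VC: "cont_on C euclidean (\<lambda>z. snd (V z) a)"
  by (rule continuous_map_ST_coord[OF a(1) cmap_mono[OF V]]) (use a(3) in \<open>auto simp: C_def\<close>)
 have yc: "continuous_on S y" if S: "S \<subseteq> ?W1" for S
 proof -
  have "cont_on S (subtopology X (chart_dom a)) P" using cmap_mono[OF PC, of S] S by (auto simp: into_sub)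
  from cmap_comp[OF this chart_cont[OF a(1)]] have "continuous_on S (\<lambda>x. snd a (P x))" by (simp add: o_def)
  moreover have "continuous_on S (\<lambda>x. snd (V (snd x)) a)"
  proof -
   have cV: "continuous_on C (\<lambda>z. snd (V z) a)" using VC by simp
   show ?thesis by (rule continuous_on_compose2[OF cV continuous_on_snd[OF continuous_on_id]]) (use S in auto)
  qed
  moreover have "continuous_on S (\<lambda>x. psi (snd x))"
   by (rule continuous_on_compose2[OF psic[of UNIV]]) (auto intro!: continuous_intros)
  ultimately show ?thesis unfolding y_def by (intro continuous_intros)
 qed
 let ?W = "{x \<in> ?W1. y x \<in> snd a ` chart_dom a}"
 have "openin (top_of_set ?W1) (?W1 \<inter> y -` (snd a ` chart_dom a))"
  by (rule continuous_openin_preimage_gen[OF yc[OF order_refl] chart_image_open[OF a(1)]])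
 moreover have "?W1 \<inter> y -` (snd a ` chart_dom a) = ?W" by auto
 ultimately have "openin (top_of_set ?W1) ?W" by simp
 then have W: "openin (top_of_set ({0..e} \<times> C)) ?W" by (rule openin_trans[OF _ W1])
 have "(0, z) \<in> ?W" if "z \<in> C" for z using that a P0 e by (auto simp: C_def y_def)
 then obtain e' where e': "0 < e'" "e' \<le> e" "{0..e'} \<times> C \<subseteq> ?W" using tube_lemma_interval[OF C W e] by blast
 define P' where "P' x = (if snd x \<in> cball q rho then chart_inv a (y x) else P x)" for x
 have P'y: "P' x = chart_inv a (y x)" if "P x \<in> chart_dom a" for x
  using that psi0[of "snd x"] chart_inv_chart[OF a(1)] by (auto simp: P'_def y_def dist_commute)
 have c1: "cont_on ({0..e'} \<times> C) X P'"
 proof (rule continuous_map_eq)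
  have "cont_on ({0..e'} \<times> C) (top_of_set (snd a ` chart_dom a)) y" using yc[of "{0..e'} \<times> C"] e'(3) by auto
  from cmap_comp[OF this chart_inv_continuous[OF a(1)]]
  show "cont_on ({0..e'} \<times> C) X (\<lambda>x. chart_inv a (y x))" by (simp add: o_def)
 qed (auto simp: P'_def C_def)
 let ?O = "{x \<in> {0..e'} \<times> K. rho \<le> dist (snd x) q}"
 have c2: "cont_on ?O X P'"
 proof (rule continuous_map_eq)
  show "cont_on ?O X P" by (rule cmap_mono[OF Pc]) (use e'(2) in auto)
  show "P x = P' x" if "x \<in> topspace (top_of_set ?O)" for x
  proof (cases "snd x \<in> cball q rho")
   case True
   then have "x \<in> {0..e'} \<times> C" using that by (cases x) (auto simp: C_def)
   then have "x \<in> ?W" using e'(3) by blast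
   then show ?thesis using P'y[of x] psi0[of "snd x"] that chart_inv_chart[OF a(1)] by (simp add: y_def)
  qed (simp add: P'_def)
 qed
 have "cont_on ({0..e'} \<times> K) X P'"
 proof (rule cmap_paste)
  show "closedin (top_of_set ({0..e'} \<times> K)) {x \<in> {0..e'} \<times> K. dist (snd x) q \<le> rho}"
   by (intro closedin_le_preimage continuous_intros)
  show "closedin (top_of_set ({0..e'} \<times> K)) ?O" by (intro closedin_le_preimage continuous_intros)
  have "{x \<in> {0..e'} \<times> K. dist (snd x) q \<le> rho} = {0..e'} \<times> C" by (auto simp: C_def dist_commute)
  then show "continuous_map (subtopology (top_of_set ({0..e'} \<times> K)) {x \<in> {0..e'} \<times> K. dist (snd x) q \<le> rho}) X P'"
   using c1 by (simp add: subtopology_subtopology C_def Times_Int_Times inf.absorb2)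
  show "continuous_map (subtopology (top_of_set ({0..e'} \<times> K)) ?O) X P'"
   using c2 by (simp add: subtopology_subtopology inf.absorb2 Collect_conj_eq)
 qed auto
 moreover have "P' (0, z) = fst (V z)" if "z \<in> K" for z
  using a(3)[OF that] P0[OF that] chart_inv_chart[OF a(1)] by (auto simp: P'_def y_def)
 moreover have "eventually (\<lambda>x. P' x \<in> chart_dom c) (pfil z K) \<and>
   ((\<lambda>x. slope c P' V x) \<longlongrightarrow> (Phi z + psi z) *\<^sub>R snd (V z) c) (pfil z K)"
  if z: "z \<in> K" "c \<in> A" "fst (V z) \<in> chart_dom c" for z c
 proof -
  have Pz: "eventually (\<lambda>x. P x \<in> chart_dom c) (pfil z K)"
   "((\<lambda>x. slope c P V x) \<longlongrightarrow> Phi z *\<^sub>R snd (V z) c) (pfil z K)" using P z unfolding pushes_def by blast+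
  show ?thesis
  proof (cases "dist z q \<le> rho")
   case False
   then have "eventually (\<lambda>x. x \<in> - cball q rho) (nhds z)"
    by (intro eventually_nhds_in_open) (auto simp: dist_commute)
   then have "eventually (\<lambda>x. x \<in> - cball q rho) (within_nhds z K)"
    unfolding eventually_inf_principal by (auto elim: eventually_mono)
   then have ev: "eventually (\<lambda>x. P x = P' x) (pfil z K)"
    by (auto dest!: eventually_push_snd simp: P'_def elim: eventually_mono)
   have "eventually (\<lambda>x. P' x \<in> chart_dom c) (pfil z K)" using Pz(1) ev by eventually_elim simp
   moreover have "((\<lambda>x. slope c P' V x) \<longlongrightarrow> Phi z *\<^sub>R snd (V z) c) (pfil z K)"
    by (rule Lim_transform_eventually[OF Pz(2)]) (use ev in \<open>auto elim: eventually_mono\<close>)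
   ultimately show ?thesis using False psi0[of z] by simp
  next
   case True
   then have za: "fst (V z) \<in> chart_dom a" using a(3)[OF z(1)] by (simp add: dist_commute)
   have Pa: "eventually (\<lambda>x. P x \<in> chart_dom a) (pfil z K)" using P z(1) a(1) za unfolding pushes_def by blast
   have Va: "((\<lambda>x. snd (V (snd x)) a) \<longlongrightarrow> snd (V z) a) (pfil z K)"
    by (rule filterlim_compose[OF ST_coord_tendsto[OF V z(1) a(1) za] push_filter_snd])
   have "(psi \<longlongrightarrow> psi z) (within_nhds z K)"
    using continuous_map_tendsto[of K K z psi] z(1) psic by (simp add: subtopology_subtopology)
   then have psiz: "((\<lambda>x. psi (snd x)) \<longlongrightarrow> psi z) (pfil z K)" by (rule filterlim_compose[OF _ push_filter_snd])
   have Pya: "((\<lambda>x. snd a (P x)) \<longlongrightarrow> snd a (fst (V z))) (pfil z K)" by (rule pushes_chart[OF P V z(1) a(1) za])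
   have "((\<lambda>x. snd a (P x) + (fst x * psi (snd x)) *\<^sub>R snd (V (snd x)) a) \<longlongrightarrow> snd a (fst (V z)) + (0 * psi z) *\<^sub>R snd (V z) a) (pfil z K)"
    by (intro tendsto_intros Pya push_filter_fst psiz Va)
   then have yz: "(y \<longlongrightarrow> snd a (fst (V z))) (pfil z K)" by (simp add: y_def[abs_def])
   have "((\<lambda>x. psi (snd x) *\<^sub>R snd (V (snd x)) a) \<longlongrightarrow> psi z *\<^sub>R snd (V z) a) (pfil z K)"
    by (intro tendsto_intros psiz Va)
   then have "((\<lambda>x. (y x - snd a (P x)) /\<^sub>R fst x) \<longlongrightarrow> psi z *\<^sub>R snd (V z) a) (pfil z K)"
    by (rule Lim_transform_eventually) (rule eventually_mono[OF push_filter_fst(2)], simp add: y_def)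
   from strict_tendsto[OF a(1) z(2) za z(3) Pya yz push_filter_fst(2) this]
   have 1: "((\<lambda>x. (transition a c (y x) - transition a c (snd a (P x))) /\<^sub>R fst x) \<longlongrightarrow> DT a c (fst (V z)) (psi z *\<^sub>R snd (V z) a)) (pfil z K)" .
   have zV: "snd (V z) \<in> tangent_space A (fst (V z))" using V z(1) by (force simp: continuous_map_def topspace_ST)
   have D: "DT a c (fst (V z)) (psi z *\<^sub>R snd (V z) a) = psi z *\<^sub>R snd (V z) c"
    using linear_cmul[OF DT_linear[OF a(1) z(2) za z(3)]] tangent_eq[OF zV a(1) z(2) za z(3)] by simp
   have yi: "eventually (\<lambda>x. y x \<in> snd a ` (chart_dom a \<inter> chart_dom c)) (pfil z K)"
    using yz za z(3) transition_C1(2)[OF a(1) z(2)] by (auto simp: tendsto_def)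
   have ev: "eventually (\<lambda>x. P' x \<in> chart_dom c \<and> snd c (P' x) = transition a c (y x) \<and> snd c (P x) = transition a c (snd a (P x))) (pfil z K)"
    using yi Pa
   proof eventually_elim
    case (elim x)
    then obtain p where p: "p \<in> chart_dom a" "p \<in> chart_dom c" "y x = snd a p" by auto
    then have "P' x = p" using P'y[of x] elim(2) chart_inv_chart[OF a(1)] by simp
    then show ?case using p transition_chart[OF a(1)] elim(2) by simp
   qed
   have "((\<lambda>x. (transition a c (y x) - transition a c (snd a (P x))) /\<^sub>R fst x + slope c P V x)
     \<longlongrightarrow> psi z *\<^sub>R snd (V z) c + Phi z *\<^sub>R snd (V z) c) (pfil z K)" using tendsto_add[OF 1 Pz(2)] D by simp
   then have "((\<lambda>x. slope c P' V x) \<longlongrightarrow> psi z *\<^sub>R snd (V z) c + Phi z *\<^sub>R snd (V z) c) (pfil z K)"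
    by (rule Lim_transform_eventually) (use ev in \<open>auto elim!: eventually_mono simp: algebra_simps\<close>)
   moreover have "eventually (\<lambda>x. P' x \<in> chart_dom c) (pfil z K)" using ev by eventually_elim simp
   ultimately show ?thesis by (simp add: scaleR_add_left add.commute)
  qed
 qed
 ultimately show ?thesis using e'(1) unfolding pushes_def by blast
qed

end

lemma push_filter_uniform:
 fixes K :: "'z::metric_space set"
 assumes K: "compact K" and Q: "\<And>z. z \<in> K \<Longrightarrow> eventually Q (pfil z K)"
 shows "\<exists>dlt>0. \<forall>eps x. 0 < eps \<longrightarrow> eps < dlt \<longrightarrow> x \<in> K \<longrightarrow> Q (eps, x)"
proof -
 have "\<forall>z\<in>K. \<exists>dlt>0. \<forall>eps x. 0 < eps \<longrightarrow> eps < dlt \<longrightarrow> x \<in> K \<longrightarrow> dist x z < dlt \<longrightarrow> Q (eps, x)"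
  using eventually_push_filter[OF Q] by blast
 then obtain dlt where dlt: "\<forall>z\<in>K. dlt z > 0 \<and> (\<forall>eps x. 0 < eps \<longrightarrow> eps < dlt z \<longrightarrow> x \<in> K \<longrightarrow> dist x z < dlt z \<longrightarrow> Q (eps, x))"
  by metis
 obtain F where F: "F \<subseteq> K" "finite F" "K \<subseteq> (\<Union>z\<in>F. ball z (dlt z))"
  by (rule compactE_image[OF K, of K "\<lambda>z. ball z (dlt z)"]) (use dlt in auto)
 define m where "m = Min (insert 1 (dlt ` F))"
 have "m > 0" unfolding m_def using F dlt by (subst Min_gr_iff) auto
 moreover have "Q (eps, x)" if "0 < eps" "eps < m" "x \<in> K" for eps x
 proof -
  obtain z where z: "z \<in> F" "x \<in> ball z (dlt z)" using F(3) \<open>x \<in> K\<close> by blast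
  have "m \<le> dlt z" unfolding m_def using F(2) z(1) by (intro Min_le) auto
  moreover have "dist x z < dlt z" using z(2) by (simp add: dist_commute)
  ultimately show ?thesis using dlt F(1) z(1) that by auto
 qed
 ultimately show ?thesis by blast
qed

context riem_mfd
begin

lemma finite_chart_cover:
 fixes K :: "'z::metric_space set"
 assumes K: "compact K" and f: "cont_on K X f"
 shows "\<exists>F a rho. finite F \<and> F \<subseteq> K \<and> K \<subseteq> (\<Union>q\<in>F. ball q (rho q)) \<and>
  (\<forall>q\<in>F. a q \<in> A \<and> rho q > 0 \<and> (\<forall>z\<in>K \<inter> cball q (rho q). f z \<in> chart_dom (a q)))"
proof -
 have "\<exists>a rho. a \<in> A \<and> rho > 0 \<and> (\<forall>z\<in>K \<inter> cball q rho. f z \<in> chart_dom a)" if q: "q \<in> K" for q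
 proof -
  have "f q \<in> topspace X" using f q by (auto simp: continuous_map_def)
  then obtain a where a: "a \<in> A" "f q \<in> chart_dom a" using chart_cover by blast
  from continuous_map_eventually[OF f q chart_open[OF a(1)] a(2)]
  obtain d where d: "d > 0" "\<And>x. dist x q < d \<Longrightarrow> x \<in> K \<Longrightarrow> f x \<in> chart_dom a"
   unfolding eventually_inf_principal eventually_nhds_metric by blast
  then show ?thesis using a(1) by (intro exI[of _ a] exI[of _ "d / 2"]) (auto simp: dist_commute)
 qed
 then obtain a rho where a: "\<forall>q\<in>K. a q \<in> A \<and> rho q > 0 \<and> (\<forall>z\<in>K \<inter> cball q (rho q). f z \<in> chart_dom (a q))" by metis
 obtain F where F: "F \<subseteq> K" "finite F" "K \<subseteq> (\<Union>q\<in>F. ball q (rho q))"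
  by (rule compactE_image[OF K, of K "\<lambda>q. ball q (rho q)"]) (use a in auto)
 show ?thesis using F a by (intro exI[of _ F] exI[of _ a] exI[of _ rho]) auto
qed

text \<open>Local motions in finitely many charts compose to a homotopy with positive velocity along \<open>V\<close>, so for small
 times it moves every point. In the chart \<open>c\<close> the points over \<open>b\<close> move into the half space that \<open>V\<close> points to, which
 identifies the boundary sphere later.\<close>

lemma push_exists:
 fixes K :: "'z::metric_space set"
 assumes K: "compact K" and V: "cont_on K ST V" and c: "c \<in> A" "b \<in> chart_dom c"
 shows "\<exists>(e::real) P. e > 0 \<and> cont_on ({0..e} \<times> K) X P \<and> (\<forall>z\<in>K. P (0, z) = fst (V z)) \<and>
  (\<forall>z\<in>K. \<forall>eps\<in>{0<..e}. P (eps, z) \<noteq> fst (V z)) \<and>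
  (\<forall>z\<in>K. fst (V z) = b \<longrightarrow> (\<forall>eps\<in>{0<..e}. P (eps, z) \<in> chart_dom c \<and>
    (snd c (P (eps, z)) - snd c b) \<bullet> snd (V z) c > 0))"
proof -
 have f: "cont_on K X (\<lambda>x. fst (V x))" using cmap_comp[OF V ST_fst_continuous] by (simp add: o_def)
 obtain F a rho where F: "finite F" "F \<subseteq> K" "K \<subseteq> (\<Union>q\<in>F. ball q (rho q))"
  and a: "\<forall>q\<in>F. a q \<in> A \<and> rho q > 0 \<and> (\<forall>z\<in>K \<inter> cball q (rho q). fst (V z) \<in> chart_dom (a q))"
  using finite_chart_cover[OF K f] by blast
 define psi where "psi q z = max 0 (1 - dist z q / rho q)" for q z :: 'z
 have "\<exists>e P. pushes K V e P (\<lambda>z. \<Sum>q\<in>F'. psi q z)" if "F' \<subseteq> F" for F' using finite_subset[OF that F(1)] that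
 proof (induction F' rule: finite_induct)
  case empty
  have "pushes K V 1 (\<lambda>x. fst (V (snd x))) (\<lambda>z. 0)" unfolding pushes_def
  proof (intro conjI ballI impI)
   show "cont_on ({0..1} \<times> K) X (\<lambda>x. fst (V (snd x)))"
    by (rule cmap_comp_on[OF _ _ f]) (auto intro!: continuous_intros)
   show "eventually (\<lambda>x. fst (V (snd x)) \<in> chart_dom c) (pfil z K)"
    if "z \<in> K" "c \<in> A" "fst (V z) \<in> chart_dom c" for z c
    by (rule eventually_push_snd[OF continuous_map_eventually[OF f that(1) chart_open[OF that(2)] that(3)]])
  qed auto
  then show ?case by auto
 next
  case (insert q F')
  then obtain e P where "pushes K V e P (\<lambda>z. \<Sum>q\<in>F'. psi q z)" by auto
  from pushes_step[OF this V K, of "a q" "rho q" q] a insert.prems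
  have "\<exists>e P. pushes K V e P (\<lambda>z. (\<Sum>q\<in>F'. psi q z) + psi q z)" by (auto simp: psi_def)
  moreover have "(\<lambda>z. (\<Sum>q\<in>F'. psi q z) + psi q z) = (\<lambda>z. \<Sum>q\<in>insert q F'. psi q z)"
   using insert.hyps by (simp add: add.commute)
  ultimately show ?case by simp
 qed
 from this[OF order_refl] obtain e P where P: "pushes K V e P (\<lambda>z. \<Sum>q\<in>F. psi q z)" by blast
 have Phi: "(\<Sum>q\<in>F. psi q z) > 0" if z: "z \<in> K" for z
 proof -
  obtain q where q: "q \<in> F" "z \<in> ball q (rho q)" using F(3) z by blast
  then have "psi q z > 0" using a by (auto simp: psi_def dist_commute)
  moreover have "psi q' z \<ge> 0" for q' by (simp add: psi_def)
  ultimately show ?thesis using F(1) q(1) by (intro sum_pos2[of F q])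
 qed
 \<comment> \<open>the difference quotients tend to a positive multiple of \<open>V z\<close>\<close>
 have pos: "eventually (\<lambda>x. P x \<in> chart_dom d \<and> fst (V (snd x)) \<in> chart_dom d \<and>
   (snd d (P x) - snd d (fst (V (snd x)))) \<bullet> snd (V (snd x)) d > 0) (pfil z K)"
  if z: "z \<in> K" "d \<in> A" "fst (V z) \<in> chart_dom d" for z d
 proof -
  have "V z \<in> topspace ST" using V z(1) by (auto simp: continuous_map_def)
  then have nz: "snd (V z) d \<noteq> 0" using ST_vec(3)[of "fst (V z)" "snd (V z)" d] z by simp
  have Vd: "((\<lambda>x. snd (V (snd x)) d) \<longlongrightarrow> snd (V z) d) (pfil z K)"
   by (rule filterlim_compose[OF ST_coord_tendsto[OF V z] push_filter_snd])
  have "((\<lambda>x. slope d P V x) \<longlongrightarrow> (\<Sum>q\<in>F. psi q z) *\<^sub>R snd (V z) d) (pfil z K)" using P z unfolding pushes_def by blast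
  from tendsto_inner[OF this Vd] have lim: "((\<lambda>x. (slope d P V x) \<bullet> snd (V (snd x)) d) \<longlongrightarrow>
   ((\<Sum>q\<in>F. psi q z) *\<^sub>R snd (V z) d) \<bullet> snd (V z) d) (pfil z K)" .
  have "((\<Sum>q\<in>F. psi q z) *\<^sub>R snd (V z) d) \<bullet> snd (V z) d > 0" using Phi[OF z(1)] nz by simp
  from order_tendstoD(1)[OF lim this] have "eventually (\<lambda>x. (slope d P V x) \<bullet> snd (V (snd x)) d > 0) (pfil z K)" .
  then have "eventually (\<lambda>x. (snd d (P x) - snd d (fst (V (snd x)))) \<bullet> snd (V (snd x)) d > 0) (pfil z K)"
   using push_filter_fst(2) by eventually_elim (simp add: zero_less_mult_iff)
  moreover have "eventually (\<lambda>x. P x \<in> chart_dom d) (pfil z K)" using P z unfolding pushes_def by blast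
  moreover have "eventually (\<lambda>x. fst (V (snd x)) \<in> chart_dom d) (pfil z K)"
   by (rule eventually_push_snd[OF continuous_map_eventually[OF f z(1) chart_open[OF z(2)] z(3)]])
  ultimately show ?thesis by eventually_elim simp
 qed
 have "eventually (\<lambda>x. P x \<noteq> fst (V (snd x)) \<and> (fst (V (snd x)) = b \<longrightarrow> P x \<in> chart_dom c \<and>
    (snd c (P x) - snd c b) \<bullet> snd (V (snd x)) c > 0)) (pfil z K)" if z: "z \<in> K" for z
 proof -
  have "fst (V z) \<in> topspace X" using f z by (auto simp: continuous_map_def)
  then obtain d where d: "d \<in> A" "fst (V z) \<in> chart_dom d" using chart_cover by blast
  have ne: "eventually (\<lambda>x. P x \<noteq> fst (V (snd x))) (pfil z K)" using pos[OF z d] by eventually_elim auto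
  show ?thesis
  proof (cases "fst (V z) = b")
   case True
   have "eventually (\<lambda>x. P x \<in> chart_dom c \<and> (snd c (P x) - snd c (fst (V (snd x)))) \<bullet> snd (V (snd x)) c > 0) (pfil z K)"
    using pos[OF z c(1)] c(2) True by (auto elim: eventually_mono)
   with ne show ?thesis by eventually_elim auto
  next
   case False
   have "openin X (topspace X - {b})" by (rule openin_punctured[OF Hausdorff])
   from continuous_map_eventually[OF f z this] False \<open>fst (V z) \<in> topspace X\<close>
   have "eventually (\<lambda>x. fst (V x) \<in> topspace X - {b}) (within_nhds z K)" by simp
   from eventually_push_snd[OF this] ne show ?thesis by eventually_elim auto
  qed
 qed
 from push_filter_uniform[OF K this] obtain dlt where dlt: "dlt > 0"
  "\<forall>eps x. 0 < eps \<longrightarrow> eps < dlt \<longrightarrow> x \<in> K \<longrightarrow> P (eps, x) \<noteq> fst (V x) \<and> (fst (V x) = b \<longrightarrow> P (eps, x) \<in> chart_dom c \<and>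
    (snd c (P (eps, x)) - snd c b) \<bullet> snd (V x) c > 0)" by auto
 define e' where "e' = min e (dlt / 2)"
 have P': "e > 0" "cont_on ({0..e} \<times> K) X P" "\<forall>z\<in>K. P (0, z) = fst (V z)" using P by (auto simp: pushes_def)
 have e': "0 < e'" "e' \<le> e" "e' < dlt" using P'(1) dlt(1) by (auto simp: e'_def)
 have Pe': "cont_on ({0..e'} \<times> K) X P" by (rule cmap_mono[OF P'(2)]) (use e'(2) in auto)
 have 1: "\<forall>z\<in>K. \<forall>eps\<in>{0<..e'}. P (eps, z) \<noteq> fst (V z)" using dlt(2) e' by auto
 have 2: "\<forall>z\<in>K. fst (V z) = b \<longrightarrow> (\<forall>eps\<in>{0<..e'}. P (eps, z) \<in> chart_dom c \<and>
    (snd c (P (eps, z)) - snd c b) \<bullet> snd (V z) c > 0)" using dlt(2) e' by auto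
 show ?thesis using e'(1) Pe' P'(3) 1 2 by blast
qed

lemma DT_tendsto:
 assumes c: "c \<in> A" "d \<in> A" "p \<in> chart_dom c" "p \<in> chart_dom d"
  and q: "eventually (\<lambda>x. q x \<in> chart_dom c \<inter> chart_dom d) F" "((\<lambda>x. snd c (q x)) \<longlongrightarrow> snd c p) F"
  and u: "(u \<longlongrightarrow> u0) F"
 shows "((\<lambda>x. DT c d (q x) (u x)) \<longlongrightarrow> DT c d p u0) F"
proof -
 let ?S = "snd c ` (chart_dom c \<inter> chart_dom d)"
 have "((\<lambda>x. (\<lambda>(x, u). frechet_derivative (transition c d) (at x) u) (snd c (q x), u x)) \<longlongrightarrow>
   (\<lambda>(x, u). frechet_derivative (transition c d) (at x) u) (snd c p, u0)) F"
  by (rule continuous_on_tendsto_compose[OF C1_derivative_continuous[OF transition_C1(1)[OF c(1,2)]]])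
   (use c(3,4) q u in \<open>auto intro!: tendsto_intros elim: eventually_mono\<close>)
 then show ?thesis by (simp add: DT_def)
qed

lemma unit_vec_indep:
 assumes v: "v \<in> tangent_space A p" and c: "c \<in> A" "p \<in> chart_dom c" and d: "d \<in> A" "p \<in> chart_dom d"
 shows "unit_vec c p (v c) = unit_vec d p (v d)"
proof -
 have "unit_vec c p (v c) = (\<lambda>e. v e /\<^sub>R sqrt (g p v v))" if "c \<in> A" "p \<in> chart_dom c" for c
  using coord_vec_tangent_eq[OF v that] coord_vec_linear(1)[OF that] by (simp add: unit_vec_def gsq_def)
 then show ?thesis using c d by simp
qed

text \<open>Average the coordinate differences of \<open>f z\<close> and \<open>f' z\<close> over finitely many charts with the weights \<open>psi\<close>, as
 tangent vectors at \<open>f z\<close>. For \<open>f' z\<close> close to \<open>f z\<close> the average \<open>wv\<close> does not vanish: otherwise there is a sequence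
 of bad pairs that converges to one point, and a subsequence whose directions converge in a chart; by strict
 differentiability all charts agree on the limit direction, so the averages tend to a positive multiple of it.\<close>

lemma direction_exists:
 fixes K :: "'z::metric_space set"
 assumes K: "compact K" and f: "cont_on K X f"
  and d: "Metric_space (topspace X) d" "Metric_space.mtopology (topspace X) d = X"
 shows "\<exists>eps>0. \<forall>f'. cont_on K X f' \<longrightarrow> (\<forall>z\<in>K. d (f z) (f' z) < eps \<and> f' z \<noteq> f z) \<longrightarrow>
  (\<exists>V. cont_on K ST V \<and> (\<forall>z\<in>K. fst (V z) = f z))"
proof -
 interpret d: Metric_space "topspace X" d by (rule d(1))
 have fX: "f z \<in> topspace X" if "z \<in> K" for z using f that by (auto simp: continuous_map_def)
 obtain F a rho where F: "finite F" "F \<subseteq> K" "K \<subseteq> (\<Union>q\<in>F. ball q (rho q))"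
  and a: "\<forall>q\<in>F. a q \<in> A \<and> rho q > 0 \<and> (\<forall>z\<in>K \<inter> cball q (rho q). f z \<in> chart_dom (a q))"
  using finite_chart_cover[OF K f] by blast
 define psi where "psi q z = max 0 (1 - dist z q / rho q)" for q z :: 'z
 have psi0: "psi q z = 0" if "q \<in> F" "rho q \<le> dist z q" for q z using a that by (auto simp: psi_def)
 have psic: "continuous_on S (psi q)" if "q \<in> F" for S q
  unfolding psi_def using a that by (intro continuous_intros) auto
 define wv where "wv z y = (\<lambda>e. \<Sum>q\<in>F. psi q z *\<^sub>R coord_vec A (a q) (f z) (snd (a q) y - snd (a q) (f z)) e)" for z y
 define good where "good z y \<longleftrightarrow> (\<forall>q\<in>F. z \<in> cball q (rho q) \<longrightarrow> y \<in> chart_dom (a q)) \<and> (\<forall>c\<in>A. f z \<in> chart_dom c \<longrightarrow> wv z y c \<noteq> 0)" for z y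
 have wvT: "wv z y \<in> tangent_space A (f z)" if z: "z \<in> K" for z y unfolding tangent_space_def mem_Collect_eq
 proof (intro conjI ballI impI allI)
  fix c e assume ce: "c \<in> A" "e \<in> A" "f z \<in> chart_dom c" "f z \<in> chart_dom e"
  have "psi q z *\<^sub>R coord_vec A (a q) (f z) u e = DT c e (f z) (psi q z *\<^sub>R coord_vec A (a q) (f z) u c)" if q: "q \<in> F" for q u
  proof (cases "z \<in> cball q (rho q)")
   case True
   then have "coord_vec A (a q) (f z) u \<in> tangent_space A (f z)" using coord_vec_tangent a q z by blast
   from tangent_eq[OF this ce] show ?thesis by (simp add: linear_cmul[OF DT_linear[OF ce]])
  next
   case False
   then show ?thesis using psi0[OF q, of z] by (simp add: dist_commute linear_0[OF DT_linear[OF ce]])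
  qed
  then show "wv z y e = frechet_derivative (transition c e) (at (snd c (f z))) (wv z y c)"
   unfolding wv_def DT_def[symmetric] by (simp add: linear_sum[OF DT_linear[OF ce]])
 next
  fix c assume "\<not> (c \<in> A \<and> f z \<in> chart_dom c)"
  then have "coord_vec A (a q) (f z) u c = 0" for q u by (auto simp: coord_vec_eq)
  then show "wv z y c = 0" by (simp add: wv_def)
 qed
 have "\<exists>eps>0. \<forall>z\<in>K. \<forall>y\<in>topspace X. d (f z) y < eps \<longrightarrow> y \<noteq> f z \<longrightarrow> good z y"
 proof (rule ccontr)
  assume "\<not> ?thesis"
  then have "\<forall>n. \<exists>z y. z \<in> K \<and> y \<in> topspace X \<and> d (f z) y < 1 / real (Suc n) \<and> y \<noteq> f z \<and> \<not> good z y"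
   by (metis of_nat_0_less_iff zero_less_Suc zero_less_divide_1_iff)
  then obtain z y where zy: "\<And>n. z n \<in> K" "\<And>n. y n \<in> topspace X" "\<And>n. d (f (z n)) (y n) < 1 / real (Suc n)"
   "\<And>n. y n \<noteq> f (z n)" "\<And>n. \<not> good (z n) (y n)" by metis
  obtain z0 r where z0: "z0 \<in> K" "strict_mono r" "(z \<circ> r) \<longlonglongrightarrow> z0" using K zy(1) unfolding compact_def by blast
  have zlim: "filterlim (\<lambda>n. z (r n)) (within_nhds z0 K) sequentially"
   using z0(3) zy(1) by (auto simp: filterlim_inf filterlim_principal o_def)
  obtain c where c: "c \<in> A" "f z0 \<in> chart_dom c" using chart_cover[OF fX[OF z0(1)]] by blast
  have fev: "eventually (\<lambda>n. f (z (r n)) \<in> U) sequentially" if "openin X U" "f z0 \<in> U" for U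
   by (rule eventually_compose_filterlim[OF continuous_map_eventually[OF f z0(1) that] zlim])
  have yev: "eventually (\<lambda>n. y (r n) \<in> U) sequentially" if U: "openin X U" "f z0 \<in> U" for U
  proof -
   have "openin d.mtopology U" using U(1) d(2) by simp
   then obtain s where s: "s > 0" "d.mball (f z0) s \<subseteq> U" using U(2) d.openin_mtopology by blast
   have "openin X (d.mball (f z0) (s / 2))" using d(2) d.openin_mball by metis
   from fev[OF this] s(1) fX[OF z0(1)] have e1: "eventually (\<lambda>n. f (z (r n)) \<in> d.mball (f z0) (s / 2)) sequentially" by simp
   have "(\<lambda>n. 1 / real (Suc (r n))) \<longlonglongrightarrow> 0"
    using LIMSEQ_subseq_LIMSEQ[OF lim_1_over_n[THEN LIMSEQ_Suc, where 'a1=real] z0(2)] by (simp add: o_def)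
   from order_tendstoD(2)[OF this, of "s / 2"] s(1) have e2: "eventually (\<lambda>n. 1 / real (Suc (r n)) < s / 2) sequentially" by simp
   show ?thesis using e1 e2
   proof eventually_elim
    case (elim n)
    have "d (f z0) (y (r n)) \<le> d (f z0) (f (z (r n))) + d (f (z (r n))) (y (r n))"
     using fX z0(1) zy(1,2) by (intro d.triangle) auto
    also have "\<dots> < s" using elim zy(3)[of "r n"] by auto
    finally show ?case using s(2) fX[OF z0(1)] zy(2) by auto
   qed
  qed
  have ychart: "(\<lambda>n. snd b (y (r n))) \<longlonglongrightarrow> snd b (f z0)" if b: "b \<in> A" "f z0 \<in> chart_dom b" for b unfolding tendsto_def
  proof (intro allI impI)
   fix S assume S: "open S" "snd b (f z0) \<in> S"
   have "openin (subtopology X (chart_dom b)) {x \<in> topspace (subtopology X (chart_dom b)). snd b x \<in> S}"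
    by (rule open_preim[OF chart_cont[OF b(1)]]) (use S in simp)
   then have "openin X {x \<in> chart_dom b. snd b x \<in> S}"
    unfolding topspace_dom[OF b(1)] using chart_open[OF b(1)] openin_trans_full by blast
   from yev[OF this] b(2) S(2) show "eventually (\<lambda>n. snd b (y (r n)) \<in> S) sequentially"
    by (auto elim: eventually_mono)
  qed
  have fchart: "(\<lambda>n. snd b (f (z (r n)))) \<longlonglongrightarrow> snd b (f z0)" if b: "b \<in> A" "f z0 \<in> chart_dom b" for b
   by (rule filterlim_compose[OF chart_tendsto[OF f z0(1) b] zlim])
  define h where "h n = norm (snd c (y (r n)) - snd c (f (z (r n))))" for n
  define u where "u n = (if h n = 0 then SOME w. norm w = 1 else (snd c (y (r n)) - snd c (f (z (r n)))) /\<^sub>R h n)" for n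
  have ex1: "\<exists>w::'e. norm w = 1" by (metis norm_Basis nonempty_Basis ex_in_conv)
  have "u n \<in> sphere 0 1" for n using someI_ex[OF ex1] by (auto simp: u_def h_def)
  then obtain u0 r' where u0: "u0 \<in> sphere 0 1" "strict_mono r'" "(u \<circ> r') \<longlonglongrightarrow> u0"
   using compact_sphere[of "0::'e" 1] unfolding compact_def by blast
  define F' where "F' = filtermap r' sequentially"
  have F'le: "F' \<le> sequentially" unfolding F'_def using filterlim_subseq[OF u0(2)] by (simp add: filterlim_def)
  have u0': "(u \<longlongrightarrow> u0) F'" using u0(3) unfolding F'_def by (simp add: filterlim_filtermap o_def)
  have F'ev: "eventually Q F'" if "eventually Q sequentially" for Q using that F'le by (rule filter_leD[rotated])
  have F'lim: "(s \<longlongrightarrow> l) F'" if "s \<longlonglongrightarrow> l" for s :: "nat \<Rightarrow> 'e" and l using that F'le by (rule tendsto_mono[rotated])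
  have hpos: "eventually (\<lambda>n. h n > 0) F'"
  proof -
   have "eventually (\<lambda>n. h n > 0) sequentially"
    using fev[OF chart_open[OF c(1)] c(2)] yev[OF chart_open[OF c(1)] c(2)]
   proof eventually_elim
    case (elim n)
    then have "snd c (y (r n)) \<noteq> snd c (f (z (r n)))" using chart_inj[OF c(1)] zy(4) by (meson inj_onD)
    then show ?case by (simp add: h_def)
   qed
   then show ?thesis by (rule F'ev)
  qed
  have ulim: "((\<lambda>n. (snd c (y (r n)) - snd c (f (z (r n)))) /\<^sub>R h n) \<longlongrightarrow> u0) F'"
   by (rule Lim_transform_eventually[OF u0']) (rule eventually_mono[OF hpos], simp add: u_def)
  have first: "eventually (\<lambda>n. \<forall>q\<in>F. z (r n) \<in> cball q (rho q) \<longrightarrow> y (r n) \<in> chart_dom (a q)) F'"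
  proof (rule eventually_ball_finite[OF F(1)], rule ballI)
   fix q assume q: "q \<in> F"
   show "eventually (\<lambda>n. z (r n) \<in> cball q (rho q) \<longrightarrow> y (r n) \<in> chart_dom (a q)) F'"
   proof (cases "z0 \<in> cball q (rho q)")
    case True
    then have "f z0 \<in> chart_dom (a q)" "a q \<in> A" using a q z0(1) by auto
    from F'ev[OF yev[OF chart_open[OF this(2)] this(1)]] show ?thesis by (auto elim: eventually_mono)
   next
    case False
    then have "eventually (\<lambda>x. x \<in> - cball q (rho q)) (nhds z0)" by (intro eventually_nhds_in_open) auto
    then have "eventually (\<lambda>x. x \<in> - cball q (rho q)) (within_nhds z0 K)"
     unfolding eventually_inf_principal by (auto elim: eventually_mono)
    from F'ev[OF eventually_compose_filterlim[OF this zlim]] show ?thesis by (auto elim: eventually_mono)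
   qed
  qed
  have term_lim: "((\<lambda>n. psi q (z (r n)) *\<^sub>R DT (a q) c (f (z (r n))) ((snd (a q) (y (r n)) - snd (a q) (f (z (r n)))) /\<^sub>R h n))
   \<longlongrightarrow> psi q z0 *\<^sub>R u0) F'" if q: "q \<in> F" for q
  proof -
   have aq: "a q \<in> A" using a q by auto
   have psiz: "((\<lambda>n. psi q (z (r n))) \<longlongrightarrow> psi q z0) F'"
   proof -
    have "(\<lambda>n. psi q (z (r n))) \<longlonglongrightarrow> psi q z0"
     by (rule continuous_on_tendsto_compose[OF psic[OF q, of UNIV] z0(3)[unfolded o_def]]) auto
    then show ?thesis using F'le by (rule tendsto_mono[rotated])
   qed
   show ?thesis
   proof (cases "z0 \<in> cball q (rho q)")
    case True
    then have z0a: "f z0 \<in> chart_dom (a q)" using a q z0(1) by auto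
    have "((\<lambda>n. (transition c (a q) (snd c (y (r n))) - transition c (a q) (snd c (f (z (r n))))) /\<^sub>R h n) \<longlongrightarrow> DT c (a q) (f z0) u0) F'"
     by (rule strict_tendsto[OF c(1) aq c(2) z0a F'lim[OF fchart[OF c]] F'lim[OF ychart[OF c]] hpos ulim])
    moreover have "eventually (\<lambda>n. y (r n) \<in> chart_dom c \<and> f (z (r n)) \<in> chart_dom c) F'"
     by (intro eventually_conj F'ev fev yev chart_open c)
    then have "eventually (\<lambda>n. (transition c (a q) (snd c (y (r n))) - transition c (a q) (snd c (f (z (r n))))) /\<^sub>R h n =
     (snd (a q) (y (r n)) - snd (a q) (f (z (r n)))) /\<^sub>R h n) F'"
     by eventually_elim (simp add: transition_chart[OF c(1)])
    ultimately have l: "((\<lambda>n. (snd (a q) (y (r n)) - snd (a q) (f (z (r n)))) /\<^sub>R h n) \<longlongrightarrow> DT c (a q) (f z0) u0) F'"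
     by (rule Lim_transform_eventually)
    have "eventually (\<lambda>n. f (z (r n)) \<in> chart_dom (a q) \<inter> chart_dom c) F'"
     by (intro F'ev fev openin_Int chart_open aq c) (use z0a c in auto)
    from DT_tendsto[OF aq c(1) z0a c(2) this F'lim[OF fchart[OF aq z0a]] l]
    show ?thesis using DT_inverse[OF c(1) aq c(2) z0a] psiz by (intro tendsto_scaleR) simp_all
   next
    case False
    then have "eventually (\<lambda>x. x \<in> - cball q (rho q)) (nhds z0)" by (intro eventually_nhds_in_open) auto
    then have "eventually (\<lambda>x. x \<in> - cball q (rho q)) (within_nhds z0 K)"
     unfolding eventually_inf_principal by (auto elim: eventually_mono)
    from F'ev[OF eventually_compose_filterlim[OF this zlim]]
    have "eventually (\<lambda>n. 0 = psi q (z (r n)) *\<^sub>R DT (a q) c (f (z (r n))) ((snd (a q) (y (r n)) - snd (a q) (f (z (r n)))) /\<^sub>R h n)) F'"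
     by eventually_elim (use psi0[OF q] in \<open>auto simp: dist_commute\<close>)
    moreover have "psi q z0 = 0" using False psi0[OF q, of z0] by (simp add: dist_commute)
    ultimately show ?thesis by (auto intro: Lim_transform_eventually[OF tendsto_const])
   qed
  qed
  have "((\<lambda>n. \<Sum>q\<in>F. psi q (z (r n)) *\<^sub>R DT (a q) c (f (z (r n))) ((snd (a q) (y (r n)) - snd (a q) (f (z (r n)))) /\<^sub>R h n))
   \<longlongrightarrow> (\<Sum>q\<in>F. psi q z0 *\<^sub>R u0)) F'" by (intro tendsto_sum term_lim)
  moreover have "(\<Sum>q\<in>F. psi q z0 *\<^sub>R u0) \<noteq> 0"
  proof -
   obtain q where q: "q \<in> F" "z0 \<in> ball q (rho q)" using F(3) z0(1) by blast
   then have "psi q z0 > 0" using a by (auto simp: psi_def dist_commute)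
   moreover have "psi q' z0 \<ge> 0" for q' by (simp add: psi_def)
   ultimately have "(\<Sum>q\<in>F. psi q z0) > 0" using F(1) q(1) by (intro sum_pos2[of F q])
   moreover have "u0 \<noteq> 0" using u0(1) by auto
   ultimately show ?thesis by (simp flip: scaleR_sum_left)
  qed
  ultimately have nz: "eventually (\<lambda>n. (\<Sum>q\<in>F. psi q (z (r n)) *\<^sub>R DT (a q) c (f (z (r n))) ((snd (a q) (y (r n)) - snd (a q) (f (z (r n)))) /\<^sub>R h n)) \<noteq> 0) F'"
   by (rule tendsto_imp_eventually_ne)
  have "eventually (\<lambda>n. good (z (r n)) (y (r n))) F'" using nz first F'ev[OF fev[OF chart_open[OF c(1)] c(2)]]
  proof eventually_elim
   case (elim n)
   let ?z = "z (r n)" and ?y = "y (r n)"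
   have "psi q ?z *\<^sub>R DT (a q) c (f ?z) ((snd (a q) ?y - snd (a q) (f ?z)) /\<^sub>R h n) =
    (psi q ?z *\<^sub>R coord_vec A (a q) (f ?z) (snd (a q) ?y - snd (a q) (f ?z)) c) /\<^sub>R h n" if q: "q \<in> F" for q
   proof (cases "?z \<in> cball q (rho q)")
    case True
    then have "linear (DT (a q) c (f ?z))" using a q zy(1) c elim by (intro DT_linear) auto
    then show ?thesis using c(1) elim(3) by (simp add: coord_vec_eq linear_cmul)
   next
    case False
    then show ?thesis using psi0[OF q, of ?z] by (simp add: dist_commute)
   qed
   then have "(\<Sum>q\<in>F. psi q ?z *\<^sub>R DT (a q) c (f ?z) ((snd (a q) ?y - snd (a q) (f ?z)) /\<^sub>R h n)) = wv ?z ?y c /\<^sub>R h n"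
    unfolding wv_def by (simp add: scaleR_sum_right)
   then have wc: "wv ?z ?y c \<noteq> 0" using elim(1) by auto
   have "wv ?z ?y e \<noteq> 0" if e: "e \<in> A" "f ?z \<in> chart_dom e" for e
    using tangent_eq[OF wvT[OF zy(1)] e(1) c(1) e(2) elim(3), of ?y] wc linear_0[OF DT_linear[OF e(1) c(1) e(2) elim(3)]] by auto
   then show ?case using elim(2) unfolding good_def by blast
  qed
  then have "eventually (\<lambda>n. False) F'" using zy(5) by (auto elim: eventually_mono)
  then show False unfolding F'_def eventually_filtermap by simp
 qed
 then obtain eps where eps: "eps > 0" "\<And>z y. z\<in>K \<Longrightarrow> y\<in>topspace X \<Longrightarrow> d (f z) y < eps \<Longrightarrow> y \<noteq> f z \<Longrightarrow> good z y" by blast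
 show ?thesis
 proof (intro exI[of _ eps] conjI eps(1) allI impI)
  fix f' assume f': "cont_on K X f'" and fd: "\<forall>z\<in>K. d (f z) (f' z) < eps \<and> f' z \<noteq> f z"
  have good: "good z (f' z)" if "z \<in> K" for z using eps(2)[OF that] fd f' that by (auto simp: continuous_map_def)
  define ch where "ch z = (SOME c. c \<in> A \<and> f z \<in> chart_dom c)" for z
  have ch: "ch z \<in> A \<and> f z \<in> chart_dom (ch z)" if "z \<in> K" for z
   unfolding ch_def by (rule someI_ex) (use chart_cover[OF fX[OF that]] in blast)
  define v where "v z = unit_vec (ch z) (f z) (wv z (f' z) (ch z))" for z
  have v: "v z = unit_vec c (f z) (wv z (f' z) c)" if "z \<in> K" "c \<in> A" "f z \<in> chart_dom c" for z c
   unfolding v_def using ch[OF that(1)] that by (intro unit_vec_indep wvT) auto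
  have "cont_on K ST (\<lambda>z. (f z, v z))"
  proof (rule continuous_map_ST[OF f])
   fix z0 assume "z0 \<in> topspace (top_of_set K)"
   then have z0: "z0 \<in> K" by simp
   show "(f z0, v z0) \<in> topspace ST"
    unfolding v_def using ch[OF z0] good[OF z0] unfolding good_def by (intro unit_vec_ST) auto
   obtain c where c: "c \<in> A" "f z0 \<in> chart_dom c" using chart_cover[OF fX[OF z0]] by blast
   let ?Q = "{z \<in> K. f z \<in> chart_dom c}"
   have Q: "openin (top_of_set K) ?Q" using open_preim[OF f chart_open[OF c(1)]] by simp
   have term_c: "cont_on ?Q euclidean (\<lambda>z. psi q z *\<^sub>R coord_vec A (a q) (f z) (snd (a q) (f' z) - snd (a q) (f z)) c)"
    if q: "q \<in> F" for q
   proof (rule cmap_paste)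
    have aq: "a q \<in> A" using a q by auto
    let ?B = "{z \<in> ?Q. dist z q \<le> rho q}" and ?C = "{z \<in> ?Q. rho q \<le> dist z q}"
    show "closedin (top_of_set ?Q) ?B" by (intro closedin_le_preimage continuous_intros)
    show "closedin (top_of_set ?Q) ?C" by (intro closedin_le_preimage continuous_intros)
    have dom: "f z \<in> chart_dom (a q)" "f' z \<in> chart_dom (a q)" if "z \<in> ?B" for z
     using that a q good[of z] by (auto simp: good_def dist_commute)
    have sf: "cont_on ?B euclidean (\<lambda>z. snd (a q) (k z))"
     if "cont_on K X k" "\<And>z. z \<in> ?B \<Longrightarrow> k z \<in> chart_dom (a q)" for k
    proof -
     have "cont_on ?B (subtopology X (chart_dom (a q))) k"
      using cmap_mono[OF that(1), of ?B] that(2) by (auto simp: into_sub)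
     from cmap_comp[OF this chart_cont[OF aq]] show ?thesis by (simp add: o_def)
    qed
    have "cont_on ?B euclidean (\<lambda>z. snd (a q) (f' z) - snd (a q) (f z))"
     using sf[OF f' dom(2)] sf[OF f dom(1)] by (simp add: continuous_on_diff)
    then have "cont_on ?B euclidean (\<lambda>z. DT (a q) c (f z) (snd (a q) (f' z) - snd (a q) (f z)))"
     by (intro DT_continuous[OF aq c(1) cmap_mono[OF f]]) (use dom in auto)
    then have "cont_on ?B euclidean (\<lambda>z. psi q z *\<^sub>R DT (a q) c (f z) (snd (a q) (f' z) - snd (a q) (f z)))"
     using psic[OF q] by (simp add: continuous_on_scaleR)
    then show "continuous_map (subtopology (top_of_set ?Q) ?B) euclidean (\<lambda>z. psi q z *\<^sub>R coord_vec A (a q) (f z) (snd (a q) (f' z) - snd (a q) (f z)) c)"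
     unfolding subtopology_subtopology using c(1) by (elim continuous_map_eq[OF cmap_mono]) (auto simp: coord_vec_eq)
    show "continuous_map (subtopology (top_of_set ?Q) ?C) euclidean (\<lambda>z. psi q z *\<^sub>R coord_vec A (a q) (f z) (snd (a q) (f' z) - snd (a q) (f z)) c)"
     by (rule continuous_map_eq[of _ _ "\<lambda>_. 0"]) (use psi0[OF q] in auto)
   qed auto
   have wc: "cont_on ?Q euclidean (\<lambda>z. wv z (f' z) c)"
    unfolding wv_def using term_c F(1) by (simp add: continuous_on_sum)
   have "cont_on ?Q ST (\<lambda>z. (f z, unit_vec c (f z) (wv z (f' z) c)))"
    by (rule unit_vec_continuous[OF cmap_mono[OF f] c(1) _ wc]) (use good c in \<open>auto simp: good_def\<close>)
   from continuous_map_ST_coord[OF c(1) this]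
   have "cont_on ?Q euclidean (\<lambda>z. unit_vec c (f z) (wv z (f' z) c) c)" by simp
   then have "cont_on ?Q euclidean (\<lambda>z. v z c)" by (rule continuous_map_eq) (use v c in auto)
   moreover have "subtopology (top_of_set K) ?Q = top_of_set ?Q" by (simp add: subtopology_subtopology Int_def)
   ultimately show "\<exists>Q c. openin (top_of_set K) Q \<and> z0 \<in> Q \<and> c \<in> A \<and> (\<forall>z'\<in>Q. f z' \<in> chart_dom c) \<and>
     continuous_map (subtopology (top_of_set K) Q) euclidean (\<lambda>z. v z c)"
    using Q z0 c by (intro exI[of _ ?Q] exI[of _ c]) auto
  qed
  then show "\<exists>V. cont_on K ST V \<and> (\<forall>z\<in>K. fst (V z) = f z)" by (intro exI[of _ "\<lambda>z. (f z, v z)"]) simp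
 qed
qed

end

section \<open>Metrizability\<close>

text \<open>Urysohn's embedding into the Banach space of bounded sequences.\<close>

lemma bounded_sequence_embedding:
 assumes R: "regular_space X" and S: "second_countable X" and H: "Hausdorff_space X"
 shows "\<exists>F :: 'a \<Rightarrow> (nat \<Rightarrow>\<^sub>C real). homeomorphic_map X (top_of_set (F ` topspace X)) F"
proof -
 obtain \<B> where B0: "countable \<B> \<and> (\<forall>V\<in>\<B>. openin X V) \<and>
   (\<forall>U x. openin X U \<and> x \<in> U \<longrightarrow> (\<exists>V\<in>\<B>. x \<in> V \<and> V \<subseteq> U))" using S unfolding second_countable_def by blast
 have B: "countable \<B>" "\<And>V. V \<in> \<B> \<Longrightarrow> openin X V"
  "\<And>U x. openin X U \<Longrightarrow> x \<in> U \<Longrightarrow> \<exists>V\<in>\<B>. x \<in> V \<and> V \<subseteq> U" using B0 by simp_all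
 have nb: "\<forall>W x. openin X W \<and> x \<in> W \<longrightarrow> (\<exists>U V. openin X U \<and> closedin X V \<and> x \<in> U \<and> U \<subseteq> V \<and> V \<subseteq> W)"
  using R unfolding neighbourhood_base_of_closedin[symmetric] neighbourhood_base_of .
 have N: "normal_space X" by (rule regular_Lindelof_imp_normal_space[OF R second_countable_imp_Lindelof_space[OF S]])
 define pairs where "pairs = insert ({}, topspace X) {(V, W). V \<in> \<B> \<and> W \<in> \<B> \<and> X closure_of V \<subseteq> W}"
 have cp: "countable pairs" "pairs \<noteq> {}"
 proof -
  have "countable (\<B> \<times> \<B>)" using B(1) by blast
  then show "countable pairs" unfolding pairs_def
   by (intro countable_insert countable_subset[OF _ \<open>countable (\<B> \<times> \<B>)\<close>]) auto
 qed (simp add: pairs_def)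
 define pr where "pr = from_nat_into pairs"
 have pr: "range pr = pairs" unfolding pr_def using cp by (simp add: range_from_nat_into)
 have "\<exists>f. continuous_map X (top_of_set {0..1::real}) f \<and> f ` (X closure_of fst (pr n)) \<subseteq> {0} \<and> f ` (topspace X - snd (pr n)) \<subseteq> {1}" for n
 proof -
  have "pr n \<in> pairs" using pr by blast
  then have "openin X (snd (pr n))" "X closure_of fst (pr n) \<subseteq> snd (pr n)" using B(2) by (auto simp: pairs_def)
  then have "closedin X (X closure_of fst (pr n))" "closedin X (topspace X - snd (pr n))"
   "disjnt (X closure_of fst (pr n)) (topspace X - snd (pr n))" by (auto simp: disjnt_def)
  from Urysohn_lemma[OF N this, of 0 1] show ?thesis by (metis zero_le_one)
 qed
 then obtain f where f: "\<And>n. continuous_map X (top_of_set {0..1::real}) (f n)"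
  "\<And>n. f n ` (X closure_of fst (pr n)) \<subseteq> {0}" "\<And>n. f n ` (topspace X - snd (pr n)) \<subseteq> {1}" by metis
 have f01: "f n x \<in> {0..1}" if "x \<in> topspace X" for n x using f(1)[of n] that by (auto simp: continuous_map_def)
 have fc: "continuous_map X euclidean (f n)" for n using f(1)[of n] by (simp add: into_sub)
 define F where "F x = Bcontfun (\<lambda>n. (if x \<in> topspace X then f n x else 0) / real (Suc n))" for x
 have F: "apply_bcontfun (F x) n = f n x / real (Suc n)" if x: "x \<in> topspace X" for x n
 proof -
  have "bounded (range (\<lambda>n. f n x / real (Suc n)))"
  proof (rule boundedI)
   fix y assume "y \<in> range (\<lambda>n. f n x / real (Suc n))"
   then obtain n where "y = f n x / real (Suc n)" by blast
   then show "norm y \<le> 1" using f01[OF x, of n] by (simp add: divide_le_eq)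
  qed
  then have "(\<lambda>n. f n x / real (Suc n)) \<in> bcontfun" by (auto simp: bcontfun_def)
  then show ?thesis using x by (simp add: F_def Bcontfun_inverse)
 qed
 have cont: "continuous_map X (top_of_set (F ` topspace X)) F"
 proof -
  have "continuous_map X Met_TC.mtopology F" unfolding Met_TC.continuous_map_to_metric
  proof (intro ballI allI impI)
   fix x and e :: real assume x: "x \<in> topspace X" and e: "e > 0"
   obtain N where N: "1 / real (Suc N) < e / 2" using e by (metis half_gt_zero nat_approx_posE)
   define U where "U = topspace X \<inter> (\<Inter>n\<in>{..N}. {y \<in> topspace X. f n y \<in> ball (f n x) (e / 2)})"
   have "openin X {y \<in> topspace X. f n y \<in> ball (f n x) (e / 2)}" for n by (rule open_preim[OF fc]) simp
   then have "openin X U" unfolding U_def by (intro openin_Int openin_topspace openin_INT2) auto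
   moreover have "x \<in> U" using x e by (simp add: U_def)
   moreover have "F y \<in> Met_TC.mball (F x) e" if y: "y \<in> U" for y
   proof -
    have yX: "y \<in> topspace X" using y by (simp add: U_def)
    have "dist (F x) (F y) \<le> e / 2"
    proof (rule dist_bound)
     fix n
     have eq: "dist (F x n) (F y n) = \<bar>f n x - f n y\<bar> / real (Suc n)"
      by (simp add: F x yX dist_real_def flip: diff_divide_distrib)
     show "dist (F x n) (F y n) \<le> e / 2"
     proof (cases "n \<le> N")
      case True
      then have "\<bar>f n x - f n y\<bar> < e / 2" using y by (auto simp: U_def dist_real_def)
      moreover have "\<bar>f n x - f n y\<bar> / real (Suc n) \<le> \<bar>f n x - f n y\<bar> / 1" by (intro divide_left_mono) auto
      ultimately show ?thesis unfolding eq by (metis div_by_1 less_eq_real_def order_trans)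
     next
      case False
      have "\<bar>f n x - f n y\<bar> \<le> 1" using f01[OF x, of n] f01[OF yX, of n] by auto
      then have "\<bar>f n x - f n y\<bar> / real (Suc n) \<le> 1 / real (Suc n)" by (intro divide_right_mono) auto
      also have "\<dots> \<le> 1 / real (Suc N)" using False by (intro divide_left_mono) auto
      finally show ?thesis using eq N by linarith
     qed
    qed
    then show ?thesis using e by simp
   qed
   ultimately show "\<exists>U. openin X U \<and> x \<in> U \<and> (\<forall>y\<in>U. F y \<in> Met_TC.mball (F x) e)" by blast
  qed
  then show ?thesis by (simp add: into_sub mtopology_is_euclidean)
 qed
 have key: "\<exists>dlt>0. \<forall>y\<in>topspace X. dist (F x) (F y) < dlt \<longrightarrow> y \<in> U" if U: "openin X U" "x \<in> U" for U x
 proof -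
  have x: "x \<in> topspace X" using U openin_subset by blast
  obtain W where W: "W \<in> \<B>" "x \<in> W" "W \<subseteq> U" using B0 U by meson
  obtain V' C where V': "openin X V'" "closedin X C" "x \<in> V'" "V' \<subseteq> C" "C \<subseteq> W" using nb B(2)[OF W(1)] W(2) by meson
  obtain V where V: "V \<in> \<B>" "x \<in> V" "V \<subseteq> V'" using B0 V'(1,3) by meson
  have "X closure_of V \<subseteq> C" by (rule closure_of_minimal) (use V(3) V'(2,4) in auto)
  then have "(V, W) \<in> pairs" using V W V' by (auto simp: pairs_def)
  then obtain n where n: "pr n = (V, W)" using pr by (metis rangeE)
  have fx: "f n x = 0" using f(2)[of n] n V(2) x closure_of_subset_Int[of X V] by fastforce
  have "y \<in> U" if y: "y \<in> topspace X" "dist (F x) (F y) < 1 / real (Suc n)" for y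
  proof (rule ccontr)
   assume "y \<notin> U"
   then have "f n y = 1" using f(3)[of n] n W(3) y(1) by auto
   then have "dist (F x n) (F y n) = 1 / real (Suc n)" by (simp add: F x y(1) fx dist_real_def)
   then show False using dist_bounded[of "F x" n "F y"] y(2) by simp
  qed
  then show ?thesis by (intro exI[of _ "1 / real (Suc n)"]) auto
 qed
 have inj: "inj_on F (topspace X)"
 proof (rule inj_onI, rule ccontr)
  fix x y assume xy: "x \<in> topspace X" "y \<in> topspace X" "F x = F y" "x \<noteq> y"
  have "openin X (topspace X - {y})" by (rule openin_punctured[OF H])
  from key[OF this, of x] xy show False by force
 qed
 have opn: "open_map X (top_of_set (F ` topspace X)) F" unfolding open_map_def
 proof (intro allI impI)
  fix U assume U: "openin X U"
  show "openin (top_of_set (F ` topspace X)) (F ` U)" unfolding openin_euclidean_subtopology_iff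
  proof (intro conjI ballI)
   show "F ` U \<subseteq> F ` topspace X" using openin_subset[OF U] by blast
   fix w assume "w \<in> F ` U"
   then obtain x where x: "w = F x" "x \<in> U" by blast
   then show "\<exists>e>0. \<forall>x'\<in>F ` topspace X. dist x' w < e \<longrightarrow> x' \<in> F ` U" using key[OF U x(2)] by (force simp: dist_commute)
  qed
 qed
 show ?thesis using cont inj opn by (intro exI[of _ F] bijective_open_imp_homeomorphic_map) auto
qed

context smooth_mfd
begin

lemma mfd_loc_euclid: "loc_euclid TYPE('e) X" by (rule loc_euclid_manifold[OF M])

lemma regular: "regular_space X"
proof (rule locally_compact_Hausdorff_imp_regular_space[OF _ Hausdorff])
 show "locally_compact_space X" unfolding locally_compact_space_def
 proof
  fix x assume x: "x \<in> topspace X"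
  obtain U phi and psi :: "'e \<Rightarrow> 'a" where U: "openin X U"
   "homeomorphic_maps (subtopology X U) euclidean phi psi" "psi 0 = x"
   using euclid_chart_exists[OF mfd_loc_euclid openin_topspace x] by blast
  note ch = euclid_chartD[OF U(2,1)]
  have "compactin X (psi ` cball 0 1)" by (rule image_compactin[OF _ ch(2)]) simp
  moreover have "openin X (psi ` ball 0 1)" by (rule ch(6)) simp
  moreover have "x \<in> psi ` ball 0 1" using U(3) by force
  moreover have "psi ` ball 0 1 \<subseteq> psi ` cball 0 1" by (intro image_mono ball_subset_cball)
  ultimately show "\<exists>U K. openin X U \<and> compactin X K \<and> x \<in> U \<and> U \<subseteq> K" by blast
 qed
qed

lemma normed_embedding: "\<exists>F :: 'a \<Rightarrow> (nat \<Rightarrow>\<^sub>C real). homeomorphic_map X (top_of_set (F ` topspace X)) F"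
 by (rule bounded_sequence_embedding[OF regular _ Hausdorff]) (use M in \<open>simp add: smooth_manifold_def\<close>)

lemma metrizable: "\<exists>d. Metric_space (topspace X) d \<and> Metric_space.mtopology (topspace X) d = X"
proof -
 obtain F :: "'a \<Rightarrow> (nat \<Rightarrow>\<^sub>C real)" where "homeomorphic_map X (top_of_set (F ` topspace X)) F"
  using normed_embedding by blast
 then have "X homeomorphic_space top_of_set (F ` topspace X)" by (rule homeomorphic_map_imp_homeomorphic_space)
 moreover have "metrizable_space (top_of_set (F ` topspace X))"
  by (simp add: metrizable_space_euclidean metrizable_space_subtopology)
 ultimately have "metrizable_space X" using homeomorphic_metrizable_space by blast
 then show ?thesis unfolding metrizable_space_def by (metis Metric_space.topspace_mtopology)
qed

end

section \<open>Small deformations and sections of the unit tangent bundle\<close>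

context riem_mfd
begin

definition lifts :: "nat \<Rightarrow> ((nat \<Rightarrow> real) \<Rightarrow> 'a) \<Rightarrow> bool" where
 "lifts k f \<longleftrightarrow> (\<exists>V. continuous_map (nsphere k) ST V \<and> (\<forall>x\<in>Sph k. fst (V x) = f x))"

lemma lifts_homotopic: "homotopic_with P (nsphere k) X f f' \<Longrightarrow> lifts k f \<Longrightarrow> lifts k f'"
 unfolding lifts_def using section_homotopic[OF sliced_ST] by blast

lemma small_deformation_imp_lifts:
 assumes f: "continuous_map (nsphere k) X f" and l: "loose_by_small_deformation (nsphere k) X f"
 shows "lifts k f"
proof -
 obtain d where d: "Metric_space (topspace X) d" "Metric_space.mtopology (topspace X) d = X" using metrizable by blast
 have f': "cont_on (Sph k) X f" using f by (simp add: nsphere_eq)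
 from direction_exists[OF compact_Sph f' d] obtain eps where eps: "eps > 0"
  "\<forall>f'. cont_on (Sph k) X f' \<longrightarrow> (\<forall>z\<in>Sph k. d (f z) (f' z) < eps \<and> f' z \<noteq> f z) \<longrightarrow>
  (\<exists>V. cont_on (Sph k) ST V \<and> (\<forall>z\<in>Sph k. fst (V z) = f z))" by blast
 obtain f' where "continuous_map (nsphere k) X f'" "\<forall>x\<in>topspace (nsphere k). d (f x) (f' x) < eps \<and> f' x \<noteq> f x"
  using l d eps(1) unfolding loose_by_small_deformation_def by blast
 then show ?thesis using eps(2) by (simp add: nsphere_eq lifts_def)
qed

lemma lifts_push:
 assumes "lifts k f"
 shows "\<exists>(e::real) P. e > 0 \<and> cont_on ({0..e} \<times> Sph k) X P \<and> (\<forall>z\<in>Sph k. P (0, z) = f z) \<and>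
  (\<forall>z\<in>Sph k. \<forall>eps\<in>{0<..e}. P (eps, z) \<noteq> f z)"
proof -
 obtain V where V: "cont_on (Sph k) ST V" "\<forall>x\<in>Sph k. fst (V x) = f x" using assms by (auto simp: lifts_def nsphere_eq)
 have "fst (V (pole k)) \<in> topspace X"
  using V(1) ST_fst_continuous pole_in_Sph[of k] by (fastforce simp: continuous_map_def)
 then obtain c where c: "c \<in> A" "fst (V (pole k)) \<in> chart_dom c" using chart_cover by blast
 from push_exists[OF compact_Sph V(1) c] V(2) show ?thesis by auto
qed

text \<open>The push moves every point, and by compactness it is small in the given metric for short times.\<close>

lemma lifts_imp_small_deformation:
 assumes "lifts k f"
 shows "loose_by_small_deformation (nsphere k) X f" unfolding loose_by_small_deformation_def
proof (intro allI impI)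
 fix d and eps :: real assume d: "Metric_space (topspace X) d" "Metric_space.mtopology (topspace X) d = X" and eps: "eps > 0"
 interpret d: Metric_space "topspace X" d by (rule d(1))
 obtain e P where e: "e > (0::real)" and P: "cont_on ({0..e} \<times> Sph k) X P" "\<forall>z\<in>Sph k. P (0, z) = f z"
  "\<forall>z\<in>Sph k. \<forall>eps\<in>{0<..e}. P (eps, z) \<noteq> f z" using lifts_push[OF assms] by blast
 have "cont_on ({0..e} \<times> Sph k) X (\<lambda>x. P (0, snd x))"
  by (rule cmap_comp_pair[OF _ _ _ P(1)]) (use e in \<open>auto intro!: continuous_intros\<close>)
 then have "cont_on ({0..e} \<times> Sph k) euclidean (\<lambda>x. d (P (0, snd x)) (P x))"
  using continuous_map_mdist[of "top_of_set ({0..e} \<times> Sph k)" d.Self "\<lambda>x. P (0, snd x)" P] P(1) d(2)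
  by (simp add: mtopology_of_def)
 then have "openin (top_of_set ({0..e} \<times> Sph k)) {x \<in> topspace (top_of_set ({0..e} \<times> Sph k)). d (P (0, snd x)) (P x) \<in> {..<eps}}"
  by (rule open_preim) simp
 then have W: "openin (top_of_set ({0..e} \<times> Sph k)) {x \<in> {0..e} \<times> Sph k. d (P (0, snd x)) (P x) < eps}" by simp
 have PX: "P x \<in> topspace X" if "x \<in> {0..e} \<times> Sph k" for x using P(1) that by (auto simp: continuous_map_def)
 have "(0, z) \<in> {x \<in> {0..e} \<times> Sph k. d (P (0, snd x)) (P x) < eps}" if "z \<in> Sph k" for z
  using PX[of "(0, z)"] e eps that by simp
 from tube_lemma_interval[OF compact_Sph W e this] obtain e' where
  e': "0 < e'" "e' \<le> e" "{0..e'} \<times> Sph k \<subseteq> {x \<in> {0..e} \<times> Sph k. d (P (0, snd x)) (P x) < eps}" by blast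
 have "continuous_map (nsphere k) X (\<lambda>z. P (e', z))"
  unfolding nsphere_eq by (rule cmap_comp_pair[OF _ _ _ P(1)]) (use e' in \<open>auto intro!: continuous_intros\<close>)
 moreover have "d (f z) (P (e', z)) < eps \<and> P (e', z) \<noteq> f z" if z: "z \<in> Sph k" for z
 proof -
  have "(e', z) \<in> {0..e'} \<times> Sph k" using e'(1) z by auto
  then have "d (P (0, z)) (P (e', z)) < eps" using e'(3) by fastforce
  then show ?thesis using P(2,3) z e' by auto
 qed
 ultimately show "\<exists>f'. continuous_map (nsphere k) X f' \<and> (\<forall>x\<in>topspace (nsphere k). d (f x) (f' x) < eps \<and> f' x \<noteq> f x)"
  by (intro exI[of _ "\<lambda>z. P (e', z)"]) simp
qed

lemma lifts_imp_loose:
 assumes f: "continuous_map (nsphere k) X f" and "lifts k f"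
 shows "loose (nsphere k) X f f"
proof -
 obtain e P where e: "e > (0::real)" and P: "cont_on ({0..e} \<times> Sph k) X P" "\<forall>z\<in>Sph k. P (0, z) = f z"
  "\<forall>z\<in>Sph k. \<forall>eps\<in>{0<..e}. P (eps, z) \<noteq> f z" using lifts_push[OF assms(2)] by blast
 have 1: "cont_cyl (Sph k) X (\<lambda>x. P (e * fst x, snd x))"
  by (rule cmap_comp_pair[OF _ _ _ P(1)]) (use e in \<open>auto intro!: continuous_intros simp: mult_le_cancel_left1\<close>)
 have "homot (nsphere k) X f (\<lambda>z. P (e, z))"
  unfolding nsphere_eq by (rule homotopic_withI_cyl[OF 1]) (use P(2) in auto)
 moreover have "homot (nsphere k) X f f" using f by simp
 ultimately show ?thesis unfolding loose_def using P(3) e by (intro exI[of _ f] exI[of _ "\<lambda>z. P (e, z)"]) auto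
qed

lemma small_deformation_iff_lifts:
 "continuous_map (nsphere k) X f \<Longrightarrow> loose_by_small_deformation (nsphere k) X f \<longleftrightarrow> lifts k f"
 using small_deformation_imp_lifts lifts_imp_small_deformation by blast

end

lemma loose_imp_not_producing:
 "continuous_map M X f \<Longrightarrow> loose M X f f \<Longrightarrow> \<not> coincidence_producing M X f" unfolding coincidence_producing_def by blast

section \<open>Coincidences and the boundary homomorphism\<close>

lemma topspace_disc [simp]: "topspace (disc m) = Dsc m" by (simp add: disc_eq)

lemma connected_Sph: "k \<ge> 1 \<Longrightarrow> connected (Sph k)"
proof -
 assume "k \<ge> 1"
 then obtain k' where k: "k = Suc k'" by (cases k) auto
 have "connectedin (disc (Suc k')) (Dsc (Suc k'))"
 proof -
  have "path_connected_space (disc (Suc k'))" unfolding path_connected_space_def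
  proof (intro ballI)
   fix x y assume xy: "x \<in> topspace (disc (Suc k'))" "y \<in> topspace (disc (Suc k'))"
   have "pathin (disc (Suc k')) (\<lambda>t. lin t x y)" unfolding pathin_def disc_eq
    using xy lin_in_Dsc continuous_on_lin[OF continuous_on_id[of "{0..1}"] continuous_on_const continuous_on_const]
    by (auto simp: into_sub)
   then show "\<exists>g. pathin (disc (Suc k')) g \<and> g 0 = x \<and> g 1 = y" by (intro exI[of _ "\<lambda>t. lin t x y"]) auto
  qed
  then have "connected_space (disc (Suc k'))" by (rule path_connected_imp_connected_space)
  then show ?thesis by (metis connectedin_topspace topspace_disc)
 qed
 from connectedin_continuous_map_image[OF continuous_map_collapse this]
 have "connectedin (nsphere (Suc k')) (collapse (Suc k') ` Dsc (Suc k'))" .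
 moreover have "collapse (Suc k') ` Dsc (Suc k') = Sph (Suc k')"
  using collapse_in_Sph collapse_surj by (fastforce simp: image_iff)
 ultimately show "connected (Sph k)" using k by (simp add: nsphere_eq connectedin_subtopology)
qed

lemma dim1_sphere_const:
 fixes h :: "(nat \<Rightarrow> real) \<Rightarrow> 'e::euclidean_space"
 assumes n: "DIM('e) = 1" and k: "k \<ge> 1" and h: "continuous_map (nsphere k) unit_sphere h" and s: "s \<in> Sph k"
 shows "h s = h (pole k)"
proof -
 obtain u :: 'e where u: "Basis = {u}" using n card_1_singletonE by blast
 have "sphere (0::'e) 1 \<subseteq> {u, - u}"
 proof
  fix x :: 'e assume x: "x \<in> sphere 0 1"
  have "(\<Sum>b\<in>Basis. (x \<bullet> b) *\<^sub>R b) = (x \<bullet> u) *\<^sub>R u" by (simp add: u)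
  then have xu: "x = (x \<bullet> u) *\<^sub>R u" by (simp add: euclidean_representation)
  have "norm u = 1" using u norm_Basis by blast
  then have "\<bar>x \<bullet> u\<bar> = 1" using x xu by (metis mem_sphere_0 mult.right_neutral norm_scaleR)
  then show "x \<in> {u, - u}" using xu by (cases "x \<bullet> u = 1") (auto simp: abs_if split: if_splits)
 qed
 then have fin: "finite (sphere (0::'e) 1)" by (meson finite.emptyI finite.insertI finite_subset)
 have hc: "continuous_on (Sph k) h" "h ` Sph k \<subseteq> sphere 0 1" using h by (auto simp: nsphere_eq)
 then have "finite (h ` Sph k)" using fin finite_subset by blast
 moreover have "connected (h ` Sph k)" using connected_Sph[OF k] hc by (intro connected_continuous_image)
 ultimately have "h ` Sph k = {} \<or> (\<exists>x. h ` Sph k = {x})" using connected_finite_iff_sing by blast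
 then show ?thesis using s pole_in_Sph[of k] by (metis empty_iff imageI singletonD)
qed

lemma nullh_const: "y \<in> topspace Y \<Longrightarrow> (\<And>s. s \<in> Sph k \<Longrightarrow> h s = y) \<Longrightarrow> nullh k Y h"
 unfolding nullh_def by (intro exI[of _ y] homotopic_with_equal) (auto intro: continuous_map_eq[of _ _ "\<lambda>_. y"])

lemma dim1_nullh:
 fixes h :: "(nat \<Rightarrow> real) \<Rightarrow> 'e::euclidean_space"
 assumes "DIM('e) = 1" "k \<ge> 1" "continuous_map (nsphere k) unit_sphere h"
 shows "nullh k unit_sphere h"
proof (rule nullh_const[OF _ dim1_sphere_const[OF assms]])
 show "h (pole k) \<in> topspace unit_sphere" using assms(3) pole_in_Sph[of k] by (simp add: nsphere_eq Pi_iff)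
qed

lemma nullh_path_connected:
 assumes Y: "path_connected_space Y" and g: "continuous_map (nsphere 0) Y g"
 shows "nullh 0 Y g"
proof -
 define q where "q = (\<lambda>i::nat. if i = 0 then - 1 else 0 :: real)"
 have S: "Sph 0 = {pole 0, q}"
 proof
  show "Sph 0 \<subseteq> {pole 0, q}"
  proof
   fix x assume x: "x \<in> Sph 0"
   then have "x 0 = 1 \<or> x 0 = -1" "\<forall>i>0. x i = 0" by (auto simp: Sph_def power2_eq_1_iff)
   then show "x \<in> {pole 0, q}" by (auto simp: pole_def q_def fun_eq_iff)
  qed
  show "{pole 0, q} \<subseteq> Sph 0" by (auto simp: Sph_def pole_def q_def)
 qed
 have qp: "pole 0 0 = 1" "q 0 = -1" by (auto simp: pole_def q_def)
 have "g q \<in> topspace Y" "g (pole 0) \<in> topspace Y" using g S by (auto simp: continuous_map_def)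
 then obtain gam where gam: "pathin Y gam" "gam 0 = g q" "gam 1 = g (pole 0)" using Y unfolding path_connected_space_def by blast
 define H where "H x = (if snd x 0 \<le> 0 then gam (fst x) else g (pole 0))" for x :: "real \<times> (nat \<Rightarrow> real)"
 have c: "cont_cyl (Sph 0) Y H" unfolding H_def
 proof (rule continuous_map_if_le)
  show "cont_on {x \<in> {0..1} \<times> Sph 0. snd x 0 \<le> 0} Y (\<lambda>x. gam (fst x))"
   by (rule cmap_comp_on[of _ fst "{0..1}"]) (use gam(1) in \<open>auto simp: pathin_def intro!: continuous_intros\<close>)
 qed (use \<open>g (pole 0) \<in> topspace Y\<close> S qp in \<open>auto intro!: continuous_intros\<close>)
 have "homot (nsphere 0) Y g (\<lambda>_. g (pole 0))"
  unfolding nsphere_eq by (rule homotopic_withI_cyl[OF c]) (use S qp gam in \<open>auto simp: H_def\<close>)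
 then show ?thesis unfolding nullh_def by blast
qed

lemma into_punctured:
 "continuous_map Z (punctured Y b) f \<longleftrightarrow> continuous_map Z Y f \<and> (\<forall>z\<in>topspace Z. f z \<noteq> b)"
proof -
 have "f \<in> topspace Z \<rightarrow> topspace Y" if "continuous_map Z Y f" using that by (auto simp: continuous_map_def)
 then show ?thesis unfolding punctured_def into_sub by blast
qed

lemma hinduced_class:
 assumes j: "continuous_map Y Z j" and h: "based_map k Y v h" and b: "j v = b"
 shows "hinduced k Z b j (hclass k Y v h) = hclass k Z b (j \<circ> h)"
proof -
 have "hclass k Z b (j \<circ> h') = hclass k Z b (j \<circ> h)" if "h' \<in> hclass k Y v h" for h'
 proof -
  have "homotopic_with (\<lambda>h. h (pole k) = v) (nsphere k) Y h h'" using that by (simp add: hclass_def)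
  then have "homotopic_with (\<lambda>h. h (pole k) = b) (nsphere k) Z (j \<circ> h) (j \<circ> h')"
   by (rule homotopic_with_compose_continuous_map_left[OF _ j]) (use b in simp)
  from hclass_eqI[OF this] show ?thesis by simp
 qed
 moreover have "h \<in> hclass k Y v h" by (rule hclass_self[OF h])
 ultimately show ?thesis unfolding hinduced_def by blast
qed

locale ball_mfd = riem_mfd X A g for X :: "'a topology" and A :: "('a, 'e::euclidean_space) chart set" and g +
 fixes c :: "('a, 'e) chart" and a v0 :: 'e and r :: real
 assumes con: "connected_space X" and cA: "c \<in> A" and r: "r > 0" and ball: "cball a r \<subseteq> snd c ` chart_dom c"
  and v0: "v0 \<in> sphere 0 1"
begin

abbreviation "b0 \<equiv> sphere_incl c a r v0"
abbreviation "x0 \<equiv> ball_center c a"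
abbreviation "jm \<equiv> sphere_incl c a r"
abbreviation "dimg \<equiv> snd c ` chart_dom c"

lemma in_ball: "v \<in> sphere 0 1 \<Longrightarrow> a + r *\<^sub>R v \<in> dimg" using ball r by (auto intro!: subsetD[OF ball] simp: dist_norm)

lemma a_in: "a \<in> dimg" using ball r by auto

lemma b0: "b0 \<in> chart_dom c" "snd c b0 = a + r *\<^sub>R v0" "b0 \<in> topspace X"
proof -
 show 1: "b0 \<in> chart_dom c" unfolding sphere_incl_def by (rule chart_inv_in[OF in_ball[OF v0]])
 show "snd c b0 = a + r *\<^sub>R v0" unfolding sphere_incl_def by (rule chart_chart_inv[OF in_ball[OF v0]])
 show "b0 \<in> topspace X" by (rule dom_topspace[OF cA 1])
qed

lemma x0: "x0 \<in> chart_dom c" "snd c x0 = a" "x0 \<in> topspace X"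
proof -
 show 1: "x0 \<in> chart_dom c" unfolding ball_center_def by (rule chart_inv_in[OF a_in])
 show "snd c x0 = a" unfolding ball_center_def by (rule chart_chart_inv[OF a_in])
 show "x0 \<in> topspace X" by (rule dom_topspace[OF cA 1])
qed

lemma chart_inv_eq: "y \<in> dimg \<Longrightarrow> y' \<in> dimg \<Longrightarrow> chart_inv c y = chart_inv c y' \<longleftrightarrow> y = y'" using chart_chart_inv by metis

lemma chart_inv_map: "continuous_on S q \<Longrightarrow> (\<And>z. z \<in> S \<Longrightarrow> q z \<in> dimg) \<Longrightarrow> cont_on S X (\<lambda>z. chart_inv c (q z))"
 by (rule cmap_comp_on[OF _ _ chart_inv_continuous[OF cA]]) auto

lemma jm_continuous: "continuous_map unit_sphere (punctured X x0) jm"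
proof -
 have "continuous_map unit_sphere X jm"
  unfolding sphere_incl_def[abs_def] by (rule chart_inv_map) (use in_ball in \<open>auto intro!: continuous_intros\<close>)
 moreover have "jm v \<noteq> x0" if "v \<in> sphere 0 1" for v
 proof -
  have "a + r *\<^sub>R v \<noteq> a" using r that by auto
  then show ?thesis unfolding sphere_incl_def ball_center_def using chart_inv_eq[OF in_ball[OF that] a_in] by simp
 qed
 ultimately show ?thesis by (simp add: into_punctured)
qed

definition rad :: real where
 "rad = (SOME rho. rho > 0 \<and> rho \<le> r \<and> (\<forall>x\<in>cball a r. cball x rho \<subseteq> dimg))"

lemma rad: "rad > 0" "rad \<le> r" "x \<in> cball a r \<Longrightarrow> cball x rad \<subseteq> dimg"
proof -
 have "compact (cball a r)" "open dimg" using chart_image_open[OF cA] by auto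
 then obtain e where e: "e > 0" "(\<Union>x\<in>cball a r. ball x e) \<subseteq> dimg"
  using compact_subset_open_imp_ball_epsilon_subset[OF _ _ ball] by blast
 have "\<exists>rho. rho > 0 \<and> rho \<le> r \<and> (\<forall>x\<in>cball a r. cball x rho \<subseteq> dimg)"
 proof (intro exI[of _ "min r (e / 2)"] conjI ballI)
  fix x assume "x \<in> cball a r"
  then have "ball x e \<subseteq> dimg" using e(2) by blast
  moreover have "cball x (min r (e / 2)) \<subseteq> ball x e" using e(1) by auto
  ultimately show "cball x (min r (e / 2)) \<subseteq> dimg" by blast
 qed (use r e in auto)
 from someI_ex[OF this] show "rad > 0" "rad \<le> r" "x \<in> cball a r \<Longrightarrow> cball x rad \<subseteq> dimg" unfolding rad_def by blast+
qed

lemma small_spheres_homotopic: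
 assumes h: "continuous_map (nsphere k) unit_sphere h" and rho: "0 < rho" "rho \<le> r"
 shows "homot (nsphere k) (punctured X x0) (\<lambda>s. chart_inv c (a + rho *\<^sub>R h s)) (jm \<circ> h)"
proof -
 have hc: "continuous_on (Sph k) h" "\<And>s. s \<in> Sph k \<Longrightarrow> norm (h s) = 1" using h by (auto simp: nsphere_eq)
 define q where "q z = a + ((1 - fst z) * rho + fst z * r) *\<^sub>R h (snd z)" for z :: "real \<times> (nat \<Rightarrow> real)"
 have q: "q z \<in> dimg" "q z \<noteq> a" if "z \<in> {0..1} \<times> Sph k" for z
 proof -
  have f: "0 \<le> fst z" "fst z \<le> 1" "norm (h (snd z)) = 1" using that hc by auto
  have "(1 - fst z) * rho + fst z * rho \<le> (1 - fst z) * rho + fst z * r" using f rho by (intro add_left_mono mult_left_mono) auto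
  moreover have "(1 - fst z) * rho + fst z * r \<le> (1 - fst z) * r + fst z * r" using f rho by (intro add_right_mono mult_left_mono) auto
  ultimately have b: "0 < (1 - fst z) * rho + fst z * r" "(1 - fst z) * rho + fst z * r \<le> r" using rho by (simp_all add: algebra_simps)
  then show "q z \<in> dimg" using f by (intro subsetD[OF ball]) (simp add: q_def dist_norm)
  show "q z \<noteq> a" using b f by (auto simp: q_def)
 qed
 have "cont_cyl (Sph k) X (\<lambda>z. chart_inv c (q z))"
  by (rule chart_inv_map) (use q(1) in \<open>auto simp: q_def[abs_def] intro!: continuous_intros continuous_on_compose2[OF hc(1) continuous_on_snd[OF continuous_on_id]]\<close>)
 then have "cont_cyl (Sph k) (punctured X x0) (\<lambda>z. chart_inv c (q z))"
  using q chart_inv_eq a_in by (auto simp: into_punctured ball_center_def)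
 then show "homot (nsphere k) (punctured X x0) (\<lambda>s. chart_inv c (a + rho *\<^sub>R h s)) (jm \<circ> h)"
  unfolding nsphere_eq by (rule homotopic_withI_cyl) (auto simp: q_def sphere_incl_def)
qed

text \<open>Dragging the point \<open>x\<^sub>0\<close> along a radius of the ball to the base point carries the sphere around \<open>x\<^sub>0\<close> to a
 sphere around the base point.\<close>

abbreviation "base_sphere h \<equiv> \<lambda>s. (b0, chart_inv c (snd c b0 + rad *\<^sub>R h s))"

lemma null_center_iff:
 assumes h: "continuous_map (nsphere k) unit_sphere h"
 shows "nullh k (fib (conf X) fst b0) (base_sphere h) \<longleftrightarrow> nullh k (punctured X x0) (jm \<circ> h)"
proof -
 have hc: "continuous_on (Sph k) h" "\<And>s. s \<in> Sph k \<Longrightarrow> norm (h s) = 1" using h by (auto simp: nsphere_eq)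
 define alp where "alp t = a + (t * r) *\<^sub>R v0" for t
 define G where "G t s = (chart_inv c (alp t), chart_inv c (alp t + rad *\<^sub>R h s))" for t s
 have alp: "alp t \<in> cball a r" if "t \<in> {0..1}" for t
  using that v0 r by (auto simp: alp_def dist_norm abs_mult mult_left_le_one_le)
 have alpd: "alp t \<in> dimg" "alp t + rad *\<^sub>R h s \<in> dimg" if "t \<in> {0..1}" "s \<in> Sph k" for t s
  using rad(1) rad(3)[OF alp[OF that(1)]] hc(2)[OF that(2)] by (auto intro!: subsetD[OF rad(3)[OF alp[OF that(1)]]] simp: dist_norm)
 have sl: "sliced (conf X) X fst" by (rule sliced_conf[OF mfd_loc_euclid Hausdorff])
 have hs: "continuous_on S (\<lambda>z. h (snd z))" if "S \<subseteq> UNIV \<times> Sph k" for S :: "(real \<times> (nat \<Rightarrow> real)) set"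
  by (rule continuous_on_compose2[OF hc(1) continuous_on_snd[OF continuous_on_id]]) (use that in auto)
 have G: "cont_cyl (Sph k) (conf X) (\<lambda>z. G (u (fst z)) (snd z))"
  if u: "continuous_on {0..1} u" "\<And>t. t \<in> {0..1} \<Longrightarrow> u t \<in> {0..1}" for u
 proof -
  have uc: "continuous_on ({0..1} \<times> Sph k) (\<lambda>z. u (fst z))"
   by (rule continuous_on_compose2[OF u(1) continuous_on_fst[OF continuous_on_id]]) auto
  have "cont_cyl (Sph k) X (\<lambda>z. chart_inv c (alp (u (fst z))))"
   by (rule chart_inv_map) (use alpd(1) u(2) uc in \<open>auto simp: alp_def intro!: continuous_intros\<close>)
  moreover have "cont_cyl (Sph k) X (\<lambda>z. chart_inv c (alp (u (fst z)) + rad *\<^sub>R h (snd z)))"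
  proof (rule chart_inv_map)
   show "continuous_on ({0..1} \<times> Sph k) (\<lambda>z. alp (u (fst z)) + rad *\<^sub>R h (snd z))"
    unfolding alp_def by (intro continuous_intros uc hs) auto
  qed (use alpd(2) u(2) in auto)
  moreover have "chart_inv c (alp (u t)) \<noteq> chart_inv c (alp (u t) + rad *\<^sub>R h s)" if "t \<in> {0..1}" "s \<in> Sph k" for t s
   using chart_inv_eq[OF alpd(1)[OF u(2)[OF that(1)] that(2)] alpd(2)[OF u(2)[OF that(1)] that(2)]] rad(1) hc(2)[OF that(2)] by auto
  ultimately show ?thesis by (simp add: into_conf o_def G_def)
 qed
 have tr: "nullh k (fib (conf X) fst (chart_inv c (alp (u 1)))) (G (u 1))"
  if u: "continuous_on {0..1} u" "\<And>t. t \<in> {0..1} \<Longrightarrow> u t \<in> {0..1}"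
   and n: "nullh k (fib (conf X) fst (chart_inv c (alp (u 0)))) (G (u 0))" for u :: "real \<Rightarrow> real"
 proof -
  obtain y where y: "homot (top_of_set (Sph k)) (fib (conf X) fst (chart_inv c (alp (u 0)))) (G (u 0)) (\<lambda>_. y)"
   using n unfolding nullh_def nsphere_eq by blast
  have ne: "Sph k \<noteq> {}" using pole_in_Sph by blast
  have "\<exists>y'. homot (top_of_set (Sph k)) (fib (conf X) fst (chart_inv c (alp (u 1)))) (\<lambda>z. G (u (fst (1::real, z))) (snd (1::real, z))) (\<lambda>_. y')"
  proof (rule null_homotopy_transport[OF sl compact_Sph ne G[OF u], where alp="\<lambda>t. chart_inv c (alp (u t))" and y=y])
   show "fst (G (u (fst (t, z))) (snd (t, z))) = chart_inv c (alp (u t))" for t :: real and z by (simp add: G_def)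
  qed (use y in simp_all)
  then show ?thesis unfolding nullh_def nsphere_eq by simp
 qed
 have "nullh k (fib (conf X) fst (chart_inv c (alp 1))) (G 1) \<longleftrightarrow> nullh k (fib (conf X) fst (chart_inv c (alp 0))) (G 0)"
 proof -
  have "continuous_on {0..1} (\<lambda>t::real. t)" "continuous_on {0..1} (\<lambda>t::real. 1 - t)" by (intro continuous_intros)+
  from tr[OF this(1)] tr[OF this(2)] show ?thesis by auto
 qed
 moreover have "chart_inv c (alp 1) = b0" "chart_inv c (alp 0) = x0" by (auto simp: alp_def sphere_incl_def ball_center_def)
 moreover have "G 1 = (base_sphere h)" using b0(2) by (auto simp: G_def alp_def sphere_incl_def)
 moreover have "G 0 = (\<lambda>s. (x0, chart_inv c (a + rad *\<^sub>R h s)))" by (auto simp: G_def alp_def ball_center_def)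
 ultimately have 1: "nullh k (fib (conf X) fst b0) (base_sphere h) \<longleftrightarrow>
  nullh k (fib (conf X) fst x0) (\<lambda>s. (x0, chart_inv c (a + rad *\<^sub>R h s)))" by simp
 have 2: "nullh k (fib (conf X) fst x0) (\<lambda>s. (x0, chart_inv c (a + rad *\<^sub>R h s))) \<longleftrightarrow> nullh k (punctured X x0) (\<lambda>s. chart_inv c (a + rad *\<^sub>R h s))"
  using nullh_compose[OF _ continuous_map_conf_fib] nullh_compose[OF _ continuous_map_fib_conf[OF x0(3)]]
  by (fastforce simp: o_def)
 note 3 = small_spheres_homotopic[OF h rad(1,2)]
 show ?thesis unfolding 1 2 using nullh_homotopic[OF 3] nullh_homotopic[OF homotopic_with_symD[OF 3]] by blast
qed

definition disc_lift :: "nat \<Rightarrow> ((nat \<Rightarrow> real) \<Rightarrow> 'a) \<Rightarrow> ((nat \<Rightarrow> real) \<Rightarrow> 'a \<times> (('a, 'e) chart \<Rightarrow> 'e)) \<Rightarrow> bool" where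
 "disc_lift k f L \<longleftrightarrow> continuous_map (disc (Suc k)) ST L \<and>
   (\<forall>x\<in>Dsc (Suc k). fst (L x) = f (collapse (Suc k) x)) \<and> L (pole k) = fiber_param A g c b0 v0"

definition bdry :: "((nat \<Rightarrow> real) \<Rightarrow> 'a \<times> (('a, 'e) chart \<Rightarrow> 'e)) \<Rightarrow> (nat \<Rightarrow> real) \<Rightarrow> 'e" where
 "bdry L s = sgn (snd (L s) c)"

lemma disc_lift_ex:
 assumes "based_map (Suc k) X b0 f" shows "\<exists>L. disc_lift k f L"
proof -
 have "fiber_param A g c b0 v0 \<in> topspace (fib ST fst b0)"
  using fiber_param_continuous[OF cA b0(1)] v0 by (auto simp: continuous_map_def)
 then show ?thesis using disc_lift_exists[OF sliced_ST, of k f "fiber_param A g c b0 v0"] assms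
  unfolding based_map_def disc_lift_def by auto
qed

context
 fixes k f L
 assumes f: "based_map (Suc k) X b0 f" and L: "disc_lift k f L"
begin

lemma L_continuous: "continuous_map (disc (Suc k)) ST L"
 and L_fst: "x \<in> Dsc (Suc k) \<Longrightarrow> fst (L x) = f (collapse (Suc k) x)"
 and L_pole: "L (pole k) = fiber_param A g c b0 v0" using L by (auto simp: disc_lift_def)

lemma f_continuous: "continuous_map (nsphere (Suc k)) X f" and f_pole: "f (pole (Suc k)) = b0"
 using f by (auto simp: based_map_def)

lemma L_boundary: "continuous_map (nsphere k) (fib ST fst b0) L"
proof -
 have "cont_on (Dsc (Suc k)) ST L" using L_continuous by (simp add: disc_eq)
 from cmap_mono[OF this Sph_subset_Dsc] have "continuous_map (nsphere k) ST L" by (simp add: nsphere_eq)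
 moreover have "fst (L s) = b0" if "s \<in> Sph k" for s
  using L_fst[OF subsetD[OF Sph_subset_Dsc that]] collapse_boundary[OF that] f_pole by simp
 ultimately show ?thesis by (simp add: into_fib)
qed

lemma bdry_continuous: "continuous_map (nsphere k) unit_sphere (bdry L)"
 using cmap_comp[OF L_boundary fiber_coord_continuous[OF cA b0(1)]] by (simp add: o_def bdry_def[abs_def])

lemma bdry_based: "based_map k unit_sphere v0 (bdry L)"
 unfolding based_map_def using bdry_continuous fiber_coord_param[OF cA b0(1) v0] by (simp add: bdry_def L_pole)

lemma L_bdry: "s \<in> Sph k \<Longrightarrow> L s = fiber_param A g c b0 (bdry L s)"
 unfolding bdry_def using L_boundary by (subst fiber_param_coord[OF cA b0(1)]) (auto simp: continuous_map_def)

lemma null_fiber_iff: "nullh k (fib ST fst b0) L \<longleftrightarrow> nullh k unit_sphere (bdry L)"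
proof
 assume "nullh k (fib ST fst b0) L"
 from nullh_compose[OF this fiber_coord_continuous[OF cA b0(1)]]
 show "nullh k unit_sphere (bdry L)" by (simp add: o_def bdry_def[abs_def])
next
 assume "nullh k unit_sphere (bdry L)"
 from nullh_compose[OF this fiber_param_continuous[OF cA b0(1)]]
 show "nullh k (fib ST fst b0) L" by (rule nullh_cong) (simp add: L_bdry)
qed

lemma lifts_iff_null:
 assumes "DIM('e) \<ge> 2 \<or> k \<ge> 1"
 shows "lifts (Suc k) f \<longleftrightarrow> nullh k unit_sphere (bdry L)"
proof
 assume l: "lifts (Suc k) f"
 show "nullh k unit_sphere (bdry L)"
 proof (cases "DIM('e) \<ge> 2")
  case True
  obtain V where V: "continuous_map (nsphere (Suc k)) ST V" "\<And>x. x\<in>Sph (Suc k) \<Longrightarrow> fst (V x) = f x"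
   using l by (auto simp: lifts_def)
  from null_of_section[OF sliced_ST f_continuous f_pole L_continuous L_fst V path_connected_fib_ST[OF True b0(3)]]
  show ?thesis by (simp add: null_fiber_iff)
 next
  case False
  then have "DIM('e) = 1" "k \<ge> 1" using assms DIM_positive[where 'a='e] by linarith+
  then show ?thesis by (rule dim1_nullh[OF _ _ bdry_continuous])
 qed
next
 assume "nullh k unit_sphere (bdry L)"
 then have "nullh k (fib ST fst b0) L" by (simp add: null_fiber_iff)
 from section_of_null[OF sliced_ST f_continuous f_pole L_continuous L_fst this]
 show "lifts (Suc k) f" by (simp add: lifts_def)
qed

text \<open>Over the boundary sphere, \<open>P\<close> leaves \<open>b0\<close> into the half space of \<open>L s\<close>. Shorten the time until the chart
 contains the path, then move straight to the sphere of radius \<open>rad\<close>; the segment stays in the half space.\<close>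

lemma pushed_boundary:
 assumes e: "(e::real) > 0" and P: "cont_on ({0..e} \<times> Dsc (Suc k)) X P" "\<forall>z\<in>Dsc (Suc k). P (0, z) = fst (L z)"
  "\<forall>z\<in>Dsc (Suc k). \<forall>eps\<in>{0<..e}. P (eps, z) \<noteq> fst (L z)"
  "\<forall>z\<in>Dsc (Suc k). fst (L z) = b0 \<longrightarrow> (\<forall>eps\<in>{0<..e}. P (eps, z) \<in> chart_dom c \<and>
    (snd c (P (eps, z)) - snd c b0) \<bullet> snd (L z) c > 0)"
 shows "homot (nsphere k) (fib (conf X) fst b0) (\<lambda>s. (b0, P (e, s)))
  (base_sphere (bdry L))"
proof -
 have Ls: "fst (L s) = b0" "s \<in> Dsc (Suc k)" if "s \<in> Sph k" for s
  using L_boundary Sph_subset_Dsc that by (auto simp: into_fib)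
 have PS: "cont_on ({0..e} \<times> Sph k) X P" by (rule cmap_mono[OF P(1)]) (use Sph_subset_Dsc in auto)
 define N where "N = {p \<in> chart_dom c. snd c p \<in> ball (snd c b0) rad}"
 have "openin (subtopology X (chart_dom c)) {p \<in> topspace (subtopology X (chart_dom c)). snd c p \<in> ball (snd c b0) rad}"
  by (rule open_preim[OF chart_cont[OF cA]]) simp
 then have N: "openin X N" unfolding topspace_dom[OF cA] N_def using chart_open[OF cA] openin_trans_full by blast
 have W: "openin (top_of_set ({0..e} \<times> Sph k)) {x \<in> {0..e} \<times> Sph k. P x \<in> N}" using open_preim[OF PS N] by simp
 have W0: "(0, s) \<in> {x \<in> {0..e} \<times> Sph k. P x \<in> N}" if "s \<in> Sph k" for s
  using P(2) Ls[OF that] that e rad(1) b0 by (auto simp: N_def)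
 from tube_lemma_interval[OF compact_Sph W e W0] obtain e' where
  e': "0 < e'" "e' \<le> e" "{0..e'} \<times> Sph k \<subseteq> {x \<in> {0..e} \<times> Sph k. P x \<in> N}" by blast
 have Pne: "P (eps, s) \<noteq> b0" if "s \<in> Sph k" "eps \<in> {0<..e}" for eps s using P(3) Ls[OF that(1)] that(2) by metis
 have i1: "(1 - t) * e + t * e' \<in> {0<..e}" if "t \<in> {0..1}" for t
 proof -
  have "e' \<le> (1 - t) * e + t * e'" using mult_left_mono[OF e'(2), of "1 - t"] that by (simp add: algebra_simps)
  moreover have "(1 - t) * e + t * e' \<le> e" using mult_left_mono[OF e'(2), of t] that by (simp add: algebra_simps)
  ultimately show ?thesis using e'(1) by simp
 qed
 have 1: "homot (nsphere k) (fib (conf X) fst b0) (\<lambda>s. (b0, P (e, s))) (\<lambda>s. (b0, P (e', s)))" unfolding nsphere_eq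
 proof (rule homotopic_withI_cyl)
  have "cont_cyl (Sph k) X (\<lambda>z. P ((1 - fst z) * e + fst z * e', snd z))"
   by (rule cmap_comp_pair[OF _ _ _ PS]) (use i1 in \<open>auto intro!: continuous_intros simp: less_imp_le\<close>)
  moreover have "P ((1 - t) * e + t * e', s) \<noteq> b0" if "t \<in> {0..1}" "s \<in> Sph k" for t s
   using Pne[OF that(2) i1[OF that(1)]] .
  ultimately show "cont_cyl (Sph k) (fib (conf X) fst b0) (\<lambda>z. (b0, P ((1 - fst z) * e + fst z * e', snd z)))"
   using b0(3) by (force simp: into_fib into_conf o_def)
 qed auto
 have PN: "P (e', s) \<in> N" if "s \<in> Sph k" for s
 proof -
  have "(e', s) \<in> {0..e'} \<times> Sph k" using that e'(1) by auto
  then show ?thesis using e'(3) by blast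
 qed
 define q where "q t s = (1 - t) *\<^sub>R snd c (P (e', s)) + t *\<^sub>R (snd c b0 + rad *\<^sub>R bdry L s)" for t s
 have hs: "norm (bdry L s) = 1" if "s \<in> Sph k" for s using bdry_continuous that by (force simp: nsphere_eq)
 have b0d: "cball (snd c b0) rad \<subseteq> dimg" by (rule rad(3)) (use b0(2) v0 r in \<open>auto simp: dist_norm\<close>)
 have qd: "q t s \<in> dimg" if "t \<in> {0..1}" "s \<in> Sph k" for t s
 proof -
  have "snd c (P (e', s)) \<in> cball (snd c b0) rad" using PN[OF that(2)] by (auto simp: N_def)
  moreover have "snd c b0 + rad *\<^sub>R bdry L s \<in> cball (snd c b0) rad"
   using hs[OF that(2)] rad(1) by (simp add: dist_norm)
  ultimately have "q t s \<in> cball (snd c b0) rad"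
   unfolding q_def using that(1) by (intro convexD_alt[OF convex_cball]) auto
  then show ?thesis using b0d by blast
 qed
 have qne: "q t s \<noteq> snd c b0" if "t \<in> {0..1}" "s \<in> Sph k" for t s
 proof -
  have Lc: "snd (L s) c \<noteq> 0"
  proof -
   have "L s \<in> topspace (fib ST fst b0)" using L_boundary that(2) by (auto simp: continuous_map_def Pi_iff)
   then have "(b0, snd (L s)) \<in> topspace ST" using Ls(1)[OF that(2)] by (metis IntD1 prod.collapse topspace_subtopology)
   from ST_vec(3)[OF this cA b0(1)] show ?thesis .
  qed
  have "(q t s - snd c b0) \<bullet> snd (L s) c = (1 - t) * ((snd c (P (e', s)) - snd c b0) \<bullet> snd (L s) c) + t * (rad * (bdry L s \<bullet> snd (L s) c))"
   by (simp add: q_def algebra_simps inner_diff_left inner_add_left)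
  moreover have "(snd c (P (e', s)) - snd c b0) \<bullet> snd (L s) c > 0" using P(4) Ls[OF that(2)] e' by auto
  moreover have "bdry L s \<bullet> snd (L s) c > 0" using Lc by (simp add: bdry_def sgn_div_norm)
  ultimately have "(q t s - snd c b0) \<bullet> snd (L s) c > 0"
   using that(1) rad(1) by (cases "t = 0") (auto intro!: add_nonneg_pos)
  then show ?thesis by auto
 qed
 have cP: "continuous_on (Sph k) (\<lambda>s. snd c (P (e', s)))"
 proof -
  have "cont_on (Sph k) X (\<lambda>s. P (e', s))"
   by (rule cmap_comp_pair[OF _ _ _ PS]) (use e' in \<open>auto intro!: continuous_intros\<close>)
  then have "cont_on (Sph k) (subtopology X (chart_dom c)) (\<lambda>s. P (e', s))" using PN by (auto simp: into_sub N_def)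
  from cmap_comp[OF this chart_cont[OF cA]] show ?thesis by (simp add: o_def)
 qed
 have hc: "continuous_on (Sph k) (bdry L)" using bdry_continuous by (simp add: nsphere_eq)
 have 2: "homot (nsphere k) (fib (conf X) fst b0) (\<lambda>s. (b0, P (e', s)))
  (base_sphere (bdry L))" unfolding nsphere_eq
 proof (rule homotopic_withI_cyl)
  have "cont_cyl (Sph k) X (\<lambda>z. chart_inv c (q (fst z) (snd z)))"
  proof (rule chart_inv_map)
   show "continuous_on ({0..1} \<times> Sph k) (\<lambda>z. q (fst z) (snd z))" unfolding q_def
    by (intro continuous_intros continuous_on_compose2[OF cP continuous_on_snd[OF continuous_on_id]]
      continuous_on_compose2[OF hc continuous_on_snd[OF continuous_on_id]]) auto
  qed (use qd in auto)
  moreover have "chart_inv c (q t s) \<noteq> b0" if "t \<in> {0..1}" "s \<in> Sph k" for t s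
   using qne[OF that] chart_chart_inv[OF qd[OF that]] by auto
  ultimately show "cont_cyl (Sph k) (fib (conf X) fst b0) (\<lambda>z. (b0, chart_inv c (q (fst z) (snd z))))"
   using b0(3) by (force simp: into_fib into_conf o_def)
 qed (use PN chart_inv_chart[OF cA] in \<open>auto simp: q_def N_def\<close>)
 from 1 2 show ?thesis by (rule homotopic_with_trans)
qed

text \<open>A map \<open>f'\<close> without coincidences is a section over \<open>f\<close> of the configuration space. A lift of \<open>f\<close> over the disc
 is given by pushing along \<open>L\<close>; its boundary is the sphere above.\<close>

lemma producing_iff_null:
 assumes "DIM('e) \<ge> 2 \<or> k \<ge> 1"
 shows "\<not> coincidence_producing (nsphere (Suc k)) X f \<longleftrightarrow> nullh k (punctured X x0) (jm \<circ> bdry L)"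
proof -
 have sl: "sliced (conf X) X fst" by (rule sliced_conf[OF mfd_loc_euclid Hausdorff])
 have LD: "cont_on (Dsc (Suc k)) ST L" using L_continuous by (simp add: disc_eq)
 obtain e P where e: "e > (0::real)" and P: "cont_on ({0..e} \<times> Dsc (Suc k)) X P" "\<forall>z\<in>Dsc (Suc k). P (0, z) = fst (L z)"
  "\<forall>z\<in>Dsc (Suc k). \<forall>eps\<in>{0<..e}. P (eps, z) \<noteq> fst (L z)"
  "\<forall>z\<in>Dsc (Suc k). fst (L z) = b0 \<longrightarrow> (\<forall>eps\<in>{0<..e}. P (eps, z) \<in> chart_dom c \<and>
    (snd c (P (eps, z)) - snd c b0) \<bullet> snd (L z) c > 0)" using push_exists[OF compact_Dsc LD cA b0(1)] by blast
 define L' where "L' x = (f (collapse (Suc k) x), P (e, x))" for x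
 have Pe: "continuous_map (disc (Suc k)) X (\<lambda>x. P (e, x))"
  unfolding disc_eq by (rule cmap_comp_pair[OF _ _ _ P(1)]) (use e in \<open>auto intro!: continuous_intros\<close>)
 have fc: "continuous_map (disc (Suc k)) X (\<lambda>x. f (collapse (Suc k) x))"
  using cmap_comp[OF continuous_map_collapse f_continuous] by (simp add: o_def)
 have L': "continuous_map (disc (Suc k)) (conf X) L'" using Pe fc P(3) L_fst e by (force simp: into_conf o_def L'_def)
 have "nullh k (fib (conf X) fst b0) L' \<longleftrightarrow> nullh k (fib (conf X) fst b0) (\<lambda>s. (b0, P (e, s)))"
  using nullh_cong[of k _ L' "\<lambda>s. (b0, P (e, s))"] nullh_cong[of k _ "\<lambda>s. (b0, P (e, s))" L'] collapse_boundary f_pole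
  by (auto simp: L'_def)
 also have "\<dots> \<longleftrightarrow> nullh k (fib (conf X) fst b0) (base_sphere (bdry L))"
  using nullh_homotopic[OF pushed_boundary[OF e P]] nullh_homotopic[OF homotopic_with_symD[OF pushed_boundary[OF e P]]] by blast
 also have "\<dots> \<longleftrightarrow> nullh k (punctured X x0) (jm \<circ> bdry L)" by (rule null_center_iff[OF bdry_continuous])
 finally have eq: "nullh k (fib (conf X) fst b0) L' \<longleftrightarrow> nullh k (punctured X x0) (jm \<circ> bdry L)" .
 show ?thesis
 proof
  assume "nullh k (punctured X x0) (jm \<circ> bdry L)"
  then have "nullh k (fib (conf X) fst b0) L'" using eq by simp
  from section_of_null[OF sl f_continuous f_pole L' _ this] obtain q where
   q: "continuous_map (nsphere (Suc k)) (conf X) q" "\<forall>x\<in>Sph (Suc k). fst (q x) = f x" by (auto simp: L'_def)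
  have c2: "continuous_map (nsphere (Suc k)) X (snd \<circ> q)" and ne: "\<forall>x\<in>Sph (Suc k). f x \<noteq> snd (q x)"
   using q by (auto simp: into_conf)
  have "loose (nsphere (Suc k)) X f (snd \<circ> q)"
   unfolding loose_def using c2 f_continuous ne by (intro exI[of _ f] exI[of _ "snd \<circ> q"]) auto
  then show "\<not> coincidence_producing (nsphere (Suc k)) X f" using c2 unfolding coincidence_producing_def by blast
 next
  assume "\<not> coincidence_producing (nsphere (Suc k)) X f"
  then obtain f' f1 f2 where ff: "homot (nsphere (Suc k)) X f f1"
   "homot (nsphere (Suc k)) X f' f2" "\<forall>x\<in>Sph (Suc k). f1 x \<noteq> f2 x"
   unfolding coincidence_producing_def loose_def by auto
  have "continuous_map (nsphere (Suc k)) (conf X) (\<lambda>x. (f1 x, f2 x))"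
   using ff(3) homotopic_with_imp_continuous_maps[OF ff(1)] homotopic_with_imp_continuous_maps[OF ff(2)]
   by (simp add: into_conf o_def)
  from section_homotopic[OF sl homotopic_with_symD[OF ff(1)] this] obtain q where
   q: "continuous_map (nsphere (Suc k)) (conf X) q" "\<And>x. x\<in>Sph (Suc k) \<Longrightarrow> fst (q x) = f x" by auto
  show "nullh k (punctured X x0) (jm \<circ> bdry L)"
  proof (cases "DIM('e) \<ge> 2")
   case True
   have "nullh k (fib (conf X) fst b0) L'"
    by (rule null_of_section[OF sl f_continuous f_pole L' _ q path_connected_fib_conf[OF mfd_loc_euclid con True Hausdorff b0(3)]])
     (simp_all add: L'_def)
   then show ?thesis using eq by simp
  next
   case False
   \<comment> \<open>\<open>S\<^sup>0\<close> is discrete and \<open>S\<^sup>k\<close> connected\<close>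
   then have "DIM('e) = 1" "k \<ge> 1" using assms DIM_positive[where 'a='e] by linarith+
   then show ?thesis by (intro nullh_compose[OF _ jm_continuous] dim1_nullh[OF _ _ bdry_continuous])
  qed
 qed
qed

text \<open>All representatives and all lifts give the same class, by uniqueness of lifts over the disc.\<close>

lemma boundary_N_class:
 assumes k: "k \<ge> 1"
 shows "boundary_N X A g c a r v0 (Suc k) (hclass (Suc k) X b0 f) = hclass k unit_sphere v0 (bdry L)"
proof -
 have "\<Union>{hclass k unit_sphere v0 h | h f' L'. f' \<in> hclass (Suc k) X b0 f \<and> continuous_map (disc (Suc k)) ST L' \<and>
   (\<forall>x\<in>topspace (disc (Suc k)). fst (L' x) = f' (collapse (Suc k) x)) \<and> based_map k unit_sphere v0 h \<and>
   (\<forall>s\<in>topspace (nsphere k). L' s = fiber_param A g c b0 (h s))} = hclass k unit_sphere v0 (bdry L)" (is "\<Union>?S = _")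
 proof -
  have "hclass k unit_sphere v0 h = hclass k unit_sphere v0 (bdry L)"
   if f': "f' \<in> hclass (Suc k) X b0 f" and L': "continuous_map (disc (Suc k)) ST L'"
    "\<And>x. x\<in>Dsc (Suc k) \<Longrightarrow> fst (L' x) = f' (collapse (Suc k) x)" and h: "based_map k unit_sphere v0 h"
    "\<And>s. s\<in>Sph k \<Longrightarrow> L' s = fiber_param A g c b0 (h s)" for h f' L'
  proof -
   have hom: "homotopic_with (\<lambda>h. h (pole (Suc k)) = b0) (nsphere (Suc k)) X f f'" using f' by (simp add: hclass_def)
   have pL': "L' (pole k) = fiber_param A g c b0 v0" using h pole_in_Sph[of k] by (simp add: based_map_def)
   from disc_lifts_homotopic_based[OF sliced_ST hom L_continuous L_fst L' L_pole pL']
   have "homotopic_with (\<lambda>h. h (pole k) = fiber_param A g c b0 v0) (nsphere k) (fib ST fst b0) L L'" .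
   from homotopic_with_compose_continuous_map_left[OF this fiber_coord_continuous[OF cA b0(1)], of "\<lambda>h. h (pole k) = v0"]
   have "homotopic_with (\<lambda>h. h (pole k) = v0) (nsphere k) unit_sphere ((\<lambda>e. sgn (snd e c)) \<circ> L) ((\<lambda>e. sgn (snd e c)) \<circ> L')"
    using fiber_coord_param[OF cA b0(1) v0] by simp
   moreover have "homotopic_with (\<lambda>h. h (pole k) = v0) (nsphere k) unit_sphere ((\<lambda>e. sgn (snd e c)) \<circ> L') h"
   proof (rule homotopic_with_equal)
    have "h s \<in> sphere 0 1" if "s \<in> Sph k" for s using h(1) that by (auto simp: based_map_def nsphere_eq)
    then have eq: "((\<lambda>e. sgn (snd e c)) \<circ> L') s = h s" if "s \<in> Sph k" for s
     using h(2)[OF that] fiber_coord_param[OF cA b0(1)] that by simp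
    then show "\<And>x. x \<in> topspace (nsphere k) \<Longrightarrow> ((\<lambda>e. sgn (snd e c)) \<circ> L') x = h x" by simp
    show "h (pole k) = v0" using h(1) by (simp add: based_map_def)
    then show "((\<lambda>e. sgn (snd e c)) \<circ> L') (pole k) = v0" using eq[OF pole_in_Sph] by simp
    show "continuous_map (nsphere k) unit_sphere ((\<lambda>e. sgn (snd e c)) \<circ> L')"
     by (rule continuous_map_eq[of _ _ h]) (use h(1) eq in \<open>auto simp: based_map_def\<close>)
   qed
   ultimately have "homotopic_with (\<lambda>h. h (pole k) = v0) (nsphere k) unit_sphere ((\<lambda>e. sgn (snd e c)) \<circ> L) h"
    by (rule homotopic_with_trans)
   moreover have "(\<lambda>e. sgn (snd e c)) \<circ> L = bdry L" by (simp add: fun_eq_iff bdry_def)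
   ultimately have "homotopic_with (\<lambda>h. h (pole k) = v0) (nsphere k) unit_sphere (bdry L) h" by metis
   from hclass_eqI[OF this] show ?thesis by simp
  qed
  then have "?S \<subseteq> {hclass k unit_sphere v0 (bdry L)}" by auto
  moreover have "hclass k unit_sphere v0 (bdry L) \<in> ?S" using hclass_self[OF f] L_continuous L_fst bdry_based L_bdry
   by (intro CollectI exI[of _ "bdry L"] exI[of _ f] exI[of _ L]) simp
  ultimately have "?S = {hclass k unit_sphere v0 (bdry L)}" by blast
  then show ?thesis by simp
 qed
 then show ?thesis using k by (simp add: boundary_N_def boundary_hom_def)
qed

end

lemma j_star_class:
 "based_map k unit_sphere v0 h \<Longrightarrow> j_star X c a r v0 k (hclass k unit_sphere v0 h) = hclass k (punctured X x0) b0 (jm \<circ> h)"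
 unfolding j_star_def by (rule hinduced_class[OF jm_continuous]) auto

lemma jm_based: "based_map k unit_sphere v0 h \<Longrightarrow> based_map k (punctured X x0) b0 (jm \<circ> h)"
 using cmap_comp[OF _ jm_continuous] by (auto simp: based_map_def)

end

section \<open>One-dimensional manifolds are orientable\<close>

text \<open>Think of \<open>E\<close> as the unit tangent vectors of a \<open>1\<close>-manifold, of \<open>L\<close> as arc length coordinates that increase in
 the direction of the vectors, and of \<open>sig\<close> as reversal of vectors. Two coordinates differ locally by a constant.\<close>

locale translation_structure =
 fixes E :: "'b topology" and L :: "('b set \<times> ('b \<Rightarrow> real)) set" and sig :: "'b \<Rightarrow> 'b"
 assumes Hausdorff_E: "Hausdorff_space E"
  and cover_L: "y \<in> topspace E \<Longrightarrow> \<exists>U l. (U, l) \<in> L \<and> y \<in> U"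
  and open_L: "(U, l) \<in> L \<Longrightarrow> openin E U"
  and inj_L: "(U, l) \<in> L \<Longrightarrow> inj_on l U"
  and compat_L: "(U, l) \<in> L \<Longrightarrow> (U', l') \<in> L \<Longrightarrow> y \<in> U \<Longrightarrow> y \<in> U' \<Longrightarrow>
   \<exists>W. openin E W \<and> y \<in> W \<and> W \<subseteq> U \<inter> U' \<and> (\<forall>z\<in>W. l' z - l z = l' y - l y)"
  and arc_L: "(U, l) \<in> L \<Longrightarrow> z \<in> U \<Longrightarrow> z' \<in> U \<Longrightarrow>
   \<exists>alp bet kap. cont_on {alp..bet} E kap \<and> (\<forall>t\<in>{alp..bet}. kap t \<in> U \<and> l (kap t) = t) \<and> z \<in> kap ` {alp..bet} \<and> z' \<in> kap ` {alp..bet}"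
  and flip_continuous: "continuous_map E E sig"
  and flip: "y \<in> topspace E \<Longrightarrow> sig (sig y) = y" "y \<in> topspace E \<Longrightarrow> sig y \<noteq> y"
  and flip_L: "(U, l) \<in> L \<Longrightarrow> \<exists>U' l'. (U', l') \<in> L \<and> (\<forall>y\<in>topspace E. sig y \<in> U \<longleftrightarrow> y \<in> U') \<and> (\<forall>y\<in>U'. l (sig y) = - l' y)"
begin

definition unit_speed :: "real set \<Rightarrow> (real \<Rightarrow> 'b) \<Rightarrow> bool" where
 "unit_speed J kap \<longleftrightarrow> cont_on J E kap \<and>
   (\<forall>t\<in>J. \<forall>U l. (U, l) \<in> L \<longrightarrow> kap t \<in> U \<longrightarrow> (\<forall>\<^sub>F t' in at t within J. kap t' \<in> U \<and> l (kap t') - l (kap t) = t' - t))"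

lemma unit_speed_unique:
 assumes J: "connected J" and u: "unit_speed J kap" "unit_speed J kap'" and t0: "t0 \<in> J" "kap t0 = kap' t0"
  and t: "t \<in> J"
 shows "kap t = kap' t"
proof -
 define S where "S = {t \<in> J. kap t = kap' t}"
 have c: "cont_on J E kap" "cont_on J E kap'" using u by (auto simp: unit_speed_def)
 have "closedin (top_of_set J) S" using closedin_continuous_maps_eq[OF Hausdorff_E c] by (simp add: S_def)
 moreover have "openin (top_of_set J) S"
 proof (subst openin_subopen, rule ballI)
  fix t assume "t \<in> S"
  then have t: "t \<in> J" "kap t = kap' t" by (auto simp: S_def)
  have "kap t \<in> topspace E" using c(1) t(1) by (auto simp: continuous_map_def)
  then obtain U l where U: "(U, l) \<in> L" "kap t \<in> U" using cover_L by blast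
  have "\<forall>\<^sub>F t' in at t within J. (kap t' \<in> U \<and> l (kap t') - l (kap t) = t' - t) \<and> (kap' t' \<in> U \<and> l (kap' t') - l (kap' t) = t' - t)"
   using u t U unfolding unit_speed_def by (auto simp: eventually_conj_iff)
  then have "\<forall>\<^sub>F t' in at t within J. kap t' = kap' t'"
   by (rule eventually_mono) (use t inj_L[OF U(1)] in \<open>auto simp: inj_on_def\<close>)
  then obtain T where T: "open T" "t \<in> T" "\<And>x. x \<in> T \<Longrightarrow> x \<noteq> t \<Longrightarrow> x \<in> J \<Longrightarrow> kap x = kap' x"
   unfolding eventually_at_topological by blast
  show "\<exists>T. openin (top_of_set J) T \<and> t \<in> T \<and> T \<subseteq> S"
   by (rule exI[of _ "J \<inter> T"]) (use T t in \<open>auto simp: S_def openin_open\<close>)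
 qed
 ultimately have "S = J" using J t0 unfolding connected_clopen S_def by blast
 then show ?thesis using t by (auto simp: S_def)
qed

lemma unit_speed_cong:
 assumes "unit_speed J kap" "\<And>t. t \<in> J \<Longrightarrow> kap' t = kap t"
 shows "unit_speed J kap'" unfolding unit_speed_def
proof (intro conjI ballI allI impI)
 show "cont_on J E kap'" by (rule continuous_map_eq[of _ _ kap]) (use assms in \<open>auto simp: unit_speed_def\<close>)
 fix t U l assume t: "t \<in> J" "(U, l) \<in> L" "kap' t \<in> U"
 then have "\<forall>\<^sub>F t' in at t within J. kap t' \<in> U \<and> l (kap t') - l (kap t) = t' - t"
  using assms unfolding unit_speed_def by simp
 then show "\<forall>\<^sub>F t' in at t within J. kap' t' \<in> U \<and> l (kap' t') - l (kap' t) = t' - t"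
  unfolding eventually_at_filter by (rule eventually_mono) (use assms(2) t in auto)
qed

lemma unit_speed_Un:
 assumes "closed J" "closed J'" "unit_speed J kap" "unit_speed J' kap"
 shows "unit_speed (J \<union> J') kap" unfolding unit_speed_def
proof (intro conjI ballI allI impI)
 show "cont_on (J \<union> J') E kap"
 proof (rule cmap_paste[of _ J J'])
  show "closedin (top_of_set (J \<union> J')) J" "closedin (top_of_set (J \<union> J')) J'"
   by (rule closedin_closed_subset[where U=UNIV]; use assms in auto)+
 qed (use assms in \<open>auto simp: unit_speed_def subtopology_subtopology Int_absorb1\<close>)
 fix t U l assume t: "t \<in> J \<union> J'" "(U, l) \<in> L" "kap t \<in> U"
 have "\<forall>\<^sub>F t' in at t within I. kap t' \<in> U \<and> l (kap t') - l (kap t) = t' - t" if "closed I" "unit_speed I kap" for I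
 proof (cases "t \<in> I")
  case False
  then have "at t within I = bot" using that closed_limpt trivial_limit_within trivial_limit_def by metis
  then show ?thesis by simp
 qed (use that t in \<open>auto simp: unit_speed_def\<close>)
 then show "\<forall>\<^sub>F t' in at t within J \<union> J'. kap t' \<in> U \<and> l (kap t') - l (kap t) = t' - t"
  unfolding at_within_union eventually_sup using assms by blast
qed

lemma unit_speed_flip:
 assumes "unit_speed {alp..bet} kap"
 shows "unit_speed {d - bet..d - alp} (\<lambda>t. sig (kap (d - t)))" unfolding unit_speed_def
proof (intro conjI ballI allI impI)
 have c: "cont_on {alp..bet} E kap" using assms by (simp add: unit_speed_def)
 have "cont_on {d - bet..d - alp} E (\<lambda>t. kap (d - t))"
  by (rule cmap_comp_on[OF _ _ c]) (auto intro!: continuous_intros)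
 from cmap_comp[OF this flip_continuous]
 show "cont_on {d - bet..d - alp} E (\<lambda>t. sig (kap (d - t)))" by (simp add: o_def)
 have top: "kap t \<in> topspace E" if "t \<in> {alp..bet}" for t using c that by (auto simp: continuous_map_def)
 fix t U l assume t: "t \<in> {d - bet..d - alp}" "(U, l) \<in> L" "sig (kap (d - t)) \<in> U"
 obtain U' l' where U': "(U', l') \<in> L" "\<And>y. y \<in> topspace E \<Longrightarrow> sig y \<in> U \<longleftrightarrow> y \<in> U'" "\<And>y. y \<in> U' \<Longrightarrow> l (sig y) = - l' y"
  using flip_L[OF t(2)] by blast
 have dt: "d - t \<in> {alp..bet}" using t by auto
 then have y: "kap (d - t) \<in> U'" using U'(2) t(3) top by blast
 then have "\<forall>\<^sub>F t' in at (d - t) within {alp..bet}. kap t' \<in> U' \<and> l' (kap t') - l' (kap (d - t)) = t' - (d - t)"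
  using assms dt U'(1) unfolding unit_speed_def by blast
 then obtain dlt where dlt: "dlt > 0" "\<And>t'. t' \<in> {alp..bet} \<Longrightarrow> t' \<noteq> d - t \<Longrightarrow> dist t' (d - t) < dlt \<Longrightarrow> kap t' \<in> U' \<and> l' (kap t') - l' (kap (d - t)) = t' - (d - t)"
  unfolding eventually_at by blast
 show "\<forall>\<^sub>F t' in at t within {d - bet..d - alp}. sig (kap (d - t')) \<in> U \<and> l (sig (kap (d - t'))) - l (sig (kap (d - t))) = t' - t"
  unfolding eventually_at
 proof (intro exI[of _ dlt] conjI ballI impI dlt(1))
  fix x assume x: "x \<in> {d - bet..d - alp}" "x \<noteq> t \<and> dist x t < dlt"
  then have x': "d - x \<in> {alp..bet}" "d - x \<noteq> d - t" "dist (d - x) (d - t) < dlt" by (auto simp: dist_real_def)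
  note 1 = dlt(2)[OF this]
  show "sig (kap (d - x)) \<in> U" using 1 U'(2) top[OF x'(1)] by blast
  show "l (sig (kap (d - x))) - l (sig (kap (d - t))) = x - t" using 1 U'(3) y by auto
 qed
qed

lemma unit_speed_shift:
 assumes "unit_speed {alp..bet} kap"
 shows "unit_speed {alp - d..bet - d} (\<lambda>t. kap (t + d))"
proof -
 have eq: "kap (t + d) = sig (sig (kap (0 - (- d - t))))" if "t \<in> {alp - d..bet - d}" for t
  using assms that flip(1)[of "kap (t + d)"] by (auto simp: unit_speed_def continuous_map_def Pi_iff add.commute)
 have "- d - (0 - alp) = alp - d" "- d - (0 - bet) = bet - d" by simp_all
 with unit_speed_flip[OF unit_speed_flip[OF assms, of 0], of "- d"]
 have "unit_speed {alp - d..bet - d} (\<lambda>t. sig (sig (kap (0 - (- d - t)))))" by simp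
 then show ?thesis by (rule unit_speed_cong) (rule eq)
qed

lemma unit_speed_glue:
 assumes u: "unit_speed {alp..bet} kap" "unit_speed {alp'..bet'} kap'" and s: "s \<in> {alp..bet}" "s \<in> {alp'..bet'}" "kap s = kap' s"
 shows "unit_speed {min alp alp'..max bet bet'} (\<lambda>t. if t \<in> {alp..bet} then kap t else kap' t)"
  and "t \<in> {alp..bet} \<Longrightarrow> t \<in> {alp'..bet'} \<Longrightarrow> kap t = kap' t"
proof -
 let ?J = "{alp..bet}" and ?J' = "{alp'..bet'}"
 let ?k = "\<lambda>t. if t \<in> ?J then kap t else kap' t"
 have sub: "unit_speed J k" if "unit_speed I k" "J \<subseteq> I" for I J k unfolding unit_speed_def
 proof (intro conjI ballI allI impI)
  show "cont_on J E k" by (rule cmap_mono[OF _ that(2)]) (use that(1) in \<open>simp add: unit_speed_def\<close>)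
  fix t U l assume "t \<in> J" "(U, l) \<in> L" "k t \<in> U"
  then have "\<forall>\<^sub>F t' in at t within I. k t' \<in> U \<and> l (k t') - l (k t) = t' - t"
   using that unfolding unit_speed_def by auto
  then show "\<forall>\<^sub>F t' in at t within J. k t' \<in> U \<and> l (k t') - l (k t) = t' - t"
   by (rule filter_leD[OF at_le[OF that(2)]])
 qed
 have ag: "kap t = kap' t" if "t \<in> ?J" "t \<in> ?J'" for t
 proof (rule unit_speed_unique[of "?J \<inter> ?J'"])
  show "connected (?J \<inter> ?J')" by simp
  show "unit_speed (?J \<inter> ?J') kap" "unit_speed (?J \<inter> ?J') kap'" by (rule sub[OF u(1)] sub[OF u(2)]; blast)+
 qed (use s that in auto)
 then show "t \<in> ?J \<Longrightarrow> t \<in> ?J' \<Longrightarrow> kap t = kap' t" by blast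
 have un: "{min alp alp'..max bet bet'} = ?J \<union> ?J'" using s by auto
 have "unit_speed (?J \<union> ?J') ?k"
  by (intro unit_speed_Un unit_speed_cong[OF u(1)] unit_speed_cong[OF u(2)]) (use ag in auto)
 then show "unit_speed {min alp alp'..max bet bet'} ?k" unfolding un .
qed

text \<open>The orbit relation of the unit speed flow, defined by curves because the flow need not be complete.\<close>

definition on_curve :: "'b \<Rightarrow> 'b \<Rightarrow> bool" where
 "on_curve y z \<longleftrightarrow> (\<exists>alp bet kap s t. unit_speed {alp..bet} kap \<and> s \<in> {alp..bet} \<and> t \<in> {alp..bet} \<and> kap s = y \<and> kap t = z)"

lemma on_curve_sym: "on_curve y z \<Longrightarrow> on_curve z y" unfolding on_curve_def by blast

lemma on_curve_trans:
 assumes "on_curve x y" "on_curve y z" shows "on_curve x z"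
proof -
 obtain alp bet kap s t where 1: "unit_speed {alp..bet} kap" "s \<in> {alp..bet}" "t \<in> {alp..bet}" "kap s = x" "kap t = y"
  using assms(1) unfolding on_curve_def by blast
 obtain alp' bet' kap' s' t' where 2: "unit_speed {alp'..bet'} kap'" "s' \<in> {alp'..bet'}" "t' \<in> {alp'..bet'}" "kap' s' = y" "kap' t' = z"
  using assms(2) unfolding on_curve_def by blast
 let ?d = "s' - t"
 let ?k = "\<lambda>u. kap' (u + ?d)"
 note 3 = unit_speed_shift[OF 2(1), of ?d]
 have "t \<in> {alp' - ?d..bet' - ?d}" "kap t = ?k t" using 1 2 by auto
 note g = unit_speed_glue[OF 1(1) 3 1(3) this]
 let ?g = "\<lambda>u. if u \<in> {alp..bet} then kap u else ?k u"
 have "?g s = x" using 1 by simp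
 moreover have "?g (t' - ?d) = z"
 proof (cases "t' - ?d \<in> {alp..bet}")
  case True
  then have "kap (t' - ?d) = ?k (t' - ?d)" using 2 by (intro g(2)) auto
  then show ?thesis using True 2 by simp
 next
  case False
  then have "?g (t' - ?d) = kap' t'" unfolding if_not_P[OF False] by simp
  then show ?thesis using 2 by simp
 qed
 moreover have "s \<in> {min alp (alp' - ?d)..max bet (bet' - ?d)}" "t' - ?d \<in> {min alp (alp' - ?d)..max bet (bet' - ?d)}"
  using 1 2 by auto
 ultimately show ?thesis unfolding on_curve_def using g(1) by blast
qed

lemma on_curve_local:
 assumes U: "(U, l) \<in> L" and z: "z \<in> U" "z' \<in> U"
 shows "on_curve z z'"
proof -
 obtain alp bet kap where k: "cont_on {alp..bet} E kap" "\<And>t. t\<in>{alp..bet} \<Longrightarrow> kap t \<in> U \<and> l (kap t) = t"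
  "z \<in> kap ` {alp..bet}" "z' \<in> kap ` {alp..bet}" using arc_L[OF U z] by blast
 have "unit_speed {alp..bet} kap" unfolding unit_speed_def
 proof (intro conjI ballI allI impI k(1))
  fix t U' l' assume t: "t \<in> {alp..bet}" "(U', l') \<in> L" "kap t \<in> U'"
  obtain W where W: "openin E W" "kap t \<in> W" "W \<subseteq> U \<inter> U'" "\<And>z. z \<in> W \<Longrightarrow> l' z - l z = l' (kap t) - l (kap t)"
   using compat_L[OF U t(2) _ t(3)] k(2)[OF t(1)] by blast
  have "openin (top_of_set {alp..bet}) {x \<in> {alp..bet}. kap x \<in> W}" using open_preim[OF k(1) W(1)] by simp
  then obtain T where T: "open T" "{x \<in> {alp..bet}. kap x \<in> W} = {alp..bet} \<inter> T" unfolding openin_open by blast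
  show "\<forall>\<^sub>F t' in at t within {alp..bet}. kap t' \<in> U' \<and> l' (kap t') - l' (kap t) = t' - t"
   unfolding eventually_at_topological
  proof (intro exI[of _ T] conjI ballI impI)
   show "open T" "t \<in> T" using T W t by auto
   fix x assume x: "x \<in> T" "x \<in> {alp..bet}"
   then have xW: "kap x \<in> W" using T by blast
   then show "kap x \<in> U'" using W(3) by blast
   show "l' (kap x) - l' (kap t) = x - t" using W(4)[OF xW] k(2)[OF x(2)] k(2)[OF t(1)] by simp
  qed
 qed
 then show ?thesis unfolding on_curve_def using k(3,4) by blast
qed

text \<open>A path from \<open>y\<close> to \<open>sig y\<close> stays in one orbit, since orbits are open. The reversed image under \<open>sig\<close> of the
 curve from \<open>y\<close> to \<open>sig y\<close> is again such a curve, so both agree, and \<open>sig\<close> fixes the midpoint.\<close>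

lemma no_flipping_path:
 assumes mu: "cont_on {0..1::real} E mu"
 shows "mu 1 \<noteq> sig (mu 0)"
proof
 assume 1: "mu 1 = sig (mu 0)"
 have top: "mu t \<in> topspace E" if "t \<in> {0..1}" for t using mu that by (auto simp: continuous_map_def)
 have "on_curve (mu 0) (mu 1)"
 proof (rule connected_equivalence_relation[of "{0..1::real}" 0 1 "\<lambda>s t. on_curve (mu s) (mu t)"])
  fix t :: real assume t: "t \<in> {0..1}"
  obtain U l where U: "(U, l) \<in> L" "mu t \<in> U" using cover_L[OF top[OF t]] by blast
  have "openin (top_of_set {0..1}) {x \<in> {0..1}. mu x \<in> U}" using open_preim[OF mu open_L[OF U(1)]] by simp
  then show "\<exists>T. openin (top_of_set {0..1}) T \<and> t \<in> T \<and> (\<forall>x\<in>T. on_curve (mu t) (mu x))"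
   using on_curve_local[OF U(1)] U(2) t by blast
 next
  show "on_curve (mu y) (mu x)" if "on_curve (mu x) (mu y)" for x y using that by (rule on_curve_sym)
  show "on_curve (mu x) (mu z)" if "on_curve (mu x) (mu y)" "on_curve (mu y) (mu z)" for x y z using that by (rule on_curve_trans)
 qed auto
 then obtain alp bet kap s t where k: "unit_speed {alp..bet} kap" "s \<in> {alp..bet}" "t \<in> {alp..bet}" "kap s = mu 0" "kap t = sig (mu 0)"
  unfolding on_curve_def 1 by blast
 note f = unit_speed_flip[OF k(1), of "s + t"]
 have "t \<in> {s + t - bet..s + t - alp}" "kap t = sig (kap (s + t - t))" using k by auto
 note g = unit_speed_glue(2)[OF k(1) f k(3) this, of "(s + t) / 2"]
 have m: "(s + t) / 2 \<in> {alp..bet}" "(s + t) / 2 \<in> {s + t - bet..s + t - alp}" using k(2,3) by (auto simp: field_simps)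
 have e: "s + t - (s + t) / 2 = (s + t) / 2" by (simp add: field_simps)
 have "kap ((s + t) / 2) = sig (kap ((s + t) / 2))" using g[OF m] unfolding e .
 moreover have "kap ((s + t) / 2) \<in> topspace E" using k(1) m(1) by (auto simp: unit_speed_def continuous_map_def)
 ultimately show False using flip(2) by metis
qed

end


context riem_mfd
begin

definition reverse :: "'a \<times> (('a, 'e) chart \<Rightarrow> 'e) \<Rightarrow> 'a \<times> (('a, 'e) chart \<Rightarrow> 'e)" where
 "reverse z = (fst z, \<lambda>d. - snd z d)"

lemma reverse_unit_vec:
 assumes "c \<in> A" "p \<in> chart_dom c" shows "reverse (p, unit_vec c p w) = (p, unit_vec c p (- w))"
proof -
 have g: "gsq c p (- w) = gsq c p w" using gsq_scale[OF assms, of "-1" w] by simp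
 have "unit_vec c p (- w) = coord_vec A c p ((- 1) *\<^sub>R (w /\<^sub>R sqrt (gsq c p w)))" by (simp add: unit_vec_def g)
 also have "\<dots> = (\<lambda>d. (- 1) *\<^sub>R unit_vec c p w d)" unfolding coord_vec_linear[OF assms] unit_vec_def ..
 finally show ?thesis by (simp add: reverse_def)
qed

lemma reverse_ST:
 assumes "z \<in> topspace ST" "c \<in> A" "fst z \<in> chart_dom c"
 shows "reverse z = (fst z, unit_vec c (fst z) (- snd z c))"
proof -
 have "(fst z, snd z) \<in> topspace ST" using assms by simp
 from ST_vec(4)[OF this assms(2,3)] show ?thesis using reverse_unit_vec[OF assms(2,3), of "snd z c"] by simp
qed

lemma reverse_in_ST: "z \<in> topspace ST \<Longrightarrow> reverse z \<in> topspace ST"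
proof -
 assume z: "z \<in> topspace ST"
 then have "fst z \<in> topspace X" by (auto simp: topspace_ST)
 then obtain c where c: "c \<in> A" "fst z \<in> chart_dom c" using chart_cover by blast
 have "snd z c \<noteq> 0" using ST_vec(3)[of "fst z" "snd z" c] z c by simp
 then show ?thesis unfolding reverse_ST[OF z c] by (intro unit_vec_ST(1) c) simp
qed

lemma reverse_continuous: "continuous_map ST ST reverse" unfolding reverse_def[abs_def]
proof (rule continuous_map_ST[OF ST_fst_continuous])
 show "(fst z, \<lambda>d. - snd z d) \<in> topspace ST" if "z \<in> topspace ST" for z
  using reverse_in_ST[OF that] by (simp add: reverse_def)
 fix z assume z: "z \<in> topspace ST"
 then have "fst z \<in> topspace X" by (auto simp: topspace_ST)
 then obtain c where c: "c \<in> A" "fst z \<in> chart_dom c" using chart_cover by blast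
 let ?Q = "{z \<in> topspace ST. fst z \<in> chart_dom c}"
 have Q: "openin ST ?Q" by (rule open_preim[OF ST_fst_continuous chart_open[OF c(1)]])
 have "continuous_map (subtopology ST ?Q) euclidean (\<lambda>z. snd z c)"
  by (rule continuous_map_ST_coord[OF c(1)]) (auto intro: cmap_restrict)
 then have "continuous_map (subtopology ST ?Q) euclidean (\<lambda>z. - snd z c)" by (rule continuous_map_minus)
 then show "\<exists>Q c. openin ST Q \<and> z \<in> Q \<and> c \<in> A \<and> (\<forall>z'\<in>Q. fst z' \<in> chart_dom c) \<and>
   continuous_map (subtopology ST Q) euclidean (\<lambda>z. - snd z c)" using c z Q by (intro exI[of _ ?Q] exI[of _ c]) auto
qed

lemma ST_Hausdorff: "Hausdorff_space ST" unfolding Hausdorff_space_def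
proof (intro allI impI)
 fix y z assume yz: "y \<in> topspace ST \<and> z \<in> topspace ST \<and> y \<noteq> z"
 then have X: "fst y \<in> topspace X" "fst z \<in> topspace X" by (auto simp: topspace_ST)
 show "\<exists>U V. openin ST U \<and> openin ST V \<and> y \<in> U \<and> z \<in> V \<and> disjnt U V"
 proof (cases "fst y = fst z")
  case False
  then obtain U V where UV: "openin X U" "openin X V" "fst y \<in> U" "fst z \<in> V" "disjnt U V"
   using Hausdorff X unfolding Hausdorff_space_def by blast
  show ?thesis by (intro exI[of _ "{e \<in> topspace ST. fst e \<in> U}"] exI[of _ "{e \<in> topspace ST. fst e \<in> V}"] conjI
    open_preim[OF ST_fst_continuous] UV(1,2)) (use UV yz in \<open>auto simp: disjnt_iff\<close>)
 next
  case True
  obtain c where c: "c \<in> A" "fst y \<in> chart_dom c" using chart_cover X by blast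
  have "snd y c \<noteq> snd z c"
  proof
   assume e: "snd y c = snd z c"
   have "snd y = snd z"
    using ST_vec(1)[of "fst y" "snd y" c] ST_vec(1)[of "fst z" "snd z" c] yz c True e by (metis prod.collapse)
   then show False using yz True by (metis prod.collapse)
  qed
  then obtain U V where UV: "open U" "open V" "snd y c \<in> U" "snd z c \<in> V" "U \<inter> V = {}" by (metis hausdorff)
  let ?Q = "{z \<in> topspace ST. fst z \<in> chart_dom c}"
  have Q: "openin ST ?Q" by (rule open_preim[OF ST_fst_continuous chart_open[OF c(1)]])
  have cc: "continuous_map (subtopology ST ?Q) euclidean (\<lambda>z. snd z c)"
   by (rule continuous_map_ST_coord[OF c(1)]) (auto intro: cmap_restrict)
  have o: "openin ST {e \<in> ?Q. snd e c \<in> W}" if "open W" for W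
  proof -
   have "openin (subtopology ST ?Q) {e \<in> topspace (subtopology ST ?Q). snd e c \<in> W}"
    by (rule open_preim[OF cc]) (use that in simp)
   then have "openin ST {e \<in> topspace (subtopology ST ?Q). snd e c \<in> W}" using openin_trans_full[OF _ Q] by blast
   moreover have "{e \<in> topspace (subtopology ST ?Q). snd e c \<in> W} = {e \<in> ?Q. snd e c \<in> W}" by auto
   ultimately show ?thesis by simp
  qed
  show ?thesis by (intro exI[of _ "{e \<in> ?Q. snd e c \<in> U}"] exI[of _ "{e \<in> ?Q. snd e c \<in> V}"] conjI o UV(1,2))
    (use UV yz c True in \<open>auto simp: disjnt_iff\<close>)
 qed
qed

end

locale riem_line = riem_mfd X A g for X :: "'a topology" and A :: "('a, 'e::euclidean_space) chart set" and g +
 fixes u :: 'e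
 assumes Bu: "Basis = {u}"
begin

lemma u_scale: "(w \<bullet> u) *\<^sub>R u = w"
proof -
 have "(\<Sum>b\<in>Basis. (w \<bullet> b) *\<^sub>R b) = w" by (rule euclidean_representation)
 then show ?thesis by (simp add: Bu)
qed

lemma uu: "u \<bullet> u = 1" "u \<noteq> 0" "norm u = 1"
proof -
 have "u \<in> Basis" by (simp add: Bu)
 then show "u \<bullet> u = 1" "u \<noteq> 0" "norm u = 1" by (auto simp: inner_same_Basis)
qed

definition speed :: "('a, 'e) chart \<Rightarrow> real \<Rightarrow> real" where
 "speed c xi = sqrt (gsq c (chart_inv c (xi *\<^sub>R u)) u)"

definition arc_point :: "('a, 'e) chart \<Rightarrow> real \<Rightarrow> real \<Rightarrow> 'a \<times> (('a, 'e) chart \<Rightarrow> 'e)" where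
 "arc_point c eps xi = (chart_inv c (xi *\<^sub>R u), unit_vec c (chart_inv c (xi *\<^sub>R u)) (eps *\<^sub>R u))"

definition arc_length :: "('a, 'e) chart \<Rightarrow> real \<Rightarrow> real \<Rightarrow> (real \<Rightarrow> real) \<Rightarrow> bool" where
 "arc_length c alp bet Lam \<longleftrightarrow> (\<forall>xi\<in>{alp<..<bet}. xi *\<^sub>R u \<in> snd c ` chart_dom c \<and> (Lam has_real_derivative speed c xi) (at xi))"

text \<open>The sign \<open>eps\<close> selects the vectors that point in the direction \<open>eps *\<^sub>R u\<close>; on these, arc length in their
 direction is \<open>eps * Lam\<close>.\<close>

definition arcs :: "(('a \<times> (('a, 'e) chart \<Rightarrow> 'e)) set \<times> ('a \<times> (('a, 'e) chart \<Rightarrow> 'e) \<Rightarrow> real)) set" where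
 "arcs = {(arc_point c eps ` {alp<..<bet}, \<lambda>z. eps * Lam (snd c (fst z) \<bullet> u)) | c eps alp bet Lam. c \<in> A \<and> eps \<in> {1, -1} \<and> arc_length c alp bet Lam}"

lemma arc_point_coord: "xi *\<^sub>R u \<in> snd c ` chart_dom c \<Longrightarrow> snd c (fst (arc_point c eps xi)) \<bullet> u = xi"
 by (simp add: arc_point_def chart_chart_inv uu)

lemma arc_point_ST:
 "c \<in> A \<Longrightarrow> eps \<noteq> 0 \<Longrightarrow> xi *\<^sub>R u \<in> snd c ` chart_dom c \<Longrightarrow> arc_point c eps xi \<in> topspace ST"
 unfolding arc_point_def by (rule unit_vec_ST(1)) (auto simp: chart_inv_in uu)

lemma arc_point_continuous:
 assumes "c \<in> A" "eps \<noteq> 0" "\<And>xi. xi \<in> J \<Longrightarrow> xi *\<^sub>R u \<in> snd c ` chart_dom c"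
 shows "cont_on J ST (arc_point c eps)" unfolding arc_point_def[abs_def]
proof (rule unit_vec_continuous[OF _ assms(1)])
 show "cont_on J X (\<lambda>xi. chart_inv c (xi *\<^sub>R u))"
  by (rule cmap_comp_on[OF _ _ chart_inv_continuous[OF assms(1)]]) (use assms(3) in \<open>auto intro!: continuous_intros\<close>)
qed (use assms uu in \<open>auto simp: chart_inv_in\<close>)

lemma arc_point_eqI:
 assumes "z \<in> topspace ST" "c \<in> A" "fst z \<in> chart_dom c" "eps \<in> {1, -1}" "eps * (snd z c \<bullet> u) > 0"
 shows "z = arc_point c eps (snd c (fst z) \<bullet> u)"
proof -
 have z: "(fst z, snd z) \<in> topspace ST" using assms by simp
 have "snd z = unit_vec c (fst z) (snd z c)" using ST_vec(4)[OF z assms(2,3)] by simp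
 also have "snd z c = (eps * (snd z c \<bullet> u)) *\<^sub>R (eps *\<^sub>R u)" using assms(4) u_scale[of "snd z c"] by auto
 also have "unit_vec c (fst z) \<dots> = unit_vec c (fst z) (eps *\<^sub>R u)" by (rule unit_vec_scale[OF assms(2,3,5)])
 finally show ?thesis by (simp add: arc_point_def u_scale chart_inv_chart[OF assms(2,3)] prod_eq_iff)
qed

lemma arc_point_sign:
 assumes "c \<in> A" "eps \<in> {1, -1}" "xi *\<^sub>R u \<in> snd c ` chart_dom c"
 shows "eps * (snd (arc_point c eps xi) c \<bullet> u) > 0"
proof -
 have p: "chart_inv c (xi *\<^sub>R u) \<in> chart_dom c" by (rule chart_inv_in[OF assms(3)])
 have e: "eps *\<^sub>R u \<noteq> 0" using assms uu by auto
 show ?thesis using unit_vec_ST(2)[OF assms(1) p e] gsq_pos[OF assms(1) p e] assms(2) uu by (auto simp: arc_point_def)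
qed

lemma arc_open:
 assumes c: "c \<in> A" and e: "eps \<in> {1, -1}" and J: "\<And>xi. xi \<in> {alp<..<bet} \<Longrightarrow> xi *\<^sub>R u \<in> snd c ` chart_dom c"
 shows "openin ST (arc_point c eps ` {alp<..<bet})"
proof -
 let ?Q = "{z \<in> topspace ST. fst z \<in> chart_dom c}"
 have Q: "openin ST ?Q" by (rule open_preim[OF ST_fst_continuous chart_open[OF c]])
 have 1: "continuous_map (subtopology ST ?Q) euclidean (\<lambda>z. snd z c)"
  by (rule continuous_map_ST_coord[OF c]) (auto intro: cmap_restrict)
 have "continuous_map (subtopology ST ?Q) (subtopology X (chart_dom c)) fst"
  using ST_fst_continuous by (auto simp: into_sub intro: cmap_restrict)
 from cmap_comp[OF this chart_cont[OF c]]
 have 2: "continuous_map (subtopology ST ?Q) euclidean (\<lambda>z. snd c (fst z))" by (simp add: o_def)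
 have "continuous_map (subtopology ST ?Q) (prod_topology euclidean euclidean) (\<lambda>z. (snd z c, snd c (fst z)))"
  using 1 2 by (intro continuous_map_pairedI)
 then have 3: "continuous_map (subtopology ST ?Q) euclidean (\<lambda>z. (snd z c, snd c (fst z)))" by simp
 have o: "open {w :: 'e \<times> 'e. eps * (fst w \<bullet> u) > 0 \<and> snd w \<bullet> u > alp \<and> snd w \<bullet> u < bet}"
  by (intro open_Collect_conj open_Collect_less continuous_intros)
 have "openin (subtopology ST ?Q) {z \<in> topspace (subtopology ST ?Q). (snd z c, snd c (fst z)) \<in> {w. eps * (fst w \<bullet> u) > 0 \<and> snd w \<bullet> u > alp \<and> snd w \<bullet> u < bet}}"
  by (rule open_preim[OF 3]) (use o in simp)
 from openin_trans_full[OF this Q]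
 have "openin ST {z \<in> topspace (subtopology ST ?Q). (snd z c, snd c (fst z)) \<in> {w. eps * (fst w \<bullet> u) > 0 \<and> snd w \<bullet> u > alp \<and> snd w \<bullet> u < bet}}" .
 moreover have "{z \<in> topspace (subtopology ST ?Q). (snd z c, snd c (fst z)) \<in> {w. eps * (fst w \<bullet> u) > 0 \<and> snd w \<bullet> u > alp \<and> snd w \<bullet> u < bet}}
  = arc_point c eps ` {alp<..<bet}" (is "?L = ?R")
 proof
  show "?L \<subseteq> ?R"
  proof
   fix z assume "z \<in> ?L"
   then have z: "z \<in> topspace ST" "fst z \<in> chart_dom c" "eps * (snd z c \<bullet> u) > 0" "snd c (fst z) \<bullet> u \<in> {alp<..<bet}" by auto
   show "z \<in> ?R" using arc_point_eqI[OF z(1) c z(2) e z(3)] z(4) by blast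
  qed
  show "?R \<subseteq> ?L"
  proof
   fix z assume "z \<in> ?R"
   then obtain xi where x: "xi \<in> {alp<..<bet}" "z = arc_point c eps xi" by blast
   have "fst z \<in> chart_dom c" using x chart_inv_in[OF J[OF x(1)]] by (simp add: arc_point_def)
   then show "z \<in> ?L" using arc_point_coord[OF J[OF x(1)]] arc_point_sign[OF c e J[OF x(1)]] arc_point_ST[OF c _ J[OF x(1)], of eps] x e by auto
  qed
 qed
 ultimately show ?thesis by simp
qed

lemma speed_pos: "c \<in> A \<Longrightarrow> xi *\<^sub>R u \<in> snd c ` chart_dom c \<Longrightarrow> speed c xi > 0"
 unfolding speed_def by (simp add: gsq_pos chart_inv_in uu)

lemma arc_length_mono:
 assumes c: "c \<in> A" and L: "arc_length c alp bet Lam" and x: "xi \<in> {alp<..<bet}" "xi' \<in> {alp<..<bet}" "xi < xi'"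
 shows "Lam xi < Lam xi'"
proof (rule DERIV_pos_imp_increasing[OF x(3)])
 fix t assume "xi \<le> t" "t \<le> xi'"
 then have t: "t \<in> {alp<..<bet}" using x by auto
 then show "\<exists>y. DERIV Lam t :> y \<and> 0 < y" using L speed_pos[OF c] unfolding arc_length_def by blast
qed

lemma arc_length_inj: "c \<in> A \<Longrightarrow> arc_length c alp bet Lam \<Longrightarrow> inj_on Lam {alp<..<bet}"
 using arc_length_mono by (metis inj_onI linorder_neqE_linordered_idom less_irrefl)

lemma arcs_cover:
 assumes y: "y \<in> topspace ST" shows "\<exists>U l. (U, l) \<in> arcs \<and> y \<in> U"
proof -
 obtain c where c: "c \<in> A" "fst y \<in> chart_dom c" using chart_cover y by (fastforce simp: topspace_ST)
 have "snd y c \<noteq> 0" using ST_vec(3)[of "fst y" "snd y" c] y c by simp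
 then have ne: "snd y c \<bullet> u \<noteq> 0" using u_scale[of "snd y c"] by auto
 define eps :: real where "eps = (if snd y c \<bullet> u > 0 then 1 else -1)"
 have e: "eps \<in> {1, -1}" "eps * (snd y c \<bullet> u) > 0" using ne by (auto simp: eps_def)
 let ?x = "snd c (fst y) \<bullet> u"
 have "open {xi. xi *\<^sub>R u \<in> snd c ` chart_dom c}"
  using open_vimage[OF chart_image_open[OF c(1)] continuous_on_scaleR[OF continuous_on_id continuous_on_const], of u] by (simp add: vimage_def)
 moreover have "?x \<in> {xi. xi *\<^sub>R u \<in> snd c ` chart_dom c}" using c by (simp add: u_scale)
 ultimately obtain dlt where d: "dlt > 0" "cball ?x dlt \<subseteq> {xi. xi *\<^sub>R u \<in> snd c ` chart_dom c}"
  using open_contains_cball by blast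
 let ?J = "{?x - dlt..?x + dlt}"
 have J: "xi *\<^sub>R u \<in> snd c ` chart_dom c" if "xi \<in> ?J" for xi using d(2) that by (auto simp: cball_eq_atLeastAtMost)
 have "cont_on ?J euclidean (\<lambda>xi. gsq c (chart_inv c (xi *\<^sub>R u)) u)"
 proof (rule gsq_continuous[OF c(1)])
  show "cont_on ?J X (\<lambda>xi. chart_inv c (xi *\<^sub>R u))"
   by (rule cmap_comp_on[OF _ _ chart_inv_continuous[OF c(1)]]) (use J in \<open>auto intro!: continuous_intros\<close>)
 qed (use J in \<open>auto simp: chart_inv_in\<close>)
 then have "continuous_on ?J (speed c)" unfolding speed_def[abs_def] by (auto intro!: continuous_intros)
 then obtain Lam where L: "\<And>x. x \<in> ?J \<Longrightarrow> (Lam has_vector_derivative speed c x) (at x within ?J)"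
  using antiderivative_continuous by blast
 have "arc_length c (?x - dlt) (?x + dlt) Lam" unfolding arc_length_def
 proof (intro ballI conjI)
  fix xi assume x: "xi \<in> {?x - dlt<..<?x + dlt}"
  show "xi *\<^sub>R u \<in> snd c ` chart_dom c" using J x by simp
  have "at xi within ?J = at xi" by (rule at_within_interior) (use x in simp)
  then show "(Lam has_real_derivative speed c xi) (at xi)" using L[of xi] x by (simp add: has_real_derivative_iff_has_vector_derivative)
 qed
 then have "(arc_point c eps ` {?x - dlt<..<?x + dlt}, \<lambda>z. eps * Lam (snd c (fst z) \<bullet> u)) \<in> arcs"
  unfolding arcs_def using c(1) e(1) by blast
 moreover have "y \<in> arc_point c eps ` {?x - dlt<..<?x + dlt}"
  using arc_point_eqI[OF y c e] d(1) by (intro image_eqI[of y _ ?x]) auto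
 ultimately show ?thesis by blast
qed

lemma arcs_curve:
 assumes c: "c \<in> A" and e: "eps \<in> {1, -1}" and L: "arc_length c alp bet Lam"
  and x: "xi1 \<in> {alp<..<bet}" "xi2 \<in> {alp<..<bet}" "xi1 \<le> xi2"
 shows "\<exists>s t kap. cont_on {s..t} ST kap \<and> (\<forall>tau\<in>{s..t}. kap tau \<in> arc_point c eps ` {alp<..<bet} \<and> eps * Lam (snd c (fst (kap tau)) \<bullet> u) = tau)
  \<and> arc_point c eps xi1 \<in> kap ` {s..t} \<and> arc_point c eps xi2 \<in> kap ` {s..t}"
proof -
 let ?K = "{xi1..xi2}"
 let ?f = "\<lambda>xi. eps * Lam xi"
 have K: "?K \<subseteq> {alp<..<bet}" using x by auto
 have "continuous_on {alp<..<bet} Lam" using L unfolding arc_length_def by (intro DERIV_continuous_on) (auto intro: has_field_derivative_at_within)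
 then have f: "continuous_on ?K ?f" using K by (auto intro!: continuous_intros intro: continuous_on_subset)
 have "inj_on ?f ?K" using arc_length_inj[OF c L] K e by (auto simp: inj_on_def)
 then have inv: "inv_into ?K ?f (?f xi) = xi" if "xi \<in> ?K" for xi using that by (rule inv_into_f_f)
 have g: "continuous_on (?f ` ?K) (inv_into ?K ?f)" by (rule continuous_on_inv[OF f]) (use inv in auto)
 have "connected (?f ` ?K)" "compact (?f ` ?K)" using f by (auto intro: connected_continuous_image compact_continuous_image)
 then obtain s t where st: "?f ` ?K = {s..t}" using connected_compact_interval_1 by (metis box_real(2))
 have gK: "inv_into ?K ?f tau \<in> ?K" "?f (inv_into ?K ?f tau) = tau" if "tau \<in> {s..t}" for tau
  using that unfolding st[symmetric] by (rule inv_into_into, rule f_inv_into_f)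
 have J: "xi *\<^sub>R u \<in> snd c ` chart_dom c" if "xi \<in> ?K" for xi using that K L unfolding arc_length_def by blast
 let ?k = "\<lambda>tau. arc_point c eps (inv_into ?K ?f tau)"
 have "cont_on {s..t} ST ?k"
 proof (rule cmap_comp_on[OF _ _ arc_point_continuous[OF c _ J]])
  show "continuous_on {s..t} (inv_into ?K ?f)" using g by (simp only: st)
  show "inv_into ?K ?f \<in> {s..t} \<rightarrow> ?K" using gK(1) by blast
 qed (use e in auto)
 moreover have "\<forall>tau\<in>{s..t}. ?k tau \<in> arc_point c eps ` {alp<..<bet} \<and> eps * Lam (snd c (fst (?k tau)) \<bullet> u) = tau"
 proof
  fix tau assume t: "tau \<in> {s..t}"
  show "?k tau \<in> arc_point c eps ` {alp<..<bet} \<and> eps * Lam (snd c (fst (?k tau)) \<bullet> u) = tau"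
   using gK(2)[OF t] subsetD[OF K gK(1)[OF t]] by (simp add: arc_point_coord[OF J[OF gK(1)[OF t]]])
 qed
 moreover have "arc_point c eps xi \<in> ?k ` {s..t}" if "xi \<in> ?K" for xi
  by (rule image_eqI[of _ _ "?f xi"]) (use inv[OF that] that in \<open>auto simp: st[symmetric]\<close>)
 ultimately show ?thesis using x(3) by (intro exI[of _ s] exI[of _ t] exI[of _ ?k]) auto
qed

lemma arcs_compat:
 assumes c: "c \<in> A" "c' \<in> A" and e: "eps \<in> {1, -1}" "eps' \<in> {1, -1}" and L: "arc_length c alp bet Lam" "arc_length c' alp' bet' Lam'"
  and y: "y \<in> arc_point c eps ` {alp<..<bet}" "y \<in> arc_point c' eps' ` {alp'<..<bet'}"
 shows "\<exists>W. openin ST W \<and> y \<in> W \<and> W \<subseteq> arc_point c eps ` {alp<..<bet} \<inter> arc_point c' eps' ` {alp'<..<bet'} \<and>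
  (\<forall>z\<in>W. eps' * Lam' (snd c' (fst z) \<bullet> u) - eps * Lam (snd c (fst z) \<bullet> u) = eps' * Lam' (snd c' (fst y) \<bullet> u) - eps * Lam (snd c (fst y) \<bullet> u))"
proof -
 let ?U' = "arc_point c' eps' ` {alp'<..<bet'}" and ?m = "arc_point c eps"
 obtain xi0 where x0: "xi0 \<in> {alp<..<bet}" "y = ?m xi0" using y(1) by blast
 have J: "xi *\<^sub>R u \<in> snd c ` chart_dom c" if "xi \<in> {alp<..<bet}" for xi using L(1) that unfolding arc_length_def by blast
 have J': "xi *\<^sub>R u \<in> snd c' ` chart_dom c'" if "xi \<in> {alp'<..<bet'}" for xi using L(2) that unfolding arc_length_def by blast
 have "cont_on {alp<..<bet} ST ?m" by (rule arc_point_continuous[OF c(1) _ J]) (use e in auto)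
 from open_preim[OF this arc_open[OF c(2) e(2) J']]
 have "openin (top_of_set {alp<..<bet}) {xi \<in> {alp<..<bet}. ?m xi \<in> ?U'}" by simp
 then have "open {xi \<in> {alp<..<bet}. ?m xi \<in> ?U'}" by (rule openin_open_trans) simp
 moreover have "xi0 \<in> {xi \<in> {alp<..<bet}. ?m xi \<in> ?U'}" using x0 y(2) by simp
 ultimately obtain dlt where d: "dlt > 0" "ball xi0 dlt \<subseteq> {xi \<in> {alp<..<bet}. ?m xi \<in> ?U'}"
  unfolding open_contains_ball by meson
 let ?I = "{xi0 - dlt<..<xi0 + dlt}"
 have I: "xi \<in> {alp<..<bet}" "?m xi \<in> ?U'" if "xi \<in> ?I" for xi using d(2) that by (auto simp: ball_eq_greaterThanLessThan)
 let ?D = "\<lambda>xi. eps' * Lam' (snd c' (fst (?m xi)) \<bullet> u) - eps * Lam xi"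
 have "\<exists>C. \<forall>xi\<in>?I. ?D xi = C"
 proof (rule has_field_derivative_zero_constant)
  fix xi assume xI: "xi \<in> ?I"
  note x = I(1)[OF xI] and Jx = J[OF I(1)[OF xI]]
  let ?p = "chart_inv c (xi *\<^sub>R u)"
  obtain eta where eta: "eta \<in> {alp'<..<bet'}" "?m xi = arc_point c' eps' eta" using I(2)[OF xI] by blast
  have p: "?p \<in> chart_dom c" by (rule chart_inv_in[OF Jx])
  have p': "?p \<in> chart_dom c'" using eta chart_inv_in[OF J'[OF eta(1)]] by (simp add: arc_point_def)
  have cp: "snd c ?p = xi *\<^sub>R u" by (rule chart_chart_inv[OF Jx])
  have eta': "eta = snd c' ?p \<bullet> u" using arc_point_coord[OF J'[OF eta(1)], of eps'] eta(2) by (simp add: arc_point_def)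
  have pe: "chart_inv c' (eta *\<^sub>R u) = ?p" using eta(2) by (simp add: arc_point_def)
  define D where "D = DT c c' ?p u \<bullet> u"
  have T: "(transition c c' has_derivative DT c c' ?p) (at (xi *\<^sub>R u))" using DT_derivative[OF c p p'] by (simp add: cp)
  have "((\<lambda>xi. transition c c' (xi *\<^sub>R u) \<bullet> u) has_derivative (\<lambda>h. DT c c' ?p (h *\<^sub>R u) \<bullet> u)) (at xi)"
   by (rule has_derivative_inner_left[OF has_derivative_compose[of "\<lambda>xi::real. xi *\<^sub>R u" "\<lambda>h. h *\<^sub>R u" xi UNIV, OF _ T]]) (auto intro!: derivative_eq_intros)
  moreover have "(\<lambda>h. DT c c' ?p (h *\<^sub>R u) \<bullet> u) = (*) D"
   using linear_cmul[OF DT_linear[OF c p p']] by (auto simp: D_def)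
  ultimately have psi: "((\<lambda>xi. transition c c' (xi *\<^sub>R u) \<bullet> u) has_real_derivative D) (at xi)"
   by (simp add: has_field_derivative_def)
  have tr: "transition c c' (xi *\<^sub>R u) = snd c' (fst (?m xi))" for xi by (simp add: transition_def arc_point_def)
  have "(Lam' has_real_derivative speed c' eta) (at (transition c c' (xi *\<^sub>R u) \<bullet> u))"
   using L(2) eta(1) eta' unfolding arc_length_def tr by (simp add: arc_point_def)
  from DERIV_chain2[OF this psi]
  have 1: "((\<lambda>xi. Lam' (snd c' (fst (?m xi)) \<bullet> u)) has_real_derivative speed c' eta * D) (at xi)" unfolding tr .
  have D: "DT c c' ?p u = D *\<^sub>R u" using u_scale[of "DT c c' ?p u"] by (simp add: D_def)
  \<comment> \<open>the metric does not depend on the chart\<close>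
  have "coord_vec A c' ?p (DT c c' ?p u) = coord_vec A c ?p u"
   using coord_vec_tangent_eq[OF coord_vec_tangent[OF c(1) p] c(2) p'] p' c(2) by (simp add: coord_vec_eq)
  then have "gsq c ?p u = gsq c' ?p (D *\<^sub>R u)" unfolding D[symmetric] gsq_def by simp
  then have sp: "speed c xi = \<bar>D\<bar> * speed c' eta"
   unfolding speed_def pe by (simp add: gsq_scale[OF c(2) p'] real_sqrt_mult)
  \<comment> \<open>and the orientations agree\<close>
  have "eps * (snd (?m xi) c \<bullet> u) > 0" by (rule arc_point_sign[OF c(1) e(1) Jx])
  moreover have "eps' * (snd (?m xi) c' \<bullet> u) > 0" unfolding eta(2) by (rule arc_point_sign[OF c(2) e(2) J'[OF eta(1)]])
  moreover have "snd (?m xi) c' = (snd (?m xi) c \<bullet> u) *\<^sub>R DT c c' ?p u"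
  proof -
   have "?m xi \<in> topspace ST" using arc_point_ST[OF c(1) _ Jx, of eps] e by auto
   then have "snd (?m xi) \<in> tangent_space A ?p" by (auto simp: topspace_ST arc_point_def)
   then have "snd (?m xi) c' = DT c c' ?p (snd (?m xi) c)" by (rule tangent_eq[OF _ c p p'])
   also have "\<dots> = DT c c' ?p ((snd (?m xi) c \<bullet> u) *\<^sub>R u)" by (simp add: u_scale)
   finally show ?thesis by (simp add: linear_cmul[OF DT_linear[OF c p p']])
  qed
  ultimately have "eps * (snd (?m xi) c \<bullet> u) > 0" "eps' * ((snd (?m xi) c \<bullet> u) * D) > 0" by (simp_all add: D uu)
  then have "eps' * D = eps * \<bar>D\<bar>" using e by (auto simp: zero_less_mult_iff mult_less_0_iff)
  then have "eps' * (speed c' eta * D) = eps * speed c xi" unfolding sp by (metis mult.assoc mult.commute)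
  moreover have "(Lam has_real_derivative speed c xi) (at xi)" using L(1) x unfolding arc_length_def by blast
  ultimately have "(?D has_real_derivative 0) (at xi)"
   using DERIV_diff[OF DERIV_cmult[OF 1, of eps'] DERIV_cmult[of Lam "speed c xi" xi UNIV eps]] by simp
  then show "(?D has_field_derivative 0) (at xi within ?I)" by (rule has_field_derivative_at_within)
 qed simp
 then obtain C where C: "\<And>xi. xi \<in> ?I \<Longrightarrow> ?D xi = C" by blast
 have co: "snd c (fst (?m xi)) \<bullet> u = xi" if "xi \<in> ?I" for xi by (rule arc_point_coord[OF J[OF I(1)[OF that]]])
 have xI: "xi0 \<in> ?I" using d by simp
 show ?thesis
 proof (intro exI[of _ "?m ` ?I"] conjI)
  show "openin ST (?m ` ?I)" by (rule arc_open[OF c(1) e(1) J[OF I(1)]])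
  show "y \<in> ?m ` ?I" using x0 xI by blast
  show "?m ` ?I \<subseteq> ?m ` {alp<..<bet} \<inter> ?U'" using I by blast
  show "\<forall>z\<in>?m ` ?I. eps' * Lam' (snd c' (fst z) \<bullet> u) - eps * Lam (snd c (fst z) \<bullet> u) = eps' * Lam' (snd c' (fst y) \<bullet> u) - eps * Lam (snd c (fst y) \<bullet> u)"
   using C co xI by (auto simp: x0)
 qed
qed

lemma arcsE:
 assumes "(U, l) \<in> arcs"
 shows "\<exists>c eps alp bet Lam. c \<in> A \<and> eps \<in> {1, -1} \<and> arc_length c alp bet Lam \<and> U = arc_point c eps ` {alp<..<bet} \<and> l = (\<lambda>z. eps * Lam (snd c (fst z) \<bullet> u))"
 using assms unfolding arcs_def by blast

lemma reverse_arc_point: "c \<in> A \<Longrightarrow> xi *\<^sub>R u \<in> snd c ` chart_dom c \<Longrightarrow> reverse (arc_point c eps xi) = arc_point c (- eps) xi"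
 unfolding arc_point_def by (simp add: reverse_unit_vec chart_inv_in)

lemma translation_structure_ST: "translation_structure ST arcs reverse"
proof
 show "Hausdorff_space ST" by (rule ST_Hausdorff)
 show "\<exists>U l. (U, l) \<in> arcs \<and> y \<in> U" if "y \<in> topspace ST" for y by (rule arcs_cover[OF that])
 show "continuous_map ST ST reverse" by (rule reverse_continuous)
 show "reverse (reverse y) = y" for y by (simp add: reverse_def)
 show "reverse y \<noteq> y" if "y \<in> topspace ST" for y
 proof
  assume e: "reverse y = y"
  have "fst y \<in> topspace X" using that by (auto simp: topspace_ST)
  then obtain c where c: "c \<in> A" "fst y \<in> chart_dom c" using chart_cover by blast
  have "snd y c \<noteq> 0" using ST_vec(3)[of "fst y" "snd y" c] that c by simp
  moreover have "snd y c = - snd y c" using e unfolding reverse_def by (metis snd_conv)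
  ultimately show False using u_scale[of "snd y c"] by (metis equal_neg_zero inner_minus_left scaleR_zero_left)
 qed
 fix U l assume "(U, l) \<in> arcs"
 from arcsE[OF this] obtain c eps alp bet Lam where a: "c \<in> A" "eps \<in> {1, -1}" "arc_length c alp bet Lam" "U = arc_point c eps ` {alp<..<bet}" "l = (\<lambda>z. eps * Lam (snd c (fst z) \<bullet> u))"
  by (elim exE conjE)
 have J: "xi *\<^sub>R u \<in> snd c ` chart_dom c" if "xi \<in> {alp<..<bet}" for xi using a(3) that unfolding arc_length_def by blast
 show "openin ST U" unfolding a(4) by (rule arc_open[OF a(1,2) J])
 have l: "l (arc_point c eps xi) = eps * Lam xi" if "xi \<in> {alp<..<bet}" for xi by (simp add: a(5) arc_point_coord[OF J[OF that]])
 show "inj_on l U"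
 proof (rule inj_onI)
  fix y z assume yz: "y \<in> U" "z \<in> U" "l y = l z"
  then obtain xi xi' where x: "xi \<in> {alp<..<bet}" "y = arc_point c eps xi" "xi' \<in> {alp<..<bet}" "z = arc_point c eps xi'" unfolding a(4) by blast
  then have "Lam xi = Lam xi'" using yz(3) l a(2) by auto
  then show "y = z" using inj_onD[OF arc_length_inj[OF a(1,3)]] x by blast
 qed
 show "\<exists>W. openin ST W \<and> y \<in> W \<and> W \<subseteq> U \<inter> U' \<and> (\<forall>z\<in>W. l' z - l z = l' y - l y)"
  if U': "(U', l') \<in> arcs" and y: "y \<in> U" "y \<in> U'" for U' l' y
 proof -
  obtain c' eps' alp' bet' Lam' where b: "c' \<in> A" "eps' \<in> {1, -1}" "arc_length c' alp' bet' Lam'" "U' = arc_point c' eps' ` {alp'<..<bet'}" "l' = (\<lambda>z. eps' * Lam' (snd c' (fst z) \<bullet> u))"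
   using arcsE[OF U'] by blast
  show ?thesis using arcs_compat[OF a(1) b(1) a(2) b(2) a(3) b(3)] y unfolding a(4,5) b(4,5) by blast
 qed
 show "\<exists>alp bet kap. cont_on {alp..bet} ST kap \<and> (\<forall>t\<in>{alp..bet}. kap t \<in> U \<and> l (kap t) = t) \<and> z \<in> kap ` {alp..bet} \<and> z' \<in> kap ` {alp..bet}"
  if z: "z \<in> U" "z' \<in> U" for z z'
 proof -
  obtain xi xi' where x: "xi \<in> {alp<..<bet}" "z = arc_point c eps xi" "xi' \<in> {alp<..<bet}" "z' = arc_point c eps xi'" using z unfolding a(4) by blast
  show ?thesis
  proof (cases "xi \<le> xi'")
   case True
   show ?thesis using arcs_curve[OF a(1-3) x(1,3) True] unfolding a(4,5) x(2,4) by blast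
  next
   case False
   then have le: "xi' \<le> xi" by simp
   show ?thesis using arcs_curve[OF a(1-3) x(3,1) le] unfolding a(4,5) x(2,4) by blast
  qed
 qed
 show "\<exists>U' l'. (U', l') \<in> arcs \<and> (\<forall>y\<in>topspace ST. (reverse y \<in> U) = (y \<in> U')) \<and> (\<forall>y\<in>U'. l (reverse y) = - l' y)"
 proof (intro exI conjI ballI)
  show "(arc_point c (- eps) ` {alp<..<bet}, \<lambda>z. - eps * Lam (snd c (fst z) \<bullet> u)) \<in> arcs"
   unfolding arcs_def mem_Collect_eq using a(1-3)
   by (intro exI[of _ c] exI[of _ "- eps"] exI[of _ alp] exI[of _ bet] exI[of _ Lam]) auto
  fix y show "l (reverse y) = - (- eps * Lam (snd c (fst y) \<bullet> u))" by (simp add: a(5) reverse_def)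
 next
  fix y
  have rr: "reverse (reverse y) = y" for y by (simp add: reverse_def)
  show "(reverse y \<in> U) = (y \<in> arc_point c (- eps) ` {alp<..<bet})"
  proof
   assume "reverse y \<in> U"
   then obtain xi where x: "xi \<in> {alp<..<bet}" "reverse y = arc_point c eps xi" unfolding a(4) by blast
   then have "y = arc_point c (- eps) xi" using rr[of y] reverse_arc_point[OF a(1) J[OF x(1)], of eps] by simp
   then show "y \<in> arc_point c (- eps) ` {alp<..<bet}" using x by blast
  next
   assume "y \<in> arc_point c (- eps) ` {alp<..<bet}"
   then obtain xi where x: "xi \<in> {alp<..<bet}" "y = arc_point c (- eps) xi" by blast
   then have "reverse y = arc_point c eps xi" using reverse_arc_point[OF a(1) J[OF x(1)], of "- eps"] by simp
   then show "reverse y \<in> U" unfolding a(4) using x by blast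
  qed
 qed
qed

end


context ball_mfd
begin

text \<open>If \<open>n \<ge> 2\<close>, the fiber is connected. If \<open>n = 1\<close>, the lift over \<open>[-1, 1]\<close> has equal ends, as it cannot end in
 the opposite vector.\<close>

lemma circle_maps_lift_based:
 assumes f: "based_map (Suc 0) X b0 f"
 shows "lifts (Suc 0) f"
proof -
 obtain L where L: "disc_lift 0 f L" using disc_lift_ex[OF f] by blast
 have "nullh 0 (fib ST fst b0) L"
 proof (cases "DIM('e) = 1")
  case False
  then have "DIM('e) \<ge> 2" using DIM_positive[where 'a='e] by linarith
  then show ?thesis by (rule nullh_path_connected[OF path_connected_fib_ST[OF _ b0(3)] L_boundary[OF f L]])
 next
  case True
  then obtain u :: 'e where u: "Basis = {u}" using card_1_singletonE by blast
  interpret riem_line X A g u by unfold_locales (rule u)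
  interpret translation_structure ST arcs reverse by (rule translation_structure_ST)
  define mu where "mu t = (\<lambda>i. (1 - 2 * t) * pole 0 i)" for t
  have D: "mu t \<in> Dsc (Suc 0)" if "t \<in> {0..1}" for t
   using that by (auto simp: mu_def Dsc_def pole_def power2_le_iff_abs_le abs_square_le_1)
  have "continuous_on {0..1} mu"
   unfolding mu_def[abs_def] by (rule continuous_on_coordinatewise_then_product) (intro continuous_intros)
  then have "cont_on {0..1} ST (\<lambda>t. L (mu t))"
   using L_continuous[OF f L] D by (intro cmap_comp_on[of _ mu "Dsc (Suc 0)"]) (auto simp: disc_eq)
  note flip = no_flipping_path[OF this]
  have S: "mu 0 \<in> Sph 0" "mu 1 \<in> Sph 0" by (auto simp: mu_def Sph_def pole_def)
  have bS: "bdry L s \<in> {u, - u}" if "s \<in> Sph 0" for s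
  proof -
   have "norm (bdry L s) = 1" using bdry_continuous[OF f L] that by (auto simp: continuous_map_def nsphere_eq)
   then have "\<bar>bdry L s \<bullet> u\<bar> = 1" using u_scale[of "bdry L s"] uu(3) by (metis mult.right_neutral norm_scaleR)
   then show ?thesis using u_scale[of "bdry L s"] by (cases "bdry L s \<bullet> u = 1") (auto simp: abs_if split: if_splits)
  qed
  have "bdry L (mu 1) \<noteq> - bdry L (mu 0)"
  proof
   assume "bdry L (mu 1) = - bdry L (mu 0)"
   then have "L (mu 1) = reverse (L (mu 0))"
    unfolding L_bdry[OF f L S(1)] L_bdry[OF f L S(2)] fiber_param_eq reverse_unit_vec[OF cA b0(1)] by simp
   then show False using flip by simp
  qed
  then have e: "bdry L (mu 1) = bdry L (mu 0)" using bS[OF S(1)] bS[OF S(2)] by auto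
  have S0: "s = mu 0 \<or> s = mu 1" if "s \<in> Sph 0" for s
  proof -
   have s: "s 0 ^ 2 = 1" "\<And>i. i \<noteq> 0 \<Longrightarrow> s i = 0" using that by (auto simp: Sph_def)
   then have "s 0 = 1 \<or> s 0 = -1" by (simp add: power2_eq_1_iff)
   then show ?thesis using s(2) by (auto simp: mu_def fun_eq_iff pole_def)
  qed
  have "L s = fiber_param A g c b0 (bdry L (mu 0))" if "s \<in> Sph 0" for s
   using S0[OF that] e L_bdry[OF f L that] by auto
  moreover have "fiber_param A g c b0 (bdry L (mu 0)) \<in> topspace (fib ST fst b0)"
  proof -
   have "L (mu 0) \<in> topspace (fib ST fst b0)" using L_boundary[OF f L] S(1) unfolding continuous_map_def nsphere_eq by auto
   then show ?thesis using L_bdry[OF f L S(1)] by metis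
  qed
  ultimately show ?thesis by (intro nullh_const)
 qed
 from section_of_null[OF sliced_ST f_continuous[OF f L] f_pole[OF f L] L_continuous[OF f L] L_fst[OF f L] this]
 show ?thesis by (simp add: lifts_def)
qed

lemma homotopic_based:
 assumes f: "continuous_map (nsphere (Suc k)) X f"
 shows "\<exists>f'. based_map (Suc k) X b0 f' \<and> homot (nsphere (Suc k)) X f f'"
proof -
 have "f (pole (Suc k)) \<in> topspace X" using f pole_in_Sph[of "Suc k"] by (auto simp: continuous_map_def nsphere_eq)
 then obtain gam where "pathin X gam" "gam 0 = f (pole (Suc k))" "gam 1 = b0"
  using loc_euclid_path_connected[OF mfd_loc_euclid con] b0(3) unfolding path_connected_space_def by blast
 from homotopic_to_based[OF f this] show ?thesis .
qed

end

section \<open>The universal cover\<close>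

text \<open>All paths in \<open>U\<close> with the same ends are homotopic in \<open>S\<close>; such sets are evenly covered.\<close>

definition small :: "'b::real_normed_vector set \<Rightarrow> 'b set \<Rightarrow> bool" where
 "small S U \<longleftrightarrow> openin (top_of_set S) U \<and> path_connected U \<and>
   (\<forall>p q. path p \<longrightarrow> path q \<longrightarrow> path_image p \<subseteq> U \<longrightarrow> path_image q \<subseteq> U \<longrightarrow>
    pathstart q = pathstart p \<longrightarrow> pathfinish q = pathfinish p \<longrightarrow> homotopic_paths S p q)"

lemma small_exists:
 fixes S :: "'b::real_normed_vector set"
 assumes S: "loc_euclid TYPE('e::euclidean_space) (top_of_set S)" and V: "openin (top_of_set S) V" "x \<in> V"
 shows "\<exists>U. small S U \<and> x \<in> U \<and> U \<subseteq> V"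
proof -
 obtain U phi and psi :: "'e \<Rightarrow> 'b" where U: "openin (top_of_set S) U" "U \<subseteq> V"
  "homeomorphic_maps (subtopology (top_of_set S) U) euclidean phi psi" "psi 0 = x"
  using euclid_chart_exists[OF S V] by blast
 note ch = euclid_chartD[OF U(3,1)]
 have US: "U \<subseteq> S" using U(1) openin_imp_subset by blast
 have c: "continuous_on U phi" "continuous_on UNIV psi" "range psi \<subseteq> S"
  using ch(1,2) US by (auto simp: subtopology_subtopology inf.absorb2 into_sub)
 have "U = range psi" using ch(3,5) by (metis image_subset_iff rangeI subsetI subset_antisym)
 then have pc: "path_connected U" using path_connected_continuous_image[OF c(2)] convex_imp_path_connected[OF convex_UNIV] by metis
 have "homotopic_paths S p q" if p: "path p" "path_image p \<subseteq> U" and q: "path q" "path_image q \<subseteq> U"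
  "pathstart q = pathstart p" "pathfinish q = pathfinish p" for p q
 proof -
  have e: "homotopic_paths S p' (psi \<circ> (phi \<circ> p'))" if p': "path p'" "path_image p' \<subseteq> U" for p'
   by (rule homotopic_paths_eq[OF p'(1)]) (use p' US in \<open>auto simp: path_image_def intro!: ch(5)[symmetric]\<close>)
  have "homotopic_paths UNIV (phi \<circ> p) (phi \<circ> q)"
   by (rule homotopic_paths_linear) (use p q c in \<open>auto intro!: path_continuous_image intro: continuous_on_subset simp: pathstart_def pathfinish_def\<close>)
  from homotopic_paths_continuous_image[OF this c(2)] c(3)
  have "homotopic_paths S (psi \<circ> (phi \<circ> p)) (psi \<circ> (phi \<circ> q))" by blast
  then show ?thesis using e[OF p] e[OF q(1,2)] homotopic_paths_trans homotopic_paths_sym by meson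
 qed
 then have "small S U" unfolding small_def using U(1) pc by blast
 then show ?thesis using ch(3)[of 0] U by blast
qed

text \<open>The universal cover consists of the homotopy classes of paths from \<open>b\<close>. The base \<open>S\<close> is a subset of a normed
 space, so that paths are maps on the unit interval and compose by \<open>+++\<close>.\<close>

locale path_classes =
 fixes S :: "'b::real_normed_vector set" and b :: 'b
 assumes small_ex: "openin (top_of_set S) V \<Longrightarrow> x \<in> V \<Longrightarrow> \<exists>U. small S U \<and> x \<in> U \<and> U \<subseteq> V"
begin

definition based_path :: "(real \<Rightarrow> 'b) \<Rightarrow> bool" where
 "based_path p \<longleftrightarrow> path p \<and> path_image p \<subseteq> S \<and> pathstart p = b"

definition cls :: "(real \<Rightarrow> 'b) \<Rightarrow> (real \<Rightarrow> 'b) set" where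
 "cls p = {q. homotopic_paths S p q}"

abbreviation "classes \<equiv> cls ` {p. based_path p}"

definition endpt :: "(real \<Rightarrow> 'b) set \<Rightarrow> 'b" where
 "endpt xi = pathfinish (SOME p. p \<in> xi)"

definition extend :: "'b set \<Rightarrow> (real \<Rightarrow> 'b) set \<Rightarrow> 'b \<Rightarrow> (real \<Rightarrow> 'b) set" where
 "extend U xi y = cls ((SOME p. p \<in> xi) +++ (SOME q. path q \<and> path_image q \<subseteq> U \<and> pathstart q = endpt xi \<and> pathfinish q = y))"

text \<open>A set of classes is open if every class in it can be extended within a small set around its end.\<close>

definition cover_space :: "(real \<Rightarrow> 'b) set topology" where
 "cover_space = topology (\<lambda>W. W \<subseteq> classes \<and> (\<forall>xi\<in>W. \<exists>U. small S U \<and> endpt xi \<in> U \<and> extend U xi ` U \<subseteq> W))"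

lemma cls_eq_iff: "based_path p \<Longrightarrow> cls p = cls q \<longleftrightarrow> homotopic_paths S p q"
 unfolding cls_def based_path_def using homotopic_paths_trans homotopic_paths_sym homotopic_paths_refl by blast

lemma cls_rep:
 assumes "based_path p" shows "homotopic_paths S p (SOME q. q \<in> cls p)"
proof -
 have "p \<in> cls p" using assms by (simp add: cls_def based_path_def)
 then have "(SOME q. q \<in> cls p) \<in> cls p" by (rule someI[of "\<lambda>q. q \<in> cls p"])
 then show ?thesis by (simp add: cls_def)
qed

lemma endpt_cls: "based_path p \<Longrightarrow> endpt (cls p) = pathfinish p"
 unfolding endpt_def using homotopic_paths_imp_pathfinish[OF cls_rep] by metis

lemma endpt_in: "based_path p \<Longrightarrow> endpt (cls p) \<in> S"
 using endpt_cls pathfinish_in_path_image unfolding based_path_def by fastforce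

lemma small_sub: "small S U \<Longrightarrow> U \<subseteq> S" unfolding small_def using openin_imp_subset by blast

lemma based_join:
 "based_path p \<Longrightarrow> path q \<Longrightarrow> path_image q \<subseteq> S \<Longrightarrow> pathstart q = pathfinish p \<Longrightarrow> based_path (p +++ q)"
 unfolding based_path_def by (auto simp: path_image_join)

lemma extend_cls:
 assumes p: "based_path p" and U: "small S U" and q: "path q" "path_image q \<subseteq> U" "pathstart q = pathfinish p" "pathfinish q = y"
 shows "extend U (cls p) y = cls (p +++ q)"
proof -
 let ?p = "SOME q. q \<in> cls p" and ?q = "SOME q. path q \<and> path_image q \<subseteq> U \<and> pathstart q = endpt (cls p) \<and> pathfinish q = y"
 have "path ?q \<and> path_image ?q \<subseteq> U \<and> pathstart ?q = endpt (cls p) \<and> pathfinish ?q = y"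
  by (rule someI[of _ q]) (use q endpt_cls[OF p] in simp)
 then have "homotopic_paths S q ?q" using U q endpt_cls[OF p] unfolding small_def by simp
 then have "homotopic_paths S (p +++ q) (?p +++ ?q)" using homotopic_paths_join[OF cls_rep[OF p]] q(3) by simp
 then show ?thesis unfolding extend_def using cls_eq_iff[OF based_join[OF p q(1)]] small_sub[OF U] q by auto
qed

lemma path_in_small:
 assumes "small S U" "x \<in> U" "y \<in> U"
 shows "\<exists>q. path q \<and> path_image q \<subseteq> U \<and> pathstart q = x \<and> pathfinish q = y"
 using assms unfolding small_def path_connected_def by blast

lemma extend_facts:
 assumes x: "xi \<in> classes" and U: "small S U" "endpt xi \<in> U" and y: "y \<in> U"
 shows "extend U xi y \<in> classes" "endpt (extend U xi y) = y" "extend U xi (endpt xi) = xi"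
  "small S U' \<Longrightarrow> U' \<subseteq> U \<Longrightarrow> y \<in> U' \<Longrightarrow> y' \<in> U' \<Longrightarrow> extend U' (extend U xi y) y' = extend U xi y'"
  "small S U' \<Longrightarrow> U' \<subseteq> U \<Longrightarrow> endpt xi \<in> U' \<Longrightarrow> y' \<in> U' \<Longrightarrow> extend U' xi y' = extend U xi y'"
proof -
 obtain p where p: "based_path p" "xi = cls p" using x by blast
 have e: "endpt xi = pathfinish p" using p endpt_cls by simp
 obtain q where q: "path q" "path_image q \<subseteq> U" "pathstart q = endpt xi" "pathfinish q = y"
  using path_in_small[OF U y] by blast
 note US = small_sub[OF U(1)]
 have pq: "based_path (p +++ q)" using based_join[OF p(1) q(1)] q US e by auto
 have ex: "extend U xi y = cls (p +++ q)" unfolding p(2) by (rule extend_cls[OF p(1) U(1)]) (use q e in auto)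
 show "extend U xi y \<in> classes" unfolding ex using pq by blast
 show "endpt (extend U xi y) = y" unfolding ex using endpt_cls[OF pq] q by simp
 have l: "extend U xi (endpt xi) = cls (p +++ linepath (endpt xi) (endpt xi))"
  unfolding p(2) by (rule extend_cls[OF p(1) U(1)]) (use U e p in auto)
 also have "\<dots> = xi"
  using cls_eq_iff[OF p(1)] homotopic_paths_rid[of p S] p e homotopic_paths_sym unfolding based_path_def by metis
 finally show "extend U xi (endpt xi) = xi" .
 show "extend U' (extend U xi y) y' = extend U xi y'" if U': "small S U'" "U' \<subseteq> U" "y \<in> U'" "y' \<in> U'"
 proof -
  obtain q' where q': "path q'" "path_image q' \<subseteq> U'" "pathstart q' = y" "pathfinish q' = y'"
   using path_in_small[OF U'(1,3,4)] by blast
  have "extend U' (extend U xi y) y' = cls ((p +++ q) +++ q')"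
   unfolding ex by (rule extend_cls[OF pq U'(1)]) (use q q' in auto)
  also have "\<dots> = cls (p +++ (q +++ q'))"
  proof -
   have "homotopic_paths S (p +++ (q +++ q')) ((p +++ q) +++ q')"
    by (rule homotopic_paths_assoc) (use p q q' US U'(2) e in \<open>auto simp: based_path_def\<close>)
   then show ?thesis using cls_eq_iff based_join[OF pq q'(1)] q q' US U'(2) homotopic_paths_sym by (metis order_trans pathfinish_join)
  qed
  also have "\<dots> = extend U xi y'"
   unfolding p(2) by (rule extend_cls[OF p(1) U(1), symmetric]) (use q q' e U'(2) in \<open>auto simp: path_image_join\<close>)
  finally show ?thesis .
 qed
 show "extend U' xi y' = extend U xi y'" if U': "small S U'" "U' \<subseteq> U" "endpt xi \<in> U'" "y' \<in> U'"
 proof -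
  obtain q' where q': "path q'" "path_image q' \<subseteq> U'" "pathstart q' = endpt xi" "pathfinish q' = y'"
   using path_in_small[OF U'(1,3,4)] by blast
  have "extend U' xi y' = cls (p +++ q')" unfolding p(2) by (rule extend_cls[OF p(1) U'(1)]) (use q' e in auto)
  also have "\<dots> = extend U xi y'" unfolding p(2) by (rule extend_cls[OF p(1) U(1), symmetric]) (use q' e U'(2) in auto)
  finally show ?thesis .
 qed
qed

lemma small_Int:
 assumes "small S U" "openin (top_of_set S) V" "x \<in> U" "x \<in> V"
 shows "\<exists>U'. small S U' \<and> x \<in> U' \<and> U' \<subseteq> U \<and> U' \<subseteq> V"
 using small_ex[of "U \<inter> V" x] assms unfolding small_def by (metis IntI Int_subset_iff openin_Int)

lemma openin_cover:
 "openin cover_space W \<longleftrightarrow> W \<subseteq> classes \<and> (\<forall>xi\<in>W. \<exists>U. small S U \<and> endpt xi \<in> U \<and> extend U xi ` U \<subseteq> W)"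
proof -
 let ?P = "\<lambda>W. W \<subseteq> classes \<and> (\<forall>xi\<in>W. \<exists>U. small S U \<and> endpt xi \<in> U \<and> extend U xi ` U \<subseteq> W)"
 have "?P (W \<inter> W')" if W: "?P W" "?P W'" for W W'
 proof (intro conjI ballI)
  fix xi assume x: "xi \<in> W \<inter> W'"
  then obtain U U' where U: "small S U" "endpt xi \<in> U" "extend U xi ` U \<subseteq> W" "small S U'" "endpt xi \<in> U'" "extend U' xi ` U' \<subseteq> W'"
   using W by (meson IntD1 IntD2)
  obtain U2 where U2: "small S U2" "endpt xi \<in> U2" "U2 \<subseteq> U" "U2 \<subseteq> U'"
   using small_Int[OF U(1) _ U(2,5)] U(4) unfolding small_def by blast
  have xc: "xi \<in> classes" using x W by blast
  have "extend U2 xi y \<in> W \<inter> W'" if "y \<in> U2" for y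
  proof -
   have "y \<in> U" "y \<in> U'" using that U2 by auto
   then show ?thesis
    using extend_facts(5)[OF xc U(1,2) U(2) U2(1,3,2) that] extend_facts(5)[OF xc U(4,5) U(5) U2(1,4,2) that] U(3,6) by (metis IntI image_subset_iff)
  qed
  then show "\<exists>U. small S U \<and> endpt xi \<in> U \<and> extend U xi ` U \<subseteq> W \<inter> W'" using U2 by blast
 qed (use W in blast)
 moreover have "?P (\<Union>\<K>)" if "\<forall>W\<in>\<K>. ?P W" for \<K>
 proof (intro conjI ballI)
  fix xi assume "xi \<in> \<Union>\<K>"
  then obtain W where W: "W \<in> \<K>" "xi \<in> W" by blast
  then have "\<exists>U. small S U \<and> endpt xi \<in> U \<and> extend U xi ` U \<subseteq> W" using that by blast
  then show "\<exists>U. small S U \<and> endpt xi \<in> U \<and> extend U xi ` U \<subseteq> \<Union>\<K>" using W(1) by blast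
 qed (use that in blast)
 ultimately have "istopology ?P" unfolding istopology_def by blast
 then show ?thesis unfolding cover_space_def by (simp add: topology_inverse')
qed

lemma topspace_cover: "topspace cover_space = classes"
proof -
 have "openin cover_space classes" unfolding openin_cover
 proof (intro conjI ballI order_refl)
  fix xi assume x: "xi \<in> classes"
  then have "endpt xi \<in> S" using endpt_in by blast
  then obtain U where "small S U" "endpt xi \<in> U" using small_ex[of S] by auto
  then show "\<exists>U. small S U \<and> endpt xi \<in> U \<and> extend U xi ` U \<subseteq> classes" using extend_facts(1)[OF x] by blast
 qed
 from openin_subset[OF this] openin_topspace[of cover_space] show ?thesis unfolding openin_cover by blast
qed

lemma sheet_open:
 assumes x: "xi \<in> classes" and U: "small S U" "endpt xi \<in> U" and V: "openin (top_of_set S) V" "V \<subseteq> U"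
 shows "openin cover_space (extend U xi ` V)" unfolding openin_cover
proof (intro conjI ballI)
 show "extend U xi ` V \<subseteq> classes" using extend_facts(1)[OF x U] V by blast
 fix eta assume "eta \<in> extend U xi ` V"
 then obtain y where y: "y \<in> V" "eta = extend U xi y" by blast
 obtain U' where U': "small S U'" "y \<in> U'" "U' \<subseteq> V" using small_ex[OF V(1) y(1)] by blast
 have "y \<in> U" using y V by blast
 from extend_facts(2)[OF x U this] extend_facts(4)[OF x U this U'(1) _ U'(2)]
 have "endpt eta \<in> U'" "extend U' eta ` U' \<subseteq> extend U xi ` V" using U' V(2) y by auto
 then show "\<exists>U'. small S U' \<and> endpt eta \<in> U' \<and> extend U' eta ` U' \<subseteq> extend U xi ` V" using U'(1) by blast
qed

lemma endpt_continuous: "continuous_map cover_space (top_of_set S) endpt" unfolding continuous_map_def topspace_cover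
proof (intro conjI allI impI)
 show "endpt \<in> classes \<rightarrow> topspace (top_of_set S)" using endpt_in by auto
 fix V assume V: "openin (top_of_set S) V"
 show "openin cover_space {xi \<in> classes. endpt xi \<in> V}" unfolding openin_cover
 proof (intro conjI ballI)
  fix xi assume x: "xi \<in> {xi \<in> classes. endpt xi \<in> V}"
  then obtain U where U: "small S U" "endpt xi \<in> U" "U \<subseteq> V" using small_ex[OF V] by blast
  have "extend U xi y \<in> {xi \<in> classes. endpt xi \<in> V}" if "y \<in> U" for y
   using extend_facts(1,2)[OF _ U(1,2) that] x that U(3) by auto
  then show "\<exists>U. small S U \<and> endpt xi \<in> U \<and> extend U xi ` U \<subseteq> {xi \<in> classes. endpt xi \<in> V}" using U by blast
 qed auto
qed

text \<open>Extending within \<open>U\<close> depends only on the sheet over \<open>U\<close>, so it is locally constant in the class.\<close>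

lemma extend_continuous:
 assumes U: "small S U"
 shows "continuous_map (subtopology (prod_topology cover_space (top_of_set S)) {(xi, y). endpt xi \<in> U \<and> y \<in> U}) cover_space (\<lambda>(xi, y). extend U xi y)"
  (is "continuous_map ?Z _ _") unfolding continuous_map_def
proof (intro conjI allI impI)
 have tz: "topspace ?Z = {(xi, y). xi \<in> classes \<and> endpt xi \<in> U \<and> y \<in> U}"
  using small_sub[OF U] by (auto simp: topspace_cover)
 show "(\<lambda>(xi, y). extend U xi y) \<in> topspace ?Z \<rightarrow> topspace cover_space"
  unfolding tz topspace_cover using extend_facts(1)[OF _ U] by auto
 fix W assume W: "openin cover_space W"
 show "openin ?Z {z \<in> topspace ?Z. (case z of (xi, y) \<Rightarrow> extend U xi y) \<in> W}"
 proof (subst openin_subopen, rule ballI)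
  fix z assume "z \<in> {z \<in> topspace ?Z. (case z of (xi, y) \<Rightarrow> extend U xi y) \<in> W}"
  then obtain xi y where z: "z = (xi, y)" "xi \<in> classes" "endpt xi \<in> U" "y \<in> U" "extend U xi y \<in> W" unfolding tz by auto
  note f = extend_facts[OF z(2) U z(3,4)]
  obtain V where V: "small S V" "y \<in> V" "extend V (extend U xi y) ` V \<subseteq> W" using W z(5) f(2) unfolding openin_cover by metis
  obtain V' where V': "small S V'" "y \<in> V'" "V' \<subseteq> U" "V' \<subseteq> V"
   using small_Int[OF U _ z(4) V(2)] V(1) unfolding small_def by blast
  let ?N = "(extend U xi ` U) \<times> V'"
  have oU: "openin (top_of_set S) U" "openin (top_of_set S) V'" using U V' by (auto simp: small_def)
  have "openin (prod_topology cover_space (top_of_set S)) ?N"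
   unfolding openin_prod_Times_iff using sheet_open[OF z(2) U z(3) oU(1)] oU(2) by blast
  moreover have "?N \<subseteq> {(xi, y). endpt xi \<in> U \<and> y \<in> U}" using extend_facts(2)[OF z(2) U z(3)] V'(3) by auto
  ultimately have "openin ?Z ?N" using openin_subtopology_Int2 by (metis inf.absorb_iff2)
  moreover have "z \<in> ?N" using z V'(2) f(3) by (auto intro!: image_eqI[of xi "extend U xi" "endpt xi"])
  moreover have "?N \<subseteq> {z \<in> topspace ?Z. (case z of (xi, y) \<Rightarrow> extend U xi y) \<in> W}"
  proof
   fix w assume "w \<in> ?N"
   then obtain x y' where w: "w = (extend U xi x, y')" "x \<in> U" "y' \<in> V'" by blast
   note g = extend_facts[OF z(2) U z(3) w(2)]
   have y': "y' \<in> U" using w V' by blast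
   have "extend U (extend U xi x) y' = extend U xi y'" by (rule g(4)[OF U order_refl w(2) y'])
   also have "\<dots> = extend V' (extend U xi y) y'" using f(4)[OF V'(1,3,2) w(3)] by simp
   also have "\<dots> = extend V (extend U xi y) y'"
    by (rule extend_facts(5)[OF f(1) V(1) _ V(2) V'(1,4)]) (use f(2) V V' w in auto)
   finally have "extend U (extend U xi x) y' \<in> W" using V(3) V'(4) w(3) by auto
   then show "w \<in> {z \<in> topspace ?Z. (case z of (xi, y) \<Rightarrow> extend U xi y) \<in> W}" unfolding tz using g(1,2) w y' by auto
  qed
  ultimately show "\<exists>T. openin ?Z T \<and> z \<in> T \<and> T \<subseteq> {z \<in> topspace ?Z. (case z of (xi, y) \<Rightarrow> extend U xi y) \<in> W}" by blast
 qed
qed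

lemma sliced_cover: "sliced cover_space (top_of_set S) endpt" unfolding sliced_def topspace_cover
proof (intro conjI ballI endpt_continuous)
 fix x assume "x \<in> topspace (top_of_set S)"
 then obtain U where U: "small S U" "x \<in> U" using small_ex[of S x] by auto
 show "\<exists>U T. openin (top_of_set S) U \<and> x \<in> U \<and>
    continuous_map (subtopology (prod_topology cover_space (top_of_set S)) {(e, y). endpt e \<in> U \<and> y \<in> U}) cover_space (\<lambda>(e, y). T e y) \<and>
    (\<forall>e\<in>classes. \<forall>y\<in>U. endpt e \<in> U \<longrightarrow> endpt (T e y) = y) \<and> (\<forall>e\<in>classes. endpt e \<in> U \<longrightarrow> T e (endpt e) = e)"
  by (intro exI[of _ U] exI[of _ "extend U"] conjI extend_continuous[OF U(1)] ballI impI extend_facts(2,3))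
   (use U in \<open>auto simp: small_def\<close>)
qed

lemma extend_inj:
 assumes x: "xi \<in> classes" "eta \<in> classes" "endpt xi = endpt eta" and U: "small S U" "endpt xi \<in> U" and y: "y \<in> U" "y' \<in> U"
  and e: "extend U xi y = extend U eta y'"
 shows "xi = eta"
proof -
 note U' = U(2)[unfolded x(3)]
 have yy: "y = y'" using extend_facts(2)[OF x(1) U y(1)] extend_facts(2)[OF x(2) U(1) U' y(2)] e by simp
 have "xi = extend U (extend U xi y) (endpt xi)"
  using extend_facts(3)[OF x(1) U y(1)] extend_facts(4)[OF x(1) U y(1) U(1) order_refl y(1) U(2)] by simp
 also have "\<dots> = eta"
  using extend_facts(3)[OF x(2) U(1) U' y(2)] extend_facts(4)[OF x(2) U(1) U' y(2) U(1) order_refl y(2) U'] e x(3) by simp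
 finally show ?thesis .
qed

lemma Hausdorff_cover: "Hausdorff_space cover_space" unfolding Hausdorff_space_def topspace_cover
proof (intro allI impI)
 fix xi eta assume x: "xi \<in> classes \<and> eta \<in> classes \<and> xi \<noteq> eta"
 show "\<exists>U V. openin cover_space U \<and> openin cover_space V \<and> xi \<in> U \<and> eta \<in> V \<and> disjnt U V"
 proof (cases "endpt xi = endpt eta")
  case False
  have S: "endpt xi \<in> S" "endpt eta \<in> S" using x endpt_in by blast+
  have "Hausdorff_space (top_of_set S)" by (simp add: Hausdorff_space_subtopology)
  then obtain U V where UV: "openin (top_of_set S) U" "openin (top_of_set S) V" "endpt xi \<in> U" "endpt eta \<in> V" "disjnt U V"
   using False S unfolding Hausdorff_space_def by (metis topspace_euclidean_subtopology)
  show ?thesis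
   by (intro exI[of _ "{z \<in> topspace cover_space. endpt z \<in> U}"] exI[of _ "{z \<in> topspace cover_space. endpt z \<in> V}"] conjI
    open_preim[OF endpt_continuous] UV(1,2)) (use UV x in \<open>auto simp: disjnt_iff topspace_cover\<close>)
 next
  case True
  have "endpt xi \<in> S" using x endpt_in by blast
  then obtain U where U: "small S U" "endpt xi \<in> U" using small_ex[of S] by auto
  then have oU: "openin (top_of_set S) U" by (simp add: small_def)
  have xc: "xi \<in> classes" "eta \<in> classes" using x by auto
  show ?thesis
  proof (rule exI[of _ "extend U xi ` U"], rule exI[of _ "extend U eta ` U"], intro conjI)
   show "openin cover_space (extend U xi ` U)" "openin cover_space (extend U eta ` U)"
    using sheet_open[OF _ U(1) _ oU order_refl] xc U(2) True by auto
   show "xi \<in> extend U xi ` U" "eta \<in> extend U eta ` U"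
    using extend_facts(3)[OF xc(1) U U(2)] extend_facts(3)[OF xc(2) U(1), of "endpt eta"] U(2) True by (metis imageI)+
   show "disjnt (extend U xi ` U) (extend U eta ` U)" unfolding disjnt_iff using extend_inj[OF xc True U] x by blast
  qed
 qed
qed

text \<open>The initial pieces of a path join the constant path to its class.\<close>

lemma connected_cover:
 assumes "b \<in> S" shows "connected_space cover_space"
proof -
 let ?o = "linepath b b"
 have o: "based_path ?o" using assms by (simp add: based_path_def)
 have "path_component_of cover_space (cls ?o) xi" if x: "xi \<in> classes" for xi
 proof -
  obtain p where p: "based_path p" "xi = cls p" using x by blast
  then have p': "path p" "path_image p \<subseteq> S" "pathstart p = b" by (auto simp: based_path_def)
  let ?g = "\<lambda>t. cls (subpath 0 t p)"
  have sb: "based_path (subpath 0 t p)" if "t \<in> {0..1}" for t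
   using p' that path_image_subpath_subset[of 0 t p] path_subpath[of p 0 t] unfolding based_path_def by (auto simp: pathstart_def subpath_def)
  have "pathin cover_space ?g" unfolding pathin_def continuous_map_def
  proof (intro conjI allI impI)
   show "?g \<in> topspace (top_of_set {0..1}) \<rightarrow> topspace cover_space" using sb by (auto simp: topspace_cover)
   fix W assume W: "openin cover_space W"
   show "openin (top_of_set {0..1}) {t \<in> topspace (top_of_set {0..1}). ?g t \<in> W}"
   proof (subst openin_subopen, rule ballI)
    fix t assume "t \<in> {t \<in> topspace (top_of_set {0..1}). ?g t \<in> W}"
    then have t: "t \<in> {0..1}" "?g t \<in> W" by auto
    have e: "endpt (?g t) = p t" using endpt_cls[OF sb[OF t(1)]] by (simp add: pathfinish_def subpath_def)
    obtain U where U: "small S U" "p t \<in> U" "extend U (?g t) ` U \<subseteq> W" using W t(2) e unfolding openin_cover by metis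
    have "cont_on {0..1} (top_of_set S) p" using p' by (auto simp: path_def path_image_def)
    from open_preim[OF this, of U] U(1)
    have "openin (top_of_set {0..1}) {s \<in> {0..1}. p s \<in> U}" unfolding small_def by simp
    then obtain O' where O': "open O'" "{s \<in> {0..1}. p s \<in> U} = {0..1} \<inter> O'" unfolding openin_open by blast
    have "t \<in> O'" using O'(2) t U(2) by blast
    then obtain dlt where d: "dlt > 0" "ball t dlt \<subseteq> O'" using O'(1) open_contains_ball by blast
    have "?g s \<in> W" if s: "s \<in> {0..1}" "s \<in> ball t dlt" for s
    proof -
     have "{min t s..max t s} \<subseteq> {0..1} \<inter> O'" using s t(1) d(2) by (force simp: dist_real_def)
     moreover have "p x \<in> U" if "x \<in> {0..1} \<inter> O'" for x using O'(2) that by blast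
     ultimately have im: "path_image (subpath t s p) \<subseteq> U"
      by (force simp: path_image_subpath closed_segment_eq_real_ivl split: if_splits)
     have "extend U (?g t) (p s) = cls (subpath 0 t p +++ subpath t s p)"
      by (rule extend_cls[OF sb[OF t(1)] U(1) _ im]) (use p' s t(1) path_subpath[of p t s] in \<open>auto simp: pathfinish_def pathstart_def subpath_def\<close>)
     also have "\<dots> = ?g s"
      using homotopic_join_subpaths[OF p'(1,2), of 0 t s] t(1) s(1) cls_eq_iff[OF sb[OF s(1)]] homotopic_paths_sym by (metis atLeastAtMost_iff order_refl zero_le_one)
     finally have "?g s = extend U (?g t) (p s)" by simp
     moreover have "p s \<in> U" using subsetD[OF im pathfinish_in_path_image] by (simp add: pathfinish_def subpath_def)
     ultimately show ?thesis using U(3) by (metis image_subset_iff)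
    qed
    then show "\<exists>T. openin (top_of_set {0..1}) T \<and> t \<in> T \<and> T \<subseteq> {t \<in> topspace (top_of_set {0..1}). ?g t \<in> W}"
     using t d(1) by (intro exI[of _ "{0..1} \<inter> ball t dlt"]) (auto simp: openin_open)
   qed
  qed
  moreover have "?g 0 = cls ?o" "?g 1 = xi" using p p' by (auto simp: subpath_refl pathstart_def)
  ultimately show ?thesis unfolding path_component_of_def by blast
 qed
 then have "path_connected_space cover_space"
  unfolding path_connected_space_iff_path_component topspace_cover using path_component_of_sym path_component_of_trans by metis
 then show ?thesis by (rule path_connected_imp_connected_space)
qed

end


definition local_homeo :: "'y topology \<Rightarrow> 'b topology \<Rightarrow> ('y \<Rightarrow> 'b) \<Rightarrow> bool" where
 "local_homeo Y B p \<longleftrightarrow> continuous_map Y B p \<and> (\<forall>y\<in>topspace Y. \<exists>U s. openin B U \<and> p y \<in> U \<and>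
   continuous_map (subtopology B U) Y s \<and> (\<forall>x\<in>U. p (s x) = x) \<and> s (p y) = y \<and>
   (\<forall>V. openin B V \<longrightarrow> V \<subseteq> U \<longrightarrow> openin Y (s ` V)))"

definition covering :: "'y topology \<Rightarrow> 'b topology \<Rightarrow> ('y \<Rightarrow> 'b) \<Rightarrow> bool" where
 "covering Y B p \<longleftrightarrow> sliced Y B p \<and> local_homeo Y B p"

text \<open>Two non-homotopic paths with the same ends, continued to \<open>x0\<close>, are two points over \<open>x0\<close>.\<close>

lemma covering_exists:
 fixes S :: "'b::real_normed_vector set"
 assumes S: "loc_euclid TYPE('e::euclidean_space) (top_of_set S)" "connected_space (top_of_set S)" "\<not> simply_connected S" and x0: "x0 \<in> S"
 shows "\<exists>(Y :: (real \<Rightarrow> 'b) set topology) p y0 y1. covering Y (top_of_set S) p \<and> Hausdorff_space Y \<and> connected_space Y \<and>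
  y0 \<in> topspace Y \<and> y1 \<in> topspace Y \<and> p y0 = x0 \<and> p y1 = x0 \<and> y0 \<noteq> y1"
proof -
 have pc: "path_connected S" using loc_euclid_path_connected[OF S(1)] S(2) by (simp add: path_connected_space_euclidean_subtopology)
 obtain p q where pq: "path p" "path_image p \<subseteq> S" "path q" "path_image q \<subseteq> S" "pathstart q = pathstart p" "pathfinish q = pathfinish p"
  "\<not> homotopic_paths S p q" using S(3) pc unfolding simply_connected_eq_homotopic_paths by metis
 interpret path_classes S "pathstart p" by unfold_locales (rule small_exists[OF S(1)])
 have "pathfinish p \<in> S" using pq(2) pathfinish_in_path_image by blast
 then obtain r where r: "path r" "path_image r \<subseteq> S" "pathstart r = pathfinish p" "pathfinish r = x0"
  using pc x0 unfolding path_connected_def by blast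
 have b: "based_path p" "based_path q" using pq by (auto simp: based_path_def)
 have br: "based_path (p +++ r)" "based_path (q +++ r)" using based_join[OF _ r(1,2)] b pq r by auto
 have cancel: "homotopic_paths S ((s +++ r) +++ reversepath r) s" if s: "path s" "path_image s \<subseteq> S" "pathfinish s = pathfinish p" for s
 proof -
  have "homotopic_paths S ((s +++ r) +++ reversepath r) (s +++ (r +++ reversepath r))"
   by (rule homotopic_paths_sym[OF homotopic_paths_assoc]) (use s r in auto)
  also have "homotopic_paths S \<dots> (s +++ linepath (pathstart r) (pathstart r))"
   by (rule homotopic_paths_join[OF _ homotopic_paths_rinv]) (use s r in auto)
  also have "homotopic_paths S \<dots> s" using homotopic_paths_rid[OF s(1,2)] s r by simp
  finally show ?thesis .
 qed
 have "cls (p +++ r) \<noteq> cls (q +++ r)"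
 proof
  assume "cls (p +++ r) = cls (q +++ r)"
  then have "homotopic_paths S (p +++ r) (q +++ r)" using cls_eq_iff[OF br(1)] by blast
  then have "homotopic_paths S ((p +++ r) +++ reversepath r) ((q +++ r) +++ reversepath r)"
   by (rule homotopic_paths_join) (use r in auto)
  then show False using cancel[OF pq(1,2)] cancel[OF pq(3,4,6)] pq(7) homotopic_paths_trans homotopic_paths_sym by metis
 qed
 moreover have "covering cover_space (top_of_set S) endpt" unfolding covering_def local_homeo_def topspace_cover
 proof (intro conjI ballI sliced_cover endpt_continuous)
  fix y assume y: "y \<in> classes"
  then have "endpt y \<in> S" using endpt_in by blast
  then obtain U where U: "small S U" "endpt y \<in> U" using small_ex[of S] by auto
  then have sU: "subtopology (top_of_set S) U = top_of_set U" using small_sub by (simp add: subtopology_subtopology inf.absorb2)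
  have "cont_on U (subtopology (prod_topology cover_space (top_of_set S)) {(xi, x). endpt xi \<in> U \<and> x \<in> U}) (\<lambda>x. (y, x))"
   using y U(2) small_sub[OF U(1)] by (auto simp: into_sub continuous_map_pairwise o_def topspace_cover)
  from cmap_comp[OF this extend_continuous[OF U(1)]] have "cont_on U cover_space (extend U y)" by (simp add: o_def)
  then show "\<exists>U s. openin (top_of_set S) U \<and> endpt y \<in> U \<and> continuous_map (subtopology (top_of_set S) U) cover_space s \<and>
    (\<forall>x\<in>U. endpt (s x) = x) \<and> s (endpt y) = y \<and> (\<forall>V. openin (top_of_set S) V \<longrightarrow> V \<subseteq> U \<longrightarrow> openin cover_space (s ` V))"
   using U extend_facts(2,3)[OF y U] sheet_open[OF y U] by (intro exI[of _ U] exI[of _ "extend U y"]) (auto simp: small_def sU)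
 qed
 moreover have "connected_space cover_space" by (rule connected_cover) (use pq(2) pathstart_in_path_image in blast)
 moreover have "cls (p +++ r) \<in> classes" "cls (q +++ r) \<in> classes" using br by auto
 moreover have "endpt (cls (p +++ r)) = x0" "endpt (cls (q +++ r)) = x0" using endpt_cls br r by simp_all
 ultimately show ?thesis using Hausdorff_cover topspace_cover by metis
qed


lemma loc_euclid_local_homeo:
 assumes B: "loc_euclid TYPE('e::euclidean_space) B" and s: "local_homeo Y B p"
 shows "loc_euclid TYPE('e) Y" unfolding loc_euclid_def
proof
 fix y assume "y \<in> topspace Y"
 then obtain W s where W: "openin B W" "p y \<in> W" "continuous_map (subtopology B W) Y s" "\<And>x. x \<in> W \<Longrightarrow> p (s x) = x" "s (p y) = y"
  "\<And>V. openin B V \<Longrightarrow> V \<subseteq> W \<Longrightarrow> openin Y (s ` V)" using s unfolding local_homeo_def by meson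
 have p: "continuous_map Y B p" using s by (simp add: local_homeo_def)
 obtain U phi and psi :: "'e \<Rightarrow> _" where U: "openin B U" "U \<subseteq> W" "homeomorphic_maps (subtopology B U) euclidean phi psi" "psi 0 = p y"
  using euclid_chart_exists[OF B W(1,2)] by blast
 note ch = euclid_chartD[OF U(3,1)]
 have ps: "p (s x) = x" if "x \<in> U" for x using that U(2) W(4) by blast
 have pU: "p z \<in> U" if "z \<in> s ` U" for z using that ps by auto
 have "continuous_map (subtopology Y (s ` U)) (subtopology B U) p"
  using pU by (auto simp: into_sub intro: cmap_restrict[OF p])
 from cmap_comp[OF this ch(1)] have 1: "continuous_map (subtopology Y (s ` U)) euclidean (phi \<circ> p)" .
 have "continuous_map euclidean (subtopology B W) psi" using ch(2,3) U(2) by (auto simp: into_sub)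
 from cmap_comp[OF this W(3)] have "continuous_map euclidean Y (s \<circ> psi)" .
 then have 2: "continuous_map euclidean (subtopology Y (s ` U)) (s \<circ> psi)" using ch(3) by (auto simp: into_sub)
 have "homeomorphic_maps (subtopology Y (s ` U)) (top_of_set (UNIV :: 'e set)) (phi \<circ> p) (s \<circ> psi)"
  unfolding homeomorphic_maps_def using 1 2 ch(3,4,5) ps by auto
 then show "\<exists>U S phi. openin Y U \<and> y \<in> U \<and> open (S :: 'e set) \<and> homeomorphic_map (subtopology Y U) (top_of_set S) phi"
  using W(6)[OF U(1,2)] W(5) ch(3)[of 0] U(4) homeomorphic_maps_map open_UNIV by (metis imageI)
qed

section \<open>Spheres around one of two punctures\<close>

lemma nullh_sphere_if:
 fixes h F :: "(nat \<Rightarrow> real) \<Rightarrow> 'e::euclidean_space"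
 assumes h: "continuous_map (nsphere k) unit_sphere h" and F: "nullh k (top_of_set (- {0})) F"
  and seg: "\<And>s. s \<in> Sph k \<Longrightarrow> 0 \<notin> closed_segment (h s) (F s)"
 shows "nullh k unit_sphere h"
proof -
 have Fc: "continuous_map (nsphere k) (top_of_set (- {0})) F"
  using F homotopic_with_imp_continuous_maps unfolding nullh_def by blast
 have "homotopic_with_canon (\<lambda>z. True) (Sph k) (- {0}) h F"
  by (rule homotopic_with_linear) (use h Fc seg in \<open>auto simp: nsphere_eq\<close>)
 then have "nullh k (top_of_set (- {0})) h" using nullh_homotopic[OF _ F] by (simp add: nsphere_eq)
 moreover have "cont_on (- {0}) unit_sphere (sgn :: 'e \<Rightarrow> 'e)" by (auto simp: sgn_div_norm intro!: continuous_intros)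
 ultimately have null: "nullh k unit_sphere (sgn \<circ> h)" by (rule nullh_compose)
 have "norm (h s) = 1" if "s \<in> Sph k" for s using h that by (auto simp: nsphere_eq)
 with null show ?thesis by (intro nullh_cong[OF null]) (simp add: sgn_div_norm)
qed

text \<open>The identity near \<open>0\<close> up to homotopy, constant off the unit ball, with exactly one further zero, at \<open>w / 2\<close>.\<close>

definition dipole :: "'e::euclidean_space \<Rightarrow> 'e \<Rightarrow> 'e" where
 "dipole w v = max 0 (1 - norm v) *\<^sub>R v - min 1 ((norm v)\<^sup>2) *\<^sub>R w"

lemma dipole_zero:
 assumes "norm w = 1" "dipole w v = 0" shows "v = 0 \<or> v = (1/2) *\<^sub>R w"
proof (cases "norm v < 1")
 case True
 then have "(norm v)\<^sup>2 \<le> 1" by (simp add: abs_square_le_1)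
 then have e: "(1 - norm v) *\<^sub>R v = (norm v)\<^sup>2 *\<^sub>R w" using assms True by (simp add: dipole_def)
 then have "(1 - norm v) * norm v = (norm v)\<^sup>2"
  using assms(1) True by (metis abs_of_pos abs_power2 diff_gt_0_iff_gt mult.right_neutral norm_scaleR)
 then have "norm v = 0 \<or> norm v = 1/2" by (auto simp: power2_eq_square algebra_simps)
 then show ?thesis
 proof
  assume n: "norm v = 1/2"
  have "(1/2) *\<^sub>R v = (1/2) *\<^sub>R ((1/2) *\<^sub>R w)" using e unfolding n by (simp add: power2_eq_square)
  then have "2 *\<^sub>R ((1/2) *\<^sub>R v) = 2 *\<^sub>R ((1/2) *\<^sub>R ((1/2) *\<^sub>R w))" by (rule arg_cong)
  then show ?thesis by simp
 qed simp
next
 case False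
 then have "1 \<le> (norm v)\<^sup>2" by simp
 then have "w = 0" using assms False by (simp add: dipole_def)
 then show ?thesis using assms(1) by simp
qed

lemma dipole_far: "norm v \<ge> 1 \<Longrightarrow> dipole w v = - w" by (simp add: dipole_def max_absorb1 min_absorb1)

lemma dipole_near:
 assumes w: "norm w = 1" and h: "norm h = 1" and d: "0 < dlt" "dlt \<le> 1/4"
 shows "0 \<notin> closed_segment h (dipole w (dlt *\<^sub>R h))"
proof
 have d2: "dlt\<^sup>2 \<le> dlt / 4" using d by (simp add: power2_eq_square)
 then have D: "dipole w (dlt *\<^sub>R h) = ((1 - dlt) * dlt) *\<^sub>R h - dlt\<^sup>2 *\<^sub>R w" using d h by (simp add: dipole_def)
 assume "0 \<in> closed_segment h (dipole w (dlt *\<^sub>R h))"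
 then obtain u where u: "0 \<le> u" "u \<le> 1" "0 = (1 - u) *\<^sub>R h + u *\<^sub>R dipole w (dlt *\<^sub>R h)" unfolding in_segment by auto
 then have "((1 - u) + u * ((1 - dlt) * dlt)) *\<^sub>R h = (u * dlt\<^sup>2) *\<^sub>R w" unfolding D by (simp add: algebra_simps)
 then have "norm (((1 - u) + u * ((1 - dlt) * dlt)) *\<^sub>R h) = norm ((u * dlt\<^sup>2) *\<^sub>R w)" by simp
 then have "\<bar>(1 - u) + u * ((1 - dlt) * dlt)\<bar> = u * dlt\<^sup>2" using w h u by (simp add: abs_mult)
 then have e: "(1 - u) + u * (dlt - dlt\<^sup>2) \<le> u * dlt\<^sup>2" by (simp add: algebra_simps power2_eq_square)
 have "u * (2 * dlt\<^sup>2 - dlt) \<le> 0" using u d2 d by (intro mult_nonneg_nonpos) auto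
 then have "1 - u \<le> 0" using e by (simp add: algebra_simps)
 then have "u = 1" using u by simp
 then show False using e d2 d by simp
qed

text \<open>Drag the second puncture along a path to the second zero of the dipole, past a sphere so small that the path
 avoids it. The dipole then maps the complement of both punctures to nonzero vectors.\<close>

lemma sphere_null_off_two_points:
 fixes sig :: "'e::euclidean_space \<Rightarrow> 'y"
 assumes Y: "loc_euclid TYPE('e) Y" "Hausdorff_space Y" "connected_space Y" and n: "DIM('e) \<ge> 2"
  and sig: "cont_on (ball 0 2) Y sig" and open_sig: "openin Y (sig ` ball 0 2)"
  and kap: "continuous_map (subtopology Y (sig ` ball 0 2)) euclidean kap" "\<And>v. v \<in> ball 0 2 \<Longrightarrow> kap (sig v) = v"
  and y1: "y1 \<in> topspace Y" "y1 \<notin> sig ` ball 0 2"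
  and h: "continuous_map (nsphere k) unit_sphere h"
  and null: "nullh k (punctured (punctured Y (sig 0)) y1) (\<lambda>s. sig (h s))"
 shows "nullh k unit_sphere h"
proof -
 let ?Y = "punctured Y (sig 0)"
 have hc: "continuous_on (Sph k) h" "\<And>s. s \<in> Sph k \<Longrightarrow> norm (h s) = 1" using h by (auto simp: nsphere_eq)
 obtain w :: 'e where w: "norm w = 1" using norm_Basis SOME_Basis by blast
 let ?x1 = "sig ((1/2) *\<^sub>R w)"
 have inj: "sig v = sig v' \<longleftrightarrow> v = v'" if "v \<in> ball 0 2" "v' \<in> ball 0 2" for v v' using kap(2) that by metis
 have sY: "sig v \<in> topspace Y" if "v \<in> ball 0 2" for v using sig that by (auto simp: continuous_map_def)
 have w2: "(1/2) *\<^sub>R w \<in> ball 0 2" "(1/2) *\<^sub>R w \<noteq> 0" using w by auto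
 have x1: "?x1 \<in> topspace ?Y" using sY[OF w2(1)] inj[OF w2(1), of 0] w2 by (simp add: punctured_def)
 have y1': "y1 \<in> topspace ?Y" using y1 by (auto simp: punctured_def)
 obtain alp where "pathin ?Y alp" and a01: "alp 0 = y1" "alp 1 = ?x1"
  using path_connected_punctured[OF Y(1,3) n Y(2)] x1 y1' unfolding path_connected_space_def by blast
 then have a: "cont_on {0..1} ?Y alp" by (simp add: pathin_def)
 then have a': "cont_on {0..1} Y alp" "\<And>t. t \<in> {0..1} \<Longrightarrow> alp t \<noteq> sig 0" by (auto simp: into_punctured)
 have "compactin Y (alp ` {0..1})" by (rule image_compactin[OF _ a'(1)]) (simp add: compactin_subtopology)
 then have "closedin Y (alp ` {0..1})" using compactin_imp_closedin[OF Y(2)] by blast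
 then have "openin (top_of_set (ball 0 2)) {v \<in> ball 0 2. sig v \<in> topspace Y - alp ` {0..1}}"
  using open_preim[OF sig, of "topspace Y - alp ` {0..1}"] by (simp add: closedin_def)
 then have "open {v \<in> ball 0 2. sig v \<in> topspace Y - alp ` {0..1}}" by (rule openin_open_trans) simp
 moreover have "0 \<in> {v \<in> ball 0 2. sig v \<in> topspace Y - alp ` {0..1}}" using sY[of 0] a'(2) by fastforce
 ultimately obtain eps where eps: "eps > 0" "ball 0 eps \<subseteq> {v \<in> ball 0 2. sig v \<in> topspace Y - alp ` {0..1}}"
  unfolding open_contains_ball by meson
 \<comment> \<open>shrink the sphere until it avoids the path\<close>
 define dlt where "dlt = min (eps / 2) (1/4)"
 have d: "0 < dlt" "dlt \<le> 1/4" "dlt < eps" using eps(1) by (auto simp: dlt_def)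
 have dh: "sig (dlt *\<^sub>R h s) \<notin> alp ` {0..1}" if "s \<in> Sph k" for s using subsetD[OF eps(2), of "dlt *\<^sub>R h s"] hc(2)[OF that] d by auto
 have c: "cont_on S (punctured ?Y y1) (\<lambda>z. sig (q z *\<^sub>R h (r z)))"
  if "continuous_on S q" "continuous_on S r" "\<And>z. z \<in> S \<Longrightarrow> 0 < q z \<and> q z \<le> 1 \<and> r z \<in> Sph k" for S and q :: "'s::topological_space \<Rightarrow> real" and r
 proof -
  have b: "q z *\<^sub>R h (r z) \<in> ball 0 2" "q z *\<^sub>R h (r z) \<noteq> 0" if "z \<in> S" for z using that \<open>\<And>z. z \<in> S \<Longrightarrow> 0 < q z \<and> q z \<le> 1 \<and> r z \<in> Sph k\<close>[OF that] hc(2)[of "r z"] by auto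
  have "cont_on S Y (\<lambda>z. sig (q z *\<^sub>R h (r z)))"
   by (rule cmap_comp_on[OF _ _ sig]) (use that b in \<open>auto intro!: continuous_intros continuous_on_compose2[OF hc(1)]\<close>)
  moreover have "sig (q z *\<^sub>R h (r z)) \<noteq> sig 0" "sig (q z *\<^sub>R h (r z)) \<noteq> y1" if "z \<in> S" for z
   using b[OF that] inj[OF b(1)[OF that], of 0] y1(2) by auto
  ultimately show ?thesis by (simp add: into_punctured)
 qed
 have "cont_cyl (Sph k) (punctured ?Y y1) (\<lambda>z. sig (((1 - fst z) * dlt + fst z) *\<^sub>R h (snd z)))"
 proof (rule c)
  fix z :: "real \<times> (nat \<Rightarrow> real)" assume z: "z \<in> {0..1} \<times> Sph k"
  then have f: "0 \<le> fst z" "fst z \<le> 1" "snd z \<in> Sph k" by auto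
  have "(1 - fst z) * dlt + fst z \<le> 1 - fst z + fst z" using f d by (intro add_right_mono mult_left_le) auto
  moreover have "(1 - fst z) * dlt + fst z \<ge> (1 - fst z) * dlt + fst z * dlt" using f d by (intro add_left_mono mult_left_le) auto
  moreover have "(1 - fst z) * dlt + fst z * dlt = dlt" by (simp add: algebra_simps)
  ultimately show "0 < (1 - fst z) * dlt + fst z \<and> (1 - fst z) * dlt + fst z \<le> 1 \<and> snd z \<in> Sph k" using d f by simp
 qed (auto intro!: continuous_intros)
 then have "homot (nsphere k) (punctured ?Y y1) (\<lambda>s. sig (dlt *\<^sub>R h s)) (\<lambda>s. sig (h s))"
  unfolding nsphere_eq by (rule homotopic_withI_cyl) auto
 then have "nullh k (punctured ?Y y1) (\<lambda>s. sig (dlt *\<^sub>R h s))" using nullh_homotopic null by blast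
 from nullh_compose[OF this continuous_map_fib_conf[OF y1']]
 have "nullh k (fib (conf ?Y) fst (alp 0)) (\<lambda>s. (alp 0, sig (dlt *\<^sub>R h s)))" by (simp add: o_def a01)
 then obtain y where y: "homot (top_of_set (Sph k)) (fib (conf ?Y) fst (alp 0)) (\<lambda>s. (alp 0, sig (dlt *\<^sub>R h s))) (\<lambda>_. y)"
  unfolding nullh_def nsphere_eq by blast
 define G where "G z = (alp (fst z), sig (dlt *\<^sub>R h (snd z)))" for z
 have G: "cont_cyl (Sph k) (conf ?Y) G"
 proof -
  have "cont_cyl (Sph k) ?Y (\<lambda>z. alp (fst z))" by (rule cmap_comp_on[OF _ _ a]) (auto intro!: continuous_intros)
  moreover have "cont_cyl (Sph k) ?Y (\<lambda>z. sig (dlt *\<^sub>R h (snd z)))"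
   using c[OF continuous_on_const[of "{0..1::real} \<times> Sph k" dlt] continuous_on_snd[OF continuous_on_id]] d
   by (simp add: into_punctured mem_Times_iff)
  moreover have "alp (fst z) \<noteq> sig (dlt *\<^sub>R h (snd z))" if "z \<in> {0..1} \<times> Sph k" for z using dh[of "snd z"] that by (metis imageI mem_Times_iff)
  ultimately show ?thesis unfolding into_conf by (auto simp: o_def G_def)
 qed
 have "\<exists>y'. homot (top_of_set (Sph k)) (fib (conf ?Y) fst (alp 1)) (\<lambda>s. G (1, s)) (\<lambda>_. y')"
  by (rule null_homotopy_transport[OF sliced_conf[OF loc_euclid_punctured[OF Y(1,2)]] compact_Sph _ G])
   (use y pole_in_Sph Y(2) in \<open>auto simp: G_def punctured_def Hausdorff_space_subtopology\<close>)
 then have "nullh k (fib (conf ?Y) fst ?x1) (\<lambda>s. (?x1, sig (dlt *\<^sub>R h s)))"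
  unfolding nullh_def nsphere_eq by (simp add: G_def a01)
 from nullh_compose[OF this continuous_map_conf_fib]
 have N: "nullh k (punctured ?Y ?x1) (\<lambda>s. sig (dlt *\<^sub>R h s))" by (simp add: o_def)
 \<comment> \<open>the dipole extends by a constant from the chart to the whole space\<close>
 define q where "q y = (if y \<in> sig ` ball 0 2 then dipole w (kap y) else - w)" for y
 have qs: "q (sig v) = dipole w v" if "v \<in> ball 0 2" for v using that kap(2) by (auto simp: q_def)
 have q: "continuous_map Y euclidean q"
 proof (rule pasting_lemma[where I="{True, False}" and T="\<lambda>i. if i then sig ` ball 0 2 else topspace Y - sig ` cball 0 1" and f="\<lambda>i. if i then (\<lambda>y. dipole w (kap y)) else (\<lambda>_. - w)"])
  have "continuous_map euclidean euclidean (dipole w)" unfolding dipole_def[abs_def] by (auto intro!: continuous_intros)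
  from cmap_comp[OF kap(1) this]
  show "continuous_map (subtopology Y (if i then sig ` ball 0 2 else topspace Y - sig ` cball 0 1)) euclidean (if i then (\<lambda>y. dipole w (kap y)) else (\<lambda>_. - w))" for i
   by (simp add: o_def)
  have "cball (0::'e) 1 \<subseteq> ball 0 2" by auto
  then have "compactin Y (sig ` cball 0 1)" by (intro image_compactin[OF _ sig]) (simp add: compactin_subtopology)
  then have "closedin Y (sig ` cball 0 1)" using compactin_imp_closedin[OF Y(2)] by blast
  then show "openin Y (if i then sig ` ball 0 2 else topspace Y - sig ` cball 0 1)" for i using open_sig by (simp add: closedin_def)
  have far: "dipole w (kap y) = - w" if "y \<in> sig ` ball 0 2" "y \<notin> sig ` cball 0 1" for y
  proof -
   obtain v where v: "v \<in> ball 0 2" "y = sig v" using \<open>y \<in> sig ` ball 0 2\<close> by blast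
   then have "norm v \<ge> 1" using \<open>y \<notin> sig ` cball 0 1\<close> by (meson image_eqI le_cases mem_cball_0)
   then show ?thesis using kap(2)[OF v(1)] v(2) dipole_far by simp
  qed
  show "(if i then (\<lambda>y. dipole w (kap y)) else (\<lambda>_. - w)) y = (if j then (\<lambda>y. dipole w (kap y)) else (\<lambda>_. - w)) y"
   if "y \<in> topspace Y \<inter> (if i then sig ` ball 0 2 else topspace Y - sig ` cball 0 1) \<inter> (if j then sig ` ball 0 2 else topspace Y - sig ` cball 0 1)" for i j y
   using that far[of y] by (cases i; cases j) simp_all
  have sub: "sig ` cball 0 1 \<subseteq> sig ` ball 0 2" using \<open>cball (0::'e) 1 \<subseteq> ball 0 2\<close> by blast
  show "\<exists>j. j \<in> {True, False} \<and> y \<in> (if j then sig ` ball 0 2 else topspace Y - sig ` cball 0 1) \<and> q y = (if j then (\<lambda>y. dipole w (kap y)) else (\<lambda>_. - w)) y"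
   if "y \<in> topspace Y" for y
  proof (cases "y \<in> sig ` ball 0 2")
   case True
   then show ?thesis by (intro exI[of _ True]) (simp add: q_def)
  next
   case False
   then have "y \<notin> sig ` cball 0 1" using sub by blast
   then show ?thesis using False that by (intro exI[of _ False]) (simp add: q_def)
  qed
 qed
 have q0: "q y \<noteq> 0" if "y \<noteq> sig 0" "y \<noteq> ?x1" for y
 proof (cases "y \<in> sig ` ball 0 2")
  case True
  then obtain v where v: "v \<in> ball 0 2" "y = sig v" by blast
  then show ?thesis using qs[OF v(1)] dipole_zero[OF w, of v] that by metis
 qed (use w in \<open>auto simp: q_def\<close>)
 have "continuous_map (punctured ?Y ?x1) (top_of_set (- {0})) q"
  using q q0 by (auto simp: into_sub punctured_def intro!: cmap_restrict)
 from nullh_compose[OF N this] have "nullh k (top_of_set (- {0})) (\<lambda>s. dipole w (dlt *\<^sub>R h s))"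
  by (rule nullh_cong) (use d hc(2) qs in auto)
 then show ?thesis by (rule nullh_sphere_if[OF h]) (use dipole_near[OF w hc(2) d(1,2)] in blast)
qed


text \<open>A sphere of positive dimension is connected, and the fibers of a covering are discrete.\<close>

lemma covering_constant:
 assumes Y: "covering Y (top_of_set S) p" "Hausdorff_space Y" and k: "k \<ge> 1" and e: "cont_on (Sph k) Y e"
  and pe: "\<And>s. s \<in> Sph k \<Longrightarrow> p (e s) = x" and s: "s \<in> Sph k"
 shows "e s = e (pole k)"
proof -
 let ?y = "e (pole k)" and ?T = "{s \<in> Sph k. e s = e (pole k)}"
 have y: "?y \<in> topspace Y" using e pole_in_Sph[of k] by (auto simp: continuous_map_def)
 obtain U f where U: "openin (top_of_set S) U" "p ?y \<in> U" "\<forall>x\<in>U. p (f x) = x" "f (p ?y) = ?y" "openin Y (f ` U)"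
  using Y(1) y unfolding covering_def local_homeo_def by (meson order_refl)
 have "{s \<in> topspace (top_of_set (Sph k)). e s \<in> f ` U} = ?T" using U(2,3,4) pe pole_in_Sph[of k] by force
 then have "openin (top_of_set (Sph k)) ?T" using open_preim[OF e U(5)] by simp
 moreover have "closedin (top_of_set (Sph k)) ?T" using closedin_continuous_maps_eq[OF Y(2) e, of "\<lambda>_. ?y"] y by simp
 ultimately show ?thesis using connected_Sph[OF k] pole_in_Sph[of k] s unfolding connected_clopen by blast
qed

lemma simply_connected_space_if:
 fixes S :: "'b::real_normed_vector set"
 assumes h: "homeomorphic_maps X (top_of_set S) F G" and S: "simply_connected S"
 shows "simply_connected_space X"
proof -
 have F: "continuous_map X (top_of_set S) F" "cont_on S X G" "\<And>x. x \<in> topspace X \<Longrightarrow> G (F x) = x"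
  using h by (auto simp: homeomorphic_maps_def)
 have "top_of_set S homeomorphic_space X" using h homeomorphic_maps_sym homeomorphic_space_def by blast
 then have pc: "path_connected_space X"
  using S simply_connected_imp_path_connected homeomorphic_path_connected_space_imp path_connected_space_euclidean_subtopology by metis
 have null: "nullh 1 X f" if f: "continuous_map (nsphere 1) X f" for f
 proof -
  define u where "u z = (\<lambda>i. Re z * pole 0 i + Im z * pole 1 i)" for z
  have "continuous_on (sphere 0 1) u"
   unfolding u_def[abs_def] by (rule continuous_on_coordinatewise_then_product) (intro continuous_intros)
  moreover have "u z \<in> Sph 1" if "z \<in> sphere 0 1" for z using that by (auto simp: u_def Sph_def cmod_def pole_def)
  ultimately have "cont_on (sphere 0 1) (nsphere 1) u" by (auto simp: nsphere_eq)
  from cmap_comp[OF cmap_comp[OF this f] F(1)]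
  have "continuous_on (sphere 0 1) (F \<circ> (f \<circ> u)) \<and> (F \<circ> (f \<circ> u)) ` sphere 0 1 \<subseteq> S"
   by (simp add: image_subset_iff_funcset o_def)
  then obtain a where a: "homotopic_with_canon (\<lambda>h. True) (sphere 0 1) S (F \<circ> (f \<circ> u)) (\<lambda>x. a)"
   using S unfolding simply_connected_eq_contractible_circlemap by blast
  have "continuous_map (nsphere 1) (top_of_set (sphere 0 1)) (\<lambda>x. Complex (x 0) (x 1))"
   by (auto simp: nsphere_eq Sph_def cmod_def Complex_eq intro!: continuous_intros continuous_on_product_coordinates)
  from homotopic_with_compose_continuous_map_right[OF homotopic_with_compose_continuous_map_left[OF a F(2), of "\<lambda>_. True"] this, of "\<lambda>_. True"]
  have "nullh 1 X (G \<circ> (F \<circ> (f \<circ> u)) \<circ> (\<lambda>x. Complex (x 0) (x 1)))" unfolding nullh_def by (auto simp: o_def)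
  then show ?thesis
  proof (rule nullh_cong)
   fix x assume x: "x \<in> Sph 1"
   have "u (Complex (x 0) (x 1)) = x" using x by (auto simp: u_def Sph_def fun_eq_iff pole_def)
   moreover have "f x \<in> topspace X" using f x by (auto simp: continuous_map_def nsphere_eq)
   ultimately show "f x = (G \<circ> (F \<circ> (f \<circ> u)) \<circ> (\<lambda>x. Complex (x 0) (x 1))) x" using F(3) by simp
  qed
 qed
 have "hgroup 1 X b = {hzero 1 X b}" if "b \<in> topspace X" for b
 proof -
  have "hclass 1 X b f = hzero 1 X b" if "based_map 1 X b f" for f
   using hclass_eq_hzero_iff[OF that] null that by (simp add: based_map_def)
  moreover have "based_map 1 X b (\<lambda>_. b)" using that by (simp add: based_map_def)
  ultimately show ?thesis unfolding hgroup_def by blast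
 qed
 then show ?thesis using pc by (simp add: simply_connected_space_def)
qed

context ball_mfd
begin

lemma null_inclusion_not_simply_connected:
 assumes nsc: "\<not> simply_connected_space X" and n: "DIM('e) \<ge> 2" and k: "k \<ge> 1"
  and h: "continuous_map (nsphere k) unit_sphere h" and null: "nullh k (punctured X x0) (jm \<circ> h)"
 shows "nullh k unit_sphere h"
proof -
 have hc: "continuous_on (Sph k) h" "\<And>s. s \<in> Sph k \<Longrightarrow> norm (h s) = 1" using h by (auto simp: nsphere_eq)
 obtain F :: "'a \<Rightarrow> (nat \<Rightarrow>\<^sub>C real)" where "homeomorphic_map X (top_of_set (F ` topspace X)) F" using normed_embedding by blast
 then obtain G where FG: "homeomorphic_maps X (top_of_set (F ` topspace X)) F G" using homeomorphic_map_maps by blast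
 define S where "S = F ` topspace X"
 have F: "continuous_map X (top_of_set S) F" "cont_on S X G" "\<And>x. x \<in> topspace X \<Longrightarrow> G (F x) = x" "\<And>x. x \<in> S \<Longrightarrow> F (G x) = x"
  using FG by (auto simp: homeomorphic_maps_def S_def)
 have Fo: "openin (top_of_set S) (F ` V)" if "openin X V" for V
  using FG that homeomorphic_imp_open_map homeomorphic_maps_map unfolding open_map_def S_def by blast
 have leS: "loc_euclid TYPE('e) (top_of_set S)"
 proof (rule loc_euclid_local_homeo[OF mfd_loc_euclid, of _ G], unfold local_homeo_def, intro conjI ballI)
  show "cont_on S X G" by (rule F(2))
  fix y assume y: "y \<in> topspace (top_of_set S)"
  have "G y \<in> topspace X" using F(2) y by (auto simp: continuous_map_def)
  then show "\<exists>W s. openin X W \<and> G y \<in> W \<and> continuous_map (subtopology X W) (top_of_set S) s \<and>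
   (\<forall>x\<in>W. G (s x) = x) \<and> s (G y) = y \<and> (\<forall>V. openin X V \<longrightarrow> V \<subseteq> W \<longrightarrow> openin (top_of_set S) (s ` V))"
   by (intro exI[of _ "topspace X"] exI[of _ F]) (use F Fo y in auto)
 qed
 have S: "connected_space (top_of_set S)" using con FG homeomorphic_connected_space homeomorphic_space_def unfolding S_def by metis
 have nS: "\<not> simply_connected S" using simply_connected_space_if[OF FG] nsc unfolding S_def by blast
 have "F x0 \<in> S" using x0 by (simp add: S_def)
 from covering_exists[OF leS S nS this]
 obtain Y :: "(real \<Rightarrow> (nat \<Rightarrow>\<^sub>C real)) set topology" and p y0 y1 where Y: "covering Y (top_of_set S) p" "Hausdorff_space Y" "connected_space Y"
  and y: "y0 \<in> topspace Y" "y1 \<in> topspace Y" "p y0 = F x0" "p y1 = F x0" "y0 \<noteq> y1" by (elim exE conjE)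
 have pc: "continuous_map Y (top_of_set S) p" and sl: "sliced Y (top_of_set S) p" using Y(1) by (auto simp: covering_def sliced_def)
 have leY: "loc_euclid TYPE('e) Y" using loc_euclid_local_homeo[OF leS] Y(1) unfolding covering_def by blast
 \<comment> \<open>a small ball lifts to a neighbourhood of one of the two points\<close>
 obtain U s where U: "openin (top_of_set S) U" "p y0 \<in> U" "continuous_map (subtopology (top_of_set S) U) Y s" "\<And>x. x\<in>U \<Longrightarrow> p (s x) = x" "s (p y0) = y0"
   "\<And>V. openin (top_of_set S) V \<Longrightarrow> V \<subseteq> U \<Longrightarrow> openin Y (s ` V)" using Y(1) y(1) unfolding covering_def local_homeo_def by meson
 have Fc: "cont_on dimg (top_of_set S) (F \<circ> chart_inv c)" by (rule cmap_comp[OF chart_inv_continuous[OF cA] F(1)])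
 have "openin (top_of_set dimg) {y \<in> dimg. F (chart_inv c y) \<in> U}" using open_preim[OF Fc U(1)] by (simp add: o_def)
 then have "open {y \<in> dimg. F (chart_inv c y) \<in> U}" by (rule openin_open_trans) (rule chart_image_open[OF cA])
 moreover have "a \<in> {y \<in> dimg. F (chart_inv c y) \<in> U}" using a_in U(2) y(3) by (simp add: ball_center_def)
 ultimately obtain eps where eps: "eps > 0" "ball a eps \<subseteq> {y \<in> dimg. F (chart_inv c y) \<in> U}" unfolding open_contains_ball by meson
 define rho where "rho = min (eps / 2) r"
 have rho: "0 < rho" "rho \<le> eps / 2" "rho \<le> r" using eps r by (auto simp: rho_def)
 define m where "m v = a + rho *\<^sub>R v" for v
 have m: "m v \<in> dimg" "F (chart_inv c (m v)) \<in> U" if "v \<in> ball 0 2" for v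
 proof -
  have "rho * norm v < rho * 2" using that rho by (intro mult_strict_left_mono) auto
  then have "rho * norm v < eps" using rho by linarith
  then have "m v \<in> ball a eps" using rho by (simp add: m_def dist_norm)
  then show "m v \<in> dimg" "F (chart_inv c (m v)) \<in> U" using eps(2) by auto
 qed
 have mc: "continuous_on T m" for T unfolding m_def[abs_def] by (intro continuous_intros)
 define sig where "sig v = s (F (chart_inv c (m v)))" for v
 have US: "U \<subseteq> S" using openin_imp_subset[OF U(1)] .
 have sigc: "cont_on (ball 0 2) Y sig"
 proof -
  have "cont_on (ball 0 2) (top_of_set S) (\<lambda>v. (F \<circ> chart_inv c) (m v))"
   by (rule cmap_comp_on[OF mc _ Fc]) (use m in auto)
  then have "cont_on (ball 0 2) (subtopology (top_of_set S) U) (\<lambda>v. F (chart_inv c (m v)))"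
   using m(2) by (auto simp: into_sub o_def)
  from cmap_comp[OF this U(3)] show ?thesis by (simp add: o_def sig_def[abs_def])
 qed
 have psig: "p (sig v) = F (chart_inv c (m v))" if "v \<in> ball 0 2" for v unfolding sig_def by (rule U(4)[OF m(2)[OF that]])
 have sig0: "sig 0 = y0" using U(5) y(3) by (simp add: sig_def m_def ball_center_def)
 have Gp: "G (p (sig v)) = chart_inv c (m v)" if "v \<in> ball 0 2" for v
  unfolding psig[OF that] by (rule F(3)[OF dom_topspace[OF cA chart_inv_in[OF m(1)[OF that]]]])
 have sigo: "openin Y (sig ` ball 0 2)"
 proof -
  have "open (m ` ball 0 2)" unfolding m_def[abs_def] image_comp[symmetric, of "(+) a" "(*\<^sub>R) rho", unfolded o_def]
   using rho by (intro open_translation open_scaling) auto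
  then have "openin (subtopology X (chart_dom c)) {x \<in> topspace (subtopology X (chart_dom c)). snd c x \<in> m ` ball 0 2}"
   by (intro open_preim[OF chart_cont[OF cA]]) simp
  then have "openin X {x \<in> topspace (subtopology X (chart_dom c)). snd c x \<in> m ` ball 0 2}" using openin_trans_full chart_open[OF cA] by blast
  moreover have "{x \<in> topspace (subtopology X (chart_dom c)). snd c x \<in> m ` ball 0 2} = chart_inv c ` m ` ball 0 2"
  proof
   show "{x \<in> topspace (subtopology X (chart_dom c)). snd c x \<in> m ` ball 0 2} \<subseteq> chart_inv c ` m ` ball 0 2"
    using chart_inv_chart[OF cA] unfolding topspace_dom[OF cA] by force
   show "chart_inv c ` m ` ball 0 2 \<subseteq> {x \<in> topspace (subtopology X (chart_dom c)). snd c x \<in> m ` ball 0 2}"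
    using chart_inv_in[OF m(1)] chart_chart_inv[OF m(1)] unfolding topspace_dom[OF cA] by auto
  qed
  ultimately have "openin X (chart_inv c ` m ` ball 0 2)" by simp
  from U(6)[OF Fo[OF this]] have "openin Y (s ` F ` chart_inv c ` m ` ball 0 2)" using m(2) by blast
  then show ?thesis by (simp add: image_image sig_def)
 qed
 let ?kap = "\<lambda>y. (snd c (G (p y)) - a) /\<^sub>R rho"
 have kap: "?kap (sig v) = v" if "v \<in> ball 0 2" for v
  using rho Gp[OF that] chart_chart_inv[OF m(1)[OF that]] by (simp add: m_def)
 have kapc: "continuous_map (subtopology Y (sig ` ball 0 2)) euclidean ?kap"
 proof -
  have "continuous_map (subtopology Y (sig ` ball 0 2)) X (\<lambda>y. G (p y))"
   using cmap_comp[OF pc F(2)] by (auto simp: o_def intro: cmap_restrict)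
  then have "continuous_map (subtopology Y (sig ` ball 0 2)) (subtopology X (chart_dom c)) (\<lambda>y. G (p y))"
   using Gp chart_inv_in[OF m(1)] by (auto simp: into_sub)
  from cmap_comp[OF this chart_cont[OF cA]]
  have 1: "continuous_map (subtopology Y (sig ` ball 0 2)) euclidean (\<lambda>y. snd c (G (p y)))" by (simp add: o_def)
  have "continuous_map euclidean euclidean (\<lambda>x::'e. (x - a) /\<^sub>R rho)" by (auto intro!: continuous_intros)
  from cmap_comp[OF 1 this] show ?thesis by (simp add: o_def)
 qed
 have y1: "y1 \<notin> sig ` ball 0 2"
 proof
  assume "y1 \<in> sig ` ball 0 2"
  then obtain v where v: "v \<in> ball 0 2" "y1 = sig v" by blast
  have z: "(0::'e) \<in> ball 0 2" by simp
  have "p (sig v) = p (sig 0)" using y(3,4) v(2) sig0 by simp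
  then have "v = 0" using kap[OF v(1)] kap[OF z] by simp
  then show False using v(2) sig0 y(5) by simp
 qed
 \<comment> \<open>lift the null-homotopy\<close>
 have hb: "h s \<in> ball 0 2" if "s \<in> Sph k" for s using hc(2)[OF that] by simp
 have "nullh k (punctured X x0) (\<lambda>s. chart_inv c (m (h s)))" unfolding m_def by (rule nullh_homotopic[OF small_spheres_homotopic[OF h rho(1,3)] null])
 then obtain x' where "homot (top_of_set (Sph k)) (punctured X x0) (\<lambda>s. chart_inv c (m (h s))) (\<lambda>_. x')"
  unfolding nullh_def nsphere_eq by blast
 from homotopic_withD_cyl[OF this] obtain H where H: "cont_cyl (Sph k) (punctured X x0) H"
  "\<forall>s. H (0, s) = chart_inv c (m (h s))" "\<forall>s. H (1, s) = x'" by blast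
 have H': "cont_cyl (Sph k) X H" "\<And>z. z \<in> {0..1} \<times> Sph k \<Longrightarrow> H z \<noteq> x0 \<and> H z \<in> topspace X"
 proof -
  show 1: "cont_cyl (Sph k) X H" using H(1) by (simp add: into_punctured)
  show "H z \<noteq> x0 \<and> H z \<in> topspace X" if "z \<in> {0..1} \<times> Sph k" for z
   using H(1) 1 that unfolding into_punctured by (auto simp: continuous_map_def)
 qed
 have FH: "cont_cyl (Sph k) (top_of_set S) (\<lambda>z. F (H z))" using cmap_comp[OF H'(1) F(1)] by (simp add: o_def)
 have sh: "cont_on (Sph k) Y (\<lambda>s. sig (h s))" by (rule cmap_comp_on[OF hc(1) _ sigc]) (use hb in auto)
 have "p (sig (h s)) = F (H (0, s))" if "s \<in> Sph k" for s using psig[OF hb[OF that]] H(2) by simp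
 then obtain K where K: "cont_cyl (Sph k) Y K" "\<forall>s\<in>Sph k. K (0, s) = sig (h s)" "\<forall>t\<in>{0..1}. \<forall>s\<in>Sph k. p (K (t, s)) = F (H (t, s))"
  using homotopy_lifting[OF sl compact_Sph FH sh] by blast
 have "p (K z) \<noteq> F x0" if "z \<in> {0..1} \<times> Sph k" for z
  using K(3) H'(2)[OF that] F(3) x0(3) that by (metis mem_Times_iff prod.collapse)
 then have "K z \<noteq> y0" "K z \<noteq> y1" if "z \<in> {0..1} \<times> Sph k" for z using that y(3,4) by metis+
 then have K': "cont_cyl (Sph k) (punctured (punctured Y y0) y1) K" using K(1) by (simp add: into_punctured)
 have K1: "K (1, s) = K (1, pole k)" if "s \<in> Sph k" for s
 proof (rule covering_constant[OF Y(1,2) k _ _ that, of "\<lambda>s. K (1, s)" "F x'"])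
  show "cont_on (Sph k) Y (\<lambda>s. K (1, s))" by (rule cmap_comp_pair[OF _ _ _ K(1)]) (auto intro!: continuous_intros)
  show "p (K (1, s)) = F x'" if "s \<in> Sph k" for s using K(3) H(3) that by simp
 qed
 have "homot (top_of_set (Sph k)) (punctured (punctured Y y0) y1) (\<lambda>s. sig (h s)) (\<lambda>_. K (1, pole k))"
  by (rule homotopic_withI_cyl[OF K']) (use K(2) K1 in auto)
 then have "nullh k (punctured (punctured Y (sig 0)) y1) (\<lambda>s. sig (h s))" unfolding nullh_def nsphere_eq sig0 by blast
 from sphere_null_off_two_points[OF leY Y(2,3) n sigc sigo kapc kap y(2) y1 h this] show ?thesis .
qed

end

section \<open>Projective spaces\<close>

text \<open>Covers the reals, the complex numbers and the quaternions; lines are sets of right multiples.\<close>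

locale skew_field =
 fixes mul :: "'K::euclidean_space \<Rightarrow> 'K \<Rightarrow> 'K" and e :: 'K and inv' :: "'K \<Rightarrow> 'K"
 assumes bil: "bilinear mul" and assoc: "mul (mul x y) z = mul x (mul y z)"
  and unit: "mul e x = x" "mul x e = x" "e \<noteq> 0"
  and inverse: "x \<noteq> 0 \<Longrightarrow> mul x (inv' x) = e" "x \<noteq> 0 \<Longrightarrow> mul (inv' x) x = e"
  and inv_continuous: "continuous_on (- {0}) inv'"
begin

lemma mul_0: "mul 0 x = 0" "mul x 0 = 0" using bilinear_lzero[OF bil] bilinear_rzero[OF bil] by auto

lemma mul_eq_0: "mul x y = 0 \<longleftrightarrow> x = 0 \<or> y = 0" using assoc[of "inv' x" x y] inverse(2)[of x] unit(1) mul_0 by metis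

definition scale :: "'K ^ 'i \<Rightarrow> 'K \<Rightarrow> 'K ^ 'i" where
 "scale x l = (\<chi> i. mul (x $ i) l)"

lemma scale_nth [simp]: "scale x l $ i = mul (x $ i) l" by (simp add: scale_def)

lemma scale_scale: "scale (scale x l) m = scale x (mul l m)"
 and scale_e: "scale x e = x" by (simp_all add: vec_eq_iff assoc unit)

lemma scale_eq_0: "scale x l = 0 \<longleftrightarrow> x = 0 \<or> l = 0" by (auto simp: vec_eq_iff mul_eq_0)

lemma scale_continuous:
 "continuous_on S f \<Longrightarrow> continuous_on S g \<Longrightarrow> continuous_on S (\<lambda>z. scale (f z) (g z))"
 unfolding scale_def using bil bilinear_conv_bounded_bilinear
 by (intro continuous_on_vec_lambda bounded_bilinear.continuous_on[of mul]) (auto intro!: continuous_intros)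

lemma line_eq: "line mul x = range (scale x)" by (simp add: line_def scale_def)

lemma line_scale: "l \<noteq> 0 \<Longrightarrow> line mul (scale x l) = line mul x"
proof -
 assume "l \<noteq> 0"
 then have "scale x m = scale (scale x l) (mul (inv' l) m)" for m
  by (simp add: scale_scale assoc[symmetric] inverse unit)
 then show ?thesis unfolding line_eq by (auto simp: scale_scale)
qed

lemma line_eqD: "line mul x = line mul y \<Longrightarrow> \<exists>l. x = scale y l" unfolding line_eq using scale_e by (metis rangeE rangeI)

definition norm_rep :: "'i \<Rightarrow> 'K ^ 'i \<Rightarrow> 'K ^ 'i" where
 "norm_rep i x = scale x (inv' (x $ i))"

lemma norm_rep_line: "x $ i \<noteq> 0 \<Longrightarrow> line mul (norm_rep i x) = line mul x"
 unfolding norm_rep_def by (rule line_scale) (use inverse(1) unit(3) mul_0 in metis)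

lemma norm_rep_scale:
 assumes "l \<noteq> 0" "x $ i \<noteq> 0" shows "norm_rep i (scale x l) = norm_rep i x"
proof -
 have "mul l (inv' (mul (x $ i) l)) = inv' (x $ i)"
 proof -
  have 1: "mul (x $ i) (mul l (inv' (mul (x $ i) l))) = e"
   using assms inverse(1)[of "mul (x $ i) l"] mul_eq_0 by (simp add: assoc)
  have "mul l (inv' (mul (x $ i) l)) = mul (mul (inv' (x $ i)) (x $ i)) (mul l (inv' (mul (x $ i) l)))"
   by (simp add: inverse assms unit)
  also have "\<dots> = inv' (x $ i)" unfolding assoc[of "inv' (x $ i)"] 1 by (rule unit)
  finally show ?thesis .
 qed
 then show ?thesis by (simp add: norm_rep_def scale_scale)
qed

abbreviation "PS \<equiv> proj_space mul :: ('K ^ 'k::finite option) set topology"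

lemma topspace_PS: "topspace PS = line mul ` {x :: 'K ^ 'k::finite option. x \<noteq> 0}"
proof -
 have "{x::'K ^ 'k option. x \<noteq> 0 \<and> line mul x \<in> line mul ` {x. x \<noteq> 0}} = - {0}" by auto
 then have "openin PS (line mul ` {x :: 'K ^ 'k option. x \<noteq> 0})" unfolding openin_proj_space by (simp add: open_Compl)
 from openin_subset[OF this] openin_topspace[of PS] show ?thesis unfolding openin_proj_space by blast
qed

lemma line_continuous: "cont_on (- {0}) PS (line mul)" unfolding continuous_map_def
proof (intro conjI allI impI)
 show "line mul \<in> topspace (top_of_set (- {0})) \<rightarrow> topspace PS" by (auto simp: topspace_PS)
 fix U assume "openin PS U"
 then have "open {x. x \<noteq> 0 \<and> line mul x \<in> U}" by (simp add: openin_proj_space)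
 then show "openin (top_of_set (- {0})) {x \<in> topspace (top_of_set (- {0})). line mul x \<in> U}"
  by (simp add: openin_open_eq open_Compl)
qed

definition affine :: "'k::finite option \<Rightarrow> ('K ^ 'k option) set set" where
 "affine i = line mul ` {x. x $ i \<noteq> 0}"

definition sect :: "'k::finite option \<Rightarrow> ('K ^ 'k option) set \<Rightarrow> 'K ^ 'k option" where
 "sect i L = norm_rep i (SOME x. L = line mul x \<and> x \<noteq> 0)"

lemma sect_line:
 assumes "x $ i \<noteq> 0" shows "sect i (line mul x) = norm_rep i x"
proof -
 let ?y = "SOME y. line mul x = line mul y \<and> y \<noteq> 0"
 have "x \<noteq> 0" using assms by auto
 then have y: "line mul x = line mul ?y \<and> ?y \<noteq> 0" using someI[of "\<lambda>y. line mul x = line mul y \<and> y \<noteq> 0" x] by blast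
 then obtain l where l: "?y = scale x l" using line_eqD[of ?y x] by metis
 have "scale x l \<noteq> 0" unfolding l[symmetric] using y by blast
 then have "l \<noteq> 0" using scale_eq_0 by blast
 then show ?thesis unfolding sect_def l by (rule norm_rep_scale[OF _ assms])
qed

lemma sect_affine:
 assumes "L \<in> affine i" shows "line mul (sect i L) = L" "sect i L $ i = e" "sect i L \<noteq> 0"
proof -
 obtain x where x: "L = line mul x" "x $ i \<noteq> 0" using assms unfolding affine_def by blast
 show "line mul (sect i L) = L" unfolding x(1) sect_line[OF x(2)] by (rule norm_rep_line[OF x(2)])
 show "sect i L $ i = e" using x by (simp add: sect_line norm_rep_def inverse)
 then show "sect i L \<noteq> 0" using unit(3) by auto
qed

lemma affine_iff: "x \<noteq> 0 \<Longrightarrow> line mul x \<in> affine i \<longleftrightarrow> x $ i \<noteq> 0"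
proof
 assume x: "x \<noteq> 0" "line mul x \<in> affine i"
 then obtain y where y: "line mul x = line mul y" "y $ i \<noteq> 0" unfolding affine_def by blast
 then obtain l where l: "x = scale y l" using line_eqD by blast
 then have "l \<noteq> 0" using x(1) scale_eq_0 by blast
 then show "x $ i \<noteq> 0" using l y(2) mul_eq_0 by simp
qed (simp add: affine_def)

lemma affine_subset: "affine i \<subseteq> line mul ` {x. x \<noteq> 0}" unfolding affine_def by (intro image_mono subsetI) clarsimp

lemma affine_open: "openin PS (affine i)"
proof -
 have "x \<noteq> 0 \<and> line mul x \<in> affine i \<longleftrightarrow> x \<in> - {x. x $ i = 0}" for x by (cases "x = 0") (simp_all add: affine_iff)
 then have "{x. x \<noteq> 0 \<and> line mul x \<in> affine i} = - {x. x $ i = 0}" by blast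
 moreover have "closed {x. x $ i = (0::'K)}" by (intro closed_Collect_eq continuous_intros)
 ultimately show ?thesis unfolding openin_proj_space using affine_subset by (simp add: open_Compl)
qed

lemma sect_continuous:
 fixes i :: "'k::finite option"
 shows "continuous_map (subtopology PS (affine i)) (top_of_set (- {0})) (sect i)"
proof -
 have t: "topspace (subtopology PS (affine i)) = affine i" using openin_subset[OF affine_open] by auto
 have n: "continuous_on {x. x $ i \<noteq> 0} (norm_rep i)"
  unfolding norm_rep_def by (intro scale_continuous continuous_on_compose2[OF inv_continuous]) (auto intro!: continuous_intros)
 have o: "open {x::'K ^ 'k option. x $ i \<noteq> 0}" by (rule open_Collect_neq) (intro continuous_intros)+
 have "continuous_map (subtopology PS (affine i)) euclidean (sect i)" unfolding continuous_map_def
 proof (intro conjI allI impI)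
  fix W :: "('K ^ 'k option) set" assume "openin euclidean W"
  then have W: "open W" by simp
  let ?T = "{L \<in> affine i. sect i L \<in> W}"
  have "x \<noteq> 0 \<and> line mul x \<in> ?T \<longleftrightarrow> x \<in> {x. x $ i \<noteq> 0} \<inter> norm_rep i -` W" for x
   using affine_iff[of x i] sect_line[of x i] by (cases "x = 0") auto
  then have "{x. x \<noteq> 0 \<and> line mul x \<in> ?T} = {x. x $ i \<noteq> 0} \<inter> norm_rep i -` W" by blast
  then have "openin PS ?T"
   unfolding openin_proj_space using continuous_open_preimage[OF n o W] affine_subset[of i] by auto
  then show "openin (subtopology PS (affine i)) {L \<in> topspace (subtopology PS (affine i)). sect i L \<in> W}"
   unfolding t using affine_open[of i] by (intro openin_open_subtopology[THEN iffD2]) auto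
 qed auto
 then show ?thesis using sect_affine(3) t by (auto simp: into_sub)
qed

text \<open>The tautological bundle: normalize the \<open>i\<close>-th coordinate over an affine chart.\<close>

lemma sliced_line: "sliced (top_of_set (- {0})) PS (line mul)" unfolding sliced_def
proof (intro conjI ballI line_continuous)
 fix L assume "L \<in> topspace PS"
 then obtain x where x: "L = line mul x" "x \<noteq> 0" unfolding topspace_PS by blast
 then obtain i where i: "x $ i \<noteq> 0" by (auto simp: vec_eq_iff)
 let ?T = "\<lambda>x L. scale (sect i L) (x $ i)"
 let ?Z = "subtopology (prod_topology (top_of_set (- {0})) PS) {(x, L). line mul x \<in> affine i \<and> L \<in> affine i}"
 have 1: "continuous_map ?Z euclidean fst" using cmap_restrict[OF continuous_map_fst] into_sub by metis
 have "continuous_map ?Z (subtopology PS (affine i)) snd"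
  by (auto simp: into_sub intro: cmap_restrict continuous_map_snd)
 from cmap_comp[OF this sect_continuous] have 2: "continuous_map ?Z euclidean (sect i \<circ> snd)" by (auto simp: into_sub)
 have "continuous_map ?Z euclidean (\<lambda>z. (fst z, sect i (snd z)))"
  using continuous_map_pairedI[OF 1 2] by (simp add: o_def)
 moreover have "continuous_on UNIV (\<lambda>w. scale (snd w) (fst w $ i))" by (intro scale_continuous continuous_intros)
 ultimately have "continuous_map ?Z euclidean ((\<lambda>w. scale (snd w) (fst w $ i)) \<circ> (\<lambda>z. (fst z, sect i (snd z))))"
  by (intro cmap_comp) auto
 then have "continuous_map ?Z euclidean (\<lambda>z. scale (sect i (snd z)) (fst z $ i))" by (simp only: o_def fst_conv snd_conv)
 moreover have "scale (sect i (snd z)) (fst z $ i) \<noteq> 0" if "z \<in> topspace ?Z" for z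
  using that affine_iff[of "fst z" i] sect_affine(3)[of "snd z" i] by (auto simp: scale_eq_0)
 ultimately have c: "continuous_map ?Z (top_of_set (- {0})) (\<lambda>(x, L). ?T x L)"
  by (auto simp: into_sub case_prod_unfold)
 show "\<exists>U T. openin PS U \<and> L \<in> U \<and>
   continuous_map (subtopology (prod_topology (top_of_set (- {0})) PS) {(x, L). line mul x \<in> U \<and> L \<in> U}) (top_of_set (- {0})) (\<lambda>(x, L). T x L) \<and>
   (\<forall>x\<in>topspace (top_of_set (- {0})). \<forall>L\<in>U. line mul x \<in> U \<longrightarrow> line mul (T x L) = L) \<and>
   (\<forall>x\<in>topspace (top_of_set (- {0})). line mul x \<in> U \<longrightarrow> T x (line mul x) = x)"
 proof (intro exI[of _ "affine i"] exI[of _ ?T] conjI ballI impI affine_open c)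
  show "L \<in> affine i" using x i affine_iff by blast
  fix x assume "x \<in> topspace (top_of_set (- {0}))" "line mul x \<in> affine i"
  then have xi: "x $ i \<noteq> 0" using affine_iff by auto
  then show "line mul (scale (sect i L) (x $ i)) = L" if "L \<in> affine i" for L
   using line_scale[OF xi, of "sect i L"] sect_affine(1)[OF that] by simp
  show "scale (sect i (line mul x)) (x $ i) = x"
   by (simp add: sect_line[OF xi] norm_rep_def scale_scale inverse[OF xi] scale_e)
 qed
qed

text \<open>A punctured affine hyperplane of dimension at least two is not contained in a line.\<close>

lemma line_misses_direction:
 fixes y :: "'K ^ 'k::finite option"
 assumes k: "CARD('k) \<ge> 2" and y: "y \<noteq> 0" "y $ i = 0"
 shows "\<exists>w. w $ i = 0 \<and> w \<noteq> 0 \<and> w \<notin> range (scale y)"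
proof -
 have "\<not> card (UNIV - {i}) \<le> Suc 0" using k by (simp add: card_Diff_singleton)
 then obtain j j' where j: "j \<noteq> i" and j': "j' \<noteq> i" "j' \<noteq> j" by (subst (asm) card_le_Suc0_iff_eq) auto
 have "axis j e \<notin> range (scale y) \<or> axis j' e \<notin> range (scale y)"
 proof (rule ccontr)
  assume "\<not> ?thesis"
  then obtain l l' where l: "axis j e = scale y l" "axis j' e = scale y l'" by auto
  have "mul (y $ j) l = e" "mul (y $ j') l = 0" "mul (y $ j') l' = e"
   using arg_cong[OF l(1), of "\<lambda>v. v $ j"] arg_cong[OF l(1), of "\<lambda>v. v $ j'"] arg_cong[OF l(2), of "\<lambda>v. v $ j'"] j'
   by (simp_all add: axis_def)
  then show False using mul_eq_0[of "y $ j'" l] mul_0 unit(3) by auto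
 qed
 moreover have "axis j e $ i = 0" "axis j e \<noteq> 0" "axis j' e $ i = 0" "axis j' e \<noteq> 0"
  using j j' unit(3) by (auto simp: axis_def vec_eq_iff)
 ultimately show ?thesis by blast
qed

end


lemma skew_field_field: "skew_field (*) (1 :: 'K::{real_normed_field, euclidean_space}) inverse"
 by unfold_locales (auto simp: bilinear_conv_bounded_bilinear bounded_bilinear_mult intro!: continuous_intros)

definition qinv :: "quat \<Rightarrow> quat" where
 "qinv x = (1 / (norm x)\<^sup>2) *\<^sub>R (cnj (fst x), - snd x)"

lemma skew_field_quat: "skew_field qmul qone qinv"
proof
 show "bilinear qmul" unfolding bilinear_def by (auto intro!: linearI simp: qmul_def algebra_simps scaleR_conv_of_real)
 show "continuous_on (- {0}) qinv" unfolding qinv_def by (auto intro!: continuous_intros)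
 have s: "qmul (t *\<^sub>R x) y = t *\<^sub>R qmul x y" "qmul x (t *\<^sub>R y) = t *\<^sub>R qmul x y" for x y t
  by (simp_all add: qmul_def algebra_simps scaleR_conv_of_real)
 have n: "qmul x (cnj (fst x), - snd x) = (norm x)\<^sup>2 *\<^sub>R qone" "qmul (cnj (fst x), - snd x) x = (norm x)\<^sup>2 *\<^sub>R qone" for x
 proof -
  have "complex_of_real ((norm x)\<^sup>2) = complex_of_real ((cmod (fst x))\<^sup>2 + (cmod (snd x))\<^sup>2)" by (simp add: norm_prod_def)
  also have "\<dots> = fst x * cnj (fst x) + snd x * cnj (snd x)" unfolding of_real_add complex_norm_square ..
  finally show "qmul x (cnj (fst x), - snd x) = (norm x)\<^sup>2 *\<^sub>R qone" "qmul (cnj (fst x), - snd x) x = (norm x)\<^sup>2 *\<^sub>R qone"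
   by (simp_all add: qmul_def qone_def scaleR_conv_of_real mult.commute)
 qed
 show "qmul x (qinv x) = qone" "qmul (qinv x) x = qone" if "x \<noteq> 0" for x unfolding qinv_def s n using that by simp_all
qed (simp_all add: qmul_assoc qmul_qone, simp add: qone_def zero_prod_def)

context ball_mfd
begin

text \<open>The vectors with vanishing \<open>i\<close>-th coordinate are a model \<open>V\<close> of the affine chart around the center
 \<open>line mul b\<close>, and \<open>pr\<close> projects to \<open>V\<close> along the center. It is nonzero on vectors of other lines and linear over
 the skew field. Small spheres around the center correspond to small spheres in \<open>V\<close>.\<close>

lemma null_inclusion_projective:
 fixes kap :: "'a \<Rightarrow> ('K::euclidean_space ^ 'k::finite option) set"
 assumes sk: "skew_field mul e inv'" and k: "CARD('k) \<ge> 2" and hom: "homeomorphic_maps X (proj_space mul) kap kap'"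
  and h: "continuous_map (nsphere k) unit_sphere h" and null: "nullh k (punctured X x0) (jm \<circ> h)"
 shows "nullh k unit_sphere h"
proof -
 interpret skew_field mul e inv' by (rule sk)
 have hc: "\<And>s. s \<in> Sph k \<Longrightarrow> norm (h s) = 1" and hc': "continuous_on (Sph k) h" using h by (auto simp: nsphere_eq)
 have K: "continuous_map X PS kap" "continuous_map PS X kap'" "\<And>x. x \<in> topspace X \<Longrightarrow> kap' (kap x) = x" "\<And>x. x \<in> topspace PS \<Longrightarrow> kap (kap' x) = x"
  using hom by (auto simp: homeomorphic_maps_def)
 have "kap x0 \<in> topspace PS" using K(1) x0 by (auto simp: continuous_map_def)
 then obtain x where x: "kap x0 = line mul x" "x \<noteq> 0" unfolding topspace_PS by blast
 then obtain i where "x $ i \<noteq> 0" by (auto simp: vec_eq_iff)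
 then have l0: "kap x0 \<in> affine i" using affine_iff[OF x(2), of i] x(1) by simp
 define b where "b = sect i (kap x0)"
 have b: "line mul b = kap x0" "b $ i = e" unfolding b_def using sect_affine[OF l0] by auto
 define V where "V = {w :: 'K ^ 'k option. w $ i = 0}"
 have bV: "b + w \<noteq> 0" "(b + w) $ i = e" if "w \<in> V" for w
 proof -
  show "(b + w) $ i = e" using b(2) that by (simp add: V_def)
  then show "b + w \<noteq> 0" using unit(3) by (metis zero_index)
 qed
 have Vs: "t *\<^sub>R w \<in> V" if "w \<in> V" for t w using that by (simp add: V_def)
 \<comment> \<open>the affine chart around the centre of the ball\<close>
 define tht where "tht w = kap' (line mul (b + w))" for w
 have "cont_on V PS (\<lambda>w. line mul (b + w))"
  by (rule cmap_comp_on[OF _ _ line_continuous]) (use bV in \<open>auto intro!: continuous_intros\<close>)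
 from cmap_comp[OF this K(2)] have tht: "cont_on V X tht" by (simp add: o_def tht_def[abs_def])
 have tht0: "tht 0 = x0" using K(3)[OF x0(3)] by (simp add: tht_def b)
 have thtx0: "w = 0" if "w \<in> V" "tht w = x0" for w
 proof -
  have "line mul (b + w) \<in> topspace PS" using bV(1)[OF that(1)] by (auto simp: topspace_PS)
  then have "line mul (b + w) = line mul b" using K(4) that(2) b(1) by (metis tht_def)
  then obtain l where l: "b + w = scale b l" using line_eqD by blast
  then have "l = e" using bV(2)[OF that(1)] b(2) unit(1) by (metis scale_nth)
  with l have "b + w = b" by (simp add: scale_e)
  then show ?thesis by simp
 qed
 have "openin (top_of_set V) {w \<in> V. tht w \<in> chart_dom c}" using open_preim[OF tht chart_open[OF cA]] by simp
 moreover have "0 \<in> {w \<in> V. tht w \<in> chart_dom c}" using tht0 x0 by (simp add: V_def)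
 ultimately obtain eta where eta: "eta > 0" "cball 0 eta \<inter> V \<subseteq> {w \<in> V. tht w \<in> chart_dom c}" unfolding openin_contains_cball by blast
 \<comment> \<open>a small sphere in the coordinates of the projective space\<close>
 define u where "u v = sect i (kap (chart_inv c (a + v))) - b" for v
 let ?D = "{v. a + v \<in> dimg}"
 have oD: "open ?D" using open_vimage[OF chart_image_open[OF cA], of "\<lambda>v. a + v"] by (simp add: vimage_def continuous_intros)
 have "cont_on ?D X (\<lambda>v. chart_inv c (a + v))" by (rule chart_inv_map) (auto intro!: continuous_intros)
 from cmap_comp[OF this K(1)] have ck: "cont_on ?D PS (\<lambda>v. kap (chart_inv c (a + v)))" by (simp add: o_def)
 define D' where "D' = {v \<in> ?D. kap (chart_inv c (a + v)) \<in> affine i}"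
 have D': "open D'" "D' \<subseteq> ?D" using open_preim[OF ck affine_open[of i]] openin_open_trans oD by (auto simp: D'_def)
 have "cont_on D' (subtopology PS (affine i)) (\<lambda>v. kap (chart_inv c (a + v)))"
  using cmap_mono[OF ck D'(2)] by (auto simp: into_sub D'_def)
 from cmap_comp[OF this sect_continuous] have uc: "continuous_on D' u"
  by (auto simp: into_sub o_def u_def[abs_def] intro!: continuous_intros)
 have "open (D' \<inter> u -` ball 0 eta)" by (rule continuous_open_preimage[OF uc D'(1)]) simp
 moreover have "0 \<in> D' \<inter> u -` ball 0 eta" using eta(1) a_in l0 by (simp add: D'_def u_def b_def ball_center_def)
 ultimately obtain dlt where del: "dlt > 0" "ball 0 dlt \<subseteq> D' \<inter> u -` ball 0 eta" unfolding open_contains_ball by meson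
 define eps where "eps = min (dlt / 2) r"
 have eps: "0 < eps" "eps \<le> r" "eps < dlt" using del(1) r by (auto simp: eps_def)
 have hs: "eps *\<^sub>R h s \<in> D'" "norm (u (eps *\<^sub>R h s)) < eta" if "s \<in> Sph k" for s
  using subsetD[OF del(2), of "eps *\<^sub>R h s"] hc[OF that] eps by auto
 have ub: "b + u v \<noteq> 0" "line mul (b + u v) = kap (chart_inv c (a + v))" "u v \<in> V" if "v \<in> D'" for v
  using that sect_affine[of "kap (chart_inv c (a + v))" i] b(2) by (auto simp: u_def V_def D'_def)
 \<comment> \<open>lift the null-homotopy to nonzero vectors and project along the centre\<close>
 obtain x' where "homot (top_of_set (Sph k)) (punctured X x0) (\<lambda>s. chart_inv c (a + eps *\<^sub>R h s)) (\<lambda>_. x')"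
  using nullh_homotopic[OF small_spheres_homotopic[OF h eps(1,2)] null] unfolding nullh_def nsphere_eq by blast
 from homotopic_withD_cyl[OF this] obtain H where H: "cont_cyl (Sph k) (punctured X x0) H"
  "\<forall>s. H (0, s) = chart_inv c (a + eps *\<^sub>R h s)" "\<forall>s. H (1, s) = x'" by blast
 have H': "cont_cyl (Sph k) X H" "\<And>z. z \<in> {0..1} \<times> Sph k \<Longrightarrow> H z \<noteq> x0" using H(1) by (auto simp: into_punctured)
 have KH: "cont_cyl (Sph k) PS (\<lambda>z. kap (H z))" using cmap_comp[OF H'(1) K(1)] by (simp add: o_def)
 have ch: "continuous_on (Sph k) (\<lambda>s. u (eps *\<^sub>R h s))"
  by (rule continuous_on_compose2[OF uc]) (use hs hc' in \<open>auto intro!: continuous_intros\<close>)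
 then have g: "cont_on (Sph k) (top_of_set (- {0})) (\<lambda>s. b + u (eps *\<^sub>R h s))"
  using ub(1)[OF hs(1)] by (auto intro!: continuous_intros)
 have "line mul (b + u (eps *\<^sub>R h s)) = kap (H (0, s))" if "s \<in> Sph k" for s using ub(2)[OF hs(1)[OF that]] H(2) by simp
 then obtain L where L: "cont_cyl (Sph k) (top_of_set (- {0})) L" "\<forall>s\<in>Sph k. L (0, s) = b + u (eps *\<^sub>R h s)"
  "\<forall>t\<in>{0..1}. \<forall>s\<in>Sph k. line mul (L (t, s)) = kap (H (t, s))"
  using homotopy_lifting[OF sliced_line compact_Sph KH g] by blast
 define pr where "pr x = x - scale b (x $ i)" for x
 have prV: "pr x \<in> V" for x using b(2) unit by (simp add: pr_def V_def)
 have pr_scale: "pr (scale x l) = scale (pr x) l" for x l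
  using bilinear_lsub[OF bil] by (simp add: pr_def vec_eq_iff assoc)
 have pr_b: "pr (b + w) = w" if "w \<in> V" for w unfolding pr_def bV(2)[OF that] by (simp add: scale_e)
 have pr0: "pr (L z) \<noteq> 0" if z: "z \<in> {0..1} \<times> Sph k" for z
 proof
  have Lz: "L z \<noteq> 0" using L(1) z by (auto simp: continuous_map_def)
  assume "pr (L z) = 0"
  then have e: "L z = scale b (L z $ i)" by (simp add: pr_def)
  then have "L z $ i \<noteq> 0" using Lz scale_eq_0 by metis
  then have "line mul (L z) = kap x0" using e line_scale b(1) by metis
  then have "kap (H z) = kap x0" using L(3) z by auto
  moreover have "H z \<in> topspace X" using H'(1) z by (auto simp: continuous_map_def)
  ultimately show False using H'(2)[OF z] K(3) x0(3) by metis
 qed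
 have prc: "continuous_on ({0..1} \<times> Sph k) (\<lambda>z. pr (L z))"
  unfolding pr_def using L(1) by (intro continuous_intros scale_continuous) auto
 define z1 where "z1 = pr (L (1, pole k))"
 have z1: "z1 \<in> V" "z1 \<noteq> 0" unfolding z1_def using prV pr0[of "(1, pole k)"] pole_in_Sph by auto
 obtain w where w: "w \<in> V" "w \<noteq> 0" "w \<notin> range (scale z1)"
  using line_misses_direction[OF k z1(2), of i] z1(1) unfolding V_def by blast
 have seg: "closed_segment (pr (L (1, s))) w \<subseteq> V - {0}" if s: "s \<in> Sph k" for s
 proof
  have "line mul (L (1, s)) = line mul (L (1, pole k))" using L(3) H(3) s pole_in_Sph[of k] by simp
  then obtain l where l: "pr (L (1, s)) = scale z1 l" unfolding z1_def using line_eqD pr_scale by metis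
  fix y assume "y \<in> closed_segment (pr (L (1, s))) w"
  then obtain t where t: "0 \<le> t" "t \<le> 1" "y = (1 - t) *\<^sub>R pr (L (1, s)) + t *\<^sub>R w" unfolding in_segment by auto
  have "y \<noteq> 0"
  proof (cases "t = 0")
   case True
   then show ?thesis using t(3) pr0[of "(1, s)"] s by simp
  next
   case False
   show ?thesis
   proof
    assume "y = 0"
    then have tw: "t *\<^sub>R w = (t - 1) *\<^sub>R scale z1 l" using t(3) l by (simp add: add_eq_0_iff algebra_simps)
    have "w = (1 / t) *\<^sub>R (t *\<^sub>R w)" using False by simp
    also have "\<dots> = ((t - 1) / t) *\<^sub>R scale z1 l" unfolding tw by simp
    also have "\<dots> = scale z1 (((t - 1) / t) *\<^sub>R l)" using bilinear_rmul[OF bil] by (simp add: vec_eq_iff)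
    finally show False using w(3) by blast
   qed
  qed
  moreover have "y \<in> V" using t(3) prV[of "L (1, s)"] w(1) by (simp add: V_def)
  ultimately show "y \<in> V - {0}" by blast
 qed
 have 1: "homot (nsphere k) (top_of_set (V - {0})) (\<lambda>s. pr (L (0, s))) (\<lambda>s. pr (L (1, s)))"
  unfolding nsphere_eq by (rule homotopic_withI_cyl[of _ _ "\<lambda>z. pr (L z)"]) (use prc prV pr0 in auto)
 have "continuous_on (Sph k) (\<lambda>s. pr (L (1, s)))"
  by (rule continuous_on_compose2[OF prc, of _ "\<lambda>s. (1, s)"]) (auto intro!: continuous_intros)
 then have "homotopic_with_canon (\<lambda>_. True) (Sph k) (V - {0}) (\<lambda>s. pr (L (1, s))) (\<lambda>_. w)"
  by (rule homotopic_with_linear[OF _ continuous_on_const seg])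
 then have "nullh k (top_of_set (V - {0})) (\<lambda>s. pr (L (0, s)))"
  using homotopic_with_trans[OF 1] unfolding nullh_def nsphere_eq by blast
 then have N: "nullh k (top_of_set (V - {0})) (\<lambda>s. u (eps *\<^sub>R h s))"
  by (rule nullh_cong) (use L(2) pr_b ub(3) hs(1) in auto)
 \<comment> \<open>compress into the ball and return to the chart\<close>
 define q where "q w = min 1 (eta / norm w) *\<^sub>R w" for w :: "'K ^ 'k option"
 have q: "q w \<in> cball 0 eta \<inter> V" "q w \<noteq> 0" if "w \<in> V - {0}" for w
 proof -
  have "min 1 (eta / norm w) * norm w \<le> (eta / norm w) * norm w" by (intro mult_right_mono) auto
  then show "q w \<in> cball 0 eta \<inter> V" using that Vs eta(1) by (auto simp: q_def)
  show "q w \<noteq> 0" using that eta(1) by (auto simp: q_def min_def)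
 qed
 define Psi where "Psi w = snd c (tht (q w)) - a" for w
 have thtq: "tht (q w) \<in> chart_dom c" if "w \<in> V - {0}" for w using q(1)[OF that] eta(2) by blast
 have "cont_on (V - {0}) X (\<lambda>w. tht (q w))"
  by (rule cmap_comp_on[OF _ _ tht]) (use q(1) in \<open>auto simp: q_def[abs_def] intro!: continuous_intros\<close>)
 then have "cont_on (V - {0}) (subtopology X (chart_dom c)) (\<lambda>w. tht (q w))" using thtq by (auto simp: into_sub)
 from cmap_comp[OF this chart_cont[OF cA]] have "continuous_on (V - {0}) Psi"
  unfolding Psi_def[abs_def] by (auto simp: o_def intro!: continuous_intros)
 moreover have "Psi w \<noteq> 0" if w: "w \<in> V - {0}" for w
 proof
  assume "Psi w = 0"
  then have "snd c (tht (q w)) = snd c x0" using x0(2) by (simp add: Psi_def)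
  then have "tht (q w) = x0" using chart_inj[OF cA] thtq[OF w] x0(1) by (metis inj_onD)
  then show False using thtx0 q[OF w] by blast
 qed
 ultimately have "cont_on (V - {0}) (top_of_set (- {0})) Psi" by auto
 from nullh_compose[OF N this] have "nullh k (top_of_set (- {0})) (\<lambda>s. eps *\<^sub>R h s)"
 proof (rule nullh_cong)
  fix s assume s: "s \<in> Sph k"
  let ?v = "eps *\<^sub>R h s"
  have D: "a + ?v \<in> dimg" using hs(1)[OF s] by (simp add: D'_def)
  have "eps \<noteq> 0 \<and> h s \<noteq> 0" using eps hc[OF s] by auto
  have "q (u ?v) = u ?v" using hs(2)[OF s] by (cases "u ?v = 0") (simp_all add: q_def min_def)
  moreover have "tht (u ?v) = chart_inv c (a + ?v)" unfolding tht_def ub(2)[OF hs(1)[OF s]] using K(3)[OF dom_topspace[OF cA chart_inv_in[OF D]]] .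
  ultimately show "?v = (Psi \<circ> (\<lambda>s. u (eps *\<^sub>R h s))) s" using chart_chart_inv[OF D] by (simp add: Psi_def)
 qed
 then show ?thesis
 proof (rule nullh_sphere_if[OF h])
  fix s assume s: "s \<in> Sph k"
  have "(1 - t) *\<^sub>R h s + t *\<^sub>R (eps *\<^sub>R h s) = ((1 - t) + t * eps) *\<^sub>R h s" for t by (simp add: algebra_simps)
  moreover have "(1 - t) + t * eps > 0" if "0 \<le> t" "t \<le> 1" for t using that eps(1) by (cases "t = 1") (auto intro: add_pos_nonneg)
  moreover have "h s \<noteq> 0" using hc[OF s] by auto
  ultimately show "0 \<notin> closed_segment (h s) (eps *\<^sub>R h s)" unfolding in_segment by (metis less_irrefl scaleR_eq_0_iff)
 qed
qed

lemma null_inclusion_projective_space: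
 assumes P: "is_projective_space TYPE('k::finite) X A" and k: "CARD('k) \<ge> 2"
  and h: "continuous_map (nsphere k) unit_sphere h" and null: "nullh k (punctured X x0) (jm \<circ> h)"
 shows "nullh k unit_sphere h"
proof -
 have hom: "\<exists>kap kap'. homeomorphic_maps X Y kap kap'" if "diffeomorphic X A Y B" for Y :: "'y topology" and B :: "('y, 'f::euclidean_space) chart set"
  using that unfolding diffeomorphic_def homeomorphic_maps_def smooth_map_def by blast
 consider "diffeomorphic X A (proj_space (*) :: (real ^ 'k option) set topology) (proj_atlas (*) 1)"
  | "diffeomorphic X A (proj_space (*) :: (complex ^ 'k option) set topology) (proj_atlas (*) 1)"
  | "diffeomorphic X A (proj_space qmul :: (quat ^ 'k option) set topology) (proj_atlas qmul qone)"
  using P unfolding is_projective_space_def by blast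
 then show ?thesis
 proof cases
  case 1
  from hom[OF this] show ?thesis using null_inclusion_projective[OF skew_field_field k _ h null] by blast
 next
  case 2
  from hom[OF this] show ?thesis using null_inclusion_projective[OF skew_field_field k _ h null] by blast
 next
  case 3
  from hom[OF this] show ?thesis using null_inclusion_projective[OF skew_field_quat k _ h null] by blast
 qed
qed

end

section \<open>The equivalences\<close>

context ball_mfd
begin

abbreviation "bdN k \<equiv> boundary_N X A g c a r v0 (Suc k)"
abbreviation "producing k \<equiv> coincidence_producing (nsphere (Suc k)) X"
abbreviation "ker_cap k \<equiv> bdN k ` hgroup (Suc k) X b0 \<inter> ker_j X c a r v0 k"

lemma hzero_in: "hzero k unit_sphere v0 \<in> hgroup k unit_sphere v0"
 unfolding hgroup_def hzero_def using v0 by (auto simp: based_map_def)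

lemma j_star_hzero: "j_star X c a r v0 k (hzero k unit_sphere v0) = hzero k (punctured X x0) b0"
 unfolding hzero_def using j_star_class[of k "\<lambda>_. v0"] v0 by (simp add: based_map_def o_def)

lemma homotopic_producing:
 assumes "homot M X f f'" "coincidence_producing M X f'"
 shows "coincidence_producing M X f" using assms(2) homotopic_with_trans[OF homotopic_with_symD[OF assms(1)]]
 unfolding coincidence_producing_def loose_def by blast

context
 fixes k f assumes f: "based_map (Suc k) X b0 f"
begin

lemma lifts_not_producing: "lifts (Suc k) f \<Longrightarrow> \<not> producing k f"
 using f lifts_imp_loose loose_imp_not_producing unfolding based_map_def by blast

text \<open>For \<open>k = 0\<close> the boundary is trivial by definition, so this contains that all maps of the circle lift.\<close>

lemma boundary_facts_conj:
 "bdN k (hclass (Suc k) X b0 f) \<in> hgroup k unit_sphere v0 \<and>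
  (\<not> producing k f \<longleftrightarrow> j_star X c a r v0 k (bdN k (hclass (Suc k) X b0 f)) = hzero k (punctured X x0) b0) \<and>
  (lifts (Suc k) f \<longleftrightarrow> bdN k (hclass (Suc k) X b0 f) = hzero k unit_sphere v0)"
proof (cases "k = 0")
 case True
 then have "bdN k (hclass (Suc k) X b0 f) = hzero k unit_sphere v0" by (simp add: boundary_N_def boundary_hom_def)
 moreover have "lifts (Suc k) f" using circle_maps_lift_based f True by simp
 ultimately show ?thesis using hzero_in j_star_hzero lifts_not_producing by simp
next
 case False
 then have k: "k \<ge> 1" by simp
 obtain L where L: "disc_lift k f L" using disc_lift_ex[OF f] by blast
 note b = bdry_based[OF f L]
 show ?thesis
  unfolding boundary_N_class[OF f L k] j_star_class[OF b] hclass_eq_hzero_iff[OF jm_based[OF b]] hclass_eq_hzero_iff[OF b]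
  using k producing_iff_null[OF f L] lifts_iff_null[OF f L] b unfolding hgroup_def by blast
qed

lemmas boundary_facts = boundary_facts_conj[THEN conjunct1] boundary_facts_conj[THEN conjunct2, THEN conjunct1]
 boundary_facts_conj[THEN conjunct2, THEN conjunct2]

end

lemma image_ker:
 "ker_cap k =
  {bdN k (hclass (Suc k) X b0 f) | f. based_map (Suc k) X b0 f \<and> \<not> producing k f}"
 unfolding hgroup_def[of "Suc k" X] ker_j_def by (auto simp: boundary_facts(1,2)) (metis boundary_facts(2))

lemma hzero_in_image:
 "hzero k unit_sphere v0 \<in> ker_cap k"
proof -
 have f: "based_map (Suc k) X b0 (\<lambda>_. b0)" using b0 by (simp add: based_map_def)
 have "fiber_param A g c b0 v0 \<in> topspace (fib ST fst b0)"
  using fiber_param_continuous[OF cA b0(1)] v0 by (auto simp: continuous_map_def)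
 then have l: "lifts (Suc k) (\<lambda>_. b0)" unfolding lifts_def by (intro exI[of _ "\<lambda>_. fiber_param A g c b0 v0"]) auto
 show ?thesis unfolding image_ker using f lifts_not_producing[OF f l] boundary_facts(3)[OF f] l by force
qed

text \<open>The intersection consists of the boundaries of the maps that are not coincidence producing.\<close>

lemma image_ker_trivial_iff:
 "{hzero k unit_sphere v0} = ker_cap k \<longleftrightarrow>
  (\<forall>f. based_map (Suc k) X b0 f \<longrightarrow> \<not> producing k f \<longrightarrow> lifts (Suc k) f)"
 (is "{?z} = ?I \<longleftrightarrow> ?R")
proof -
 have "?I \<subseteq> {?z} \<longleftrightarrow> ?R" unfolding image_ker using boundary_facts(3) by auto
 then show ?thesis unfolding set_eq_subset using hzero_in_image by simp
qed

lemma equivalence_iff: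
 "(\<forall>f. continuous_map (nsphere (Suc k)) X f \<longrightarrow>
   (loose_by_small_deformation (nsphere (Suc k)) X f \<longleftrightarrow> loose (nsphere (Suc k)) X f f) \<and>
   (loose (nsphere (Suc k)) X f f \<longleftrightarrow> \<not> producing k f)) \<longleftrightarrow>
  {hzero k unit_sphere v0} = ker_cap k"
 (is "?L \<longleftrightarrow> _") unfolding image_ker_trivial_iff
proof
 assume ?L
 then show "\<forall>f. based_map (Suc k) X b0 f \<longrightarrow> \<not> producing k f \<longrightarrow> lifts (Suc k) f"
  using small_deformation_iff_lifts unfolding based_map_def by blast
next
 assume R: "\<forall>f. based_map (Suc k) X b0 f \<longrightarrow> \<not> producing k f \<longrightarrow> lifts (Suc k) f"
 show ?L
 proof (intro allI impI)
  fix f assume f: "continuous_map (nsphere (Suc k)) X f"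
  have "lifts (Suc k) f" if p: "\<not> producing k f"
  proof -
   obtain f' where f': "based_map (Suc k) X b0 f'" "homot (nsphere (Suc k)) X f f'"
    using homotopic_based[OF f] by blast
   then have "lifts (Suc k) f'" using R p homotopic_producing by blast
   then show ?thesis using lifts_homotopic homotopic_with_symD f'(2) by blast
  qed
  then show "(loose_by_small_deformation (nsphere (Suc k)) X f \<longleftrightarrow> loose (nsphere (Suc k)) X f f) \<and>
   (loose (nsphere (Suc k)) X f f \<longleftrightarrow> \<not> producing k f)"
   using small_deformation_iff_lifts[OF f] lifts_imp_loose[OF f] loose_imp_not_producing[OF f] by blast
 qed
qed

lemma ker_trivial:
 assumes N: "\<And>h. continuous_map (nsphere k) unit_sphere h \<Longrightarrow> nullh k (punctured X x0) (jm \<circ> h) \<Longrightarrow> nullh k unit_sphere h"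
 shows "ker_j X c a r v0 k = {hzero k unit_sphere v0}"
  "{hzero k unit_sphere v0} = ker_cap k"
proof -
 have "hclass k unit_sphere v0 h = hzero k unit_sphere v0"
  if h: "based_map k unit_sphere v0 h" and j: "j_star X c a r v0 k (hclass k unit_sphere v0 h) = hzero k (punctured X x0) b0" for h
  using h j N hclass_eq_hzero_iff[OF h] hclass_eq_hzero_iff[OF jm_based[OF h]] unfolding j_star_class[OF h] based_map_def by blast
 then show ker: "ker_j X c a r v0 k = {hzero k unit_sphere v0}"
  using hzero_in[of k] j_star_hzero[of k] unfolding ker_j_def hgroup_def by auto
 then show "{hzero k unit_sphere v0} = ker_cap k" using hzero_in_image by blast
qed

lemma not_simply_connected_trivial:
 assumes "\<not> simply_connected_space X"
 shows "{hzero k unit_sphere v0} = ker_cap k"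
proof (cases "k = 0")
 case True
 then show ?thesis unfolding image_ker_trivial_iff using circle_maps_lift_based by simp
next
 case False
 then have k: "k \<ge> 1" by simp
 have "nullh k unit_sphere h" if h: "continuous_map (nsphere k) unit_sphere h" and null: "nullh k (punctured X x0) (jm \<circ> h)" for h
 proof (cases "DIM('e) \<ge> 2")
  case True
  show ?thesis by (rule null_inclusion_not_simply_connected[OF assms True k h null])
 next
  case False
  then have "DIM('e) = 1" using DIM_positive[where 'a='e] by linarith
  then show ?thesis by (rule dim1_nullh[OF _ k h])
 qed
 then show ?thesis by (rule ker_trivial(2))
qed

end

theorem theorem1p22:
  fixes X :: "'a topology"
    and A :: "('a, 'e::euclidean_space) chart set"
    and g :: "'a \<Rightarrow> (('a, 'e) chart \<Rightarrow> 'e) \<Rightarrow> (('a, 'e) chart \<Rightarrow> 'e) \<Rightarrow> real"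
    and c :: "('a, 'e) chart" and a v0 :: 'e and r :: real and m :: nat
  assumes "smooth_manifold X A" and "connected_space X" and "riemannian_metric A g"
    and "m \<ge> 1"
    and "c \<in> A" and "r > 0" and "cball a r \<subseteq> snd c ` chart_dom c" and "v0 \<in> sphere 0 1"
  shows
    "(\<forall>f. based_map m X (sphere_incl c a r v0) f \<longrightarrow>
        (loose_by_small_deformation (nsphere m) X f \<longrightarrow> loose (nsphere m) X f f) \<and>
        (loose (nsphere m) X f f \<longrightarrow> \<not> coincidence_producing (nsphere m) X f) \<and>
        (\<not> coincidence_producing (nsphere m) X f \<longleftrightarrow>
           j_star X c a r v0 (m - 1)
             (boundary_N X A g c a r v0 m (hclass m X (sphere_incl c a r v0) f))
           = hzero (m - 1) (punctured X (ball_center c a)) (sphere_incl c a r v0)))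
     \<and>
     ((\<forall>f. continuous_map (nsphere m) X f \<longrightarrow>
         (loose_by_small_deformation (nsphere m) X f \<longleftrightarrow> loose (nsphere m) X f f) \<and>
         (loose (nsphere m) X f f \<longleftrightarrow> \<not> coincidence_producing (nsphere m) X f))
      \<longleftrightarrow>
      {hzero (m - 1) unit_sphere v0} =
        boundary_N X A g c a r v0 m ` hgroup m X (sphere_incl c a r v0) \<inter> ker_j X c a r v0 (m - 1))
     \<and>
     (\<not> simply_connected_space X \<longrightarrow>
        {hzero (m - 1) unit_sphere v0} =
          boundary_N X A g c a r v0 m ` hgroup m X (sphere_incl c a r v0) \<inter> ker_j X c a r v0 (m - 1))
     \<and>
     (CARD('k::finite) \<ge> 2 \<and> is_projective_space TYPE('k) X A \<longrightarrow>
        ker_j X c a r v0 (m - 1) = {hzero (m - 1) unit_sphere v0} \<and>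
        {hzero (m - 1) unit_sphere v0} =
          boundary_N X A g c a r v0 m ` hgroup m X (sphere_incl c a r v0) \<inter> ker_j X c a r v0 (m - 1))"
proof -
 interpret ball_mfd X A g c a v0 r by unfold_locales (use assms in auto)
 obtain k where m: "m = Suc k" using assms(4) by (cases m) auto
 show ?thesis unfolding m diff_Suc_1
 proof (intro conjI)
  show "\<forall>f. based_map (Suc k) X b0 f \<longrightarrow>
    (loose_by_small_deformation (nsphere (Suc k)) X f \<longrightarrow> loose (nsphere (Suc k)) X f f) \<and>
    (loose (nsphere (Suc k)) X f f \<longrightarrow> \<not> producing k f) \<and>
    (\<not> producing k f \<longleftrightarrow> j_star X c a r v0 k (bdN k (hclass (Suc k) X b0 f)) = hzero k (punctured X x0) b0)"
   using small_deformation_iff_lifts lifts_imp_loose loose_imp_not_producing boundary_facts(2) unfolding based_map_def by blast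
  show "\<not> simply_connected_space X \<longrightarrow> {hzero k unit_sphere v0} = ker_cap k" using not_simply_connected_trivial by blast
  show "CARD('k) \<ge> 2 \<and> is_projective_space TYPE('k) X A \<longrightarrow> ker_j X c a r v0 k = {hzero k unit_sphere v0} \<and>
    {hzero k unit_sphere v0} = ker_cap k" using ker_trivial[OF null_inclusion_projective_space[where 'k='k]] by blast
 qed (rule equivalence_iff)
qed

end
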